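(* Let $\Omega\subset\mathbb{R}^3$ be a domain, $S_0\subset\Omega$ a bounded connected domain, and let $S(t)\subset\Omega$, $t\in(0,T)$, be the moving rigid body with initial position $S_0$ described in the context, $F(t)=\Omega\setminus\overline{S(t)}$ and $h(t)=\operatorname{dist}(S(t),\partial\Omega)$. (i) Let $\alpha\in(0,1]$ and assume that $\Omega$ and $S_0$ are uniformly $C^{1,\alpha}$ domains and that in addition $\Omega$ satisfies an inner sphere condition. Let $p\in[1,\infty)$ and $$\mathbf{u}\in L^\infty(0,T;L^2(\Omega))\cap L^1(0,T;W^{1,p}_0(S(t),\Omega)),\qquad \operatorname{div}\mathbf{u}=0.$$ Then there exist positive constants $H_0$, $C_w$, $c_0$ depending only on the shape of $S_0$, on $\Omega$ and on $p$ such that, whenever $h<H_0$, the function $h=h(t)$ is Lipschitz continuous and, for $\sigma_h:=c_0h^{\frac1{1+\alpha}}$, for a.a. $t\in(0,T)$ (with $0<h(t)<H_0$), $$\left|\frac{dh}{dt}\right|\le C_w\,h^{\frac{1+2\alpha}{p(1+\alpha)}\left(p-\frac{3+\alpha}{1+2\alpha}\right)}\|\nabla\mathbf{u}\|_{L^p(\mathcal{C}_{\sigma_h}\cap F)}.$$ (ii) Assume that $\Omega$ and $S_0$ are uniformly $C^3$ domains, that $$\mathbf{u}\in L^\infty(0,T;L^2(\Omega))\cap L^1(0,T;W^{1,2}_0(S(t),\Omega)),\qquad\operatorname{div}\mathbf{u}=0,$$ and in addition $|\nabla^2\mathbf{u}|\in L^2(F(t))$ for a.a. $t\in(0,T)$.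 Then there exist positive constants $H_0$, $C_s$, $c_0$ depending only on the shape of $S_0$ and on $\Omega$ such that, whenever $h<H_0$, the function $h=h(t)$ is Lipschitz continuous and, for $\sigma_h:=c_0h^{\frac12}$, for a.a. $t\in(0,T)$ (with $h(t)<H_0$), $$\left|\frac{dh}{dt}\right|\le C_s\left(h^{\frac32}\|\nabla^2\mathbf{u}\|_{L^2(\mathcal{C}_{\sigma_h}\cap F)}+h\,\|\nabla\mathbf{u}\|_{L^2(\mathcal{C}_{\sigma_h}\cap F)}\right).$$
   Context: A domain $D\subset\mathbb{R}^3$ is uniformly $C^{1,\alpha}$, $\alpha\in(0,1]$, if there are constants $k>0$, $\sigma_0>0$ such that for each $x_0\in\partial D$ there is an isometry $\mathcal{R}:\mathbb{R}^3\to\mathbb{R}^3$ with $\mathcal{R}(0)=x_0$ and $\mathcal{R}(\{x\in\mathbb{R}^3:\ k|\mathbf{x}'|^{1+\alpha}<|x_3|<k\sigma_0^{1+\alpha},\ |\mathbf{x}'|<\sigma_0\})\cap\partial D=\emptyset$, where $\mathbf{x}'=(x_1,x_2)$. It is uniformly $C^3$ if there are constants $\sigma_0,K>0$ such that, near each boundary point $x_0$, in suitable orthonormal coordinates centred at $x_0$ with $x_3$-axis normal to $\partial D$, $\partial D$ is the graph $x_3=g(\mathbf{x}')$, $|\mathbf{x}'|<\sigma_0$, with $|\nabla^ig(\mathbf{x}')|\le K|\mathbf{x}'|^{2-i}$ for $i=0,1,2$ and $|\nabla^3g(\mathbf{x}')|\le K$. The inner sphere condition for $\Omega$: there is a fixed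 radius $R>0$ such that every point of $\partial\Omega$ lies on the boundary of a ball of radius $R$ contained in $\Omega$. Motion of the body: there are functions $\mathbf{u}_*(t),\boldsymbol{\omega}(t)\in L^\infty(0,T)$ (with values in $\mathbb{R}^3$) such that $S(t)\subset\Omega$ consists of the points $\mathbf{x}(t)$ satisfying $\frac{d\mathbf{x}(t)}{dt}=\mathbf{u}_*(t)+\boldsymbol{\omega}(t)\times(\mathbf{x}(t)-\mathbf{x}_*(t))$, $\mathbf{x}(0)=\mathbf{x}_0\in S_0$, where $\mathbf{x}_*(t)\in\overline{S(t)}$ is the position at time $t$ of a fixed point of the body. For $p,q\ge1$, $$L^q(0,T;W^{1,p}_0(S(t),\Omega))=\{\mathbf{u}\in L^q(0,T;W^{1,p}_0(\Omega)):\ \mathbf{u}(\mathbf{x},t)=\mathbf{u}_*(t)+\boldsymbol{\omega}(t)\times(\mathbf{x}-\mathbf{x}_*(t))\ \text{for }\mathbf{x}\in S(t)\},$$ with $\mathbf{u}:\Omega\times(0,T)\to\mathbb{R}^3$. At each time $t$, let $P\in\partial S(t)$, $Q\in\partial\Omega$ realize the distance $h(t)=|PQ|$, and use orthogonal coordinates $(x_1,x_2,x_3)$ with origin $Q$ and $P=(0,0,h(t))$, the plane of $\mathbf{x}'=(x_1,x_2)$ being tangent to $\partial\Omega$ at $Q$ and parallel to the tangent plane of $\partial S(t)$ at $P$. In these coordinates $\mathcal{C}_\sigma\cap F=\{|\mathbf{x}'|<\sigma\}\cap F(t)$. It is assumed throughout that the distances $h$ considered satisfy $h<\operatorname{dia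m}S_0$.
   Formalization: In (i), "uniformly C^{1,α}" additionally requires the domain to lie locally on exactly one side of its boundary (cusp zone x_3>0 inside, x_3<0 outside); with the disjointness condition alone the claim fails, e.g. for Ω=ℝ³∖{0}, p≤3. *)

theory Defs
  imports "HOL-Analysis.Analysis"
begin

section \<open>Geometry in three-dimensional space\<close>

definition domain3 :: "(real^3) set \<Rightarrow> bool" where
  "domain3 D \<longleftrightarrow> open D \<and> connected D \<and> D \<noteq> {}"

definition is_isometry :: "(real^3 \<Rightarrow> real^3) \<Rightarrow> bool" where
  "is_isometry R \<longleftrightarrow> (\<forall>x y. dist (R x) (R y) = dist x y)"

definition horiz :: "real^3 \<Rightarrow> real^2" where
  "horiz x = vector [x $ 1, x $ 2]"

definition cusp_zone :: "real \<Rightarrow> real \<Rightarrow> real \<Rightarrow> (real^3) set" where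
  "cusp_zone \<alpha> k \<sigma>0 =
     {x. k * norm (horiz x) powr (1 + \<alpha>) < \<bar>x $ 3\<bar> \<and> \<bar>x $ 3\<bar> < k * \<sigma>0 powr (1 + \<alpha>)
         \<and> norm (horiz x) < \<sigma>0}"

text \<open>The last two conjuncts say that \<open>D\<close> lies locally on exactly one side of its boundary
  (an isometry may reflect, so the side may be taken to be the upper one).  This is part of the
  usual meaning of a domain of class $C^{1,\alpha}$ and is not implied by the disjointness condition
  alone, which also holds, e.g., for all of space with a point, a line or a flat disc removed.\<close>

definition uniformly_C1 :: "real \<Rightarrow> (real^3) set \<Rightarrow> bool" where
  "uniformly_C1 \<alpha> D \<longleftrightarrow>
     (\<exists>k>0. \<exists>\<sigma>0>0. \<forall>x0\<in>frontier D. \<exists>R. is_isometry R \<and> R 0 = x0 \<and>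
        R ` cusp_zone \<alpha> k \<sigma>0 \<inter> frontier D = {} \<and>
        R ` {x \<in> cusp_zone \<alpha> k \<sigma>0. x $ 3 > 0} \<subseteq> D \<and>
        R ` {x \<in> cusp_zone \<alpha> k \<sigma>0. x $ 3 < 0} \<inter> D = {})"

definition partial :: "'n::finite \<Rightarrow> (real^'n \<Rightarrow> 'b::real_normed_vector) \<Rightarrow> real^'n \<Rightarrow> 'b" where
  "partial j f x = frechet_derivative f (at x) (axis j 1)"

definition grad :: "(real^'n::finite \<Rightarrow> 'b::real_normed_vector) \<Rightarrow> real^'n \<Rightarrow> 'b^'n" where
  "grad f x = (\<chi> j. partial j f x)"

text \<open>Meant for open \<open>U\<close>.\<close>

primrec Ck_on :: "nat \<Rightarrow> (real^'n::finite) set \<Rightarrow> (real^'n \<Rightarrow> 'b::real_normed_vector) \<Rightarrow> bool" where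
  "Ck_on 0 U f \<longleftrightarrow> continuous_on U f"
| "Ck_on (Suc m) U f \<longleftrightarrow> f differentiable_on U \<and> (\<forall>j. Ck_on m U (partial j f))"

text \<open>The vertical extent \<open>K \<sigma>0\<^sup>2\<close> of the cylinder makes ``near the boundary point'' precise; the
  bound on \<open>g\<close> keeps the graph inside it.  The bound on \<open>grad g\<close> at \<open>0\<close> makes the third axis
  normal to the boundary.\<close>

definition uniformly_C3 :: "(real^3) set \<Rightarrow> bool" where
  "uniformly_C3 D \<longleftrightarrow>
     (\<exists>\<sigma>0>0. \<exists>K>0. \<forall>x0\<in>frontier D. \<exists>R. \<exists>g :: real^2 \<Rightarrow> real.
        is_isometry R \<and> R 0 = x0 \<and> Ck_on 3 (ball 0 \<sigma>0) g \<and>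
        (\<forall>y\<in>ball 0 \<sigma>0. \<bar>g y\<bar> \<le> K * norm y ^ 2 \<and> norm (grad g y) \<le> K * norm y \<and>
           norm (grad (grad g) y) \<le> K \<and> norm (grad (grad (grad g)) y) \<le> K) \<and>
        (\<forall>x. norm (horiz x) < \<sigma>0 \<and> \<bar>x $ 3\<bar> < K * \<sigma>0 ^ 2 \<longrightarrow>
           (R x \<in> frontier D \<longleftrightarrow> x $ 3 = g (horiz x))))"

definition inner_sphere_condition :: "(real^3) set \<Rightarrow> bool" where
  "inner_sphere_condition D \<longleftrightarrow>
     (\<exists>r>0. \<forall>x\<in>frontier D. \<exists>c. x \<in> sphere c r \<and> ball c r \<subseteq> D)"

section \<open>Lebesgue and Sobolev spaces\<close>

definition in_Lp :: "real \<Rightarrow> (real^3) set \<Rightarrow> (real^3 \<Rightarrow> 'b::euclidean_space) \<Rightarrow> bool" where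
  "in_Lp p A f \<longleftrightarrow> set_borel_measurable lebesgue A f \<and>
     set_integrable lebesgue A (\<lambda>x. norm (f x) powr p)"

definition Lp_norm :: "real \<Rightarrow> (real^3) set \<Rightarrow> (real^3 \<Rightarrow> 'b::euclidean_space) \<Rightarrow> real" where
  "Lp_norm p A f = (LINT x:A|lebesgue. norm (f x) powr p) powr (1 / p)"

definition test_function :: "(real^3) set \<Rightarrow> (real^3 \<Rightarrow> 'b::euclidean_space) \<Rightarrow> bool" where
  "test_function D \<phi> \<longleftrightarrow> (\<forall>m. Ck_on m UNIV \<phi>) \<and>
     compact (closure {x. \<phi> x \<noteq> 0}) \<and> closure {x. \<phi> x \<noteq> 0} \<subseteq> D"

text \<open>The component \<open>G x $ j\<close> is the weak derivative of \<open>f\<close> in direction \<open>j\<close>; the norm on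
  \<open>'b^3\<close> is the Frobenius norm.\<close>

definition has_weak_gradient ::
    "(real^3) set \<Rightarrow> (real^3 \<Rightarrow> 'b::euclidean_space) \<Rightarrow> (real^3 \<Rightarrow> 'b^3) \<Rightarrow> bool" where
  "has_weak_gradient D f G \<longleftrightarrow>
     (\<forall>K. compact K \<and> K \<subseteq> D \<longrightarrow> f absolutely_integrable_on K \<and> G absolutely_integrable_on K) \<and>
     (\<forall>\<phi> :: real^3 \<Rightarrow> real. test_function D \<phi> \<longrightarrow> (\<forall>j.
        (LINT x:D|lebesgue. partial j \<phi> x *\<^sub>R f x) = - (LINT x:D|lebesgue. \<phi> x *\<^sub>R (G x $ j))))"

definition weakly_differentiable :: "(real^3) set \<Rightarrow> (real^3 \<Rightarrow> 'b::euclidean_space) \<Rightarrow> bool" where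
  "weakly_differentiable D f \<longleftrightarrow> (\<exists>G. has_weak_gradient D f G)"

text \<open>A representative of the weak gradient, which is determined up to a null set of \<open>D\<close>.\<close>

definition weak_grad ::
    "(real^3) set \<Rightarrow> (real^3 \<Rightarrow> 'b::euclidean_space) \<Rightarrow> real^3 \<Rightarrow> 'b^3" where
  "weak_grad D f = (SOME G. has_weak_gradient D f G)"

definition weak_hess ::
    "(real^3) set \<Rightarrow> (real^3 \<Rightarrow> 'b::euclidean_space) \<Rightarrow> real^3 \<Rightarrow> 'b^3^3" where
  "weak_hess D f = weak_grad D (weak_grad D f)"

definition W1p :: "real \<Rightarrow> (real^3) set \<Rightarrow> (real^3 \<Rightarrow> real^3) set" where
  "W1p p D = {f. in_Lp p D f \<and> weakly_differentiable D f \<and> in_Lp p D (weak_grad D f)}"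

definition W1p_norm :: "real \<Rightarrow> (real^3) set \<Rightarrow> (real^3 \<Rightarrow> real^3) \<Rightarrow> real" where
  "W1p_norm p D f = (Lp_norm p D f powr p + Lp_norm p D (weak_grad D f) powr p) powr (1 / p)"

definition W1p_zero :: "real \<Rightarrow> (real^3) set \<Rightarrow> (real^3 \<Rightarrow> real^3) set" where
  "W1p_zero p D = {f \<in> W1p p D.
     \<forall>\<epsilon>>0. \<exists>\<phi>. test_function D \<phi> \<and> W1p_norm p D (\<lambda>x. f x - \<phi> x) < \<epsilon>}"

section \<open>Bochner spaces over a time interval\<close>

text \<open>\<open>V\<close> is a vector space of fields and \<open>N\<close> its seminorm (fields equal almost everywhere are
  not identified).  Measurability is strong measurability: almost everywhere approximation by
  simple functions with values in \<open>V\<close>.\<close>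

definition bochner_measurable ::
    "real \<Rightarrow> (real^3 \<Rightarrow> real^3) set \<Rightarrow> ((real^3 \<Rightarrow> real^3) \<Rightarrow> real)
      \<Rightarrow> (real \<Rightarrow> real^3 \<Rightarrow> real^3) \<Rightarrow> bool" where
  "bochner_measurable T V N u \<longleftrightarrow>
     (\<exists>s :: nat \<Rightarrow> real \<Rightarrow> real^3 \<Rightarrow> real^3.
        (\<forall>n. finite (s n ` {0<..<T}) \<and> s n ` {0<..<T} \<subseteq> V \<and>
             (\<forall>v. {t \<in> {0<..<T}. s n t = v} \<in> sets lebesgue)) \<and>
        (AE t in lebesgue. t \<in> {0<..<T} \<longrightarrow>
             (\<lambda>n. N (\<lambda>x. u t x - s n t x)) \<longlonglongrightarrow> 0))"

definition bochner_Lq ::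
    "real \<Rightarrow> real \<Rightarrow> (real^3 \<Rightarrow> real^3) set \<Rightarrow> ((real^3 \<Rightarrow> real^3) \<Rightarrow> real)
      \<Rightarrow> (real \<Rightarrow> real^3 \<Rightarrow> real^3) set" where
  "bochner_Lq q T V N = {u. bochner_measurable T V N u \<and>
     (AE t in lebesgue. t \<in> {0<..<T} \<longrightarrow> u t \<in> V) \<and>
     set_integrable lebesgue {0<..<T} (\<lambda>t. N (u t) powr q)}"

definition bochner_Linf ::
    "real \<Rightarrow> (real^3 \<Rightarrow> real^3) set \<Rightarrow> ((real^3 \<Rightarrow> real^3) \<Rightarrow> real)
      \<Rightarrow> (real \<Rightarrow> real^3 \<Rightarrow> real^3) set" where
  "bochner_Linf T V N = {u. bochner_measurable T V N u \<and>
     (AE t in lebesgue. t \<in> {0<..<T} \<longrightarrow> u t \<in> V) \<and>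
     (\<exists>M. AE t in lebesgue. t \<in> {0<..<T} \<longrightarrow> N (u t) \<le> M)}"

definition Linf_L2 :: "real \<Rightarrow> (real^3) set \<Rightarrow> (real \<Rightarrow> real^3 \<Rightarrow> real^3) set" where
  "Linf_L2 T \<Omega> = bochner_Linf T {f. in_Lp 2 \<Omega> f} (Lp_norm 2 \<Omega>)"

definition div_free :: "real \<Rightarrow> (real^3) set \<Rightarrow> (real \<Rightarrow> real^3 \<Rightarrow> real^3) \<Rightarrow> bool" where
  "div_free T \<Omega> u \<longleftrightarrow> (AE t in lebesgue. t \<in> {0<..<T} \<longrightarrow>
     (AE x in lebesgue. x \<in> \<Omega> \<longrightarrow> (\<Sum>j\<in>UNIV. weak_grad \<Omega> (u t) x $ j $ j) = 0))"

section \<open>The moving rigid body\<close>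

definition rigid_velocity ::
    "(real \<Rightarrow> real^3) \<Rightarrow> (real \<Rightarrow> real^3) \<Rightarrow> (real \<Rightarrow> real^3) \<Rightarrow> real \<Rightarrow> real^3 \<Rightarrow> real^3" where
  "rigid_velocity us om xs t x = us t + cross3 (om t) (x - xs t)"

definition in_Linf :: "real \<Rightarrow> (real \<Rightarrow> real^3) \<Rightarrow> bool" where
  "in_Linf T f \<longleftrightarrow> set_borel_measurable lebesgue {0<..<T} f \<and>
     (\<exists>M. AE t in lebesgue. t \<in> {0<..<T} \<longrightarrow> norm (f t) \<le> M)"

text \<open>\<open>X t x0\<close> is the position at time \<open>t\<close> of the body point starting at \<open>x0\<close>.  As the
  coefficients are only bounded and measurable in time, the differential equation is read in
  integrated form.  The points of \<open>closure S0\<close> are transported as well, because the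
  distinguished point \<open>xs\<close> of the body may lie on its boundary.\<close>

definition rigid_body_motion ::
    "(real^3) set \<Rightarrow> real \<Rightarrow> (real^3) set \<Rightarrow> (real \<Rightarrow> real^3) \<Rightarrow> (real \<Rightarrow> real^3) \<Rightarrow> (real \<Rightarrow> real^3)
      \<Rightarrow> (real \<Rightarrow> (real^3) set) \<Rightarrow> bool" where
  "rigid_body_motion \<Omega> T S0 us om xs S \<longleftrightarrow> in_Linf T us \<and> in_Linf T om \<and>
     (\<exists>X :: real \<Rightarrow> real^3 \<Rightarrow> real^3.
        (\<forall>x0\<in>closure S0. \<forall>t\<in>{0..<T}.
           (\<lambda>s. rigid_velocity us om xs s (X s x0)) absolutely_integrable_on {0..t} \<and>
           X t x0 = x0 + (LINT s:{0..t}|lebesgue. rigid_velocity us om xs s (X s x0))) \<and>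
        (\<exists>y\<in>closure S0. \<forall>t\<in>{0..<T}. xs t = X t y) \<and>
        (\<forall>t\<in>{0<..<T}. S t = X t ` S0 \<and> S t \<subseteq> \<Omega>))"

definition Lq_W1p_zero_body ::
    "real \<Rightarrow> real \<Rightarrow> real \<Rightarrow> (real^3) set \<Rightarrow> (real \<Rightarrow> (real^3) set) \<Rightarrow> (real \<Rightarrow> real^3) \<Rightarrow> (real \<Rightarrow> real^3)
      \<Rightarrow> (real \<Rightarrow> real^3) \<Rightarrow> (real \<Rightarrow> real^3 \<Rightarrow> real^3) set" where
  "Lq_W1p_zero_body q p T \<Omega> S us om xs =
     {u \<in> bochner_Lq q T (W1p_zero p \<Omega>) (W1p_norm p \<Omega>).
        AE t in lebesgue. t \<in> {0<..<T} \<longrightarrow>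
          (AE x in lebesgue. x \<in> S t \<longrightarrow> u t x = rigid_velocity us om xs t x)}"

definition fluid_region :: "(real^3) set \<Rightarrow> (real^3) set \<Rightarrow> (real^3) set" where
  "fluid_region \<Omega> St = \<Omega> - closure St"

definition wall_distance :: "(real^3) set \<Rightarrow> (real \<Rightarrow> (real^3) set) \<Rightarrow> real \<Rightarrow> real" where
  "wall_distance \<Omega> S t = setdist (S t) (frontier \<Omega>)"

text \<open>\<open>R\<close> gives orthogonal coordinates with origin \<open>Q\<close> in which \<open>P\<close> is \<open>(0, 0, h)\<close>.  For points
  realizing a positive distance the horizontal plane of these coordinates is necessarily tangent
  to both boundaries, so tangency is not imposed separately.  If \<open>P = Q\<close>, the cylinder below is
  only used with radius \<open>0\<close>, where it is empty.\<close>

definition contact_frame ::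
    "(real^3) set \<Rightarrow> (real^3) set \<Rightarrow> real^3 \<Rightarrow> real^3 \<Rightarrow> (real^3 \<Rightarrow> real^3) \<Rightarrow> bool" where
  "contact_frame \<Omega> St P Q R \<longleftrightarrow>
     P \<in> frontier St \<and> Q \<in> frontier \<Omega> \<and> dist P Q = setdist St (frontier \<Omega>) \<and>
     is_isometry R \<and> R 0 = Q \<and> R (vector [0, 0, dist P Q]) = P"

definition cylinder :: "(real^3 \<Rightarrow> real^3) \<Rightarrow> real \<Rightarrow> (real^3) set" where
  "cylinder R \<sigma> = R ` {x. norm (horiz x) < \<sigma>}"

end

theory Submission
  imports Defs "HOL-Computational_Algebra.Polynomial"
begin

text \<open>In the contact frame the body velocity is \<open>a + W (x - h e\<^sub>3)\<close>, and \<open>dh/dt = a\<^sub>3\<close>: as a function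
 of \<open>s\<close>, the distance of \<open>Q\<close> from the body point at \<open>P\<close> dominates the Lipschitz function \<open>h(s)\<close>, with
 equality at \<open>s = t\<close>. Since \<open>u\<close> vanishes on the wall and \<open>div u = 0\<close>, testing with a cut-off of
 radius \<open>\<sigma>\<close>, comparable to \<open>h\<^sup>1\<^sup>/\<^sup>(\<^sup>1\<^sup>+\<^sup>\<alpha>\<^sup>)\<close>, expresses \<open>a\<^sub>3\<close> by the horizontal flow
 through the gap. One vertical integration by parts against \<open>x\<^sub>3\<close> turns the latter into an integral of
 \<open>\<nabla> u\<close> over the gap, whose volume is of order \<open>\<sigma>\<^sup>2 h\<close>; on the body the only contribution comes from the
 rotation \<open>W\<close>, which is controlled by the same integral on testing \<open>div u\<close> with an additional factor
 \<open>x\<^sub>1\<close> or \<open>x\<^sub>2\<close>. Hoelder's inequality gives (i). For (ii) the height is measured from the surface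
 halfway between the wall and the body, and a second vertical integration by parts, against the product of
 the distances to the two surfaces, gains another factor \<open>h\<close> at the price of \<open>\<nabla>\<^sup>2 u\<close>. The translation
 \<open>a\<close> then enters only through the odd part of the middle surface, which is cubic.\<close>

text \<open>Sobolev fields are handled without traces, so no boundary integral is ever formed. At
  the wall a test function may jump, as long as the jump lies on a surface outside
  \<open>\<Omega>\<close>. At the body the vertical cut-off \<open>vcut\<close> descends inside the
  body, where the velocity is affine; what would be a boundary term becomes the integral of an
  explicit polynomial against \<open>vcut'\<close>, and most such integrals vanish by reflection.
  This dictates the geometry. All that (i) uses is a plane at height \<open>- h / 2\<close> outside
  \<open>\<Omega>\<close> and a slab of thickness \<open>h / 2\<close> inside the body, both read
  off the cusp zones; graphs enter only for (ii), where heights are measured from the middle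
  surface. The weight is the third power of \<open>hcut\<close>, so that its gradient, which serves
  as a test function for the second time, is still differentiable. Closest points \<open>P\<close>,
  \<open>Q\<close> need not be unique, so the exceptional null set of times must not depend on them:
  it is described by the Lebesgue points of the translational and angular velocities. The constants
  depend on the shape alone because charts are transported by isometries with unchanged
  parameters.\<close>

abbreviation (input) ind :: "'a set \<Rightarrow> 'a \<Rightarrow> real" where "ind \<equiv> indicat_real"

abbreviation (input) lint :: "('a::euclidean_space \<Rightarrow> 'b::{banach,second_countable_topology}) \<Rightarrow> 'b" (binder "LI " 10)
  where "lint f \<equiv> integral\<^sup>L lebesgue f"

abbreviation (input) lmeas :: "('a::euclidean_space \<Rightarrow> 'b::topological_space) set"
  where "lmeas \<equiv> borel_measurable lebesgue"

abbreviation (input) L1 :: "('a::euclidean_space \<Rightarrow> 'b::{banach,second_countable_topology}) \<Rightarrow> bool"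
  where "L1 \<equiv> integrable lebesgue"

section \<open>Isometries and Lebesgue integration\<close>

lemma is_isometry_orthogonal:
 assumes "is_isometry R"
 obtains A where "orthogonal_transformation A" "\<And>x. R x = R 0 + A x"
proof
 show "orthogonal_transformation (\<lambda>x. R x - R 0)"
  using assms by (auto simp: orthogonal_transformation_isometry is_isometry_def dist_norm)
qed auto

lemma is_isometry_affine:
 assumes "orthogonal_transformation A"
 shows "is_isometry (\<lambda>x. c + A x)"
 using assms by (auto simp: orthogonal_transformation_isometry is_isometry_def)

lemma is_isometry_compose:
 "is_isometry R ==> is_isometry R' ==> is_isometry (\<lambda>x. R (R' x))"
 by (simp add: is_isometry_def)

lemma is_isometry_bij:
 assumes "is_isometry R"
 shows "bij R"
proof -
 obtain A where A: "orthogonal_transformation A" "\<And>x. R x = R 0 + A x"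
  using is_isometry_orthogonal[OF assms] by blast
 have "R = (+) (R 0) \<circ> A" using A(2) by (metis comp_apply ext)
 then show ?thesis
  using bij_comp[OF orthogonal_transformation_bij[OF A(1)], of "(+) (R 0)"] bij_plus[of "R 0"] by metis
qed

lemma is_isometry_inv:
 assumes "is_isometry R"
 shows "is_isometry (inv R)"
 unfolding is_isometry_def
 by (metis assms is_isometry_bij bij_inv_eq_iff is_isometry_def)

lemma is_isometry_inv_cancel:
 assumes "is_isometry R"
 shows "R (inv R x) = x" "inv R (R x) = x"
 using is_isometry_bij[OF assms] by (simp_all add: bij_is_surj surj_f_inv_f bij_is_inj)

lemma is_isometry_continuous: "is_isometry R ==> continuous_on S R"
 unfolding continuous_on_iff is_isometry_def by metis

lemma is_isometry_translation: "is_isometry (\<lambda>x. x + c)" "is_isometry (\<lambda>x. c - x)"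
 by (auto simp: is_isometry_def dist_norm norm_minus_commute)

lemma isometry_lmeasurable_image:
 assumes "is_isometry R" "S \<in> lmeasurable"
 shows "R ` S \<in> lmeasurable" "measure lebesgue (R ` S) = measure lebesgue S"
proof -
 obtain A where A: "orthogonal_transformation A" "\<And>x. R x = R 0 + A x"
  using is_isometry_orthogonal[OF assms(1)] by blast
 have im: "R ` S = (+) (R 0) ` A ` S" using A(2) by (metis image_cong image_image)
 have "A ` S \<in> lmeasurable"
  using measurable_orthogonal_image A(1) assms(2) by blast
 moreover have "measure lebesgue (A ` S) = measure lebesgue S"
  using measure_orthogonal_image A(1) assms(2) by blast
 ultimately show "R ` S \<in> lmeasurable" "measure lebesgue (R ` S) = measure lebesgue S"
  using measurable_translation[of "A ` S" "R 0"] measure_translation[of "R 0" "A ` S"]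
  by (auto simp: im)
qed

text \<open>The image theorem concerns sets of finite measure; exhausting the set by its
  intersections with balls removes the restriction.\<close>

lemma isometry_lebesgue_sets:
 assumes "is_isometry R" "S \<in> sets lebesgue"
 shows "R ` S \<in> sets lebesgue"
proof -
 have "S = (\<Union>n::nat. S \<inter> cball 0 (real n))"
  using real_arch_simple by auto
 then have eq: "R ` S = (\<Union>n::nat. R ` (S \<inter> cball 0 (real n)))"
  by (metis image_UN)
 have "S \<inter> cball 0 (real n) \<in> lmeasurable" for n
  using assms(2) fmeasurable_Int_fmeasurable[OF lmeasurable_cball[of 0 "real n"]] by (metis Int_commute)
 then have "R ` (S \<inter> cball 0 (real n)) \<in> sets lebesgue" for n
  using isometry_lmeasurable_image(1)[OF assms(1)] fmeasurableD by blast
 then show ?thesis unfolding eq by (intro sets.countable_UN) auto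
qed

lemma isometry_vimage:
 assumes "is_isometry R"
 shows "R -` S = inv R ` S"
 using is_isometry_inv_cancel[OF assms] by (auto simp: image_iff) metis

lemma isometry_measurable_lebesgue:
 assumes "is_isometry R"
 shows "R \<in> measurable lebesgue lebesgue"
 by (rule measurableI)
  (auto simp: isometry_vimage[OF assms] intro!: isometry_lebesgue_sets is_isometry_inv assms)

text \<open>Infinite measure needs its own argument: if the preimage had finite measure,
  \<open>R\<close> would carry it back to a set of finite measure. In push-forward form every change
  of variables below is an instance of general facts on \<open>distr\<close>.\<close>

lemma isometry_distr_lebesgue:
 assumes R: "is_isometry R"
 shows "distr lebesgue lebesgue R = lebesgue"
proof (rule measure_eqI)
 fix S assume "S \<in> sets (distr lebesgue lebesgue R)"
 then have S: "S \<in> sets lebesgue" by simp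
 have fin: "emeasure lebesgue (R' ` S) = emeasure lebesgue S"
  if "S \<in> lmeasurable" "is_isometry R'" for S R'
  using that isometry_lmeasurable_image[OF that(2,1)]
  by (metis emeasure_eq_measure2 fmeasurableD)
 have "emeasure lebesgue (inv R ` S) = emeasure lebesgue S"
 proof (cases "S \<in> lmeasurable")
  case True then show ?thesis using fin is_isometry_inv[OF R] by blast
 next
  case False
  then have "inv R ` S \<notin> lmeasurable"
   using isometry_lmeasurable_image(1)[OF R, of "inv R ` S"] is_isometry_inv_cancel[OF R]
   by (auto simp: image_image)
  moreover have "inv R ` S \<in> sets lebesgue" using S R by (simp add: isometry_lebesgue_sets is_isometry_inv)
  ultimately show ?thesis using False S by (auto simp: fmeasurable_def not_less top_unique)
 qed
 then show "emeasure (distr lebesgue lebesgue R) S = emeasure lebesgue S"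
  by (simp add: emeasure_distr isometry_measurable_lebesgue[OF R] S isometry_vimage[OF R])
qed simp

lemma isometry_measurable_iff:
 assumes R: "is_isometry R"
 shows "(\<lambda>x. f (R x)) \<in> measurable lebesgue N \<longleftrightarrow> f \<in> measurable lebesgue N"
proof
 assume "(\<lambda>x. f (R x)) \<in> measurable lebesgue N"
 from measurable_compose[OF isometry_measurable_lebesgue[OF is_isometry_inv[OF R]] this]
 show "f \<in> measurable lebesgue N" by (simp add: is_isometry_inv_cancel[OF R])
qed (rule measurable_compose[OF isometry_measurable_lebesgue[OF R]])

text \<open>\<open>f\<close> and its composition with \<open>R\<close> are measurable together, so
  for a non-measurable \<open>f\<close> both sides are false.\<close>

lemma isometry_integrable:
 fixes f :: "real^3 \<Rightarrow> 'b::{banach,second_countable_topology}"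
 assumes R: "is_isometry R"
 shows "L1 (\<lambda>x. f (R x)) \<longleftrightarrow> L1 f"
proof (cases "f \<in> lmeas")
 case True
 show ?thesis
  using integrable_distr_eq[OF isometry_measurable_lebesgue[OF R] True]
  by (simp add: isometry_distr_lebesgue[OF R])
next
 case False
 then show ?thesis using isometry_measurable_iff[OF R, of f] borel_measurable_integrable by blast
qed

text \<open>For a non-measurable \<open>f\<close> both integrals have the default value 0.\<close>

lemma isometry_integral:
 fixes f :: "real^3 \<Rightarrow> 'b::{banach,second_countable_topology}"
 assumes R: "is_isometry R"
 shows "(LI x. f (R x)) = (LI x. f x)"
proof (cases "f \<in> lmeas")
 case True
 show ?thesis
  using integral_distr[OF isometry_measurable_lebesgue[OF R] True]
  by (simp add: isometry_distr_lebesgue[OF R])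
next
 case False
 then show ?thesis using isometry_integrable[OF R, of f]
  by (metis borel_measurable_integrable not_integrable_integral_eq)
qed

lemma isometry_AE:
 assumes R: "is_isometry R" and "AE x in lebesgue. P x"
 shows "AE x in lebesgue. P (R x)"
proof -
 have "AE x in distr lebesgue lebesgue R. P x" using assms(2) unfolding isometry_distr_lebesgue[OF R] .
 then show ?thesis by (rule AE_distrD[OF isometry_measurable_lebesgue[OF R]])
qed

section \<open>Integration by parts and integral bounds\<close>

lemma continuous_imp_lebesgue:
 fixes f :: "'a::euclidean_space \<Rightarrow> 'b::euclidean_space"
 assumes "continuous_on UNIV f"
 shows "f \<in> lmeas"
 using borel_measurable_continuous_onI[OF assms] by (simp add: measurable_completion)

lemma integrable_indicator_cball:
 "L1 (\<lambda>x. M * indicator (cball (c::real^3) r) x :: real)"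
 using lmeasurable_cball[of c r] unfolding lmeasurable_iff_integrable
 by (rule integrable_mult_right)

lemma dominated_convergence_pointwise:
 fixes f :: "'a \<Rightarrow> 'b::{banach,second_countable_topology}"
 assumes m: "\<And>n::nat. s n \<in> borel_measurable M" and w: "integrable M w"
  and lim: "\<And>x. (\<lambda>n. s n x) \<longlonglongrightarrow> f x" and bd: "\<And>n x. norm (s n x) \<le> w x"
 shows "f \<in> borel_measurable M" "integrable M f" "\<And>n. integrable M (s n)"
  "(\<lambda>n. LINT x|M. s n x) \<longlonglongrightarrow> (LINT x|M. f x)"
proof -
 show f: "f \<in> borel_measurable M"
  by (rule borel_measurable_LIMSEQ_metric[OF m]) (rule lim)
 have l: "AE x in M. (\<lambda>n. s n x) \<longlonglongrightarrow> f x" using lim by (intro AE_I2)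
 have b: "AE x in M. norm (s n x) \<le> w x" for n using bd by (intro AE_I2)
 show "integrable M f" by (rule integrable_dominated_convergence[OF f m w l b])
 show "\<And>n. integrable M (s n)" by (rule integrable_dominated_convergence2[OF f m w l b])
 show "(\<lambda>n. LINT x|M. s n x) \<longlonglongrightarrow> (LINT x|M. f x)"
  by (rule integral_dominated_convergence[OF f m w l b])
qed

lemma integrable_bounded_support:
 fixes f :: "real^3 \<Rightarrow> 'b::euclidean_space"
 assumes "f \<in> lmeas" "\<And>x. norm (f x) \<le> M" "\<And>x. x \<notin> S ==> f x = 0" "bounded S"
 shows "L1 f"
proof -
 obtain r where r: "S \<subseteq> cball 0 r" using bounded_subset_ballD[OF assms(4), of 0] ball_subset_cball by (metis subset_trans)
 show ?thesis
 proof (rule Bochner_Integration.integrable_bound[OF integrable_indicator_cball[of M 0 r] assms(1)], intro AE_I2)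
  show "norm (f x) \<le> norm (M * indicator (cball 0 r) x :: real)" for x
  proof (cases "x \<in> S")
   case True
   with r have "x \<in> cball 0 r" by blast
   then show ?thesis using assms(2)[of x] by (simp add: order_trans[OF _ abs_ge_self])
  qed (simp add: assms(3))
 qed
qed

text \<open>The difference quotients of \<open>f\<close> have integral zero by translation invariance.\<close>

lemma integral_derivative_zero:
 fixes f :: "real^3 \<Rightarrow> 'b::euclidean_space"
 assumes der: "\<And>x. (f has_derivative f' x) (at x)"
  and bd: "\<And>x v. norm (f' x v) \<le> M * norm v"
  and supp: "\<And>x. x \<notin> S ==> f x = 0" "bounded S"
 shows "L1 (\<lambda>x. f' x e)" "(LI x. f' x e) = 0"
proof -
 obtain r where r: "S \<subseteq> cball 0 r" using bounded_subset_ballD[OF supp(2), of 0] ball_subset_cball by (metis subset_trans)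
 define s :: "nat \<Rightarrow> real"  where "s n = 1 / real (Suc n)" for n
 have s0: "s n > 0" "s n \<le> 1" for n by (auto simp: s_def divide_simps)
 have sl: "s \<longlonglongrightarrow> 0" unfolding s_def using LIMSEQ_inverse_real_of_nat unfolding inverse_eq_divide .
 define q where "q n x = (1 / s n) *\<^sub>R (f (x + s n *\<^sub>R e) - f x)" for n x
 have cont: "continuous_on UNIV f"
  by (meson der has_derivative_continuous continuous_at_imp_continuous_on)
 then have fm': "f \<in> lmeas" by (rule continuous_imp_lebesgue)
 have M0: "M \<ge> 0" using order_trans[OF norm_ge_zero bd[of 0 "axis 1 1"]] by (simp add: norm_axis_1)
 have lip: "norm (f y - f x) \<le> M * norm (y - x)" for x y
 proof (rule differentiable_bound[where S=UNIV and f'=f'])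
  show "onorm (f' x) \<le> M" for x using onorm_bound[OF M0 bd] .
 qed (use der in auto)
 have ql: "(\<lambda>n. q n x) \<longlonglongrightarrow> f' x e" for x
 proof -
  have "((\<lambda>t. f (x + t *\<^sub>R e)) has_derivative (\<lambda>t. f' x (t *\<^sub>R e))) (at (0::real))"
   by (rule has_derivative_compose[of "\<lambda>t. x + t *\<^sub>R e" "\<lambda>t. t *\<^sub>R e" 0 UNIV f "f' x"])
    (use der[of x] in \<open>auto intro!: derivative_eq_intros\<close>)
  moreover have "f' x (t *\<^sub>R e) = t *\<^sub>R f' x e" for t
   by (rule linear_scale[OF has_derivative_linear[OF der]])
  ultimately have "((\<lambda>t. f (x + t *\<^sub>R e)) has_vector_derivative f' x e) (at 0)"
   by (simp add: has_vector_derivative_def)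
  then have "((\<lambda>h. norm (f (x + h *\<^sub>R e) - f x - h *\<^sub>R f' x e) / norm h) \<longlongrightarrow> 0) (at 0)"
   by (simp add: has_vector_derivative_def has_derivative_at)
  moreover have "norm (f (x + h *\<^sub>R e) - f x - h *\<^sub>R f' x e) / norm h
    = norm ((1/h) *\<^sub>R (f (x + h *\<^sub>R e) - f x) - f' x e)" if "h \<noteq> 0" for h
  proof -
   have "(1/h) *\<^sub>R (f (x + h *\<^sub>R e) - f x) - f' x e
     = (1/h) *\<^sub>R (f (x + h *\<^sub>R e) - f x - h *\<^sub>R f' x e)"
    using that by (simp add: scaleR_diff_right)
   then show ?thesis by simp
  qed
  ultimately have "((\<lambda>h. norm ((1/h) *\<^sub>R (f (x + h *\<^sub>R e) - f x) - f' x e)) \<longlongrightarrow> 0) (at 0)"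
   by (simp add: Lim_transform_eventually[OF _ eventually_at_filter[THEN iffD2]] cong: LIM_cong)
  then have "((\<lambda>h. (1/h) *\<^sub>R (f (x + h *\<^sub>R e) - f x)) \<longlongrightarrow> f' x e) (at 0)"
   using Lim_null tendsto_norm_zero_iff by blast
  then show ?thesis unfolding q_def
   by (rule filterlim_compose) (use sl s0 in \<open>auto simp: filterlim_at less_imp_neq intro!: always_eventually\<close>, metis less_irrefl s0(1))
 qed
 have sup: "q n x = 0" if "x \<notin> cball 0 (r + norm e)" for n x
 proof -
  have "norm (s n *\<^sub>R e) \<le> norm e" using s0[of n] by (simp add: mult_left_le_one_le)
  moreover have "norm x > r + norm e" "norm x \<le> norm (x + s n *\<^sub>R e) + norm (s n *\<^sub>R e)" using that
   norm_triangle_ineq4[of "x + s n *\<^sub>R e" "s n *\<^sub>R e"] by simp_all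
  ultimately have "norm x > r" "norm (x + s n *\<^sub>R e) > r" using norm_ge_zero[of e] by linarith+
  then have "x \<notin> S \<and> x + s n *\<^sub>R e \<notin> S" using r by fastforce
  then show ?thesis using supp(1) by (simp add: q_def)
 qed
 have qb: "norm (q n x) \<le> M * norm e" for n x
  using lip[of "x + s n *\<^sub>R e" x] s0[of n] by (simp add: q_def pos_divide_le_eq mult_ac)
 have qm: "q n \<in> lmeas" for n
  unfolding q_def using fm' isometry_measurable_iff[OF is_isometry_translation(1), of f "s n *\<^sub>R e" borel]
  by (intro borel_measurable_scaleR borel_measurable_diff) simp_all
 have qi: "L1 (q n)" for n
  by (rule integrable_bounded_support[OF qm qb sup bounded_cball])
 \<comment> \<open>A zero \<open>x1\<close> of \<open>f\<close> and the Lipschitz bound make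
   \<open>f\<close> bounded, hence integrable; only then may the two translates in the difference
   quotient be integrated separately.\<close>
 have "S \<noteq> UNIV" using supp(2) not_bounded_UNIV[where 'a="real^3"] by metis
 then obtain x1 where x1: "x1 \<notin> S" by blast
 have fi: "L1 f"
 proof (rule integrable_bounded_support[OF fm'])
  have r1: "norm (x - x1) \<le> r + norm x1" if "x \<in> S" for x
   using norm_triangle_ineq4[of x x1] r that by fastforce
  show "norm (f x) \<le> \<bar>M * (r + norm x1)\<bar>" for x
   using lip[of x x1] r1[of x] supp(1)[OF x1] supp(1)[of x] mult_left_mono[OF r1[of x] M0]
   by (cases "x \<in> S") auto
 qed (use supp in auto)
 have q0: "(LI x. q n x) = 0" for n
  using fi isometry_integrable[OF is_isometry_translation(1), of f "s n *\<^sub>R e"]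
   isometry_integral[OF is_isometry_translation(1), of f "s n *\<^sub>R e"] by (simp add: q_def)
 have bb: "norm (q n x) \<le> M * norm e * indicator (cball (0::real^3) (r + norm e)) x" for n x
  using qb[of n x] sup[of x n] by (auto split: split_indicator)
 note dc = dominated_convergence_pointwise[of q, OF qm integrable_indicator_cball ql bb]
 show "L1 (\<lambda>x. f' x e)" by (rule dc(2))
 have "(\<lambda>n. LI x. q n x) \<longlonglongrightarrow> (LI x. f' x e)" by (rule dc(4))
 then show "(LI x. f' x e) = 0" by (simp add: q0 LIMSEQ_const_iff)
qed

text \<open>A crude Hoelder inequality: \<open>x \<le> x\<^sup>p / c\<^sup>p\<^sup>-\<^sup>1 + c\<close> for all \<open>c > 0\<close>.\<close>

lemma Lp_crude_Hoelder:
 fixes f :: "'a \<Rightarrow> 'b::euclidean_space"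
 assumes p: "1 \<le> p" and fm: "f \<in> borel_measurable M"
  and int: "integrable M (\<lambda>x. norm (f x) powr p)"
  and A: "A \<in> sets M" "emeasure M A < \<infinity>" "measure M A \<le> m" "0 < m"
  and supp: "\<And>x. x \<notin> A ==> f x = 0"
 shows "integrable M f"
  and "(LINT x|M. norm (f x)) \<le> 2 * m powr (1 - 1/p) * (LINT x|M. norm (f x) powr p) powr (1/p)"
proof -
 define I where "I = (LINT x|M. norm (f x) powr p)"
 have I0: "I \<ge> 0" unfolding I_def by (rule integral_nonneg_AE) auto
 have iA: "integrable M (indicator A :: _ \<Rightarrow> real)" using A by simp
 have pt: "norm (f x) \<le> norm (f x) powr p / c powr (p - 1) + c * indicator A x" if "c > 0" for c x
 proof (cases "x \<in> A")
  case True
  show ?thesis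
  proof (cases "norm (f x) \<le> c")
   case True then show ?thesis using \<open>x \<in> A\<close> by (simp add: add_increasing)
  next
   case False
   then have "norm (f x) powr p = norm (f x) * norm (f x) powr (p - 1)"
    using that by (simp add: powr_mult_base)
   moreover have "c powr (p - 1) \<le> norm (f x) powr (p - 1)"
    using False that p by (intro powr_mono2) auto
   ultimately have "norm (f x) * c powr (p - 1) \<le> norm (f x) powr p"
    by (simp add: mult_left_mono)
   then have "norm (f x) \<le> norm (f x) powr p / c powr (p - 1)"
    using that by (simp add: pos_le_divide_eq)
   then show ?thesis using that \<open>x \<in> A\<close> by simp
  qed
 qed (use supp in simp)
 have int2: "integrable M (\<lambda>x. norm (f x) powr p / c powr (p - 1) + c * indicator A x)" for c
  using int iA by simp
 have inn: "integrable M (\<lambda>x. norm (f x))"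
  by (rule Bochner_Integration.integrable_bound[OF int2[of 1]])
   (use fm pt[of 1] in \<open>auto intro!: AE_I2 order_trans[OF _ abs_ge_self]\<close>)
 then show "integrable M f" using fm integrable_norm_iff by blast
 have bd: "(LINT x|M. norm (f x)) \<le> I / c powr (p - 1) + c * m" if c: "c > 0" for c
 proof -
  have "(LINT x|M. norm (f x)) \<le> (LINT x|M. norm (f x) powr p / c powr (p - 1) + c * indicator A x)"
   by (rule integral_mono[OF inn int2 pt[OF c]])
  also have "\<dots> = I / c powr (p - 1) + c * measure M A"
   using int iA A sets.sets_into_space[OF A(1)] by (simp add: I_def inf_absorb1)
  also have "\<dots> \<le> I / c powr (p - 1) + c * m" using A c by (simp add: mult_left_mono)
  finally show ?thesis .
 qed
 have "(LINT x|M. norm (f x)) \<le> 2 * m powr (1 - 1/p) * I powr (1/p)"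
 proof (cases "I = 0")
  case True
  \<comment> \<open>There is no optimal \<open>c\<close> when \<open>I = 0\<close>; the choice
    \<open>c = e / m\<close> makes the bound equal to an arbitrary \<open>e\<close>.\<close>
  have "(LINT x|M. norm (f x)) \<le> 0 + e" if "e > 0" for e
   using bd[of "e / m"] that A True by simp
  then have "(LINT x|M. norm (f x)) \<le> 0" using field_le_epsilon by blast
  then show ?thesis using True by simp
 next
  case False
  with I0 have I: "I > 0" by simp
  \<comment> \<open>The value for which the two terms \<open>I / c powr (p - 1)\<close> and
    \<open>c * m\<close> coincide; their sum is the origin of the factor 2 where the sharp
    inequality has 1.\<close>
  define c where "c = (I / m) powr (1/p)"
  have c: "c > 0" using I A by (simp add: c_def)
  have "c powr p = I / m" using I A p by (simp add: c_def powr_powr)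
  then have "I / c powr (p - 1) = c * m"
   using c A I by (simp add: powr_diff field_simps)
  moreover have "c * m = m powr (1 - 1/p) * I powr (1/p)"
   using I A by (simp add: c_def powr_divide powr_diff)
  ultimately show ?thesis using bd[OF c] by linarith
 qed
 then show "(LINT x|M. norm (f x)) \<le> 2 * m powr (1 - 1/p) * (LINT x|M. norm (f x) powr p) powr (1/p)"
  by (simp add: I_def)
qed

section \<open>Smooth mollifiers\<close>

text \<open>With y = 1/s one has dy/ds = - y^2, so the s-derivative of P(y) exp(- y) is y^2 (P(y) -
  P'(y)) exp(- y).\<close>

primrec flat_poly :: "nat \<Rightarrow> real poly" where
 "flat_poly 0 = 1"
| "flat_poly (Suc n) = monom 1 2 * (flat_poly n - pderiv (flat_poly n))"

text \<open>The \<open>n\<close>-th derivative of \<open>exp (- 1 / s)\<close>, extended by zero to \<open>s \<le> 0\<close>.\<close>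

definition flat :: "nat \<Rightarrow> real \<Rightarrow> real" where
 "flat n s = (if s > 0 then poly (flat_poly n) (inverse s) * exp (- inverse s) else 0)"

text \<open>The free exponent \<open>k\<close> carries the induction: splitting off the constant
  coefficient leaves the same claim for the shorter polynomial with \<open>k + 1\<close>.\<close>

lemma poly_exp_decay: "((\<lambda>y::real. y ^ k * poly p y * exp (- y)) \<longlongrightarrow> 0) at_top"
proof (induction p arbitrary: k)
 case 0
 then show ?case by simp
next
 case (pCons a p)
 have "((\<lambda>y::real. a * (y ^ k / exp y) + y ^ Suc k * poly p y * exp (- y)) \<longlongrightarrow> a * 0 + 0) at_top"
  by (intro tendsto_intros tendsto_power_div_exp_0 pCons.IH)
 then show ?case by (simp add: field_simps exp_minus)
qed

text \<open>The only delicate point is 0. There the difference quotient from the right is y P(y)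
  exp(- y) with y = 1/h, which tends to 0 as y grows; from the left it is 0.\<close>

lemma flat_deriv: "(flat n has_real_derivative flat (Suc n) s) (at s)"
proof (cases s "0::real" rule: linorder_cases)
 case less
 have "((\<lambda>_. 0) has_real_derivative 0) (at s)" by simp
 then have "(flat n has_real_derivative 0) (at s)"
  by (rule has_field_derivative_transform_within_open[where S="{..<0}"]) (use less in \<open>auto simp: flat_def\<close>)
 then show ?thesis using less by (simp add: flat_def)
next
 case greater
 have "((\<lambda>s. poly (flat_poly n) (inverse s) * exp (- inverse s)) has_real_derivative flat (Suc n) s) (at s)"
  using greater
  by (auto intro!: derivative_eq_intros simp: flat_def poly_monom field_simps power2_eq_square)
 then show ?thesis
  by (rule has_field_derivative_transform_within_open[where S="{0<..}"]) (use greater in \<open>auto simp: flat_def\<close>)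
next
 case equal
 have "((\<lambda>h. poly (flat_poly n) (inverse h) * exp (- inverse h) * inverse h) \<longlongrightarrow> 0) (at_right (0::real))"
  using filterlim_compose[OF poly_exp_decay[of 1 "flat_poly n"] filterlim_inverse_at_top_right]
  by (simp add: mult_ac)
 moreover have "eventually (\<lambda>h. poly (flat_poly n) (inverse h) * exp (- inverse h) * inverse h = flat n h / h) (at_right (0::real))"
  by (auto simp: eventually_at_right_field flat_def field_simps intro!: exI[of _ 1])
 ultimately have r: "((\<lambda>h. flat n h / h) \<longlongrightarrow> 0) (at_right 0)"
  by (rule Lim_transform_eventually)
 have "eventually (\<lambda>h. 0 = flat n h / h) (at_left (0::real))"
  by (auto simp: eventually_at_left_field flat_def intro!: exI[of _ "-1"])
 then have l: "((\<lambda>h. flat n h / h) \<longlongrightarrow> 0) (at_left 0)"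
  by (rule Lim_transform_eventually[OF tendsto_const])
 show ?thesis
  using filterlim_split_at[OF l r] equal by (simp add: has_field_derivative_iff flat_def)
qed

lemma flat_nonneg: "flat 0 s \<ge> 0" and flat_pos: "s > 0 ==> flat 0 s > 0" and flat_zero: "s \<le> 0 ==> flat n s = 0"
 by (auto simp: flat_def)

section \<open>Calculus of partial derivatives and of the classes \<open>Ck_on\<close>\<close>

lemma partial_eq: "(f has_derivative f') (at x) ==> partial j f x = f' (axis j 1)"
 unfolding partial_def by (metis frechet_derivative_at)

lemma Ck_on_mono: "Ck_on (Suc m) UNIV f ==> Ck_on m UNIV f"
 by (induction m arbitrary: f) (auto simp: differentiable_imp_continuous_on)

lemma differentiable_on_UNIV_D:
 "f differentiable_on UNIV ==> (f has_derivative frechet_derivative f (at x)) (at x)"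
 by (simp add: differentiable_on_def frechet_derivative_works)

lemma Ck_on_const: "Ck_on m UNIV (\<lambda>x::real^3. c::real)"
proof (induction m arbitrary: c)
 case (Suc m)
 have "partial j (\<lambda>x::real^3. c) = (\<lambda>x. 0)" for j
  by (rule ext, subst partial_eq[of _ "\<lambda>v. 0"]) auto
 then show ?case using Suc[of 0] by simp
qed simp

lemma Ck_on_add:
 fixes f g :: "real^3 \<Rightarrow> real"
 shows "Ck_on m UNIV f ==> Ck_on m UNIV g ==> Ck_on m UNIV (\<lambda>x. f x + g x)"
proof (induction m arbitrary: f g)
 case (Suc m)
 have "partial j (\<lambda>x. f x + g x) = (\<lambda>x. partial j f x + partial j g x)" for j
 proof
  fix x
  have "((\<lambda>x. f x + g x) has_derivative (\<lambda>v. frechet_derivative f (at x) v + frechet_derivative g (at x) v)) (at x)"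
   using Suc.prems by (intro has_derivative_add differentiable_on_UNIV_D) auto
  then show "partial j (\<lambda>x. f x + g x) x = partial j f x + partial j g x"
   by (subst partial_eq) (auto simp: partial_def)
 qed
 then show ?case using Suc by (auto intro: differentiable_on_add)
qed (auto intro: continuous_on_add)

lemma Ck_on_mult:
 fixes f g :: "real^3 \<Rightarrow> real"
 shows "Ck_on m UNIV f ==> Ck_on m UNIV g ==> Ck_on m UNIV (\<lambda>x. f x * g x)"
proof (induction m arbitrary: f g)
 case (Suc m)
 have "partial j (\<lambda>x. f x * g x) = (\<lambda>x. f x * partial j g x + partial j f x * g x)" for j
 proof
  fix x
  have "((\<lambda>x. f x * g x) has_derivative (\<lambda>v. f x * frechet_derivative g (at x) v + frechet_derivative f (at x) v * g x)) (at x)"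
   using Suc.prems by (intro has_derivative_mult differentiable_on_UNIV_D) auto
  then show "partial j (\<lambda>x. f x * g x) x = f x * partial j g x + partial j f x * g x"
   by (subst partial_eq) (auto simp: partial_def)
 qed
 moreover have "Ck_on m UNIV (\<lambda>x. f x * partial j g x + partial j f x * g x)" for j
  using Suc.prems by (intro Ck_on_add Suc.IH) (auto intro: Ck_on_mono)
 ultimately show ?case using Suc.prems by (auto intro!: differentiable_on_mult)
qed (auto intro: continuous_on_mult)

lemma flat_coordinate_derivative:
 fixes i :: 3
 shows "((\<lambda>x::real^3. flat n (c + d * x $ i)) has_derivative (\<lambda>v. flat (Suc n) (c + d * x $ i) * (d * v $ i))) (at x)"
proof -
 have "((\<lambda>x::real^3. c + d * x $ i) has_derivative (\<lambda>v. d * v $ i)) (at x)"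
  using has_derivative_add[OF has_derivative_const[of c] has_derivative_mult_right[OF
   bounded_linear_imp_has_derivative[OF bounded_linear_vec_nth[of i]], of d]] by simp
 from has_derivative_compose[OF this has_field_derivative_imp_has_derivative[OF flat_deriv[of n "c + d * x $ i"]]]
 show ?thesis by (simp add: mult_ac)
qed

lemma Ck_on_flat: "Ck_on m UNIV (\<lambda>x::real^3. flat n (c + d * x $ i))"
proof (induction m arbitrary: n)
 case 0
 have "continuous_on UNIV (\<lambda>x::real^3. flat n (c + d * x $ i))"
  by (intro continuous_at_imp_continuous_on ballI has_derivative_continuous[OF flat_coordinate_derivative])
 then show ?case by simp
next
 case (Suc m)
 have "partial j (\<lambda>x::real^3. flat n (c + d * x $ i)) = (\<lambda>x. (if j = i then d else 0) * flat (Suc n) (c + d * x $ i))" for j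
  by (rule ext, subst partial_eq[OF flat_coordinate_derivative]) (auto simp: axis_def)
 moreover have "(\<lambda>x::real^3. flat n (c + d * x $ i)) differentiable_on UNIV"
  unfolding differentiable_on_def differentiable_def using flat_coordinate_derivative by blast
 ultimately show ?case using Suc Ck_on_const by (auto intro!: Ck_on_mult)
qed

text \<open>For \<open>r > 0\<close> it is positive exactly on the open cube of half side 1/r. The
  product over coordinates reduces smoothness to the one-variable function \<open>flat 0\<close> and
  to closure under products.\<close>

definition bump :: "real \<Rightarrow> real^3 \<Rightarrow> real" where
 "bump r x = (\<Prod>i\<in>UNIV. flat 0 (1 + r * x $ i) * flat 0 (1 + (- r) * x $ i))"

lemma bump_smooth: "Ck_on m UNIV (bump r)"
proof -
 have "Ck_on m UNIV (\<lambda>x. \<Prod>i\<in>I. flat 0 (1 + r * x $ i) * flat 0 (1 + (- r) * x $ i))" for I :: "3 set"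
  using finite_class.finite[of I]
 proof (induction I)
  case (insert i I)
  have "Ck_on m UNIV (\<lambda>x. (flat 0 (1 + r * x $ i) * flat 0 (1 + (- r) * x $ i)) *
    (\<Prod>i\<in>I. flat 0 (1 + r * x $ i) * flat 0 (1 + (- r) * x $ i)))"
   by (intro Ck_on_mult Ck_on_flat insert.IH)
  then show ?case by (simp only: prod.insert[OF insert.hyps(1,2)])
 qed (simp add: Ck_on_const)
 then show ?thesis unfolding bump_def[abs_def] .
qed

lemma bump_nonneg: "bump r x \<ge> 0"
 unfolding bump_def by (intro prod_nonneg mult_nonneg_nonneg) (auto simp: flat_nonneg)

lemma bump_support:
 assumes "bump r x \<noteq> 0" "r > 0"
 shows "norm x \<le> 3 / r"
proof -
 have "\<bar>x $ i\<bar> \<le> 1 / r" for i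
 proof -
  have "flat 0 (1 + r * x $ i) \<noteq> 0" "flat 0 (1 + (- r) * x $ i) \<noteq> 0"
   using assms(1) unfolding bump_def by auto
  then have "1 + r * x $ i > 0" "1 + (- r) * x $ i > 0" using flat_zero not_less by blast+
  then show ?thesis using assms(2) by (auto simp: abs_le_iff field_simps)
 qed
 then have "(\<Sum>i\<in>UNIV. \<bar>x $ i\<bar>) \<le> (\<Sum>i\<in>(UNIV::3 set). 1 / r)" by (intro sum_mono) auto
 then show ?thesis using norm_le_l1_cart[of x] by simp
qed

lemma bump_continuous: "continuous_on UNIV (bump r)"
 using bump_smooth[of 0] by simp

lemma bump_integral_pos:
 assumes "r > 0"
 shows "L1 (bump r)" "(LI x. bump r x) > 0"
proof -
 have "compact (bump r ` cball 0 (3/r))"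
  by (intro compact_continuous_image continuous_on_subset[OF bump_continuous]) auto
 then obtain B where B: "\<And>x. x \<in> cball 0 (3/r) ==> norm (bump r x) \<le> B"
  by (metis compact_imp_bounded bounded_iff imageI)
 have s: "bump r x = 0" if "x \<notin> cball 0 (3/r)" for x using bump_support[of r x] assms that by auto
 have "norm (bump r x) \<le> \<bar>B\<bar>" for x
  using B[of x] s[of x] by (cases "x \<in> cball 0 (3/r)") auto
 then show i: "L1 (bump r)"
  by (rule integrable_bounded_support[OF continuous_imp_lebesgue[OF bump_continuous] _ s bounded_cball])
 have p0: "bump r 0 > 0" unfolding bump_def by (auto intro!: prod_pos simp: flat_pos)
 have "open (bump r -` {0<..})" using bump_continuous by (simp add: continuous_on_open_vimage)
 moreover have "0 \<in> bump r -` {0<..}" using p0 by simp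
 ultimately have nz: "\<not> negligible (bump r -` {0<..})" using open_not_negligible by blast
 have "(LI x. bump r x) \<noteq> 0"
 proof
  assume "(LI x. bump r x) = 0"
  then have "AE x in lebesgue. bump r x = 0"
   using integral_nonneg_eq_0_iff_AE[OF i] bump_nonneg by simp
  then obtain N where "N \<in> null_sets lebesgue" "{x. bump r x \<noteq> 0} \<subseteq> N"
   by (auto simp: eventually_ae_filter)
  then have "negligible {x. bump r x \<noteq> 0}"
   by (meson negligible_iff_null_sets negligible_subset)
  then show False using nz negligible_subset by (metis (mono_tags, lifting) greaterThan_iff less_irrefl mem_Collect_eq subsetI vimageE)
 qed
 moreover have "(LI x. bump r x) \<ge> 0" by (rule Bochner_Integration.integral_nonneg) (rule bump_nonneg)
 ultimately show "(LI x. bump r x) > 0" by linarith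
qed

definition mollifier :: "nat \<Rightarrow> real^3 \<Rightarrow> real" where
 "mollifier n x = inverse (LI x. bump (real (Suc n)) x) * bump (real (Suc n)) x"

lemma mollifier:
 shows "Ck_on m UNIV (mollifier n)" "mollifier n x \<ge> 0" "L1 (mollifier n)"
  "(LI x. mollifier n x) = 1" "mollifier n x \<noteq> 0 ==> norm x \<le> 3 / real (Suc n)"
 using bump_integral_pos[of "real (Suc n)"] bump_nonneg[of "real (Suc n)" x] bump_support[of "real (Suc n)" x]
 unfolding mollifier_def by (auto intro!: Ck_on_mult Ck_on_const bump_smooth simp del: of_nat_Suc)

lemma Ck_on_gradient:
 fixes f :: "real^3 \<Rightarrow> 'b::real_normed_vector"
 assumes "Ck_on (Suc m) UNIV f"
 shows "(f has_derivative (\<lambda>v. \<Sum>j\<in>UNIV. v $ j *\<^sub>R partial j f x)) (at x)"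
  "continuous_on UNIV (partial j f)"
proof -
 have d: "(f has_derivative frechet_derivative f (at x)) (at x)"
  using assms by (auto intro: differentiable_on_UNIV_D)
 have "frechet_derivative f (at x) v = (\<Sum>j\<in>UNIV. v $ j *\<^sub>R partial j f x)" for v
 proof -
  have "v = (\<Sum>j\<in>UNIV. v $ j *\<^sub>R axis j 1)" by (simp add: basis_expansion flip: scalar_mult_eq_scaleR)
  then have "frechet_derivative f (at x) v = frechet_derivative f (at x) (\<Sum>j\<in>UNIV. v $ j *\<^sub>R axis j 1)" by simp
  also have "\<dots> = (\<Sum>j\<in>UNIV. v $ j *\<^sub>R partial j f x)"
   using has_derivative_linear[OF d] by (simp add: linear_sum linear_scale partial_def)
  finally show ?thesis .
 qed
 then show "(f has_derivative (\<lambda>v. \<Sum>j\<in>UNIV. v $ j *\<^sub>R partial j f x)) (at x)" using d by presburger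
 have "Ck_on m UNIV (partial j f)" using assms by simp
 then show "continuous_on UNIV (partial j f)"
  by (induction m) (use Ck_on_mono in \<open>force+\<close>)
qed

section \<open>Convolution with the mollifiers\<close>

definition conv :: "(real^3 \<Rightarrow> real) \<Rightarrow> (real^3 \<Rightarrow> real) \<Rightarrow> real^3 \<Rightarrow> real" where
 "conv \<rho> \<theta> x = (LI z. \<rho> (x - z) * \<theta> z)"

lemma continuous_support_bounded:
 fixes f :: "real^3 \<Rightarrow> 'b::euclidean_space"
 assumes "continuous_on UNIV f" "\<And>x. x \<notin> K ==> f x = 0" "bounded K"
 obtains B where "\<And>x. norm (f x) \<le> B" "B \<ge> 0"
proof -
 obtain r where r: "K \<subseteq> cball 0 r"
  using bounded_subset_ballD[OF assms(3), of 0] ball_subset_cball by (metis subset_trans)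
 have "compact (f ` cball 0 r)"
  by (intro compact_continuous_image continuous_on_subset[OF assms(1)]) auto
 then obtain B where B: "\<And>x. x \<in> cball 0 r ==> norm (f x) \<le> B"
  by (metis compact_imp_bounded bounded_iff imageI)
 have "norm (f x) \<le> max B 0" for x
  using B[of x] assms(2)[of x] r by (cases "x \<in> K") (auto simp: le_max_iff_disj)
 then show ?thesis using that by (metis max.cobounded2)
qed

lemma continuous_support_integrable:
 fixes f :: "real^3 \<Rightarrow> 'b::euclidean_space"
 assumes "continuous_on UNIV f" "\<And>x. x \<notin> K ==> f x = 0" "bounded K"
 shows "L1 f"
 by (meson continuous_support_bounded[OF assms] integrable_bounded_support continuous_imp_lebesgue assms)

lemma lebesgue_integral_cbox:
 fixes f :: "real^3 \<Rightarrow> 'b::euclidean_space"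
 assumes "continuous_on UNIV f" "\<And>x. x \<notin> cbox a b ==> f x = 0"
 shows "(LI x. f x) = integral (cbox a b) f"
proof -
 have i: "L1 f" by (rule continuous_support_integrable[OF assms]) auto
 have e: "ind (cbox a b) x *\<^sub>R f x = f x" for x using assms(2)[of x] by (auto split: split_indicator)
 have "set_integrable lebesgue (cbox a b) f" using i by (simp add: set_integrable_def e)
 from set_lebesgue_integral_eq_integral(2)[OF this] show ?thesis by (simp add: set_lebesgue_integral_def e)
qed

text \<open>All derivatives fall on \<open>\<rho>\<close>; continuity of \<open>\<theta>\<close> is
  enough. The box around the support of \<open>\<theta>\<close> turns the convolution into an
  integral over a fixed compact box, where the Leibniz rule applies.\<close>

lemma conv_has_derivative:
 assumes \<rho>: "Ck_on (Suc m) UNIV \<rho>" and \<theta>: "continuous_on UNIV \<theta>" "\<And>x. x \<notin> cbox a b ==> \<theta> x = 0"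
 shows "(conv \<rho> \<theta> has_derivative (\<lambda>v. \<Sum>j\<in>UNIV. v $ j *\<^sub>R conv (partial j \<rho>) \<theta> x)) (at x)"
proof -
 define G where "G x = (\<chi> j. partial j \<rho> x)" for x
 have contG: "continuous_on UNIV G"
  unfolding G_def by (intro continuous_on_vec_lambda Ck_on_gradient(2)[OF \<rho>])
 have der\<rho>: "(\<rho> has_derivative (\<lambda>v. G x \<bullet> v)) (at x)" for x
  using Ck_on_gradient(1)[OF \<rho>, of x] by (simp add: G_def inner_vec_def mult.commute)
 have cont\<rho>: "continuous_on UNIV \<rho>"
  by (meson der\<rho> has_derivative_continuous continuous_at_imp_continuous_on)
 have c1: "continuous_on UNIV (\<lambda>z. \<rho> (x - z) * \<theta> z)" for x
  by (intro continuous_intros \<theta> continuous_on_compose2[OF cont\<rho>]) auto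
 have eq: "conv \<rho> \<theta> = (\<lambda>x. integral (cbox a b) (\<lambda>z. \<rho> (x - z) * \<theta> z))"
  unfolding conv_def using \<theta>(2) by (intro ext lebesgue_integral_cbox c1) auto
 define fx where "fx x z = blinfun_inner_left (\<theta> z *\<^sub>R G (x - z))" for x z
 have cf: "continuous_on (UNIV \<times> cbox a b) (\<lambda>(x, z). fx x z)"
  unfolding fx_def split_beta
  by (intro bounded_linear.continuous_on[OF bounded_linear_blinfun_inner_left] continuous_intros
   continuous_on_compose2[OF \<theta>(1)] continuous_on_compose2[OF contG]) auto
 have "((\<lambda>x. integral (cbox a b) (\<lambda>z. \<rho> (x - z) * \<theta> z)) has_derivative integral (cbox a b) (fx x)) (at x within UNIV)"
 proof (rule leibniz_rule[OF _ _ cf])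
  show "((\<lambda>x. \<rho> (x - t) * \<theta> t) has_derivative blinfun_apply (fx x t)) (at x within UNIV)" for x t
  proof -
   have "((\<lambda>x. \<rho> (x - t)) has_derivative (\<lambda>v. G (x - t) \<bullet> v)) (at x)"
    by (rule has_derivative_compose[OF _ der\<rho>, where f="\<lambda>x. x - t" and f'="\<lambda>v. v", simplified]) (auto intro!: derivative_eq_intros)
   from has_derivative_mult_left[OF this, of "\<theta> t"] show ?thesis
    by (simp add: fx_def mult.commute[of _ "\<theta> t"] blinfun_inner_left.rep_eq inner_commute)
  qed
  show "(\<lambda>z. \<rho> (x - z) * \<theta> z) integrable_on cbox a b" for x
   by (rule integrable_continuous[OF continuous_on_subset[OF c1]]) auto
 qed auto
 moreover have "blinfun_apply (integral (cbox a b) (fx x)) v = (\<Sum>j\<in>UNIV. v $ j *\<^sub>R conv (partial j \<rho>) \<theta> x)" for v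
 proof -
  have cfx: "continuous_on (cbox a b) (fx x)"
   using continuous_on_compose2[OF cf, of "cbox a b" "\<lambda>z. (x, z)"] by (simp add: continuous_on_Pair image_subset_iff)
  have p: "continuous_on UNIV (\<lambda>z. partial j \<rho> (x - z) * \<theta> z)" for j
   by (intro continuous_intros \<theta> continuous_on_compose2[OF Ck_on_gradient(2)[OF \<rho>]]) auto
  have ip: "(\<lambda>z. partial j \<rho> (x - z) * \<theta> z) integrable_on cbox a b" for j
   by (rule integrable_continuous[OF continuous_on_subset[OF p]]) auto
  have "blinfun_apply (integral (cbox a b) (fx x)) v = integral (cbox a b) (\<lambda>z. blinfun_apply (fx x z) v)"
   using integral_linear[OF integrable_continuous[OF cfx], of "\<lambda>f. blinfun_apply f v"]
   by (simp add: o_def bounded_linear_intros)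
  also have "\<dots> = integral (cbox a b) (\<lambda>z. \<Sum>j\<in>UNIV. v $ j *\<^sub>R (partial j \<rho> (x - z) * \<theta> z))"
   by (intro arg_cong2[where f=integral] refl ext)
    (simp add: fx_def blinfun_inner_left.rep_eq G_def inner_vec_def sum_distrib_left mult_ac)
  also have "\<dots> = (\<Sum>j\<in>UNIV. v $ j *\<^sub>R integral (cbox a b) (\<lambda>z. partial j \<rho> (x - z) * \<theta> z))"
   by (subst integral_sum) (auto intro!: integrable_on_mult_right ip)
  also have "\<dots> = (\<Sum>j\<in>UNIV. v $ j *\<^sub>R conv (partial j \<rho>) \<theta> x)"
   unfolding conv_def using \<theta>(2) by (subst lebesgue_integral_cbox[OF p, of a b]) auto
  finally show ?thesis .
 qed
 ultimately show ?thesis unfolding eq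
  by (metis (no_types, lifting) ext)
qed

lemma conv_smooth:
 assumes \<rho>: "\<And>m. Ck_on m UNIV \<rho>" and \<theta>: "continuous_on UNIV \<theta>" "\<And>x. x \<notin> cbox a b ==> \<theta> x = 0"
 shows "Ck_on m UNIV (conv \<rho> \<theta>)" "partial j (conv \<rho> \<theta>) = conv (partial j \<rho>) \<theta>"
proof -
 have p: "partial j (conv \<rho> \<theta>) = conv (partial j \<rho>) \<theta>" if "Ck_on 1 UNIV \<rho>" for \<rho> j
 proof
  fix x show "partial j (conv \<rho> \<theta>) x = conv (partial j \<rho>) \<theta> x"
   using that by (subst partial_eq[OF conv_has_derivative[OF _ \<theta>, of 0]]) (auto simp: axis_def if_distrib[of "\<lambda>c. c *\<^sub>R _"] if_distrib[of "\<lambda>c. c * _"] cong: if_cong)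
 qed
 show "partial j (conv \<rho> \<theta>) = conv (partial j \<rho>) \<theta>" by (rule p[OF \<rho>])
 have d: "conv \<rho> \<theta> differentiable_on UNIV" if "Ck_on 1 UNIV \<rho>" for \<rho>
  using conv_has_derivative[OF _ \<theta>, of 0 \<rho>] that by (auto simp: differentiable_on_def differentiable_def)
 show "Ck_on m UNIV (conv \<rho> \<theta>)" using \<rho>
 proof (induction m arbitrary: \<rho>)
  case 0 then show ?case using differentiable_imp_continuous_on[OF d[OF 0]] by simp
 next
  case (Suc m)
  have "Ck_on k UNIV (partial j \<rho>)" for k j using Suc.prems[of "Suc k"] by simp
  then show ?case using Suc d[OF Suc.prems] p[OF Suc.prems] by simp
 qed
qed


text \<open>\<open>K\<close> keeps a positive distance from the complement of \<open>D\<close>. Once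
  the mollifier radius 3 / (n + 1) is at most \<open>e\<close>, the support stays in the closed
  \<open>e\<close>-neighbourhood of \<open>K\<close>: one compact set for all large
  \<open>n\<close>, as dominated convergence will require.\<close>

lemma conv_test_functions:
 assumes D: "open D" and K: "compact K" "K \<subseteq> D"
  and \<theta>: "continuous_on UNIV \<theta>" "\<And>x. x \<notin> K ==> \<theta> x = 0"
 obtains K' N where "compact K'" "K' \<subseteq> D" "\<And>n. n \<ge> N ==> test_function D (conv (mollifier n) \<theta>)"
  "\<And>n x. n \<ge> N ==> x \<notin> K' ==> conv (mollifier n) \<theta> x = 0"
proof (cases "K = {}")
 case True
 have "conv (mollifier n) \<theta> = (\<lambda>x. 0)" for n using \<theta>(2) True by (auto simp: conv_def)
 then show ?thesis using that[of "{}" 0] by (simp add: test_function_def Ck_on_const)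
next
 case False
 obtain e where e: "e > 0" "{x. infdist x K \<le> e} \<subseteq> D"
  using compact_in_open_separated[OF False K(1) D K(2)] by blast
 define K' where "K' = {x. infdist x K \<le> e}"
 have K': "compact K'" unfolding K'_def by (rule compact_infdist_le[OF False K(1) e(1)])
 obtain N where N: "3 / e < real N" using reals_Archimedean2 by blast
 obtain r where r: "K \<subseteq> cball 0 r"
  using bounded_subset_ballD[OF compact_imp_bounded[OF K(1)], of 0] ball_subset_cball by (metis subset_trans)
 obtain a where a: "cball 0 r \<subseteq> cbox (-a) (a::real^3)" using bounded_subset_cbox_symmetric[OF bounded_cball] by blast
 have supp: "conv (mollifier n) \<theta> x = 0" if "n \<ge> N" "x \<notin> K'" for n x
 proof -
  have "mollifier n (x - z) * \<theta> z = 0" for z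
  proof (rule ccontr)
   assume "mollifier n (x - z) * \<theta> z \<noteq> 0"
   then have z: "mollifier n (x - z) \<noteq> 0" "z \<in> K" using \<theta>(2) by auto
   have "infdist x K \<le> dist x z" by (rule infdist_le[OF z(2)])
   also have "\<dots> \<le> 3 / real (Suc n)" using mollifier(5)[OF z(1)] by (simp add: dist_norm)
   also have "\<dots> \<le> e"
   proof -
    have "3 / e < real (Suc n)" using N that(1) by linarith
    then show ?thesis using e(1) by (simp add: field_simps)
   qed
   finally show False using that(2) by (simp add: K'_def)
  qed
  then show ?thesis unfolding conv_def by (simp only: Bochner_Integration.integral_zero)
 qed
 show ?thesis
 proof (rule that[OF K'])
  show "K' \<subseteq> D" using e by (simp add: K'_def)
  fix n assume n: "n \<ge> N"
  have "{x. conv (mollifier n) \<theta> x \<noteq> 0} \<subseteq> K'" using supp[OF n] by blast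
  then have c: "closure {x. conv (mollifier n) \<theta> x \<noteq> 0} \<subseteq> K'"
   by (simp add: closure_minimal compact_imp_closed[OF K'])
  have z: "\<theta> x = 0" if "x \<notin> cbox (-a) a" for x using \<theta>(2)[of x] r a that by blast
  show "test_function D (conv (mollifier n) \<theta>)"
   unfolding test_function_def
   using conv_smooth(1)[OF mollifier(1) \<theta>(1) z] c K' e
   by (metis K'_def bounded_subset closed_closure compact_eq_bounded_closed order_trans)
 qed (use supp in auto)
qed

lemma mollifier_translate:
 "L1 (\<lambda>z. mollifier n (x - z))" "(LI z. mollifier n (x - z)) = 1"
 using isometry_integrable[OF is_isometry_translation(2), of "mollifier n" x]
  isometry_integral[OF is_isometry_translation(2), of "mollifier n" x] mollifier(3,4) by auto

lemma conv_mollifier: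
 assumes \<theta>: "continuous_on UNIV \<theta>" "\<And>x. \<bar>\<theta> x\<bar> \<le> B"
 shows "L1 (\<lambda>z. mollifier n (x - z) * \<theta> z)" "\<bar>conv (mollifier n) \<theta> x\<bar> \<le> B"
  "(\<lambda>n. conv (mollifier n) \<theta> x) \<longlonglongrightarrow> \<theta> x"
proof -
 have m: "(\<lambda>z. mollifier n (x - z)) \<in> lmeas" for n
  using mollifier_translate(1) borel_measurable_integrable by blast
 have \<theta>m: "\<theta> \<in> lmeas" by (rule continuous_imp_lebesgue[OF \<theta>(1)])
 have B0: "B \<ge> 0" using order_trans[OF abs_ge_zero \<theta>(2)] .
 show i: "L1 (\<lambda>z. mollifier n (x - z) * \<theta> z)" for n
  by (rule Bochner_Integration.integrable_bound[OF integrable_mult_right[OF mollifier_translate(1), of B n x]])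
   (use m \<theta>m \<theta>(2) mollifier(2) B0 in \<open>auto intro!: AE_I2 mult_right_mono simp: abs_mult mult.commute[of B]  mult_left_mono\<close>)
 \<comment> \<open>The mollifier has integral 1, so subtracting \<open>c\<close> averages
   \<open>\<theta> - c\<close> over its support. Used with \<open>c = 0\<close> for the uniform
   bound and with \<open>c = \<theta> x\<close> for the limit.\<close>
 have bd: "\<bar>conv (mollifier n) \<theta> x - c\<bar> \<le> e"
  if e: "\<And>z. mollifier n (x - z) \<noteq> 0 ==> \<bar>\<theta> z - c\<bar> \<le> e" for n c e
 proof -
  have "conv (mollifier n) \<theta> x - c = (LI z. mollifier n (x - z) * \<theta> z) - (LI z. mollifier n (x - z) * c)"
   using mollifier_translate[of n x] by (simp add: conv_def)
  also have "\<dots> = (LI z. mollifier n (x - z) * (\<theta> z - c))"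
   using i[of n] mollifier_translate(1)[of n x]
   by (subst Bochner_Integration.integral_diff[symmetric]) (simp_all add: right_diff_distrib)
  finally have eq: "conv (mollifier n) \<theta> x - c = (LI z. mollifier n (x - z) * (\<theta> z - c))" .
  have "\<bar>LI z. mollifier n (x - z) * (\<theta> z - c)\<bar> \<le> (LI z. mollifier n (x - z) * e)"
  proof (rule integral_abs_bound_integral)
   show "L1 (\<lambda>z. mollifier n (x - z) * (\<theta> z - c))"
    using i[of n] mollifier_translate(1)[of n x] by (simp add: right_diff_distrib)
   show "L1 (\<lambda>z. mollifier n (x - z) * e)"
    using mollifier_translate(1)[of n x] by simp
   show "\<bar>mollifier n (x - z) * (\<theta> z - c)\<bar> \<le> mollifier n (x - z) * e" for z
    using e[of z] mollifier(2)[of n "x - z"] by (cases "mollifier n (x - z) = 0") (auto simp: abs_mult mult_left_mono)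
  qed
  then show ?thesis using eq mollifier_translate[of n x] by simp
 qed
 show "\<bar>conv (mollifier n) \<theta> x\<bar> \<le> B" using bd[of n 0 B] \<theta>(2) by simp
 show "(\<lambda>n. conv (mollifier n) \<theta> x) \<longlonglongrightarrow> \<theta> x"
 proof (rule metric_LIMSEQ_I)
  fix e :: real assume e: "e > 0"
  obtain d where d: "d > 0" "\<And>z. dist z x < d ==> dist (\<theta> z) (\<theta> x) < e / 2"
   using \<theta>(1) e unfolding continuous_on_iff by (metis UNIV_I half_gt_zero)
  obtain N where N: "3 / d < real N" using reals_Archimedean2 by blast
  have "dist (conv (mollifier n) \<theta> x) (\<theta> x) < e" if "n \<ge> N" for n
  proof -
   have "\<bar>\<theta> z - \<theta> x\<bar> \<le> e / 2" if "mollifier n (x - z) \<noteq> 0" for z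
   proof -
    have "3 / d < real (Suc n)" using N \<open>n \<ge> N\<close> by linarith
    then have "3 / real (Suc n) < d" using d(1) by (simp add: field_simps)
    then have "dist z x < d" using mollifier(5)[OF that] by (simp add: dist_norm norm_minus_commute)
    then show ?thesis using d(2)[of z] by (simp add: dist_real_def)
   qed
   then have "\<bar>conv (mollifier n) \<theta> x - \<theta> x\<bar> \<le> e / 2" by (rule bd)
   then show ?thesis using e by (simp add: dist_real_def)
  qed
  then show "\<exists>no. \<forall>n\<ge>no. dist (conv (mollifier n) \<theta> x) (\<theta> x) < e" by blast
 qed
qed

text \<open>Integration by parts in the variable \<open>z\<close>: the derivative of the product of
  \<open>\<rho> (x - z)\<close> and \<open>\<theta> z\<close> has integral zero. Hence the partial
  derivatives of the regularisations of a C^1 function are regularisations of continuous functions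
  and converge boundedly.\<close>

lemma conv_partial:
 assumes \<rho>: "Ck_on 1 UNIV \<rho>" "\<And>x. x \<notin> C ==> \<rho> x = 0" "bounded C"
  and \<theta>: "\<And>x. (\<theta> has_derivative (\<lambda>v. v \<bullet> T x)) (at x)" "continuous_on UNIV T" "\<And>x. x \<notin> K ==> \<theta> x = 0" "bounded K"
 shows "conv (partial j \<rho>) \<theta> x = conv \<rho> (\<lambda>z. T z $ j) x"
proof -
 have cont\<theta>: "continuous_on UNIV \<theta>"
  by (meson \<theta>(1) has_derivative_continuous continuous_at_imp_continuous_on)
 have T0: "T x = 0" if "x \<notin> closure K" for x
 proof -
  have "(\<theta> has_derivative (\<lambda>v. 0)) (at x)"
   by (rule has_derivative_transform_within_open[of "\<lambda>_. 0" _ _ UNIV "- closure K"])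
    (use that \<theta>(3) closure_subset in auto)
  then have "(\<lambda>v. 0) = (\<lambda>v. v \<bullet> T x)" using has_derivative_unique \<theta>(1) by blast
  then show ?thesis by (metis inner_eq_zero_iff)
 qed
 have bK: "bounded (closure K)" by (rule bounded_closure[OF \<theta>(4)])
 obtain B1 where B1: "\<And>x. norm (\<theta> x) \<le> B1" "B1 \<ge> 0"
  using continuous_support_bounded[OF cont\<theta> \<theta>(3,4)] by metis
 obtain B2 where B2: "\<And>x. norm (T x) \<le> B2" "B2 \<ge> 0"
  using continuous_support_bounded[OF \<theta>(2) T0 bK] by metis
 define G where "G x = (\<chi> j. partial j \<rho> x)" for x
 have der\<rho>: "(\<rho> has_derivative (\<lambda>v. v \<bullet> G x)) (at x)" for x
  using Ck_on_gradient(1)[of 0 \<rho> x] \<rho>(1) by (simp add: G_def inner_vec_def)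
 have cont\<rho>: "continuous_on UNIV \<rho>"
  by (meson der\<rho> has_derivative_continuous continuous_at_imp_continuous_on)
 have contG: "continuous_on UNIV G"
  unfolding G_def using Ck_on_gradient(2)[of 0 \<rho>] \<rho>(1) by (auto intro!: continuous_on_vec_lambda)
 have G0: "G x = 0" if "x \<notin> closure C" for x
 proof -
  have "(\<rho> has_derivative (\<lambda>v. 0)) (at x)"
   by (rule has_derivative_transform_within_open[of "\<lambda>_. 0" _ _ UNIV "- closure C"])
    (use that \<rho>(2) closure_subset in auto)
  then have "(\<lambda>v. 0) = (\<lambda>v. v \<bullet> G x)" using has_derivative_unique der\<rho> by blast
  then show ?thesis by (metis inner_eq_zero_iff)
 qed
 have bC: "bounded (closure C)" by (rule bounded_closure[OF \<rho>(3)])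
 obtain B3 where B3: "\<And>x. norm (\<rho> x) \<le> B3" "B3 \<ge> 0"
  using continuous_support_bounded[OF cont\<rho> \<rho>(2,3)] by metis
 obtain B4 where B4: "\<And>x. norm (G x) \<le> B4" "B4 \<ge> 0"
  using continuous_support_bounded[OF contG G0 bC] by metis
 define f' where "f' z v = v \<bullet> (\<rho> (x - z) *\<^sub>R T z - \<theta> z *\<^sub>R G (x - z))" for z v
 have der: "((\<lambda>z. \<rho> (x - z) * \<theta> z) has_derivative f' z) (at z)" for z
 proof -
  have "((\<lambda>z. \<rho> (x - z)) has_derivative (\<lambda>v. (- v) \<bullet> G (x - z))) (at z)"
   using has_derivative_compose[OF has_derivative_diff[OF has_derivative_const[of x] has_derivative_ident] der\<rho>[of "x - z"], of UNIV]
   by simp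
  from has_derivative_mult[OF this \<theta>(1)] show ?thesis
   by (rule has_derivative_eq_rhs) (auto simp: f'_def inner_diff_right algebra_simps)
 qed
 have bnd: "norm (f' z v) \<le> (B3 * B2 + B1 * B4) * norm v" for z v
 proof -
  have "norm (f' z v) \<le> norm v * norm (\<rho> (x - z) *\<^sub>R T z - \<theta> z *\<^sub>R G (x - z))"
   unfolding f'_def using Cauchy_Schwarz_ineq2 by auto
  also have "\<dots> \<le> norm v * (norm (\<rho> (x - z) *\<^sub>R T z) + norm (\<theta> z *\<^sub>R G (x - z)))"
   by (intro mult_left_mono norm_triangle_ineq4) auto
  also have "\<dots> \<le> norm v * (B3 * B2 + B1 * B4)"
   using B1 B2 B3 B4 by (intro mult_left_mono add_mono) (auto simp: abs_mult intro!: mult_mono)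
  finally show ?thesis by (simp add: mult.commute)
 qed
 have *: "L1 (\<lambda>z. f' z (axis j 1))" "(LI z. f' z (axis j 1)) = 0"
  using integral_derivative_zero[OF der bnd _ \<theta>(4)] \<theta>(3) by auto
 have f'j: "f' z (axis j 1) = \<rho> (x - z) * T z $ j - partial j \<rho> (x - z) * \<theta> z" for z
  by (simp add: f'_def inner_axis' G_def)
 have c1: "continuous_on UNIV (\<lambda>z. \<rho> (x - z) * T z $ j)"
  by (intro continuous_intros continuous_on_compose2[OF cont\<rho>] \<theta>(2)) auto
 have i1: "L1 (\<lambda>z. \<rho> (x - z) * T z $ j)"
  by (rule continuous_support_integrable[OF c1 _ bK]) (simp add: T0)
 have cp: "continuous_on UNIV (partial j \<rho>)" using \<rho>(1) by simp
 have c2: "continuous_on UNIV (\<lambda>z. partial j \<rho> (x - z) * \<theta> z)"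
  by (intro continuous_intros continuous_on_compose2[OF cp] cont\<theta>) auto
 have i2: "L1 (\<lambda>z. partial j \<rho> (x - z) * \<theta> z)"
  by (rule continuous_support_integrable[OF c2 _ \<theta>(4)]) (simp add: \<theta>(3))
 show ?thesis using *(2) i1 i2 by (simp add: conv_def f'j)
qed

section \<open>Weak gradients\<close>

text \<open>\<open>lebesgue\<close> is complete, so measurability passes between functions that
  agree almost everywhere; if it fails for one it fails for both, and both integrals are 0 by
  default.\<close>

lemma lebesgue_integral_cong_AE:
 fixes f g :: "'a::euclidean_space \<Rightarrow> 'b::euclidean_space"
 assumes ae: "AE x in lebesgue. f x = g x"
 shows "(LI x. f x) = (LI x. g x)" "L1 f \<longleftrightarrow> L1 g"
proof -
 have ae': "AE x in lebesgue. g x = f x" using ae by eventually_elim simp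
 have m: "f \<in> lmeas \<longleftrightarrow> g \<in> lmeas"
  using borel_measurable_AE[OF _ ae] borel_measurable_AE[OF _ ae'] by blast
 show "L1 f \<longleftrightarrow> L1 g"
  using m integrable_cong_AE[OF _ _ ae] borel_measurable_integrable by blast
 show "(LI x. f x) = (LI x. g x)"
 proof (cases "f \<in> lmeas")
  case True then show ?thesis using m integral_cong_AE[OF _ _ ae] by blast
 next
  case False
  then show ?thesis using m by (metis borel_measurable_integrable not_integrable_integral_eq)
 qed
qed

lemma test_functionD:
 assumes "test_function D \<phi>"
 shows "\<And>m. Ck_on m UNIV \<phi>" "compact (closure {x. \<phi> x \<noteq> 0})" "closure {x. \<phi> x \<noteq> 0} \<subseteq> D"
  "x \<notin> closure {x. \<phi> x \<noteq> 0} ==> \<phi> x = 0" "x \<notin> closure {x. \<phi> x \<noteq> 0} ==> partial j \<phi> x = 0"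
proof -
 show "\<And>m. Ck_on m UNIV \<phi>" "compact (closure {x. \<phi> x \<noteq> 0})" "closure {x. \<phi> x \<noteq> 0} \<subseteq> D"
  using assms by (auto simp: test_function_def)
 have sub: "{x. \<phi> x \<noteq> 0} \<subseteq> closure {x. \<phi> x \<noteq> 0}" by (rule closure_subset)
 then show "x \<notin> closure {x. \<phi> x \<noteq> 0} ==> \<phi> x = 0" by blast
 assume x: "x \<notin> closure {x. \<phi> x \<noteq> 0}"
 have "(\<phi> has_derivative (\<lambda>v. 0)) (at x)"
  by (rule has_derivative_transform_within_open[of "\<lambda>_. 0" _ _ UNIV "- closure {x. \<phi> x \<noteq> 0}"])
   (use x sub in auto)
 then show "partial j \<phi> x = 0" by (simp add: partial_eq)
qed

lemma has_weak_gradientD: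
 assumes "has_weak_gradient D f G"
 shows "compact K ==> K \<subseteq> D ==> f absolutely_integrable_on K"
  "compact K ==> K \<subseteq> D ==> G absolutely_integrable_on K"
  "test_function D \<phi> ==> (LINT x:D|lebesgue. partial j \<phi> x *\<^sub>R f x) = - (LINT x:D|lebesgue. \<phi> x *\<^sub>R (G x $ j))"
 using assms unfolding has_weak_gradient_def by blast+

lemma weak_grad_works: "weakly_differentiable D f ==> has_weak_gradient D f (weak_grad D f)"
 unfolding weakly_differentiable_def weak_grad_def by (metis someI_ex)

lemma absolutely_integrable_vec_nth:
 fixes G :: "real^3 \<Rightarrow> 'b::euclidean_space^3"
 assumes "G absolutely_integrable_on K"
 shows "(\<lambda>x. G x $ j) absolutely_integrable_on K"
 using integrable_bounded_linear[OF bounded_linear_vec_nth[of j]] assms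
 unfolding set_integrable_def by fastforce

text \<open>\<open>f\<close> is integrable only over compact parts of \<open>D\<close>. The common
  support \<open>K\<close> reduces everything to \<open>K\<close>, where \<open>B\<close> times the
  norm of \<open>f\<close> is a majorant.\<close>

lemma conv_set_integral_tendsto:
 fixes f :: "real^3 \<Rightarrow> 'b::euclidean_space"
 assumes K: "compact K" "K \<subseteq> D" and f: "f absolutely_integrable_on K"
  and s: "\<And>n x. x \<notin> K ==> s n x = 0" "\<And>n x. \<bar>s n x\<bar> \<le> B" "\<And>x. (\<lambda>n. s n x) \<longlonglongrightarrow> \<theta> x"
  "\<And>n. s n \<in> lmeas"
 shows "(\<lambda>n. LINT x:D|lebesgue. s n x *\<^sub>R f x) \<longlonglongrightarrow> (LINT x:D|lebesgue. \<theta> x *\<^sub>R f x)"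
proof -
 have \<theta>0: "\<theta> x = 0" if "x \<notin> K" for x
  using s(3)[of x] s(1)[OF that] by (simp add: LIMSEQ_const_iff)
 have e: "ind D x *\<^sub>R (c *\<^sub>R f x) = c *\<^sub>R (ind K x *\<^sub>R f x)" if "x \<notin> K \<longrightarrow> c = 0" for x c
  using that K(2) by (auto split: split_indicator)
 have fi: "L1 (\<lambda>x. ind K x *\<^sub>R f x)" using f by (simp add: set_integrable_def)
 have "(\<lambda>n. LI x. s n x *\<^sub>R (ind K x *\<^sub>R f x)) \<longlonglongrightarrow> (LI x. \<theta> x *\<^sub>R (ind K x *\<^sub>R f x))"
 proof (rule dominated_convergence_pointwise(4))
  show "(\<lambda>x. s n x *\<^sub>R (ind K x *\<^sub>R f x)) \<in> lmeas" for n
   by (intro borel_measurable_scaleR s(4) borel_measurable_integrable fi)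
  show "L1 (\<lambda>x. B * norm (ind K x *\<^sub>R f x))"
   by (intro integrable_mult_right integrable_norm fi)
  show "(\<lambda>n. s n x *\<^sub>R (ind K x *\<^sub>R f x)) \<longlonglongrightarrow> \<theta> x *\<^sub>R (ind K x *\<^sub>R f x)" for x
   by (intro tendsto_scaleR s(3) tendsto_const)
  show "norm (s n x *\<^sub>R (ind K x *\<^sub>R f x)) \<le> B * norm (ind K x *\<^sub>R f x)" for n x
   unfolding norm_scaleR real_norm_def by (intro mult_right_mono s(2)) simp
 qed
 moreover have "ind D x *\<^sub>R (s n x *\<^sub>R f x) = s n x *\<^sub>R (ind K x *\<^sub>R f x)" for n x
  by (rule e) (simp add: s(1))
 moreover have "ind D x *\<^sub>R (\<theta> x *\<^sub>R f x) = \<theta> x *\<^sub>R (ind K x *\<^sub>R f x)" for x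
  by (rule e) (simp add: \<theta>0)
 ultimately show ?thesis unfolding set_lebesgue_integral_def by (simp only:)
qed

lemma gradient_support:
 assumes "\<And>x. (\<theta> has_derivative (\<lambda>v. v \<bullet> T x)) (at x)" "\<And>x. x \<notin> K ==> \<theta> x = (0::real)" "closed K" "x \<notin> K"
 shows "T x = 0"
proof -
 have "(\<theta> has_derivative (\<lambda>v. 0)) (at x)"
  by (rule has_derivative_transform_within_open[of "\<lambda>_. 0" _ _ UNIV "- K"]) (use assms in auto)
 then have "(\<lambda>v. 0) = (\<lambda>v. v \<bullet> T x)" using has_derivative_unique assms(1) by blast
 then show ?thesis by (metis inner_eq_zero_iff)
qed

text \<open>Weak gradients are defined with smooth test functions, whereas the second vertical
  integration by parts uses one of class C^1. Its mollifications are test functions which, together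
  with their partial derivatives, converge pointwise, boundedly and within one compact subset of
  \<open>D\<close>.\<close>

lemma has_weak_gradient_C1_test:
 fixes f :: "real^3 \<Rightarrow> 'b::euclidean_space"
 assumes D: "open D" and w: "has_weak_gradient D f G" and K: "compact K" "K \<subseteq> D"
  and \<theta>: "\<And>x. (\<theta> has_derivative (\<lambda>v. v \<bullet> T x)) (at x)" "continuous_on UNIV T" "\<And>x. x \<notin> K ==> \<theta> x = 0"
 shows "(LINT x:D|lebesgue. (T x $ j) *\<^sub>R f x) = - (LINT x:D|lebesgue. \<theta> x *\<^sub>R (G x $ j))"
proof -
 have cont\<theta>: "continuous_on UNIV \<theta>"
  by (meson \<theta>(1) has_derivative_continuous continuous_at_imp_continuous_on)
 have T0: "T x = 0" if "x \<notin> K" for x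
  using gradient_support[OF \<theta>(1,3) compact_imp_closed[OF K(1)] that] .
 have bK: "bounded K" by (rule compact_imp_bounded[OF K(1)])
 obtain B1 where B1: "\<And>x. norm (\<theta> x) \<le> B1" using continuous_support_bounded[OF cont\<theta> \<theta>(3) bK] by metis
 obtain B2 where B2: "\<And>x. norm (T x) \<le> B2" using continuous_support_bounded[OF \<theta>(2) T0 bK] by metis
 obtain K' N where K': "compact K'" "K' \<subseteq> D" "\<And>n. n \<ge> N ==> test_function D (conv (mollifier n) \<theta>)"
  "\<And>n x. n \<ge> N ==> x \<notin> K' ==> conv (mollifier n) \<theta> x = 0"
  using conv_test_functions[OF D K cont\<theta> \<theta>(3)] by metis
 define \<phi> where "\<phi> n = conv (mollifier (n + N)) \<theta>" for n
 have t: "test_function D (\<phi> n)" for n unfolding \<phi>_def using K'(3) by simp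
 obtain a where a: "K \<subseteq> cbox (- a) a" using bounded_subset_cbox_symmetric[OF bK] by blast
 have p: "partial j (\<phi> n) x = conv (mollifier (n + N)) (\<lambda>z. T z $ j) x" for n x
 proof -
  have "partial j (\<phi> n) = conv (partial j (mollifier (n + N))) \<theta>"
   unfolding \<phi>_def by (rule conv_smooth(2)[OF mollifier(1) cont\<theta>]) (use a \<theta>(3) in auto)
  then show ?thesis
   using conv_partial[OF mollifier(1)[of 1 "n+N"], of "cball 0 (3 / real (Suc (n+N)))" \<theta> T K j x] mollifier(5)[of "n+N"] \<theta> bK
   by (metis bounded_cball dist_0_norm mem_cball)
 qed
 have contTj: "continuous_on UNIV (\<lambda>z. T z $ j)" by (intro continuous_intros \<theta>(2))
 have Tj: "\<bar>T x $ j\<bar> \<le> B2" for x using B2[of x] component_le_norm_cart[of "T x" j] by linarith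
 have s1: "\<phi> n x = 0" if "x \<notin> K'" for n x unfolding \<phi>_def using K'(4) that by simp
 have s2: "partial j (\<phi> n) x = 0" if "x \<notin> K'" for n x
 proof -
  have "closure {x. \<phi> n x \<noteq> 0} \<subseteq> K'"
   by (rule closure_minimal) (use s1 compact_imp_closed[OF K'(1)] in auto)
  then show ?thesis using test_functionD(5)[OF t] that by blast
 qed
 have l1: "(\<lambda>n. LINT x:D|lebesgue. \<phi> n x *\<^sub>R (G x $ j)) \<longlonglongrightarrow> (LINT x:D|lebesgue. \<theta> x *\<^sub>R (G x $ j))"
 proof (rule conv_set_integral_tendsto[OF K'(1,2) absolutely_integrable_vec_nth[OF has_weak_gradientD(2)[OF w K'(1,2)]] s1])
  show "\<bar>\<phi> n x\<bar> \<le> B1" for n x unfolding \<phi>_def by (rule conv_mollifier(2)[OF cont\<theta>]) (use B1 in auto)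
  show "(\<lambda>n. \<phi> n x) \<longlonglongrightarrow> \<theta> x" for x unfolding \<phi>_def
   by (rule LIMSEQ_ignore_initial_segment[OF conv_mollifier(3)[OF cont\<theta>]]) (use B1 in auto)
  show "\<phi> n \<in> lmeas" for n
   using test_functionD(1)[OF t, where m=0] by (auto intro: continuous_imp_lebesgue)
 qed
 have l2: "(\<lambda>n. LINT x:D|lebesgue. partial j (\<phi> n) x *\<^sub>R f x) \<longlonglongrightarrow> (LINT x:D|lebesgue. (T x $ j) *\<^sub>R f x)"
 proof (rule conv_set_integral_tendsto[OF K'(1,2) has_weak_gradientD(1)[OF w K'(1,2)] s2])
  show "\<bar>partial j (\<phi> n) x\<bar> \<le> B2" for n x unfolding p by (rule conv_mollifier(2)[OF contTj Tj])
  show "(\<lambda>n. partial j (\<phi> n) x) \<longlonglongrightarrow> T x $ j" for x unfolding p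
   by (rule LIMSEQ_ignore_initial_segment[OF conv_mollifier(3)[OF contTj Tj]])
  show "partial j (\<phi> n) \<in> lmeas" for n
   using test_functionD(1)[OF t, where m=1] by (auto intro: continuous_imp_lebesgue)
 qed
 show ?thesis
  using l2 unfolding has_weak_gradientD(3)[OF w t, of j] by (rule LIMSEQ_unique[OF _ tendsto_minus[OF l1]])
qed

text \<open>The class of functions against which \<open>f\<close> integrates to zero grows from test
  functions to continuous functions (mollification) and to indicators of boxes (monotone cut-offs).
  Then all box integrals of \<open>f\<close> vanish, and differentiation of integrals gives
  \<open>f = 0\<close> almost everywhere.\<close>

lemma fundamental_lemma:
 fixes f :: "real^3 \<Rightarrow> 'b::euclidean_space"
 assumes D: "open D" and f: "\<And>K. compact K ==> K \<subseteq> D ==> f absolutely_integrable_on K"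
  and z: "\<And>\<phi>. test_function D \<phi> ==> (LINT x:D|lebesgue. \<phi> x *\<^sub>R f x) = 0"
 shows "AE x in lebesgue. x \<in> D \<longrightarrow> f x = 0"
proof -
 have c0: "(LINT x:D|lebesgue. \<theta> x *\<^sub>R f x) = 0"
  if \<theta>: "continuous_on UNIV \<theta>" "\<And>x. x \<notin> K ==> \<theta> x = 0" and K: "compact K" "K \<subseteq> D" for \<theta> K
 proof -
  obtain B1 where B1: "\<And>x. norm (\<theta> x) \<le> B1"
   using continuous_support_bounded[OF \<theta> compact_imp_bounded[OF K(1)]] by metis
  obtain K' N where K': "compact K'" "K' \<subseteq> D" "\<And>n. n \<ge> N ==> test_function D (conv (mollifier n) \<theta>)"
   "\<And>n x. n \<ge> N ==> x \<notin> K' ==> conv (mollifier n) \<theta> x = 0"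
   using conv_test_functions[OF D K \<theta>] by metis
  have t: "test_function D (conv (mollifier (n + N)) \<theta>)" for n using K'(3) by simp
  have "(\<lambda>n. LINT x:D|lebesgue. conv (mollifier (n + N)) \<theta> x *\<^sub>R f x) \<longlonglongrightarrow> (LINT x:D|lebesgue. \<theta> x *\<^sub>R f x)"
  proof (rule conv_set_integral_tendsto[OF K'(1,2) f[OF K'(1,2)]])
   show "\<bar>conv (mollifier (n + N)) \<theta> x\<bar> \<le> B1" for n x by (rule conv_mollifier(2)[OF \<theta>(1)]) (use B1 in auto)
   show "(\<lambda>n. conv (mollifier (n + N)) \<theta> x) \<longlonglongrightarrow> \<theta> x" for x
    by (rule LIMSEQ_ignore_initial_segment[OF conv_mollifier(3)[OF \<theta>(1)]]) (use B1 in auto)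
   show "conv (mollifier (n + N)) \<theta> \<in> lmeas" for n
    using test_functionD(1)[OF t, where m=0] by (auto intro: continuous_imp_lebesgue)
  qed (use K'(4) in auto)
  then show ?thesis using z[OF t] by (simp add: LIMSEQ_const_iff)
 qed
 have box0: "integral (cbox a b) f = 0" if C: "cbox a b \<subseteq> D" for a b
 proof (cases "cbox a b = {}")
  case False
  define C where "C = cbox a b"
  have Cc: "compact C" "C \<noteq> {}" "C \<subseteq> D" using False that by (auto simp: C_def)
  obtain e where e: "e > 0" "{x. infdist x C \<le> e} \<subseteq> D"
   using compact_in_open_separated[OF Cc(2,1) D Cc(3)] by blast
  define K' where "K' = {x. infdist x C \<le> e}"
  have K': "compact K'" "K' \<subseteq> D" unfolding K'_def using compact_infdist_le[OF Cc(2,1) e(1)] e(2) by auto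
  \<comment> \<open>Equal to 1 on \<open>C\<close>. The part \<open>1 / e\<close> of the slope makes
    it vanish outside \<open>K'\<close>; the growing part makes it decrease to the indicator of
    \<open>C\<close>.\<close>
  define s where "s n x = max 0 (1 - (1 / e + real n) * infdist x C)" for n x
  have sc: "continuous_on UNIV (s n)" for n unfolding s_def
   by (intro continuous_intros)
  have s0: "s n x = 0" if "x \<notin> K'" for n x
  proof -
   have "infdist x C > e" using that by (simp add: K'_def)
   moreover have "1 / e * e \<le> (1 / e + real n) * infdist x C"
    by (intro mult_mono) (use e(1) calculation in auto)
   ultimately show ?thesis using e(1) by (simp add: s_def)
  qed
  have "(\<lambda>n. LINT x:D|lebesgue. s n x *\<^sub>R f x) \<longlonglongrightarrow> (LINT x:D|lebesgue. indicator C x *\<^sub>R f x)"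
  proof (rule conv_set_integral_tendsto[OF K' f[OF K'] s0])
   show "\<bar>s n x\<bar> \<le> 1" for n x unfolding s_def using infdist_nonneg[of x C] e(1) by simp
   show "(\<lambda>n. s n x) \<longlonglongrightarrow> indicator C x" for x
   proof (cases "x \<in> C")
    case True then show ?thesis by (simp add: s_def)
   next
    case False
    then have pos: "infdist x C > 0"
     using Cc by (metis compact_imp_closed in_closed_iff_infdist_zero infdist_nonneg order_le_less)
    obtain N where N: "1 / infdist x C < real N" using reals_Archimedean2 by blast
    have "s n x = 0" if "n \<ge> N" for n
    proof -
     have "1 / infdist x C \<le> 1 / e + real n" using N that e(1) by (smt (verit) of_nat_mono zero_less_divide_1_iff)
     then have "1 \<le> (1 / e + real n) * infdist x C" using pos by (simp add: pos_divide_le_eq)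
     then show ?thesis by (simp add: s_def)
    qed
    then have "eventually (\<lambda>n. s n x = 0) sequentially" by (auto simp: eventually_sequentially)
    then show ?thesis using False by (simp add: tendsto_eventually)
   qed
   show "s n \<in> lmeas" for n by (rule continuous_imp_lebesgue[OF sc])
  qed
  moreover have "(LINT x:D|lebesgue. s n x *\<^sub>R f x) = 0" for n by (rule c0[OF sc s0 K'])
  ultimately have "(LINT x:D|lebesgue. ind C x *\<^sub>R f x) = 0" by (simp add: LIMSEQ_const_iff)
  moreover have "ind D x *\<^sub>R ind C x *\<^sub>R f x = ind C x *\<^sub>R f x" for x
   using Cc(3) by (auto split: split_indicator)
  ultimately have "(LINT x:C|lebesgue. f x) = 0" unfolding set_lebesgue_integral_def by (simp only:)
  then show ?thesis using set_lebesgue_integral_eq_integral(2)[OF f[OF Cc(1,3)]] by (simp add: C_def)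
 qed simp
 have n: "negligible {x \<in> cbox a b. f x \<noteq> 0}" if C: "cbox a b \<subseteq> D" for a b
 proof -
  \<comment> \<open>\<open>f\<close> is integrable only over boxes inside \<open>D\<close>; the
    truncation is integrable over every box, as the differentiation theorem demands.\<close>
  define g where "g x = (if x \<in> cbox a b then f x else 0)" for x
  have fi: "f integrable_on cbox a b" using f[OF compact_cbox C] by (simp add: absolutely_integrable_on_def)
  have "g integrable_on cbox c d" for c d
   unfolding g_def integrable_restrict_Int Int_interval
   by (rule integrable_on_subcbox[OF fi]) (simp flip: Int_interval)
  then obtain N where N: "negligible N" "\<And>x e. x \<notin> N ==> 0 < e ==>
    \<exists>d>0. \<forall>h. 0 < h \<and> h < d \<longrightarrow> norm (integral (cbox x (x + h *\<^sub>R One)) g /\<^sub>R h ^ DIM(real^3) - g x) < e"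
   using integrable_ccontinuous_explicit[of g] by metis
  have "f x = 0" if x: "x \<in> box a b" "x \<notin> N" for x
  proof -
   obtain r where r: "r > 0" "ball x r \<subseteq> box a b" using x(1) open_box open_contains_ball by blast
   have "norm (g x) < e" if e: "e > 0" for e
   proof -
    obtain d where d: "d > 0" "\<And>h. 0 < h ==> h < d ==> norm (integral (cbox x (x + h *\<^sub>R One)) g /\<^sub>R h ^ DIM(real^3) - g x) < e"
     using N(2)[OF x(2) e] by blast
    define h where "h = min (d / 2) (r / (2 * (norm (One::real^3) + 1)))"
    have no: "norm (One::real^3) \<ge> 0" by simp
    have h: "0 < h" "h < d" using d(1) r(1) no unfolding h_def by (auto intro!: divide_pos_pos add_nonneg_pos)
    have hn: "h * norm (One::real^3) < r"
    proof -
     have "h * norm (One::real^3) \<le> r / (2 * (norm (One::real^3) + 1)) * norm (One::real^3)"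
      by (intro mult_right_mono) (auto simp: h_def)
     also have "\<dots> < r" using r(1) no by (simp add: divide_less_eq add_pos_nonneg)
     finally show ?thesis .
    qed
    have "x + h *\<^sub>R One \<in> ball x r" using hn h by (simp add: dist_norm)
    then have "cbox x (x + h *\<^sub>R One) \<subseteq> box a b"
     using x(1) r by (auto simp: subset_box(2) mem_box intro!: subset_box_imp)
    then have sub: "cbox x (x + h *\<^sub>R One) \<subseteq> cbox a b" using box_subset_cbox by blast
    then have "integral (cbox x (x + h *\<^sub>R One)) g = integral (cbox x (x + h *\<^sub>R One)) f"
     by (intro Henstock_Kurzweil_Integration.integral_cong) (auto simp: g_def)
    also have "\<dots> = 0" by (rule box0) (use sub C in blast)
    finally show ?thesis using d(2)[OF h] by simp
   qed
   then have "g x = 0" by (metis less_irrefl zero_less_norm_iff)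
   then show ?thesis using x(1) box_subset_cbox[of a b] by (auto simp: g_def split: if_splits)
  qed
  then have "{x \<in> cbox a b. f x \<noteq> 0} \<subseteq> N \<union> (cbox a b - box a b)" by blast
  moreover have "negligible (N \<union> (cbox a b - box a b))"
   using N(1) negligible_frontier_interval by (simp add: negligible_Un)
  ultimately show ?thesis using negligible_subset by blast
 qed
 obtain \<D> where \<D>: "countable \<D>" "\<D> \<subseteq> Pow D" "\<And>X. X \<in> \<D> ==> \<exists>a b. X = cbox a b" "\<Union>\<D> = D"
  using open_countable_Union_open_cbox[OF D] by metis
 have "negligible (\<Union>X\<in>\<D>. {x \<in> X. f x \<noteq> 0})"
 proof (rule negligible_countable_Union[OF countable_image[OF \<D>(1)]])
  fix Y assume "Y \<in> (\<lambda>X. {x \<in> X. f x \<noteq> 0}) ` \<D>"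
  then obtain X where X: "X \<in> \<D>" "Y = {x \<in> X. f x \<noteq> 0}" by blast
  then obtain a b where "X = cbox a b" using \<D>(3) by blast
  then show "negligible Y" using n[of a b] X \<D>(2) by blast
 qed
 moreover have "(\<Union>X\<in>\<D>. {x \<in> X. f x \<noteq> 0}) = {x \<in> D. f x \<noteq> 0}" using \<D>(4) by blast
 ultimately have "{x \<in> D. f x \<noteq> 0} \<in> null_sets lebesgue" by (simp add: negligible_iff_null_sets)
 then show ?thesis by (rule AE_I') auto
qed

text \<open>\<open>weak_grad\<close> is an arbitrary choice; this is how it is compared with
  explicitly known gradients and with gradients chosen on other domains.\<close>

lemma has_weak_gradient_unique:
 fixes f :: "real^3 \<Rightarrow> 'b::euclidean_space"
 assumes D: "open D" and w: "has_weak_gradient D f G" "has_weak_gradient D f G'"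
 shows "AE x in lebesgue. x \<in> D \<longrightarrow> G x = G' x"
proof -
 have "AE x in lebesgue. x \<in> D \<longrightarrow> G x $ j - G' x $ j = 0" for j
 proof (rule fundamental_lemma[OF D])
  show "(\<lambda>x. G x $ j - G' x $ j) absolutely_integrable_on K" if "compact K" "K \<subseteq> D" for K
   by (intro set_integral_diff(1) absolutely_integrable_vec_nth has_weak_gradientD(2)[OF w(1)]
     has_weak_gradientD(2)[OF w(2)] that)
  fix \<phi> :: "real^3 \<Rightarrow> real" assume t: "test_function D \<phi>"
  have i: "set_integrable lebesgue D (\<lambda>x. \<phi> x *\<^sub>R (H x $ j))" if "has_weak_gradient D f H" for H :: "real^3 \<Rightarrow> 'b^3"
  proof -
   define K where "K = closure {x. \<phi> x \<noteq> 0}"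
   have K: "compact K" "K \<subseteq> D" and z: "\<And>x. x \<notin> K ==> \<phi> x = 0" unfolding K_def using test_functionD[OF t] by blast+
   have c: "continuous_on UNIV \<phi>" using test_functionD(1)[OF t, where m=0] by simp
   obtain B where B: "\<And>x. norm (\<phi> x) \<le> B" using continuous_support_bounded[OF c z compact_imp_bounded[OF K(1)]] by metis
   have Hi: "L1 (\<lambda>x. ind K x *\<^sub>R H x $ j)"
    using absolutely_integrable_vec_nth[OF has_weak_gradientD(2)[OF that K]] by (simp add: set_integrable_def)
   have B0: "norm (\<phi> x *\<^sub>R (ind K x *\<^sub>R H x $ j)) \<le> norm (B * norm (ind K x *\<^sub>R H x $ j))" for x
    using mult_right_mono[OF B[of x], of "norm (ind K x *\<^sub>R H x $ j)"] by (simp only: norm_scaleR real_norm_def) simp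
   have "L1 (\<lambda>x. \<phi> x *\<^sub>R (ind K x *\<^sub>R H x $ j))"
    by (rule Bochner_Integration.integrable_bound[OF integrable_mult_right[OF integrable_norm[OF Hi], of B]])
     (use borel_measurable_scaleR[OF continuous_imp_lebesgue[OF c] borel_measurable_integrable[OF Hi]] B0 in
      \<open>simp_all only: AE_I2\<close>)
   moreover have "\<phi> x *\<^sub>R (ind K x *\<^sub>R H x $ j) = ind D x *\<^sub>R \<phi> x *\<^sub>R H x $ j" for x
    using K(2) z[of x] by (auto split: split_indicator)
   ultimately show ?thesis unfolding set_integrable_def by (simp only:)
  qed
  show "(LINT x:D|lebesgue. \<phi> x *\<^sub>R (G x $ j - G' x $ j)) = 0"
   using has_weak_gradientD(3)[OF w(1) t, of j] has_weak_gradientD(3)[OF w(2) t, of j] set_integral_diff(2)[OF i[OF w(1)] i[OF w(2)]]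
   by (simp add: scaleR_diff_right)
 qed
 then have "AE x in lebesgue. \<forall>j. x \<in> D \<longrightarrow> G x $ j - G' x $ j = 0" by (rule AE_all_countable[THEN iffD2, rule_format])
 then show ?thesis by eventually_elim (auto simp: vec_eq_iff)
qed

lemma has_weak_gradient_subset:
 assumes w: "has_weak_gradient D f G" and D': "D' \<subseteq> D"
 shows "has_weak_gradient D' f G"
 unfolding has_weak_gradient_def
proof (intro conjI allI impI)
 fix \<phi> :: "real^3 \<Rightarrow> real" and j :: 3 assume t: "test_function D' \<phi>"
 then have t': "test_function D \<phi>" using D' by (auto simp: test_function_def)
 have n: "\<phi> x = 0" "partial j \<phi> x = 0" if "x \<notin> D'" for x
  using that test_functionD(3,4,5)[OF t] by blast+
 have "ind D' x *\<^sub>R partial j \<phi> x *\<^sub>R f x = ind D x *\<^sub>R partial j \<phi> x *\<^sub>R f x"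
  "ind D' x *\<^sub>R \<phi> x *\<^sub>R G x $ j = ind D x *\<^sub>R \<phi> x *\<^sub>R G x $ j" for x
  using D' n[of x] by (cases "x \<in> D'"; auto simp: indicator_def)+
 then show "(LINT x:D'|lebesgue. partial j \<phi> x *\<^sub>R f x) = - (LINT x:D'|lebesgue. \<phi> x *\<^sub>R G x $ j)"
  using has_weak_gradientD(3)[OF w t', of j] unfolding set_lebesgue_integral_def by (simp only:)
qed (use has_weak_gradientD[OF w] D' in blast)+

lemma indicator_scaleR_cong:
 fixes a b :: "'b::real_vector"
 shows "(x \<in> K ==> a = b) ==> ind K x *\<^sub>R a = ind K x *\<^sub>R b"
 by (cases "x \<in> K") auto

lemma has_weak_gradient_cong_AE:
 fixes f :: "real^3 \<Rightarrow> 'b::euclidean_space"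
 assumes w: "has_weak_gradient D f G" and ae: "AE x in lebesgue. x \<in> D \<longrightarrow> f x = f' x" "AE x in lebesgue. x \<in> D \<longrightarrow> G x = G' x"
 shows "has_weak_gradient D f' G'"
 unfolding has_weak_gradient_def
proof (intro conjI allI impI)
 fix K assume K: "compact K \<and> K \<subseteq> D"
 have this1: "AE x in lebesgue. ind K x *\<^sub>R f x = ind K x *\<^sub>R f' x"
  using ae(1) by eventually_elim (rule indicator_scaleR_cong, use K in blast)
 then show "f' absolutely_integrable_on K"
  using lebesgue_integral_cong_AE(2)[OF this1] has_weak_gradientD(1)[OF w, of K] K unfolding set_integrable_def by simp
 have this2: "AE x in lebesgue. ind K x *\<^sub>R G x = ind K x *\<^sub>R G' x"
  using ae(2) by eventually_elim (rule indicator_scaleR_cong, use K in blast)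
 then show "G' absolutely_integrable_on K"
  using lebesgue_integral_cong_AE(2)[OF this2] has_weak_gradientD(2)[OF w, of K] K unfolding set_integrable_def by simp
next
 fix \<phi> :: "real^3 \<Rightarrow> real" and j :: 3 assume t: "test_function D \<phi>"
 have "AE x in lebesgue. ind D x *\<^sub>R partial j \<phi> x *\<^sub>R f x = ind D x *\<^sub>R partial j \<phi> x *\<^sub>R f' x"
  using ae(1) by eventually_elim (auto split: split_indicator)
 note 1 = lebesgue_integral_cong_AE(1)[OF this]
 have "AE x in lebesgue. ind D x *\<^sub>R \<phi> x *\<^sub>R G x $ j = ind D x *\<^sub>R \<phi> x *\<^sub>R G' x $ j"
  using ae(2) by eventually_elim (auto split: split_indicator)
 note 2 = lebesgue_integral_cong_AE(1)[OF this]
 show "(LINT x:D|lebesgue. partial j \<phi> x *\<^sub>R f' x) = - (LINT x:D|lebesgue. \<phi> x *\<^sub>R G' x $ j)"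
  using has_weak_gradientD(3)[OF w t, of j] 1 2 by (simp add: set_lebesgue_integral_def)
qed

lemma continuous_absolutely_integrable_compact:
 fixes f :: "real^3 \<Rightarrow> 'b::euclidean_space"
 assumes "continuous_on UNIV f" "compact K"
 shows "f absolutely_integrable_on K"
proof -
 obtain a where a: "K \<subseteq> cbox (- a) a" using bounded_subset_cbox_symmetric[OF compact_imp_bounded[OF assms(2)]] by blast
 have "f absolutely_integrable_on cbox (- a) a"
  by (rule absolutely_integrable_continuous[OF continuous_on_subset[OF assms(1)]]) auto
 then show ?thesis
  by (rule set_integrable_subset) (use a assms(2) in \<open>auto intro: lmeasurable_compact fmeasurableD\<close>)
qed

text \<open>The product with a test function has compact support, so its derivative integrates to
  zero, and the product rule splits that integral into the two sides of the definition.\<close>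

lemma has_weak_gradient_C1:
 fixes f :: "real^3 \<Rightarrow> 'b::euclidean_space"
 assumes der: "\<And>x. (f has_derivative (\<lambda>v. \<Sum>j\<in>UNIV. v $ j *\<^sub>R F x $ j)) (at x)" and F: "continuous_on UNIV F"
 shows "has_weak_gradient D f F"
 unfolding has_weak_gradient_def
proof (intro conjI allI impI)
 have cf: "continuous_on UNIV f"
  by (meson der has_derivative_continuous continuous_at_imp_continuous_on)
 fix K assume "compact K \<and> K \<subseteq> D"
 then show "f absolutely_integrable_on K" "F absolutely_integrable_on K"
  using continuous_absolutely_integrable_compact F cf by blast+
next
 have cf: "continuous_on UNIV f"
  by (meson der has_derivative_continuous continuous_at_imp_continuous_on)
 fix \<phi> :: "real^3 \<Rightarrow> real" and j :: 3 assume t: "test_function D \<phi>"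
 define K where "K = closure {x. \<phi> x \<noteq> 0}"
 have K: "compact K" "K \<subseteq> D" and z: "\<And>x. x \<notin> K ==> \<phi> x = 0" "\<And>x j. x \<notin> K ==> partial j \<phi> x = 0"
  unfolding K_def using test_functionD[OF t] by blast+
 have bK: "bounded K" by (rule compact_imp_bounded[OF K(1)])
 have d\<phi>: "(\<phi> has_derivative (\<lambda>v. \<Sum>j\<in>UNIV. v $ j *\<^sub>R partial j \<phi> x)) (at x)" for x
  by (rule Ck_on_gradient(1)[OF test_functionD(1)[OF t, of "Suc 0"]])
 have cp: "continuous_on UNIV (partial j \<phi>)" for j
  by (rule Ck_on_gradient(2)[OF test_functionD(1)[OF t, of "Suc 0"]])
 have c\<phi>: "continuous_on UNIV \<phi>" using test_functionD(1)[OF t, where m=0] by simp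
 define E where "E x = (\<chi> j. \<phi> x *\<^sub>R F x $ j + partial j \<phi> x *\<^sub>R f x)" for x
 have cE: "continuous_on UNIV E" unfolding E_def
  by (intro continuous_on_vec_lambda continuous_intros c\<phi> cf cp F)
 have E0: "E x = 0" if "x \<notin> K" for x using z[OF that] by (simp add: E_def vec_eq_iff)
 obtain B where B: "\<And>x. norm (E x) \<le> B" using continuous_support_bounded[OF cE E0 bK] by metis
 define f' where "f' x v = (\<Sum>j\<in>UNIV. v $ j *\<^sub>R E x $ j)" for x and v :: "real^3"
 have d: "((\<lambda>x. \<phi> x *\<^sub>R f x) has_derivative f' x) (at x)" for x
  by (rule has_derivative_eq_rhs[OF has_derivative_scaleR[OF d\<phi> der]])
   (auto simp: f'_def E_def scaleR_sum_right scaleR_sum_left sum.distrib scaleR_add_right mult_ac)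
 have b: "norm (f' x v) \<le> (3 * B) * norm v" for x v
 proof -
  have "norm (f' x v) \<le> (\<Sum>j\<in>(UNIV::3 set). norm v * B)" unfolding f'_def
  proof (rule sum_norm_le)
   fix j :: 3
   have "norm (E x $ j) \<le> B" using B[of x] Finite_Cartesian_Product.norm_nth_le[of "E x" j] by linarith
   then show "norm (v $ j *\<^sub>R E x $ j) \<le> norm v * B"
    unfolding norm_scaleR using component_le_norm_cart[of v j] by (intro mult_mono) auto
  qed
  then show ?thesis by (simp add: mult_ac)
 qed
 have i: "(LI x. f' x (axis j 1)) = 0"
  by (rule integral_derivative_zero(2)[OF d b _ bK]) (simp add: z)
 have e: "f' x (axis j 1) = \<phi> x *\<^sub>R F x $ j + partial j \<phi> x *\<^sub>R f x" for x
  by (simp add: f'_def E_def axis_def if_distrib[of "\<lambda>c. c *\<^sub>R _"] cong: if_cong)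
 have c1: "continuous_on UNIV (\<lambda>x. \<phi> x *\<^sub>R F x $ j)" by (intro continuous_intros c\<phi> F)
 have c2: "continuous_on UNIV (\<lambda>x. partial j \<phi> x *\<^sub>R f x)" by (intro continuous_intros cp cf)
 have i1: "L1 (\<lambda>x. \<phi> x *\<^sub>R F x $ j)"
  by (rule continuous_support_integrable[OF c1 _ bK]) (simp add: z)
 have i2: "L1 (\<lambda>x. partial j \<phi> x *\<^sub>R f x)"
  by (rule continuous_support_integrable[OF c2 _ bK]) (simp add: z)
 have "(LI x. partial j \<phi> x *\<^sub>R f x) = - (LI x. \<phi> x *\<^sub>R F x $ j)"
  using i i1 i2 unfolding e by (simp add: eq_neg_iff_add_eq_0 add.commute)
 moreover have "ind D x *\<^sub>R (partial j \<phi> x *\<^sub>R f x) = partial j \<phi> x *\<^sub>R f x"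
  "ind D x *\<^sub>R (\<phi> x *\<^sub>R F x $ j) = \<phi> x *\<^sub>R F x $ j" for x
  using z[of x] K(2) by (cases "x \<in> D"; auto)+
 ultimately show "(LINT x:D|lebesgue. partial j \<phi> x *\<^sub>R f x) = - (LINT x:D|lebesgue. \<phi> x *\<^sub>R F x $ j)"
  unfolding set_lebesgue_integral_def by (simp only:)
qed

lemma has_weak_gradient_diff:
 fixes f g :: "real^3 \<Rightarrow> 'b::euclidean_space"
 assumes "has_weak_gradient D f F" "has_weak_gradient D g G"
 shows "has_weak_gradient D (\<lambda>x. f x - g x) (\<lambda>x. F x - G x)"
 unfolding has_weak_gradient_def
proof (intro conjI allI impI)
 fix \<phi> :: "real^3 \<Rightarrow> real" and j :: 3 assume t: "test_function D \<phi>"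
 define K where "K = closure {x. \<phi> x \<noteq> 0}"
 have K: "compact K" "K \<subseteq> D" and z: "\<And>x. x \<notin> K ==> \<phi> x = 0" "\<And>x j. x \<notin> K ==> partial j \<phi> x = 0"
  unfolding K_def using test_functionD[OF t] by blast+
 have bK: "bounded K" by (rule compact_imp_bounded[OF K(1)])
 have cp: "continuous_on UNIV (partial j \<phi>)" for j
  by (rule Ck_on_gradient(2)[OF test_functionD(1)[OF t, of "Suc 0"]])
 have c\<phi>: "continuous_on UNIV \<phi>" using test_functionD(1)[OF t, where m=0] by simp
 have i: "set_integrable lebesgue D (\<lambda>x. s x *\<^sub>R h x)"
  if s: "continuous_on UNIV s" "\<And>x. x \<notin> K ==> s x = 0" and h: "h absolutely_integrable_on K"
  for s :: "real^3 \<Rightarrow> real" and h :: "real^3 \<Rightarrow> 'b"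
 proof -
  obtain B where B: "\<And>x. norm (s x) \<le> B" using continuous_support_bounded[OF s bK] by metis
  have hi: "L1 (\<lambda>x. ind K x *\<^sub>R h x)" using h by (simp add: set_integrable_def)
  have b: "norm (s x *\<^sub>R (ind K x *\<^sub>R h x)) \<le> norm (B * norm (ind K x *\<^sub>R h x))" for x
   using mult_right_mono[OF B[of x], of "norm (ind K x *\<^sub>R h x)"] by (simp only: norm_scaleR real_norm_def) simp
  have "L1 (\<lambda>x. s x *\<^sub>R (ind K x *\<^sub>R h x))"
   by (rule Bochner_Integration.integrable_bound[OF integrable_mult_right[OF integrable_norm[OF hi], of B]])
    (use borel_measurable_scaleR[OF continuous_imp_lebesgue[OF s(1)] borel_measurable_integrable[OF hi]] b in
      \<open>simp_all only: AE_I2\<close>)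
  moreover have "s x *\<^sub>R (ind K x *\<^sub>R h x) = ind D x *\<^sub>R (s x *\<^sub>R h x)" for x
   using K(2) s(2)[of x] by (cases "x \<in> K") auto
  ultimately show ?thesis unfolding set_integrable_def by (simp only:)
 qed
 note D = has_weak_gradientD[OF assms(1)] has_weak_gradientD[OF assms(2)]
 have n: "(\<lambda>x. H x $ j) absolutely_integrable_on K" if "H absolutely_integrable_on K" for H :: "real^3 \<Rightarrow> 'b^3"
  by (rule absolutely_integrable_vec_nth[OF that])
 show "(LINT x:D|lebesgue. partial j \<phi> x *\<^sub>R (f x - g x)) = - (LINT x:D|lebesgue. \<phi> x *\<^sub>R (F x - G x) $ j)"
  using D(3)[OF t, of j] D(6)[OF t, of j] set_integral_diff(2)[OF i[OF cp z(2) D(1)[OF K]] i[OF cp z(2) D(4)[OF K]], of j j]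
   set_integral_diff(2)[OF i[OF c\<phi> z(1) n[OF D(2)[OF K]]] i[OF c\<phi> z(1) n[OF D(5)[OF K]]]]
  by (simp add: scaleR_diff_right)
next
 fix K assume "compact K \<and> K \<subseteq> D"
 then have K: "compact K" "K \<subseteq> D" by auto
 show "(\<lambda>x. f x - g x) absolutely_integrable_on K"
  by (rule set_integral_diff(1)[OF has_weak_gradientD(1)[OF assms(1) K] has_weak_gradientD(1)[OF assms(2) K]])
 show "(\<lambda>x. F x - G x) absolutely_integrable_on K"
  by (rule set_integral_diff(1)[OF has_weak_gradientD(2)[OF assms(1) K] has_weak_gradientD(2)[OF assms(2) K]])
qed

section \<open>Integration by parts for fields vanishing on the boundary\<close>

lemma in_Lp_diff:
 fixes f g :: "real^3 \<Rightarrow> 'b::euclidean_space"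
 assumes p: "1 \<le> p" and f: "in_Lp p A f" and g: "in_Lp p A g"
 shows "in_Lp p A (\<lambda>x. f x - g x)"
proof -
 have m: "(\<lambda>x. ind A x *\<^sub>R f x) \<in> lmeas" "(\<lambda>x. ind A x *\<^sub>R g x) \<in> lmeas"
  and i: "L1 (\<lambda>x. ind A x *\<^sub>R norm (f x) powr p)" "L1 (\<lambda>x. ind A x *\<^sub>R norm (g x) powr p)"
  using f g by (auto simp: in_Lp_def set_borel_measurable_def set_integrable_def)
 have md: "(\<lambda>x. ind A x *\<^sub>R (f x - g x)) \<in> lmeas"
  using borel_measurable_diff[OF m] by (simp add: scaleR_diff_right)
 have e: "ind A x *\<^sub>R norm (h x) powr p = norm (ind A x *\<^sub>R h x) powr p" for h :: "_ \<Rightarrow> 'b" and x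
  using p by (cases "x \<in> A") auto
 have pt: "norm (a - b) powr p \<le> 2 powr p * (norm a powr p + norm b powr p)" for a b :: 'b
 proof -
  have "norm (a - b) \<le> 2 * max (norm a) (norm b)" using norm_triangle_ineq4[of a b] by linarith
  then have "norm (a - b) powr p \<le> (2 * max (norm a) (norm b)) powr p" using p by (intro powr_mono2) auto
  also have "\<dots> = 2 powr p * max (norm a) (norm b) powr p" by (simp add: powr_mult)
  also have "\<dots> \<le> 2 powr p * (norm a powr p + norm b powr p)"
   by (intro mult_left_mono) (auto simp: max_def)
  finally show ?thesis .
 qed
 have "L1 (\<lambda>x. ind A x *\<^sub>R norm (f x - g x) powr p)"
 proof (rule Bochner_Integration.integrable_bound)
  show "L1 (\<lambda>x. 2 powr p * (ind A x *\<^sub>R norm (f x) powr p + ind A x *\<^sub>R norm (g x) powr p))"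
   using i by simp
  show "(\<lambda>x. ind A x *\<^sub>R norm (f x - g x) powr p) \<in> lmeas"
    unfolding e[where h="\<lambda>x. f x - g x"] by (intro powr_real_measurable measurable_compose[OF md borel_measurable_norm] borel_measurable_const)
  show "AE x in lebesgue. norm (ind A x *\<^sub>R norm (f x - g x) powr p)
    \<le> norm (2 powr p * (ind A x *\<^sub>R norm (f x) powr p + ind A x *\<^sub>R norm (g x) powr p))"
   using pt by (intro AE_I2) (auto split: split_indicator)
 qed
 then show ?thesis using md by (simp add: in_Lp_def set_borel_measurable_def set_integrable_def)
qed

lemma in_Lp_cong_AE:
 fixes f g :: "real^3 \<Rightarrow> 'b::euclidean_space"
 assumes ae: "AE x in lebesgue. x \<in> A \<longrightarrow> f x = g x" and f: "in_Lp p A f"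
 shows "in_Lp p A g" "Lp_norm p A g = Lp_norm p A f"
proof -
 have 1: "AE x in lebesgue. ind A x *\<^sub>R f x = ind A x *\<^sub>R g x"
  using ae by eventually_elim (rule indicator_scaleR_cong, blast)
 have 2: "AE x in lebesgue. ind A x *\<^sub>R norm (f x) powr p = ind A x *\<^sub>R norm (g x) powr p"
  using ae by eventually_elim (rule indicator_scaleR_cong, simp)
 show "in_Lp p A g" using f borel_measurable_AE[OF _ 1] lebesgue_integral_cong_AE(2)[OF 2]
  by (simp add: in_Lp_def set_borel_measurable_def set_integrable_def)
 show "Lp_norm p A g = Lp_norm p A f" using lebesgue_integral_cong_AE(1)[OF 2]
  by (simp add: Lp_norm_def set_lebesgue_integral_def)
qed

lemma in_Lp_continuous:
 fixes f :: "real^3 \<Rightarrow> 'b::euclidean_space"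
 assumes "1 \<le> p" "continuous_on UNIV f" "\<And>x. x \<notin> K ==> f x = 0" "bounded K" "A \<in> sets lebesgue"
 shows "in_Lp p A f"
proof -
 obtain B where B: "\<And>x. norm (f x) \<le> B" "B \<ge> 0" using continuous_support_bounded[OF assms(2-4)] by metis
 have fm: "f \<in> lmeas" by (rule continuous_imp_lebesgue[OF assms(2)])
 have m: "(\<lambda>x. ind A x *\<^sub>R norm (f x) powr p) \<in> lmeas"
  using assms(5) by (intro borel_measurable_scaleR powr_real_measurable measurable_compose[OF fm borel_measurable_norm]
   borel_measurable_const borel_measurable_indicator)
 have "L1 (\<lambda>x. ind A x *\<^sub>R norm (f x) powr p)"
  by (rule integrable_bounded_support[OF m _ _ assms(4), of "B powr p"])
   (use B assms(1,3) in \<open>auto intro!: powr_mono2 split: split_indicator\<close>)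
 moreover have "(\<lambda>x. ind A x *\<^sub>R f x) \<in> lmeas"
  by (intro borel_measurable_scaleR fm borel_measurable_indicator assms(5))
 ultimately show ?thesis by (simp add: in_Lp_def set_borel_measurable_def set_integrable_def)
qed

text \<open>The factor \<open>m powr (1 - 1/p)\<close> is the gain from the smallness of
  \<open>C\<close>, while the norm may be taken over the larger \<open>A\<close>. This converts
  integrals over the thin gap into norms over a cylinder.\<close>

lemma in_Lp_local_L1:
 fixes f :: "real^3 \<Rightarrow> 'b::euclidean_space"
 assumes p: "1 \<le> p" and f: "in_Lp p A f" and C: "C \<in> lmeasurable" "C \<subseteq> A" "measure lebesgue C \<le> m" "0 < m"
  and A: "A \<in> sets lebesgue"
 shows "L1 (\<lambda>x. ind C x *\<^sub>R f x)"
  "(LI x. norm (ind C x *\<^sub>R f x)) \<le> 2 * m powr (1 - 1/p) * Lp_norm p C f"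
  "(LI x. norm (ind C x *\<^sub>R f x)) \<le> 2 * m powr (1 - 1/p) * Lp_norm p A f"
proof -
 have m: "(\<lambda>x. ind A x *\<^sub>R f x) \<in> lmeas"
  and i: "L1 (\<lambda>x. ind A x *\<^sub>R norm (f x) powr p)"
  using f by (auto simp: in_Lp_def set_borel_measurable_def set_integrable_def)
 have Cs: "C \<in> sets lebesgue" using C(1) by (rule fmeasurableD)
 have e: "norm (ind C x *\<^sub>R f x) powr p = ind C x *\<^sub>R norm (f x) powr p" for x
  using p by (cases "x \<in> C") auto
 have e2: "ind C x *\<^sub>R f x = ind C x *\<^sub>R (ind A x *\<^sub>R f x)" for x
  using C(2) by (auto split: split_indicator)
 have e3: "ind C x *\<^sub>R norm (f x) powr p = ind C x *\<^sub>R (ind A x *\<^sub>R norm (f x) powr p)" for x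
  using C(2) by (auto split: split_indicator)
 have mC: "(\<lambda>x. ind C x *\<^sub>R f x) \<in> lmeas"
  unfolding e2 by (intro borel_measurable_scaleR m borel_measurable_indicator Cs)
 have iC: "L1 (\<lambda>x. norm (ind C x *\<^sub>R f x) powr p)"
  unfolding e e3 using integrable_mult_indicator[OF Cs i] .
 note H = Lp_crude_Hoelder[OF p mC iC Cs _ C(3,4)]
 have fin: "emeasure lebesgue C < \<infinity>" using C(1) by (auto simp: fmeasurable_def)
 show "L1 (\<lambda>x. ind C x *\<^sub>R f x)" by (rule H(1)[OF fin]) simp
 show h: "(LI x. norm (ind C x *\<^sub>R f x)) \<le> 2 * m powr (1 - 1/p) * Lp_norm p C f"
  unfolding Lp_norm_def set_lebesgue_integral_def e[symmetric] by (rule H(2)[OF fin]) simp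
 have "(LI x. ind C x *\<^sub>R norm (f x) powr p) \<le> (LI x. ind A x *\<^sub>R norm (f x) powr p)"
  by (rule integral_mono[OF iC[unfolded e] i]) (use C(2) in \<open>auto split: split_indicator\<close>)
 moreover have "0 \<le> (LI x. ind C x *\<^sub>R norm (f x) powr p)"
  by (rule Bochner_Integration.integral_nonneg) simp
 ultimately have "Lp_norm p C f \<le> Lp_norm p A f"
  unfolding Lp_norm_def set_lebesgue_integral_def using p by (intro powr_mono2) auto
 then show "(LI x. norm (ind C x *\<^sub>R f x)) \<le> 2 * m powr (1 - 1/p) * Lp_norm p A f"
  using h by (meson order_trans mult_left_mono mult_nonneg_nonneg powr_ge_zero zero_le_numeral)
qed


text \<open>The test function \<open>\<theta>\<close> need not vanish on the boundary of \<open>\<Omega>\<close>: for compactly supported \<open>\<phi>\<close> the product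
 \<open>\<theta> \<phi>\<close> does, and the fields in \<open>W1p_zero\<close> are limits of such \<open>\<phi>\<close>.\<close>

lemma W1p_zero_integration_by_parts:
 fixes u :: "real^3 \<Rightarrow> real^3"
 assumes \<Omega>: "open \<Omega>" and u: "u \<in> W1p_zero p \<Omega>" and p: "1 \<le> p"
  and der: "\<And>x. x \<in> \<Omega> ==> (\<theta> has_derivative (\<lambda>v. v \<bullet> T x)) (at x)"
  and bd: "\<And>x. \<bar>\<theta> x\<bar> \<le> M" "\<And>x. norm (T x) \<le> M"
  and m: "\<theta> \<in> lmeas" "T \<in> lmeas"
  and S: "bounded S" "\<And>x. x \<notin> S ==> \<theta> x = 0" "\<And>x. x \<notin> S ==> T x = 0"
 shows "L1 (\<lambda>x. (T x $ j) *\<^sub>R (ind \<Omega> x *\<^sub>R u x))"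
  "L1 (\<lambda>x. \<theta> x *\<^sub>R (ind \<Omega> x *\<^sub>R (weak_grad \<Omega> u x $ j)))"
  "(LI x. (T x $ j) *\<^sub>R (ind \<Omega> x *\<^sub>R u x))
   = - (LI x. \<theta> x *\<^sub>R (ind \<Omega> x *\<^sub>R (weak_grad \<Omega> u x $ j)))"
proof -
 have M0: "M \<ge> 0" using order_trans[OF abs_ge_zero bd(1)] .
 obtain r0 where r0: "S \<subseteq> cball 0 r0"
  using bounded_subset_ballD[OF S(1), of 0] ball_subset_cball by (metis subset_trans)
 define C :: "(real^3) set" where "C = \<Omega> \<inter> cball 0 r0"
 have \<Omega>l: "\<Omega> \<in> sets lebesgue" using \<Omega> by (simp add: borel_open)
 have C: "C \<in> lmeasurable" "C \<subseteq> \<Omega>" unfolding C_def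
  using fmeasurable_Int_fmeasurable[OF lmeasurable_cball[of 0 r0] \<Omega>l] by (auto simp: Int_commute)
 define mm where "mm = measure lebesgue C + 1"
 have mm: "measure lebesgue C \<le> mm" "0 < mm" by (auto simp: mm_def add_nonneg_pos)
 have Tj: "\<bar>T x $ j\<bar> \<le> M" for x using bd(2)[of x] component_le_norm_cart[of "T x" j] by linarith
 have mTj: "(\<lambda>x. T x $ j) \<in> lmeas"
  using measurable_compose[OF m(2) borel_measurable_continuous_onI[OF continuous_on_component[OF continuous_on_id]]] by simp
 have loc: "s x *\<^sub>R (ind \<Omega> x *\<^sub>R h) = s x *\<^sub>R (ind C x *\<^sub>R h)" if "x \<notin> S ==> s x = 0"
  for s :: "_ \<Rightarrow> real" and x and h :: "real^3"
  using that r0 by (cases "x \<in> S") (auto simp: C_def indicator_def)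
 have li: "L1 (\<lambda>x. s x *\<^sub>R (ind \<Omega> x *\<^sub>R h x))"
  "norm (LI x. s x *\<^sub>R (ind \<Omega> x *\<^sub>R h x)) \<le> M * (LI x. norm (ind C x *\<^sub>R h x))"
  if s: "\<And>x. x \<notin> S ==> s x = 0" "\<And>x. \<bar>s x\<bar> \<le> M" "s \<in> lmeas"
   and h: "L1 (\<lambda>x. ind C x *\<^sub>R h x)" for s :: "_ \<Rightarrow> real" and h :: "_ \<Rightarrow> real^3"
 proof -
  have b: "norm (s x *\<^sub>R (ind C x *\<^sub>R h x)) \<le> M * norm (ind C x *\<^sub>R h x)" for x
   using mult_right_mono[OF s(2)[of x], of "norm (ind C x *\<^sub>R h x)"] by (simp only: norm_scaleR real_norm_def) simp
  then have b': "norm (s x *\<^sub>R (ind C x *\<^sub>R h x)) \<le> norm (M * norm (ind C x *\<^sub>R h x))" for x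
   by (simp only: real_norm_def[of "M * _"] abs_of_nonneg[OF mult_nonneg_nonneg[OF M0 norm_ge_zero]])
  have hM: "L1 (\<lambda>x. M * norm (ind C x *\<^sub>R h x))"
   by (intro integrable_mult_right integrable_norm h)
  have i: "L1 (\<lambda>x. s x *\<^sub>R (ind C x *\<^sub>R h x))"
   by (rule Bochner_Integration.integrable_bound[OF hM borel_measurable_scaleR[OF s(3) borel_measurable_integrable[OF h]] AE_I2[OF b']])
  have e: "s x *\<^sub>R (ind \<Omega> x *\<^sub>R h x) = s x *\<^sub>R (ind C x *\<^sub>R h x)" for x by (rule loc[OF s(1)])
  show "L1 (\<lambda>x. s x *\<^sub>R (ind \<Omega> x *\<^sub>R h x))" unfolding e by (rule i)
  have "norm (LI x. s x *\<^sub>R (ind \<Omega> x *\<^sub>R h x)) \<le> (LI x. M * norm (ind C x *\<^sub>R h x))"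
   unfolding e by (rule Bochner_Integration.integral_norm_bound_integral[OF i hM b])
  then show "norm (LI x. s x *\<^sub>R (ind \<Omega> x *\<^sub>R h x)) \<le> M * (LI x. norm (ind C x *\<^sub>R h x))"
   by simp
 qed
 have uW: "in_Lp p \<Omega> u" "weakly_differentiable \<Omega> u" "in_Lp p \<Omega> (weak_grad \<Omega> u)"
  using u by (auto simp: W1p_zero_def W1p_def)
 define G where "G = weak_grad \<Omega> u"
 have wG: "has_weak_gradient \<Omega> u G" unfolding G_def by (rule weak_grad_works[OF uW(2)])
 have nthi: "L1 (\<lambda>x. ind C x *\<^sub>R (H x $ j))"
  "(LI x. norm (ind C x *\<^sub>R (H x $ j))) \<le> (LI x. norm (ind C x *\<^sub>R H x))"
  if H: "L1 (\<lambda>x. ind C x *\<^sub>R H x)" for H :: "_ \<Rightarrow> (real^3)^3"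
 proof -
  show i: "L1 (\<lambda>x. ind C x *\<^sub>R (H x $ j))"
   using integrable_bounded_linear[OF bounded_linear_vec_nth[of j] H] by simp
  show "(LI x. norm (ind C x *\<^sub>R (H x $ j))) \<le> (LI x. norm (ind C x *\<^sub>R H x))"
   by (rule integral_mono[OF integrable_norm[OF i] integrable_norm[OF H]])
    (auto intro!: mult_left_mono Finite_Cartesian_Product.norm_nth_le)
 qed
 note u1 = in_Lp_local_L1[OF p uW(1) C mm \<Omega>l]
 note G1 = in_Lp_local_L1[OF p uW(3)[folded G_def] C mm \<Omega>l]
 show i1: "L1 (\<lambda>x. (T x $ j) *\<^sub>R (ind \<Omega> x *\<^sub>R u x))"
  by (rule li(1)[OF _ Tj mTj u1(1)]) (simp add: S)
 show i2: "L1 (\<lambda>x. \<theta> x *\<^sub>R (ind \<Omega> x *\<^sub>R (weak_grad \<Omega> u x $ j)))"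
  using li(1)[OF S(2) bd(1) m(1) nthi(1)[OF G1(1)]] by (simp add: G_def)
 define \<Delta> where "\<Delta> = (LI x. (T x $ j) *\<^sub>R (ind \<Omega> x *\<^sub>R u x)) + (LI x. \<theta> x *\<^sub>R (ind \<Omega> x *\<^sub>R (G x $ j)))"
 define A where "A = 2 * mm powr (1 - 1/p)"
 have A0: "A > 0" using mm by (simp add: A_def)
 have "norm \<Delta> \<le> 2 * M * A * \<epsilon>" if \<epsilon>: "\<epsilon> > 0" for \<epsilon>
 proof -
  obtain \<phi> where t: "test_function \<Omega> \<phi>" and w: "W1p_norm p \<Omega> (\<lambda>x. u x - \<phi> x) < \<epsilon>"
   using u \<epsilon> by (auto simp: W1p_zero_def)
  define K where "K = closure {x. \<phi> x \<noteq> 0}"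
  have K: "compact K" "K \<subseteq> \<Omega>" and z: "\<And>x. x \<notin> K ==> \<phi> x = 0" "\<And>x j. x \<notin> K ==> partial j \<phi> x = 0"
   unfolding K_def using test_functionD[OF t] by blast+
  have bK: "bounded K" by (rule compact_imp_bounded[OF K(1)])
  have d\<phi>: "(\<phi> has_derivative (\<lambda>v. \<Sum>j\<in>UNIV. v $ j *\<^sub>R partial j \<phi> x)) (at x)" for x
   by (rule Ck_on_gradient(1)[OF test_functionD(1)[OF t, of "Suc 0"]])
  have cp: "continuous_on UNIV (partial j \<phi>)" for j
   by (rule Ck_on_gradient(2)[OF test_functionD(1)[OF t, of "Suc 0"]])
  have c\<phi>: "continuous_on UNIV \<phi>" using test_functionD(1)[OF t, where m=0] by simp
  define F where "F x = (\<chi> j. partial j \<phi> x)" for x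
  have cF: "continuous_on UNIV F" unfolding F_def by (intro continuous_on_vec_lambda cp)
  have F0: "F x = 0" if "x \<notin> K" for x using z(2)[OF that] by (simp add: F_def vec_eq_iff)
  have d\<phi>F: "(\<phi> has_derivative (\<lambda>v. \<Sum>j\<in>UNIV. v $ j *\<^sub>R F x $ j)) (at x)" for x
   using d\<phi>[of x] by (simp add: F_def)
  have wF: "has_weak_gradient \<Omega> \<phi> F" by (rule has_weak_gradient_C1[OF d\<phi>F cF])
  have wd: "has_weak_gradient \<Omega> (\<lambda>x. u x - \<phi> x) (\<lambda>x. G x - F x)"
   by (rule has_weak_gradient_diff[OF wG wF])
  have wgd: "has_weak_gradient \<Omega> (\<lambda>x. u x - \<phi> x) (weak_grad \<Omega> (\<lambda>x. u x - \<phi> x))"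
   by (rule weak_grad_works) (use wd in \<open>auto simp: weakly_differentiable_def\<close>)
  \<comment> \<open>\<open>W1p_norm\<close> of the difference involves a weak gradient chosen for
    that difference; uniqueness identifies it with \<open>G - F\<close>.\<close>
  have ae: "AE x in lebesgue. x \<in> \<Omega> \<longrightarrow> G x - F x = weak_grad \<Omega> (\<lambda>x. u x - \<phi> x) x"
   by (rule has_weak_gradient_unique[OF \<Omega> wd wgd])
  have L\<phi>: "in_Lp p \<Omega> \<phi>" by (rule in_Lp_continuous[OF p c\<phi> z(1) bK \<Omega>l])
  have LF: "in_Lp p \<Omega> F" by (rule in_Lp_continuous[OF p cF F0 bK \<Omega>l])
  have Ld: "in_Lp p \<Omega> (\<lambda>x. u x - \<phi> x)" by (rule in_Lp_diff[OF p uW(1) L\<phi>])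
  have LdG: "in_Lp p \<Omega> (\<lambda>x. G x - F x)" by (rule in_Lp_diff[OF p uW(3)[folded G_def] LF])
  have LdG': "Lp_norm p \<Omega> (weak_grad \<Omega> (\<lambda>x. u x - \<phi> x)) = Lp_norm p \<Omega> (\<lambda>x. G x - F x)"
   by (rule in_Lp_cong_AE(2)[OF ae LdG])
  have nn: "Lp_norm p \<Omega> h \<ge> 0" for h :: "_ \<Rightarrow> real^3" unfolding Lp_norm_def by simp
  have nn': "Lp_norm p \<Omega> h \<ge> 0" for h :: "_ \<Rightarrow> (real^3)^3" unfolding Lp_norm_def by simp
  have small: "a \<le> (a powr p + b powr p) powr (1 / p)" "b \<le> (a powr p + b powr p) powr (1 / p)"
   if "a \<ge> 0" "b \<ge> 0" for a b :: real
  proof -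
   have "(a powr p) powr (1/p) \<le> (a powr p + b powr p) powr (1 / p)" "(b powr p) powr (1/p) \<le> (a powr p + b powr p) powr (1 / p)"
    using p by (auto intro!: powr_mono2)
   then show "a \<le> (a powr p + b powr p) powr (1 / p)" "b \<le> (a powr p + b powr p) powr (1 / p)"
    using that p by (auto simp: powr_powr)
  qed
  have e1: "Lp_norm p \<Omega> (\<lambda>x. u x - \<phi> x) \<le> \<epsilon>" and e2: "Lp_norm p \<Omega> (\<lambda>x. G x - F x) \<le> \<epsilon>"
   using small[OF nn[of "\<lambda>x. u x - \<phi> x"] nn'[of "\<lambda>x. G x - F x"]] w unfolding W1p_norm_def LdG' by linarith+
  note d1 = in_Lp_local_L1[OF p Ld C mm \<Omega>l]
  note d2 = in_Lp_local_L1[OF p LdG C mm \<Omega>l]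
  define f' where "f' x v = (if x \<in> \<Omega> then (v \<bullet> T x) *\<^sub>R \<phi> x + \<theta> x *\<^sub>R (\<Sum>j\<in>UNIV. v $ j *\<^sub>R F x $ j) else 0)" for x v
  obtain B where B: "\<And>x. norm (\<phi> x) \<le> B" "B \<ge> 0" using continuous_support_bounded[OF c\<phi> z(1) bK] by metis
  obtain B' where B': "\<And>x. norm (F x) \<le> B'" "B' \<ge> 0" using continuous_support_bounded[OF cF F0 bK] by metis
  \<comment> \<open>Nothing is known of \<open>\<theta>\<close> at points outside
    \<open>\<Omega>\<close>, but there \<open>\<phi>\<close> vanishes on the open complement of
    \<open>K\<close>, so the product extended by zero is differentiable everywhere.\<close>
  have df: "((\<lambda>x. if x \<in> \<Omega> then \<theta> x *\<^sub>R \<phi> x else 0) has_derivative f' x) (at x)" for x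
  proof (cases "x \<in> \<Omega>")
   case True
   have "((\<lambda>x. \<theta> x *\<^sub>R \<phi> x) has_derivative f' x) (at x)"
    by (rule has_derivative_eq_rhs[OF has_derivative_scaleR[OF der[OF True] d\<phi>F[of x]]])
     (use True in \<open>simp add: f'_def fun_eq_iff add.commute\<close>)
   then show ?thesis
    by (rule has_derivative_transform_within_open[OF _ \<Omega> True]) simp
  next
   case False
   then have "x \<in> - K" "open (- K)" using K compact_imp_closed by auto
   moreover have "f' x = (\<lambda>v. 0)" using False by (simp add: f'_def fun_eq_iff)
   ultimately show ?thesis
    using has_derivative_transform_within_open[of "\<lambda>_. 0" "\<lambda>_. 0" x UNIV "- K" "\<lambda>x. if x \<in> \<Omega> then \<theta> x *\<^sub>R \<phi> x else 0"] z(1)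
    by simp
  qed
  have bf: "norm (f' x v) \<le> (M * B + M * (3 * B')) * norm v" for x v
  proof (cases "x \<in> \<Omega>")
   case True
   have "norm (\<Sum>j\<in>(UNIV::3 set). v $ j *\<^sub>R F x $ j) \<le> (\<Sum>j\<in>(UNIV::3 set). norm v * B')"
   proof (rule sum_norm_le)
    fix j :: 3
    have "norm (F x $ j) \<le> B'" using B'(1)[of x] Finite_Cartesian_Product.norm_nth_le[of "F x" j] by linarith
    then show "norm (v $ j *\<^sub>R F x $ j) \<le> norm v * B'"
     unfolding norm_scaleR using component_le_norm_cart[of v j] by (intro mult_mono) auto
   qed
   then have 1: "norm (\<theta> x *\<^sub>R (\<Sum>j\<in>(UNIV::3 set). v $ j *\<^sub>R F x $ j)) \<le> M * (3 * B' * norm v)"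
    unfolding norm_scaleR using bd(1)[of x] M0 by (intro mult_mono) (auto simp: mult_ac)
   have "\<bar>v \<bullet> T x\<bar> \<le> norm v * M"
    using Cauchy_Schwarz_ineq2[of v "T x"] mult_left_mono[OF bd(2)[of x] norm_ge_zero[of v]] by linarith
   then have 2: "norm ((v \<bullet> T x) *\<^sub>R \<phi> x) \<le> norm v * M * B"
    unfolding norm_scaleR using B M0 by (intro mult_mono) auto
   show ?thesis using norm_triangle_mono[OF 2 1] True by (simp add: f'_def algebra_simps)
  qed (use M0 B B' in \<open>simp add: f'_def\<close>)
  have "(LI x. f' x (axis j 1)) = 0"
   by (rule integral_derivative_zero(2)[OF df bf _ bK]) (simp add: z)
  moreover have "f' x (axis j 1) = (T x $ j) *\<^sub>R (ind \<Omega> x *\<^sub>R \<phi> x) + \<theta> x *\<^sub>R (ind \<Omega> x *\<^sub>R (F x $ j))" for x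
  proof -
   have "(\<Sum>i\<in>UNIV. axis j (1::real) $ i *\<^sub>R F x $ i) = F x $ j"
    by (simp add: axis_def if_distrib[of "\<lambda>c. c *\<^sub>R _"] cong: if_cong)
   then show ?thesis by (simp add: f'_def inner_axis')
  qed
  moreover have \<phi>1: "L1 (\<lambda>x. (T x $ j) *\<^sub>R (ind \<Omega> x *\<^sub>R \<phi> x))"
   by (rule li(1)[OF _ Tj mTj in_Lp_local_L1(1)[OF p L\<phi> C mm \<Omega>l]]) (simp add: S)
  moreover have \<phi>2: "L1 (\<lambda>x. \<theta> x *\<^sub>R (ind \<Omega> x *\<^sub>R (F x $ j)))"
   by (rule li(1)[OF S(2) bd(1) m(1) nthi(1)[OF in_Lp_local_L1(1)[OF p LF C mm \<Omega>l]]])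
  ultimately have \<phi>0: "(LI x. (T x $ j) *\<^sub>R (ind \<Omega> x *\<^sub>R \<phi> x)) + (LI x. \<theta> x *\<^sub>R (ind \<Omega> x *\<^sub>R (F x $ j))) = 0"
   by (simp only: Bochner_Integration.integral_add)
  have r1: "(LI x. (T x $ j) *\<^sub>R (ind \<Omega> x *\<^sub>R (u x - \<phi> x))) =
    (LI x. (T x $ j) *\<^sub>R (ind \<Omega> x *\<^sub>R u x)) - (LI x. (T x $ j) *\<^sub>R (ind \<Omega> x *\<^sub>R \<phi> x))"
   unfolding scaleR_diff_right by (rule Bochner_Integration.integral_diff[OF i1 \<phi>1])
  have r2: "(LI x. \<theta> x *\<^sub>R (ind \<Omega> x *\<^sub>R ((G x - F x) $ j))) =
    (LI x. \<theta> x *\<^sub>R (ind \<Omega> x *\<^sub>R (G x $ j))) - (LI x. \<theta> x *\<^sub>R (ind \<Omega> x *\<^sub>R (F x $ j)))"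
   unfolding scaleR_diff_right vector_minus_component by (rule Bochner_Integration.integral_diff[OF i2[folded G_def] \<phi>2])
  \<comment> \<open>The identity is exact for \<open>\<phi>\<close>, so the defect of
    \<open>u\<close> is the defect of \<open>u - \<phi>\<close>, which the small Sobolev norm
    controls.\<close>
  have "\<Delta> = (LI x. (T x $ j) *\<^sub>R (ind \<Omega> x *\<^sub>R (u x - \<phi> x))) + (LI x. \<theta> x *\<^sub>R (ind \<Omega> x *\<^sub>R ((G x - F x) $ j)))"
   unfolding \<Delta>_def r1 r2 using \<phi>0 by (simp add: algebra_simps)
  moreover have "norm (LI x. (T x $ j) *\<^sub>R (ind \<Omega> x *\<^sub>R (u x - \<phi> x))) \<le> M * (A * \<epsilon>)"
  proof -
   have "norm (LI x. (T x $ j) *\<^sub>R (ind \<Omega> x *\<^sub>R (u x - \<phi> x))) \<le> M * (LI x. norm (ind C x *\<^sub>R (u x - \<phi> x)))"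
    by (rule li(2)[OF _ Tj mTj d1(1)]) (simp add: S)
   also have "\<dots> \<le> M * (A * \<epsilon>)"
    using order_trans[OF d1(3)[folded A_def] mult_left_mono[OF e1]] A0 M0 by (intro mult_left_mono) auto
   finally show ?thesis .
  qed
  moreover have "norm (LI x. \<theta> x *\<^sub>R (ind \<Omega> x *\<^sub>R ((G x - F x) $ j))) \<le> M * (A * \<epsilon>)"
  proof -
   have "norm (LI x. \<theta> x *\<^sub>R (ind \<Omega> x *\<^sub>R ((G x - F x) $ j))) \<le> M * (LI x. norm (ind C x *\<^sub>R ((G x - F x) $ j)))"
    by (rule li(2)[OF S(2) bd(1) m(1) nthi(1)[OF d2(1)]])
   also have "\<dots> \<le> M * (A * \<epsilon>)"
    using order_trans[OF nthi(2)[OF d2(1)] order_trans[OF d2(3)[folded A_def] mult_left_mono[OF e2]]] A0 M0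
    by (intro mult_left_mono) auto
   finally show ?thesis .
  qed
  ultimately have "norm \<Delta> \<le> M * (A * \<epsilon>) + M * (A * \<epsilon>)" by (simp only: norm_triangle_mono)
  then show ?thesis by (simp add: mult_ac)
 qed
 have "norm \<Delta> \<le> 0"
 proof (rule field_le_epsilon)
  fix e :: real assume e: "e > 0"
  define q where "q = 2 * M * A"
  have q: "q \<ge> 0" using M0 A0 by (simp add: q_def)
  have "norm \<Delta> \<le> q * (e / (q + 1))"
   unfolding q_def using e q
   by (intro \<open>\<And>\<epsilon>. \<epsilon> > 0 ==> norm \<Delta> \<le> 2 * M * A * \<epsilon>\<close>) (simp add: q_def[symmetric] add_nonneg_pos)
  also have "\<dots> = e * (q / (q + 1))" by simp
  also have "\<dots> \<le> e * 1" using e q by (intro mult_left_mono) (simp_all add: divide_le_eq)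
  finally show "norm \<Delta> \<le> 0 + e" by simp
 qed
 then show "(LI x. (T x $ j) *\<^sub>R (ind \<Omega> x *\<^sub>R u x))
   = - (LI x. \<theta> x *\<^sub>R (ind \<Omega> x *\<^sub>R (weak_grad \<Omega> u x $ j)))"
  by (simp add: \<Delta>_def G_def eq_neg_iff_add_eq_0)
qed

section \<open>Cut-off functions\<close>

lemma pos_part_power_deriv:
 "((\<lambda>s::real. max 0 s ^ Suc (Suc n)) has_real_derivative real (Suc (Suc n)) * max 0 s ^ Suc n) (at s)"
proof (cases s "0::real" rule: linorder_cases)
 case less
 have "((\<lambda>_. 0) has_real_derivative 0) (at s)" by simp
 then have "((\<lambda>s::real. max 0 s ^ Suc (Suc n)) has_real_derivative 0) (at s)"
  by (rule has_field_derivative_transform_within_open[where S="{..<0}"]) (use less in \<open>auto simp: max_def\<close>)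
 then show ?thesis using less by (simp add: max_def)
next
 case greater
 have "((\<lambda>s::real. s ^ Suc (Suc n)) has_real_derivative real (Suc (Suc n)) * s ^ Suc n) (at s)"
  using DERIV_pow[of "Suc (Suc n)" s] by simp
 then have "((\<lambda>s::real. max 0 s ^ Suc (Suc n)) has_real_derivative real (Suc (Suc n)) * s ^ Suc n) (at s)"
  by (rule has_field_derivative_transform_within_open[where S="{0<..}"]) (use greater in \<open>auto simp: max_def\<close>)
 then show ?thesis using greater by (simp add: max_def)
next
 case equal
 have "((\<lambda>s::real. max 0 s ^ Suc n) \<longlongrightarrow> max 0 0 ^ Suc n) (at 0)"
  by (intro tendsto_intros)
 moreover have "eventually (\<lambda>s::real. max 0 s ^ Suc n = (max 0 s ^ Suc (Suc n) - max 0 0 ^ Suc (Suc n)) / (s - 0)) (at 0)"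
  by (auto simp: eventually_at_filter max_def)
 ultimately have "((\<lambda>s::real. (max 0 s ^ Suc (Suc n) - max 0 0 ^ Suc (Suc n)) / (s - 0)) \<longlongrightarrow> 0) (at 0)"
  by (auto dest: Lim_transform_eventually)
 then show ?thesis using equal by (simp add: has_field_derivative_iff)
qed

text \<open>A piecewise quadratic step of class C^1 from 0 to 1 over the unit interval. Its
  derivative \<open>ramp'\<close> is the hat function with peak 2 at 1/2, hence at least 1 on the
  middle half.\<close>

definition ramp :: "real \<Rightarrow> real" where
 "ramp s = 2 * ((max 0 s)^2 - 2 * (max 0 (s - 1/2))^2 + (max 0 (s - 1))^2)"

definition ramp' :: "real \<Rightarrow> real" where
 "ramp' s = 4 * (max 0 s - 2 * max 0 (s - 1/2) + max 0 (s - 1))"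

lemma pos_part_sq_deriv': "((\<lambda>s::real. (max 0 (s - c))^2) has_real_derivative 2 * max 0 (s - c)) (at s)"
proof -
 have 1: "((\<lambda>s::real. (max 0 s)^2) has_real_derivative 2 * max 0 s) (at s)" for s
  using pos_part_power_deriv[of 0 s] by (simp add: numeral_2_eq_2)
 have "((\<lambda>s. s - c) has_real_derivative 1) (at s)" by (auto intro!: derivative_eq_intros)
 from DERIV_chain2[OF 1 this] show ?thesis by simp
qed

lemma ramp_deriv: "(ramp has_real_derivative ramp' s) (at s)"
 unfolding ramp_def[abs_def] ramp'_def
 using DERIV_cmult[OF DERIV_add[OF DERIV_diff[OF pos_part_sq_deriv'[of 0 s]
  DERIV_cmult[OF pos_part_sq_deriv'[of "1/2" s], of 2]] pos_part_sq_deriv'[of 1 s]], of 2]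
 by (simp add: algebra_simps)

lemma ramp_values:
 "s \<le> 0 ==> ramp s = 0" "s \<ge> 1 ==> ramp s = 1" "s \<le> 0 ==> ramp' s = 0" "s \<ge> 1 ==> ramp' s = 0"
 "0 \<le> ramp' s" "ramp' s \<le> 2" "1/4 \<le> s ==> s \<le> 3/4 ==> 1 \<le> ramp' s"
 by (auto simp: ramp_def ramp'_def max_def power2_eq_square field_simps)

lemma ramp_bounds: "0 \<le> ramp s" "ramp s \<le> 1"
proof -
 have mono: "ramp s \<le> ramp t" if "s \<le> t" for s t
  by (rule DERIV_nonneg_imp_nondecreasing[OF that]) (use ramp_deriv ramp_values(5) in blast)
 show "0 \<le> ramp s" using mono[of "min s 0" s] ramp_values(1)[of "min s 0"] by simp
 show "ramp s \<le> 1" using mono[of s "max s 1"] ramp_values(2)[of "max s 1"] by simp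
qed

text \<open>The vertical cut-off: \<open>1\<close> below height \<open>3 h / 2\<close> and \<open>0\<close> above height \<open>2 h\<close>.\<close>

definition vcut :: "real \<Rightarrow> real^3 \<Rightarrow> real" where "vcut h x = 1 - ramp ((2 / h) * x $ 3 - 3)"
definition vcut' :: "real \<Rightarrow> real^3 \<Rightarrow> real" where "vcut' h x = - (2 / h) * ramp' ((2 / h) * x $ 3 - 3)"

lemma GDERIV_component: "GDERIV (\<lambda>x::real^'n. x $ i) x :> axis i 1"
 unfolding gderiv_def
 using bounded_linear_imp_has_derivative[OF bounded_linear_vec_nth[of i]] by (simp add: inner_axis)

lemma GDERIV_vcut: "GDERIV (vcut h) x :> vcut' h x *\<^sub>R axis 3 1"
proof -
 have "((\<lambda>z. (2 / h) * z - 3) has_real_derivative (2 / h)) (at (x $ 3))"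
  using DERIV_diff[OF DERIV_cmult[OF DERIV_ident, of "2 / h"] DERIV_const[of 3]] by simp
 from DERIV_diff[OF DERIV_const[of 1] DERIV_chain2[OF ramp_deriv this]]
 have "((\<lambda>z. 1 - ramp ((2 / h) * z - 3)) has_real_derivative - (ramp' ((2 / h) * x $ 3 - 3) * (2 / h))) (at (x $ 3))"
  by simp
 from GDERIV_DERIV_compose[OF GDERIV_component this]
 show ?thesis by (simp add: vcut_def[abs_def] vcut'_def mult.commute)
qed

lemma vcut_values:
 assumes "h > 0"
 shows "x $ 3 \<le> 3 * h / 2 ==> vcut h x = 1" "x $ 3 \<le> 3 * h / 2 ==> vcut' h x = 0"
  "2 * h \<le> x $ 3 ==> vcut h x = 0" "2 * h \<le> x $ 3 ==> vcut' h x = 0"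
  "0 \<le> vcut h x" "vcut h x \<le> 1" "\<bar>vcut' h x\<bar> \<le> 4 / h" "vcut' h x \<le> 0"
  "13 * h / 8 \<le> x $ 3 ==> x $ 3 \<le> 15 * h / 8 ==> vcut' h x \<le> - 2 / h"
proof -
 have b: "(2 / h) * x $ 3 - 3 \<le> 0 \<longleftrightarrow> x $ 3 \<le> 3 * h / 2" "(2 / h) * x $ 3 - 3 \<ge> 1 \<longleftrightarrow> 2 * h \<le> x $ 3"
  "1/4 \<le> (2 / h) * x $ 3 - 3 \<longleftrightarrow> 13 * h / 8 \<le> x $ 3" "(2 / h) * x $ 3 - 3 \<le> 3/4 \<longleftrightarrow> x $ 3 \<le> 15 * h / 8"
  using assms by (auto simp: field_simps)
 show "x $ 3 \<le> 3 * h / 2 ==> vcut h x = 1" "x $ 3 \<le> 3 * h / 2 ==> vcut' h x = 0"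
  "2 * h \<le> x $ 3 ==> vcut h x = 0" "2 * h \<le> x $ 3 ==> vcut' h x = 0"
  "0 \<le> vcut h x" "vcut h x \<le> 1"
  using ramp_values ramp_bounds b by (auto simp: vcut_def vcut'_def)
 show "\<bar>vcut' h x\<bar> \<le> 4 / h" "vcut' h x \<le> 0"
  using ramp_values(5,6)[of "(2 / h) * x $ 3 - 3"] assms by (auto simp: vcut'_def abs_mult divide_right_mono)
 show "vcut' h x \<le> - 2 / h" if "13 * h / 8 \<le> x $ 3" "x $ 3 \<le> 15 * h / 8"
  using ramp_values(7)[of "(2 / h) * x $ 3 - 3"] that b assms by (simp add: vcut'_def divide_right_mono)
qed

lemma vcut_continuous: "continuous_on A (vcut h)" "continuous_on A (vcut' h)"
proof -
 show "continuous_on A (vcut h)"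
  by (intro continuous_at_imp_continuous_on ballI has_derivative_continuous[OF GDERIV_vcut[unfolded gderiv_def]])
 show "continuous_on A (vcut' h)" unfolding vcut'_def[abs_def] ramp'_def
  by (intro continuous_intros) 
qed

definition hsq :: "real^3 \<Rightarrow> real" where "hsq x = (x $ 1)^2 + (x $ 2)^2"

abbreviation (input) cyl :: "real \<Rightarrow> real^3 \<Rightarrow> bool" where "cyl r x \<equiv> hsq x < r^2"

definition hpart :: "real^3 \<Rightarrow> real^3" where "hpart x = x $ 1 *\<^sub>R axis 1 1 + x $ 2 *\<^sub>R axis 2 1"

lemma hpart_nth [simp]: "hpart x $ 1 = x $ 1" "hpart x $ 2 = x $ 2" "hpart x $ 3 = 0"
 by (simp_all add: hpart_def axis_def)

lemma hsq_continuous: "continuous_on A hsq" and hpart_continuous: "continuous_on A hpart"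
 unfolding hsq_def[abs_def] hpart_def[abs_def] by (intro continuous_intros)+

lemma hsq_nonneg: "0 \<le> hsq x" by (simp add: hsq_def)

lemma hsq_component: "hsq x \<le> \<sigma>^2 ==> 0 \<le> \<sigma> ==> i \<noteq> 3 ==> \<bar>x $ i\<bar> \<le> \<sigma>"
 using exhaust_3[of i] by (auto simp: hsq_def intro!: power2_le_imp_le[of "\<bar>_\<bar>"] intro: order_trans[rotated])

lemma GDERIV_hsq: "GDERIV hsq x :> 2 *\<^sub>R hpart x"
 unfolding hsq_def[abs_def] power2_eq_square
 by (rule GDERIV_subst, rule GDERIV_add[OF GDERIV_mult[OF GDERIV_component GDERIV_component] GDERIV_mult[OF GDERIV_component GDERIV_component]])
  (simp add: vec_eq_iff forall_3 axis_def)

text \<open>A paraboloid cut off at radius \<open>\<sigma>\<close>, itself only Lipschitz. Its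
  square is of class C^1, and the gradient of its cube is a multiple of that square, so it can be
  differentiated once more.\<close>

definition hcut :: "real \<Rightarrow> real^3 \<Rightarrow> real" where "hcut \<sigma> x = max 0 (\<sigma>^2 - hsq x)"

lemma hcut_continuous: "continuous_on A (hcut \<sigma>)"
 unfolding hcut_def[abs_def] by (intro continuous_intros hsq_continuous)

lemma hcut_bounds: "0 \<le> hcut \<sigma> x" "hcut \<sigma> x \<le> \<sigma>^2" "hsq x \<ge> \<sigma>^2 ==> hcut \<sigma> x = 0"
 using hsq_nonneg[of x] by (auto simp: hcut_def)

lemma GDERIV_hcut_power: "GDERIV (\<lambda>x. hcut \<sigma> x ^ Suc (Suc n)) x :> (- 2 * real (Suc (Suc n)) * hcut \<sigma> x ^ Suc n) *\<^sub>R hpart x"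
proof -
 have "GDERIV (\<lambda>x. \<sigma>^2 - hsq x) x :> 0 - 2 *\<^sub>R hpart x"
  by (intro GDERIV_diff GDERIV_const GDERIV_hsq)
 from GDERIV_DERIV_compose[OF this pos_part_power_deriv[of n]]
 show ?thesis unfolding hcut_def by (rule GDERIV_subst)
   (simp add: scaleR_minus_left[symmetric] del: scaleR_minus_left of_nat_Suc power_Suc)
qed

lemma hcut_eta: "GDERIV (\<lambda>x. hcut \<sigma> x ^ 3) x :> (- 6 * hcut \<sigma> x ^ 2) *\<^sub>R hpart x"
 and hcut_sq: "GDERIV (\<lambda>x. hcut \<sigma> x ^ 2) x :> (- 4 * hcut \<sigma> x) *\<^sub>R hpart x"
 using GDERIV_hcut_power[of \<sigma> 1 x] GDERIV_hcut_power[of \<sigma> 0 x] by (simp_all add: numeral_3_eq_3 numeral_2_eq_2)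

text \<open>The flips 1 and 2 preserve the gap weights and produce the odd integrals that vanish;
  their composition is the half-turn about the vertical axis.\<close>

definition flip :: "3 \<Rightarrow> real^3 \<Rightarrow> real^3" where "flip j x = (\<chi> i. if i = j then - x $ i else x $ i)"

lemma flip_isometry: "is_isometry (flip j)"
 unfolding is_isometry_def dist_vec_def L2_set_def flip_def
 by (auto intro!: arg_cong[where f=sqrt] sum.cong simp: dist_real_def abs_minus_commute power2_eq_iff power2_abs)

lemma integral_odd_isometry:
 fixes f :: "real^3 \<Rightarrow> real"
 assumes "is_isometry R" "\<And>x. f (R x) = - f x"
 shows "(LI x. f x) = 0"
 using isometry_integral[OF assms(1), of f] assms(2) by simp

section \<open>The flow in the gap\<close>

lemma prod_3: "prod f (UNIV::3 set) = f 1 * f 2 * (f 3 :: 'a::comm_monoid_mult)"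
 unfolding UNIV_3 by (simp add: ac_simps)

lemma measure_cbox3:
 assumes "\<And>i. a $ i \<le> b $ i"
 shows "measure lebesgue (cbox a (b::real^3)) = (b $ 1 - a $ 1) * (b $ 2 - a $ 2) * (b $ 3 - a $ 3)"
proof -
 have "cbox a b \<noteq> {}" using assms by (auto simp: interval_ne_empty_cart)
 then show ?thesis using content_cbox_cart[of a b] by (simp add: prod_3)
qed


lemma GDERIV_imp_continuous_on:
 "(\<And>x. x \<in> A ==> GDERIV f x :> D x) ==> continuous_on A f"
 unfolding gderiv_def by (meson has_derivative_continuous continuous_at_imp_continuous_on)

lemma borel_measurable_indicator_continuous:
 fixes f :: "real^3 \<Rightarrow> 'b::euclidean_space"
 assumes "open V" "continuous_on V f"
 shows "(\<lambda>x. ind V x *\<^sub>R f x) \<in> lmeas"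
 using borel_measurable_continuous_on_indicator[OF _ assms(2)] assms(1)
 by (simp add: measurable_completion)

text \<open>Coordinates with origin on the wall in which the body point closest to it is \<open>(0, 0, h)\<close>. The
 surface \<open>x $ 3 = \<beta> x\<close> bounds the gap from below and \<open>S\<close> is the body, on which the velocity \<open>w\<close>
 is rigid; \<open>g i k\<close> is the derivative of \<open>w $ k\<close> in direction \<open>i\<close>.\<close>

locale gap =
 fixes \<Omega> S F :: "(real^3) set" and w :: "real^3 \<Rightarrow> real^3" and g :: "3 \<Rightarrow> 3 \<Rightarrow> real^3 \<Rightarrow> real"
  and a :: "real^3" and W :: "real^3^3" and h \<sigma> \<sigma>' :: real and \<beta> :: "real^3 \<Rightarrow> real"
 assumes h: "0 < h" "h \<le> \<sigma>" "\<sigma> < \<sigma>'"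
  and \<Omega>: "open \<Omega>" and S: "open S" "S \<subseteq> \<Omega>" and F: "F \<in> sets lebesgue" "F \<subseteq> \<Omega>"
  and SF: "S \<inter> F = {}" "AE x in lebesgue. x \<in> \<Omega> \<longrightarrow> x \<in> S \<or> x \<in> F"
  and \<beta>: "continuous_on {x. cyl \<sigma>' x} \<beta>" "\<And>x. cyl \<sigma>' x ==> - h / 2 \<le> \<beta> x \<and> \<beta> x \<le> h / 4"
   "\<And>x. cyl \<sigma>' x ==> x $ 3 = \<beta> x ==> x \<notin> \<Omega>"
  and top: "\<And>x. cyl \<sigma>' x ==> 3 * h / 2 \<le> x $ 3 ==> x $ 3 \<le> 2 * h ==> x \<in> S"
  and rigid: "AE x in lebesgue. x \<in> S \<longrightarrow> (\<forall>k. w x $ k = a $ k + W $ k $ 1 * x $ 1 + W $ k $ 2 * x $ 2 + W $ k $ 3 * (x $ 3 - h))"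
   "AE x in lebesgue. x \<in> S \<longrightarrow> (\<forall>i k. g i k x = W $ k $ i)"
  and skew: "\<And>i k. W $ k $ i = - W $ i $ k"
  and div0: "AE x in lebesgue. x \<in> \<Omega> \<longrightarrow> g 1 1 x + g 2 2 x + g 3 3 x = 0"
  and ibp: "\<And>\<theta> T M B i k. (\<And>x. x \<in> \<Omega> ==> (\<theta> has_derivative (\<lambda>v. v \<bullet> T x)) (at x)) ==>
   (\<And>x. \<bar>\<theta> x\<bar> \<le> M) ==> (\<And>x. norm (T x) \<le> M) ==> \<theta> \<in> lmeas ==>
   T \<in> lmeas ==> bounded B ==> (\<And>x. x \<notin> B ==> \<theta> x = 0) ==> (\<And>x. x \<notin> B ==> T x = 0) ==>
   L1 (\<lambda>x. T x $ i * (ind \<Omega> x * w x $ k)) \<and>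
   L1 (\<lambda>x. \<theta> x * (ind \<Omega> x * g i k x)) \<and>
   (LI x. T x $ i * (ind \<Omega> x * w x $ k)) = - (LI x. \<theta> x * (ind \<Omega> x * g i k x))"
begin

text \<open>Unbounded above on purpose: the upper end of the gap is imposed by the smooth cut-off
  \<open>vcut\<close>, only the lower end by the sharp indicator of \<open>V\<close>. All test
  functions are carried by \<open>D\<close>.\<close>

definition V where "V = {x. cyl \<sigma>' x \<and> \<beta> x < x $ 3}"
definition D where "D = {x \<in> V. cyl \<sigma> x \<and> x $ 3 < 2 * h}"

abbreviation (input) cut where "cut f x \<equiv> ind V x * f x * vcut h x"

lemma \<sigma>0: "0 < \<sigma>" "0 < \<sigma>'" "\<sigma>^2 < \<sigma>'^2"
 using h by (auto intro: power_strict_mono)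

lemma cyl_open: "open {x. hsq x < c}"
 using hsq_continuous by (intro open_Collect_less continuous_on_const) auto

lemma V_open: "open V" and below_open: "open {x. cyl \<sigma>' x \<and> x $ 3 < \<beta> x}"
proof -
 have c: "continuous_on {x. cyl \<sigma>' x} (\<lambda>x. x $ 3 - \<beta> x)" by (intro continuous_intros \<beta>(1))
 have "open ({x. cyl \<sigma>' x} \<inter> (\<lambda>x. x $ 3 - \<beta> x) -` {0<..})"
  "open ({x. cyl \<sigma>' x} \<inter> (\<lambda>x. x $ 3 - \<beta> x) -` {..<0})"
  by (rule continuous_open_preimage[OF c cyl_open]; simp)+
 then show "open V" "open {x. cyl \<sigma>' x \<and> x $ 3 < \<beta> x}"
  unfolding V_def by (simp_all add: vimage_def Collect_conj_eq[symmetric] Int_def)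
qed


definition r where "r k x = a $ k + W $ k $ 1 * x $ 1 + W $ k $ 2 * x $ 2 + W $ k $ 3 * (x $ 3 - h)"

lemma V_top: "cyl \<sigma>' x ==> 3 * h / 2 \<le> x $ 3 ==> x \<in> V"
 using \<beta>(2)[of x] h by (simp add: V_def)

text \<open>\<open>vcut'\<close> lives at heights between \<open>3 * h / 2\<close> and
  \<open>2 * h\<close>; inside the cylinder this slab belongs to the body, so there the velocity is
  the polynomial \<open>r\<close>.\<close>

lemma top_support:
 assumes "f x * vcut' h x \<noteq> 0" "hsq x \<ge> \<sigma>^2 ==> f x = 0"
 shows "cyl \<sigma> x" "3 * h / 2 \<le> x $ 3" "x $ 3 < 2 * h" "x \<in> V" "x \<in> S" "x \<in> \<Omega>" "x \<in> D"
proof -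
 show 1: "cyl \<sigma> x" using assms by (metis mult_zero_left not_le)
 then have 2: "cyl \<sigma>' x" using \<sigma>0 by simp
 show 3: "3 * h / 2 \<le> x $ 3" "x $ 3 < 2 * h" 
  using vcut_values(2,4)[OF h(1), of x] assms(1) by (metis linear mult_zero_right, metis mult_zero_right not_le)
 show "x \<in> V" using V_top 2 3 by blast
 then show "x \<in> D" using 1 3 by (simp add: D_def)
 show "x \<in> S" using top 2 3 by simp
 then show "x \<in> \<Omega>" using S by blast
qed

lemma D_open: "open D"
proof -
 have "D = V \<inter> {x. cyl \<sigma> x} \<inter> {x. x $ 3 < 2 * h}" by (auto simp: D_def)
 moreover have "open {x::real^3. x $ 3 < 2 * h}" by (intro open_Collect_less continuous_intros)
 ultimately show ?thesis using V_open cyl_open by auto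
qed

lemma comp_bound: "cyl \<sigma> x ==> i \<noteq> 3 ==> \<bar>x $ i\<bar> \<le> \<sigma>"
 using hsq_component[of x \<sigma> i] \<sigma>0 by simp

lemma D_bounds: "x \<in> D ==> - h / 2 \<le> x $ 3 \<and> x $ 3 \<le> 2 * h \<and> cyl \<sigma> x"
 using \<beta>(2)[of x] by (auto simp: D_def V_def)

lemma D_subset: "D \<subseteq> cbox (vector [-\<sigma>, -\<sigma>, -h/2]) (vector [\<sigma>, \<sigma>, 2*h])"
 using D_bounds comp_bound[of _ 1] comp_bound[of _ 2]
 by (fastforce simp: mem_box_cart forall_3 abs_le_iff)

text \<open>The enclosing box has sides \<open>2 * \<sigma>\<close>, \<open>2 * \<sigma>\<close> and
  \<open>5 * h / 2\<close>.\<close>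

lemma D_measure: "D \<in> lmeasurable" "measure lebesgue D \<le> 10 * \<sigma>^2 * h" "bounded D"
proof -
 show b: "bounded D" using D_subset bounded_cbox bounded_subset by blast
 show D: "D \<in> lmeasurable" using lmeasurable_open[OF b D_open] .
 have "measure lebesgue D \<le> measure lebesgue (cbox (vector [-\<sigma>, -\<sigma>, -h/2]) (vector [\<sigma>, \<sigma>, 2*h] :: real^3))"
  by (rule measure_mono_fmeasurable[OF D_subset]) (use D in \<open>auto dest: fmeasurableD\<close>)
 also have "\<dots> = 10 * \<sigma>^2 * h"
 proof -
  have "(vector [-\<sigma>, -\<sigma>, -h/2] :: real^3) $ i \<le> (vector [\<sigma>, \<sigma>, 2*h] :: real^3) $ i" for i :: 3
   using exhaust_3[of i] \<sigma>0 h by auto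
  from measure_cbox3[OF this] show ?thesis by (simp add: power2_eq_square field_simps)
 qed
 finally show "measure lebesgue D \<le> 10 * \<sigma>^2 * h" .
qed

text \<open>The slab has volume \<open>2 * \<sigma>^2 * h\<close> and \<open>vcut'\<close> is at
  most \<open>4 / h\<close> in absolute value, so \<open>h\<close> cancels: such an integral behaves
  like one over a surface of area of order \<open>\<sigma>^2\<close>.\<close>

lemma top_bound:
 assumes m: "(\<lambda>x. f x * vcut' h x) \<in> lmeas" and z: "\<And>x. hsq x \<ge> \<sigma>^2 ==> f x = 0"
  and b: "\<And>x. cyl \<sigma> x ==> 3 * h / 2 \<le> x $ 3 ==> x $ 3 < 2 * h ==> \<bar>f x\<bar> \<le> B"
 shows "L1 (\<lambda>x. f x * vcut' h x)" "\<bar>LI x. f x * vcut' h x\<bar> \<le> 8 * \<sigma>^2 * B"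
proof -
 define C :: "(real^3) set" where "C = cbox (vector [-\<sigma>, -\<sigma>, 3*h/2]) (vector [\<sigma>, \<sigma>, 2*h])"
 have mC: "measure lebesgue C = 2 * \<sigma>^2 * h"
  
 proof -
  have "(vector [-\<sigma>, -\<sigma>, 3*h/2] :: real^3) $ i \<le> (vector [\<sigma>, \<sigma>, 2*h] :: real^3) $ i" for i :: 3
   using exhaust_3[of i] \<sigma>0 h by auto
  from measure_cbox3[OF this] show ?thesis by (simp add: C_def power2_eq_square field_simps)
 qed
 have Cl: "C \<in> lmeasurable" by (simp add: C_def)
 have B0: "B \<ge> 0"
 proof -
  have "hsq (vector [0, 0, 3*h/2]) < \<sigma>^2" using \<sigma>0 by (simp add: hsq_def)
  from b[OF this] h show ?thesis by (auto dest: order_trans[OF abs_ge_zero])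
 qed
 have iC: "L1 (\<lambda>x. (B * (4 / h)) * ind C x)"
  using Cl by (intro integrable_mult_right) (simp add: lmeasurable_iff_integrable)
 have pt: "norm (f x * vcut' h x) \<le> (B * (4 / h)) * ind C x" for x
 proof (cases "f x * vcut' h x = 0")
  case False
  note t = top_support[of f, OF False z]
  have "x \<in> C" unfolding C_def using t comp_bound[OF t(1), of 1] comp_bound[OF t(1), of 2]
   by (auto simp: mem_box_cart forall_3)
  moreover have "\<bar>f x\<bar> * \<bar>vcut' h x\<bar> \<le> B * (4 / h)"
   using b[of x] t vcut_values(7)[OF h(1), of x] B0 by (intro mult_mono) auto
  ultimately show ?thesis by (simp add: abs_mult)
 next
  case True
  show ?thesis unfolding True using B0 h by simp
 qed
 show i: "L1 (\<lambda>x. f x * vcut' h x)"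
  by (rule Bochner_Integration.integrable_bound[OF iC m], rule AE_I2, rule order_trans[OF pt], simp only: real_norm_def abs_ge_self)
 have "norm (LI x. f x * vcut' h x) \<le> (LI x. (B * (4 / h)) * ind C x)"
  by (rule Bochner_Integration.integral_norm_bound_integral[OF i iC pt])
 also have "\<dots> = B * (4 / h) * (2 * \<sigma>^2 * h)" using mC by simp
 also have "\<dots> = 8 * \<sigma>^2 * B" using h by simp
 finally show "\<bar>LI x. f x * vcut' h x\<bar> \<le> 8 * \<sigma>^2 * B" by simp
qed

lemma cyl_measurable:
 assumes "continuous_on {x. cyl \<sigma>' x} f" "\<And>x. hsq x \<ge> \<sigma>^2 ==> f x = (0::real)"
 shows "f \<in> lmeas"
proof -
 have "ind {x. cyl \<sigma>' x} x *\<^sub>R f x = f x" for x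
  using assms(2)[of x] \<sigma>0 by (auto split: split_indicator)
 then show ?thesis using borel_measurable_indicator_continuous[OF cyl_open assms(1)] by (simp only:)
qed

lemma top_rigid:
 assumes z: "\<And>x. hsq x \<ge> \<sigma>^2 ==> f x = 0"
 shows "AE x in lebesgue. (ind V x * f x * vcut' h x) * (ind \<Omega> x * w x $ k) = f x * r k x * vcut' h x"
 using rigid(1)
proof eventually_elim
 case (elim x)
 show ?case
 proof (cases "f x * vcut' h x = 0")
  case False
  note t = top_support[of f, OF False z]
  then show ?thesis using elim by (simp add: r_def)
 qed auto
qed

text \<open>Here the larger radius \<open>\<sigma>'\<close> serves: \<open>D\<close> has a compact
  neighbour \<open>K\<close> inside the open cylinder of radius \<open>\<sigma>'\<close>, on which
  \<open>f\<close> is continuous.\<close>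

lemma bounded_on_D:
 fixes f :: "real^3 \<Rightarrow> 'b::real_normed_vector"
 assumes "continuous_on {x. cyl \<sigma>' x} f"
 obtains M where "\<And>x. x \<in> D ==> norm (f x) \<le> M"
proof -
 define K where "K = cbox (vector [-\<sigma>, -\<sigma>, -h/2]) (vector [\<sigma>, \<sigma>, 2*h] :: real^3) \<inter> {x. hsq x \<le> \<sigma>^2}"
 have "closed {x. hsq x \<le> \<sigma>^2}" by (intro closed_Collect_le continuous_on_const hsq_continuous)
 then have "compact K" unfolding K_def by (intro compact_Int_closed) auto
 moreover have "K \<subseteq> {x. cyl \<sigma>' x}" using \<sigma>0 by (auto simp: K_def)
 ultimately have "compact (f ` K)" using assms by (meson compact_continuous_image continuous_on_subset)
 then obtain M where "\<And>x. x \<in> K ==> norm (f x) \<le> M" by (metis compact_imp_bounded bounded_iff imageI)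
 moreover have "D \<subseteq> K" using D_subset D_bounds by (auto simp: K_def less_imp_le)
 ultimately show ?thesis using that by blast
qed

lemma top_integrable:
 assumes c: "continuous_on {x. cyl \<sigma>' x} f" and z: "\<And>x. hsq x \<ge> \<sigma>^2 ==> f x = 0"
 shows "L1 (\<lambda>x. f x * vcut' h x)"
proof -
 obtain M where M: "\<And>x. x \<in> D ==> norm (f x) \<le> M" using bounded_on_D[OF c] by metis
 have m: "(\<lambda>x. f x * vcut' h x) \<in> lmeas"
  by (rule cyl_measurable) (use z in \<open>auto intro!: continuous_intros c vcut_continuous\<close>)
 show ?thesis
  by (rule top_bound(1)[OF m z, of M]) (use M V_top \<sigma>0 in \<open>auto simp: D_def\<close>)
qed

lemma top_bound':
 assumes c: "continuous_on {x. cyl \<sigma>' x} f" and z: "\<And>x. hsq x \<ge> \<sigma>^2 ==> f x = 0"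
  and b: "\<And>x. cyl \<sigma> x ==> 3 * h / 2 \<le> x $ 3 ==> x $ 3 < 2 * h ==> \<bar>f x\<bar> \<le> B"
 shows "\<bar>LI x. f x * vcut' h x\<bar> \<le> 8 * \<sigma>^2 * B"
 by (rule top_bound(2)[OF _ z b]) (use top_integrable[OF c z] borel_measurable_integrable in blast)

text \<open>The test function is \<open>f\<close> times \<open>vcut\<close>, cut sharply at the
  lower surface. Only its vertical derivative sees \<open>vcut'\<close>, and that term lies in the
  body, where \<open>w\<close> is replaced by \<open>r\<close>; it takes the place of the boundary
  term on the body.\<close>

lemma ibpV:
 assumes fd: "\<And>x. cyl \<sigma>' x ==> GDERIV f x :> Df x" and cD: "continuous_on {x. cyl \<sigma>' x} Df"
  and z: "\<And>x. hsq x \<ge> \<sigma>^2 ==> f x = 0" "\<And>x. hsq x \<ge> \<sigma>^2 ==> Df x = 0"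
 shows "L1 (\<lambda>x. (cut f x) * (ind \<Omega> x * g i k x))"
  "L1 (\<lambda>x. (ind V x * Df x $ i * vcut h x) * (ind \<Omega> x * w x $ k))"
  "(LI x. (ind V x * Df x $ i * vcut h x) * (ind \<Omega> x * w x $ k))
   + (if i = 3 then (LI x. f x * r k x * vcut' h x) else 0)
   = - (LI x. (cut f x) * (ind \<Omega> x * g i k x))"
proof -
 have cf: "continuous_on {x. cyl \<sigma>' x} f" by (rule GDERIV_imp_continuous_on[OF fd]) simp
 obtain M1 where M1: "\<And>x. x \<in> D ==> norm (f x) \<le> M1" using bounded_on_D[OF cf] by metis
 obtain M2 where M2: "\<And>x. x \<in> D ==> norm (Df x) \<le> M2" using bounded_on_D[OF cD] by metis
 define M where "M = max M1 M2"
 have b: "\<bar>f x\<bar> \<le> M" "norm (Df x) \<le> M" if "x \<in> D" for x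
  using M1[OF that] M2[OF that] by (auto simp: M_def)
 define \<theta> where "\<theta> x = ind V x * f x * vcut h x" for x
 define T where "T x = ind V x *\<^sub>R (vcut h x *\<^sub>R Df x + (f x * vcut' h x) *\<^sub>R axis 3 1)" for x
 have VD: "f x = 0 \<and> Df x = 0 \<or> vcut h x = 0 \<and> vcut' h x = 0" if "x \<in> V" "x \<notin> D" for x
  using that z[of x] vcut_values(3,4)[OF h(1), of x] by (force simp: D_def not_less)
 have supp: "\<theta> x = 0" "T x = 0" if "x \<notin> D" for x
  using VD[of x] that by (cases "x \<in> V"; auto simp: \<theta>_def T_def)+
 have Vc: "V \<subseteq> {x. cyl \<sigma>' x}" by (auto simp: V_def)
 have cV: "continuous_on V f" "continuous_on V Df"
  using continuous_on_subset[OF cf Vc] continuous_on_subset[OF cD Vc] .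
 have "continuous_on V (\<lambda>x. f x * vcut h x)" "continuous_on V (\<lambda>x. vcut h x *\<^sub>R Df x + (f x * vcut' h x) *\<^sub>R axis 3 1)"
  by (intro continuous_intros cV vcut_continuous)+
 note m' = borel_measurable_indicator_continuous[OF V_open this(1)] borel_measurable_indicator_continuous[OF V_open this(2)]
 have m: "\<theta> \<in> lmeas" "T \<in> lmeas"
  using m' by (simp_all only: \<theta>_def[abs_def] T_def[abs_def] real_scaleR_def mult.assoc)
 have der: "(\<theta> has_derivative (\<lambda>v. v \<bullet> T x)) (at x)" if x: "x \<in> \<Omega>" for x
 proof -
  \<comment> \<open>A point of \<open>\<Omega>\<close> never lies on the surface
    \<open>x $ 3 = \<beta> x\<close>, so the jump of the indicator of \<open>V\<close> is not met.
    Points at or beyond radius \<open>\<sigma>'\<close> fall under the third case because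
    \<open>\<sigma>\<close> is strictly smaller.\<close>
  consider "x \<in> V" | "cyl \<sigma>' x" "x $ 3 < \<beta> x" | "\<sigma>^2 < hsq x"
   using \<beta>(3)[of x] x \<sigma>0 by (force simp: V_def)
  then show ?thesis
  proof cases
   case 1
   then have "GDERIV (\<lambda>x. f x * vcut h x) x :> f x *\<^sub>R (vcut' h x *\<^sub>R axis 3 1) + vcut h x *\<^sub>R Df x"
    by (intro GDERIV_mult fd GDERIV_vcut) (simp add: V_def)
   moreover have "f x *\<^sub>R (vcut' h x *\<^sub>R axis 3 1) + vcut h x *\<^sub>R Df x = T x" using 1 by (simp add: T_def)
   ultimately have "((\<lambda>x. f x * vcut h x) has_derivative (\<lambda>v. v \<bullet> T x)) (at x)" by (simp add: gderiv_def)
   then show ?thesis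
    by (rule has_derivative_transform_within_open[OF _ V_open 1]) (simp add: \<theta>_def)
  next
   case 2
   then have T0: "T x = 0" by (simp add: T_def V_def)
   have "((\<lambda>x. 0) has_derivative (\<lambda>v. v \<bullet> T x)) (at x)" by (simp add: T0)
   then show ?thesis
    by (rule has_derivative_transform_within_open[OF _ below_open]) (use 2 in \<open>auto simp: \<theta>_def V_def\<close>)
  next
   case 3
   then have T0: "T x = 0" using z by (simp add: T_def)
   have "((\<lambda>x. 0) has_derivative (\<lambda>v. v \<bullet> T x)) (at x)" by (simp add: T0)
   moreover have "open {x. \<sigma>^2 < hsq x}" by (intro open_Collect_less continuous_on_const hsq_continuous)
   ultimately show ?thesis
    by (rule has_derivative_transform_within_open) (use 3 z in \<open>auto simp: \<theta>_def\<close>)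
  qed
 qed
 define M' where "M' = M + M * (4 / h)"
 have bd: "\<bar>\<theta> x\<bar> \<le> max 0 M'" "norm (T x) \<le> max 0 M'" for x
 proof -
  have "\<bar>\<theta> x\<bar> \<le> M' \<and> norm (T x) \<le> M'" if x: "x \<in> D"
  proof
   have M0: "M \<ge> 0" using order_trans[OF norm_ge_zero b(2)[OF x]] .
   have v: "0 \<le> vcut h x" "vcut h x \<le> 1" "\<bar>vcut' h x\<bar> \<le> 4 / h" using vcut_values[OF h(1), of x] by auto
   have xV: "x \<in> V" using x by (simp add: D_def)
   have "\<bar>f x\<bar> * vcut h x \<le> M * 1" using b(1)[OF x] v M0 by (intro mult_mono) auto
   moreover have h4: "0 \<le> M * (4 / h)" using M0 h by simp
   ultimately show "\<bar>\<theta> x\<bar> \<le> M'" using xV v by (simp add: \<theta>_def M'_def abs_mult)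
   have "norm (T x) \<le> norm (vcut h x *\<^sub>R Df x) + norm ((f x * vcut' h x) *\<^sub>R (axis 3 1 :: real^3))"
    using xV norm_triangle_ineq[of "vcut h x *\<^sub>R Df x"] by (simp only: T_def indicator_simps scaleR_one)
   also have "\<dots> \<le> 1 * M + M * (4 / h)"
    unfolding norm_scaleR abs_mult norm_axis_1 mult_1_right using v b[OF x] M0 h(1) by (intro add_mono mult_mono) auto
   finally show "norm (T x) \<le> M'" by (simp add: M'_def)
  qed
  then show "\<bar>\<theta> x\<bar> \<le> max 0 M'" "norm (T x) \<le> max 0 M'" using supp[of x] by (cases "x \<in> D"; simp add: le_max_iff_disj)+
 qed
 note I = ibp[OF der bd m D_measure(3) supp, of i k]
 show "L1 (\<lambda>x. (cut f x) * (ind \<Omega> x * g i k x))"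
  using I by (simp add: \<theta>_def)
 have e: "T x $ i * c = (ind V x * Df x $ i * vcut h x) * c + (if i = 3 then (ind V x * f x * vcut' h x) * c else 0)" for x c
  by (simp add: T_def axis_def algebra_simps)
 have iT: "L1 (\<lambda>x. f x * r k x * vcut' h x)"
  by (rule top_integrable) (use z in \<open>auto intro!: continuous_intros cf simp: r_def\<close>)
 note AE = top_rigid[of f k, OF z(1)]
 have iB: "L1 (\<lambda>x. (ind V x * f x * vcut' h x) * (ind \<Omega> x * w x $ k))"
  and eB: "(LI x. (ind V x * f x * vcut' h x) * (ind \<Omega> x * w x $ k)) = (LI x. f x * r k x * vcut' h x)"
  using lebesgue_integral_cong_AE[OF AE] iT by auto
 have iTi: "L1 (\<lambda>x. T x $ i * (ind \<Omega> x * w x $ k))" using I by blast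
 have A: "(ind V x * Df x $ i * vcut h x) * (ind \<Omega> x * w x $ k) = T x $ i * (ind \<Omega> x * w x $ k)
   - (if i = 3 then (ind V x * f x * vcut' h x) * (ind \<Omega> x * w x $ k) else 0)" for x
  unfolding e by simp
 show iA: "L1 (\<lambda>x. (ind V x * Df x $ i * vcut h x) * (ind \<Omega> x * w x $ k))"
  unfolding A using iTi iB by (cases "i = 3") (simp_all only: simp_thms if_True if_False Bochner_Integration.integrable_diff diff_0_right)
 have "(LI x. (ind V x * Df x $ i * vcut h x) * (ind \<Omega> x * w x $ k))
   = (LI x. T x $ i * (ind \<Omega> x * w x $ k)) - (if i = 3 then (LI x. f x * r k x * vcut' h x) else 0)"
  unfolding A using iTi iB eB by (cases "i = 3") (simp_all only: simp_thms if_True if_False Bochner_Integration.integral_diff diff_0_right)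
 then show "(LI x. (ind V x * Df x $ i * vcut h x) * (ind \<Omega> x * w x $ k))
   + (if i = 3 then (LI x. f x * r k x * vcut' h x) else 0)
   = - (LI x. (cut f x) * (ind \<Omega> x * g i k x))"
  using I by (simp add: \<theta>_def)
qed

text \<open>Replacing \<open>\<Omega>\<close> by the fluid part \<open>F\<close>: on the body the gradient is the constant \<open>W\<close>.\<close>

lemma split_fluid:
 assumes i: "L1 (\<lambda>x. (cut f x) * (ind \<Omega> x * g i k x))"
  and m: "continuous_on {x. cyl \<sigma>' x} f" and z: "\<And>x. hsq x \<ge> \<sigma>^2 ==> f x = 0" and b: "\<And>x. x \<in> D ==> \<bar>f x\<bar> \<le> M"
 shows "L1 (\<lambda>x. (cut f x) * (ind F x * g i k x))"
  "\<bar>LI x. (cut f x) * (ind \<Omega> x * g i k x)\<bar>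
   \<le> \<bar>W $ k $ i\<bar> * (10 * \<sigma>^2 * h * M) + \<bar>LI x. (cut f x) * (ind F x * g i k x)\<bar>"
proof -
 define s where "s x = ind S x * (cut f x)" for x
 have "vector [0, 0, 3*h/2] \<in> D" using V_top[of "vector [0, 0, 3*h/2]"] h \<sigma>0 by (simp add: D_def hsq_def)
 then have M0: "M \<ge> 0" using b by (meson abs_ge_zero order_trans)
 have sb: "norm (s x) \<le> M * ind D x" for x
 proof (cases "x \<in> D")
  case True
  then have "\<bar>f x\<bar> * \<bar>vcut h x\<bar> \<le> M * 1"
   using b vcut_values(5,6)[OF h(1), of x] M0 by (intro mult_mono) auto
  moreover have "\<bar>s x\<bar> \<le> \<bar>f x\<bar> * \<bar>vcut h x\<bar>" by (simp add: s_def abs_mult indicator_def)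
  ultimately show ?thesis using True by simp
 next
  case False
  have "s x = 0" using False z[of x] vcut_values(3)[OF h(1), of x] by (auto simp: s_def D_def indicator_def not_less)
  then show ?thesis using False by simp
 qed
 have Vc: "V \<subseteq> {x. cyl \<sigma>' x}" by (auto simp: V_def)
 have "continuous_on V (\<lambda>x. f x * vcut h x)" by (intro continuous_intros continuous_on_subset[OF m Vc] vcut_continuous)
 from borel_measurable_indicator_continuous[OF V_open this]
 have mm: "(\<lambda>x. ind V x * f x * vcut h x) \<in> lmeas" by (simp only: real_scaleR_def mult.assoc)
 have Sl: "S \<in> sets lebesgue" using S(1) by (simp add: borel_open)
 have sm: "s \<in> lmeas"
  unfolding s_def[abs_def] by (intro borel_measurable_times mm borel_measurable_indicator Sl)
 have iD: "L1 (\<lambda>x. M * ind D x)"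
  using D_measure(1) by (intro integrable_mult_right) (simp add: lmeasurable_iff_integrable)
 have iss: "L1 s"
  by (rule Bochner_Integration.integrable_bound[OF iD sm], rule AE_I2, rule order_trans[OF sb], simp only: real_norm_def abs_ge_self)
 have ae: "AE x in lebesgue. (cut f x) * (ind F x * g i k x)
   = (cut f x) * (ind \<Omega> x * g i k x) - W $ k $ i * s x"
  using SF(2) rigid(2)
 proof eventually_elim
  case (elim x)
  show ?case using elim SF(1) S(2) F(2) by (auto simp: s_def indicator_def)
 qed
 have iR: "L1 (\<lambda>x. (cut f x) * (ind \<Omega> x * g i k x) - W $ k $ i * s x)"
  using i iss by simp
 show "L1 (\<lambda>x. (cut f x) * (ind F x * g i k x))"
  using lebesgue_integral_cong_AE(2)[OF ae] iR by blast
 have eq: "(LI x. (cut f x) * (ind F x * g i k x))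
  = (LI x. (cut f x) * (ind \<Omega> x * g i k x)) - W $ k $ i * (LI x. s x)"
  using lebesgue_integral_cong_AE(1)[OF ae]  i iss by simp
 have "norm (LI x. s x) \<le> (LI x. M * ind D x)"
  by (rule Bochner_Integration.integral_norm_bound_integral[OF iss iD sb])
 also have "\<dots> = M * measure lebesgue D" by simp
 also have "\<dots> \<le> 10 * \<sigma>^2 * h * M" using D_measure(2) M0 by (auto simp: mult.commute intro: mult_left_mono)
 finally have "\<bar>W $ k $ i * (LI x. s x)\<bar> \<le> \<bar>W $ k $ i\<bar> * (10 * \<sigma>^2 * h * M)"
  unfolding abs_mult by (intro mult_left_mono) auto
 then show "\<bar>LI x. (cut f x) * (ind \<Omega> x * g i k x)\<bar>
   \<le> \<bar>W $ k $ i\<bar> * (10 * \<sigma>^2 * h * M) + \<bar>LI x. (cut f x) * (ind F x * g i k x)\<bar>"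
  using eq by linarith
qed

lemma fluid_bound:
 assumes i: "L1 (\<lambda>x. (cut f x) * (ind F x * g i k x))"
  and z: "\<And>x. hsq x \<ge> \<sigma>^2 ==> f x = 0" and b: "\<And>x. x \<in> D ==> \<bar>f x\<bar> \<le> M"
  and \<Gamma>: "AE x in lebesgue. x \<in> F \<longrightarrow> \<bar>g i k x\<bar> \<le> \<Gamma> x" "L1 (\<lambda>x. ind (D \<inter> F) x * \<Gamma> x)"
 shows "\<bar>LI x. (cut f x) * (ind F x * g i k x)\<bar>
  \<le> M * (LI x. ind (D \<inter> F) x * \<Gamma> x)"
proof -
 have "norm (LI x. (cut f x) * (ind F x * g i k x)) \<le>
  (LI x. norm ((cut f x) * (ind F x * g i k x)))"
  by (rule Bochner_Integration.integral_norm_bound)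
 also have "\<dots> \<le> (LI x. M * (ind (D \<inter> F) x * \<Gamma> x))"
 proof (rule integral_mono_AE[OF integrable_norm[OF i] integrable_mult_right[OF \<Gamma>(2)]])
  show "AE x in lebesgue. norm ((cut f x) * (ind F x * g i k x)) \<le> M * (ind (D \<inter> F) x * \<Gamma> x)"
   using \<Gamma>(1)
  proof eventually_elim
   case (elim x)
   show ?case
   proof (cases "x \<in> D \<inter> F")
    case True
    then have "\<bar>f x\<bar> * \<bar>vcut h x\<bar> \<le> M * 1"
     using b vcut_values(5,6)[OF h(1), of x] by (intro mult_mono) (auto intro: order_trans[OF abs_ge_zero])
    then have "\<bar>f x\<bar> * \<bar>vcut h x\<bar> * \<bar>g i k x\<bar> \<le> M * \<Gamma> x"
     using elim True order_trans[OF abs_ge_zero b[of x]] by (intro mult_mono) auto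
    moreover have "x \<in> V" using True by (simp add: D_def)
    ultimately show ?thesis using True by (simp add: abs_mult)
   next
    case False
    then have "(cut f x) * ind F x = 0"
     using z[of x] vcut_values(3)[OF h(1), of x] by (auto simp: D_def indicator_def not_less)
    then have "norm ((cut f x) * (ind F x * g i k x)) = 0"
     by (simp only: mult.assoc[symmetric]) simp
    then show ?thesis using False by simp
   qed
  qed
 qed
 finally show ?thesis by simp
qed


section \<open>Symmetry and positivity of the weights\<close>

lemma flip_simps [simp]: "hsq (flip j x) = hsq x" "hcut \<sigma> (flip j x) = hcut \<sigma> x" "(flip j x) $ i = (if i = j then - x $ i else x $ i)"
 by (auto simp: hsq_def hcut_def flip_def)

lemma vcut'_flip: "j \<noteq> 3 ==> vcut' h (flip j x) = vcut' h x"
 by (simp add: vcut'_def)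

lemma top_odd: "j \<noteq> 3 ==> (\<And>x. f (flip j x) = - f x) ==> (LI x. f x * vcut' h x) = 0"
 by (rule integral_odd_isometry[OF flip_isometry[of j]]) (simp add: vcut'_flip)

text \<open>\<open>vcut'\<close> has a fixed sign, so the integral may be restricted to a box in the
  middle half of the slab, where \<open>- vcut'\<close> is at least \<open>2 / h\<close>.\<close>

lemma top_lower:
 assumes i: "L1 (\<lambda>x. f x * vcut' h x)" and f: "\<And>x. 0 \<le> f x" "\<And>x. x \<in> cbox l u ==> c \<le> f x"
  and c: "0 \<le> c" and lu: "13 * h / 8 \<le> l $ 3" "u $ 3 \<le> 15 * h / 8"
 shows "2 / h * c * measure lebesgue (cbox l u) \<le> - (LI x. f x * vcut' h x)"
proof -
 have "2 / h * c * measure lebesgue (cbox l u) = (LI x. 2 / h * c * ind (cbox l u) x)"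
  by simp
 also have "\<dots> \<le> (LI x. - (f x * vcut' h x))"
 proof (rule integral_mono)
  show "L1 (\<lambda>x. 2 / h * c * ind (cbox l u) x)"
   using lmeasurable_cbox[of l u] by (intro integrable_mult_right) (simp add: lmeasurable_iff_integrable)
  show "L1 (\<lambda>x. - (f x * vcut' h x))" using i by simp
  fix x
  show "2 / h * c * ind (cbox l u) x \<le> - (f x * vcut' h x)"
  proof (cases "x \<in> cbox l u")
   case True
   then have "13 * h / 8 \<le> x $ 3" "x $ 3 \<le> 15 * h / 8"
    using lu by (auto simp: mem_box_cart dest!: spec[of _ "3::3"])
   then have "2 / h \<le> - vcut' h x" using vcut_values(9)[OF h(1), of x] by simp
   then have "2 / h * c \<le> - vcut' h x * f x" using f(2)[OF True] c h(1) vcut_values(8)[OF h(1), of x] by (intro mult_mono) auto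
   then show ?thesis using True by (simp add: mult.commute)
  next
   case False
   then show ?thesis using mult_nonneg_nonpos[OF f(1)[of x] vcut_values(8)[OF h(1), of x]] by simp
  qed
 qed
 also have "\<dots> = - (LI x. f x * vcut' h x)" by simp
 finally show ?thesis .
qed

lemma hcut_lower:
 assumes "\<bar>x $ 1\<bar> \<le> \<sigma> / 2" "\<bar>x $ 2\<bar> \<le> \<sigma> / 2"
 shows "\<sigma>^2 / 2 \<le> hcut \<sigma> x"
proof -
 have "(x $ 1)^2 \<le> (\<sigma> / 2)^2" "(x $ 2)^2 \<le> (\<sigma> / 2)^2"
  using assms \<sigma>0 by (auto simp: abs_le_square_iff[symmetric])
 moreover have "\<sigma>^2 - ((x $ 1)^2 + (x $ 2)^2) \<le> hcut \<sigma> x" by (simp add: hcut_def hsq_def)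
 ultimately show ?thesis by (simp add: power_divide)
qed

text \<open>The coefficient of \<open>a $ 3\<close> in the flux identity; the sign compensates
  \<open>vcut'\<close>, which is never positive.\<close>

definition \<kappa> where "\<kappa> = - (LI x. hcut \<sigma> x ^ 3 * vcut' h x)"

lemma kappa_lower: "\<sigma> ^ 8 / 16 \<le> \<kappa>"
proof -
 \<comment> \<open>A box of volume \<open>\<sigma>^2 * h / 4\<close> on which \<open>hcut\<close> is
   at least \<open>\<sigma>^2 / 2\<close>; the value is \<open>2 / h\<close> times
   \<open>\<sigma> ^ 6 / 8\<close> times this volume.\<close>
 define l u :: "real^3" where "l = vector [-\<sigma>/2, -\<sigma>/2, 13*h/8]" and "u = vector [\<sigma>/2, \<sigma>/2, 15*h/8]"
 have lu: "l $ i \<le> u $ i" for i using exhaust_3[of i] \<sigma>0 h by (auto simp: l_def u_def)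
 have "2 / h * ((\<sigma>^2 / 2) ^ 3) * measure lebesgue (cbox l u) \<le> \<kappa>"
  unfolding \<kappa>_def
 proof (rule top_lower)
  show "L1 (\<lambda>x. hcut \<sigma> x ^ 3 * vcut' h x)"
   by (rule top_integrable) (auto intro!: continuous_intros hcut_continuous simp: hcut_bounds)
  show "(\<sigma>^2 / 2) ^ 3 \<le> hcut \<sigma> x ^ 3" if "x \<in> cbox l u" for x
   using that by (intro power_mono hcut_lower) (auto simp: mem_box_cart forall_3 l_def u_def abs_le_iff)
 qed (auto simp: l_def u_def hcut_bounds)
 moreover have "2 / h * ((\<sigma>^2 / 2) ^ 3) * measure lebesgue (cbox l u) = \<sigma> ^ 8 / 16"
  unfolding measure_cbox3[OF lu] using h(1) by (simp add: l_def u_def field_simps power2_eq_square eval_nat_numeral)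
 ultimately show ?thesis by simp
qed

lemma xkappa_lower:
 assumes j: "j = 1 \<or> j = 2"
 shows "\<sigma> ^ 10 / 1024 \<le> - (LI x. (x $ j)^2 * hcut \<sigma> x ^ 3 * vcut' h x)"
proof -
 \<comment> \<open>The side in direction \<open>j\<close> avoids a neighbourhood of 0 so that
   \<open>x $ j\<close> is at least \<open>\<sigma> / 4\<close>. The value is \<open>2 / h\<close>
   times \<open>\<sigma>^2 / 16\<close>, \<open>\<sigma> ^ 6 / 8\<close> and the volume
   \<open>\<sigma>^2 * h / 16\<close>.\<close>
 define l u :: "real^3" where "l = (\<chi> i. if i = 3 then 13*h/8 else if i = j then \<sigma>/4 else -\<sigma>/2)"
  and "u = (\<chi> i. if i = 3 then 15*h/8 else \<sigma>/2)"
 have lu: "l $ i \<le> u $ i" for i using \<sigma>0 h by (auto simp: l_def u_def)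
 have "2 / h * ((\<sigma> / 4)^2 * (\<sigma>^2 / 2) ^ 3) * measure lebesgue (cbox l u) \<le> - (LI x. (x $ j)^2 * hcut \<sigma> x ^ 3 * vcut' h x)"
 proof (rule top_lower)
  show "L1 (\<lambda>x. (x $ j)^2 * hcut \<sigma> x ^ 3 * vcut' h x)"
   by (rule top_integrable) (auto intro!: continuous_intros hcut_continuous simp: hcut_bounds)
  fix x assume x: "x \<in> cbox l u"
  then have "l $ i \<le> x $ i \<and> x $ i \<le> u $ i" for i by (auto simp: mem_box_cart)
  from this[of 1] this[of 2] this[of j] j \<sigma>0 have b: "\<bar>x $ 1\<bar> \<le> \<sigma>/2" "\<bar>x $ 2\<bar> \<le> \<sigma>/2" "\<sigma>/4 \<le> x $ j"
   by (auto simp: l_def u_def abs_le_iff split: if_splits)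
  show "(\<sigma> / 4)^2 * (\<sigma>^2 / 2) ^ 3 \<le> (x $ j)^2 * hcut \<sigma> x ^ 3"
   using b \<sigma>0 by (intro mult_mono power_mono hcut_lower) auto
 qed (auto simp: l_def u_def hcut_bounds)
 moreover have "2 / h * ((\<sigma> / 4)^2 * (\<sigma>^2 / 2) ^ 3) * measure lebesgue (cbox l u) = \<sigma> ^ 10 / 1024"
  unfolding measure_cbox3[OF lu] using h(1) j by (auto simp: l_def u_def field_simps power2_eq_square eval_nat_numeral)
 ultimately show ?thesis by simp
qed

lemma W_diag: "W $ i $ i = 0" using skew[of i i] by simp

lemma hcut_power_le: "hcut \<sigma> x ^ n \<le> \<sigma> ^ (2 * n)"
 using power_mono[OF hcut_bounds(2) hcut_bounds(1), of \<sigma> x n] by (simp add: power_mult)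

text \<open>\<open>f i\<close> is the vertical primitive, vanishing at height \<open>q\<close>, of
  the i-th derivative of \<open>hcut \<sigma> x ^ 3\<close>. The level \<open>q\<close> is left
  free: the first estimate takes 0, the second the middle surface. \<open>E\<close> measures how far
  \<open>q\<close> is from being even under the half-turn.\<close>

lemma flux:
 assumes q: "\<And>x. cyl \<sigma>' x ==> GDERIV q x :> Dq x" "continuous_on {x. cyl \<sigma>' x} Dq" "\<And>x. Dq x $ 3 = 0"
   "\<And>x. cyl \<sigma> x ==> \<bar>q x\<bar> \<le> h" "\<And>x. cyl \<sigma> x ==> \<bar>q x - q (flip 1 (flip 2 x))\<bar> \<le> E"
  and f: "\<And>i x. f i x = - 6 * hcut \<sigma> x ^ 2 * x $ i * (x $ 3 - q x)"
 shows "\<bar>a $ 3\<bar> * \<sigma> ^ 8 \<le> 16 * (\<Sum>i\<in>{1,2}. 24 * \<bar>a $ i\<bar> * \<sigma> ^ 7 * E + 228 * \<bar>W $ i $ 3\<bar> * \<sigma> ^ 7 * h^2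
   + \<bar>LI x. (cut (f i) x) * (ind F x * g 3 i x)\<bar>)"
  and "i \<noteq> 3 ==> L1 (\<lambda>x. (cut (f i) x) * (ind F x * g 3 i x))"
  and "i \<noteq> 3 ==> x \<in> D ==> \<bar>f i x\<bar> \<le> 18 * \<sigma> ^ 5 * h"
proof -
 have cq: "continuous_on {x. cyl \<sigma>' x} q" by (rule GDERIV_imp_continuous_on[OF q(1)]) simp
 note hz = hcut_bounds(3)
 have hx: "\<bar>hcut \<sigma> x ^ 2 * x $ i\<bar> \<le> \<sigma> ^ 5" if "cyl \<sigma> x" "i \<noteq> 3" for x i
 proof -
  have "\<bar>hcut \<sigma> x ^ 2\<bar> * \<bar>x $ i\<bar> \<le> \<sigma> ^ 4 * \<sigma>"
   using hcut_power_le[of x 2] comp_bound[OF that] \<sigma>0 by (intro mult_mono) auto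
  then show ?thesis by (simp add: abs_mult eval_nat_numeral mult_ac)
 qed
 define \<eta> where "\<eta> x = hcut \<sigma> x ^ 3" for x
 define D\<eta> where "D\<eta> x = (- 6 * hcut \<sigma> x ^ 2) *\<^sub>R hpart x" for x
 have g\<eta>: "GDERIV \<eta> x :> D\<eta> x" for x unfolding \<eta>_def[abs_def] D\<eta>_def by (rule hcut_eta)
 have cD\<eta>: "continuous_on A D\<eta>" for A unfolding D\<eta>_def[abs_def] by (intro continuous_intros hcut_continuous hpart_continuous)
 have z\<eta>: "\<eta> x = 0" "D\<eta> x = 0" if "hsq x \<ge> \<sigma>^2" for x using hz[OF that] by (auto simp: \<eta>_def D\<eta>_def)
 note I1 = ibpV[of \<eta>, OF g\<eta> cD\<eta> z\<eta>]
 have c\<eta>: "continuous_on A \<eta>" for A unfolding \<eta>_def[abs_def] by (intro continuous_intros hcut_continuous)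
 define X where "X i = (LI x. (ind V x * D\<eta> x $ i * vcut h x) * (ind \<Omega> x * w x $ i))" for i
 define Gk where "Gk k = (LI x. (cut \<eta> x) * (ind \<Omega> x * g k k x))" for k
 \<comment> \<open>The one use of the divergence condition among the gap estimates.\<close>
 have G0: "Gk 1 + Gk 2 + Gk 3 = 0"
 proof -
  have "Gk 1 + Gk 2 + Gk 3 = (LI x. (cut \<eta> x) * (ind \<Omega> x * g 1 1 x)
    + (cut \<eta> x) * (ind \<Omega> x * g 2 2 x) + (cut \<eta> x) * (ind \<Omega> x * g 3 3 x))"
   unfolding Gk_def using I1(1)[of 1 1] I1(1)[of 2 2] I1(1)[of 3 3]
   by (simp only: Bochner_Integration.integral_add Bochner_Integration.integrable_add)
  also have "\<dots> = (LINT x::real^3|lebesgue. 0)"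
  proof (rule lebesgue_integral_cong_AE(1))
   show "AE x in lebesgue. (cut \<eta> x) * (ind \<Omega> x * g 1 1 x)
    + (cut \<eta> x) * (ind \<Omega> x * g 2 2 x) + (cut \<eta> x) * (ind \<Omega> x * g 3 3 x) = 0"
    using div0
   proof eventually_elim
    case (elim x)
    have "(cut \<eta> x) * (ind \<Omega> x * g 1 1 x)
     + (cut \<eta> x) * (ind \<Omega> x * g 2 2 x) + (cut \<eta> x) * (ind \<Omega> x * g 3 3 x)
     = (cut \<eta> x) * (ind \<Omega> x * (g 1 1 x + g 2 2 x + g 3 3 x))" by (simp add: algebra_simps)
    then show ?case using elim by (cases "x \<in> \<Omega>") auto
   qed
  qed
  finally show ?thesis by simp
 qed
 have D3: "(\<lambda>x. (ind V x * D\<eta> x $ 3 * vcut h x) * (ind \<Omega> x * w x $ 3)) = (\<lambda>x. 0)"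
  by (simp add: D\<eta>_def)
 have X12: "X 1 + X 2 + (LI x. \<eta> x * r 3 x * vcut' h x) = 0"
  using I1(3)[of 1 1] I1(3)[of 2 2] I1(3)[of 3 3] G0 unfolding D3 X_def Gk_def by simp
 \<comment> \<open>The horizontal linear terms of \<open>r 3\<close> give odd integrands, and
   \<open>x $ 3 - h\<close> has the coefficient \<open>W $ 3 $ 3\<close>, which is 0 by skew
   symmetry.\<close>
 have "(LI x. \<eta> x * r 3 x * vcut' h x) = - a $ 3 * \<kappa>"
 proof -
  have i: "L1 (\<lambda>x. \<eta> x * vcut' h x)" "L1 (\<lambda>x. (\<eta> x * x $ j) * vcut' h x)" for j
   by (rule top_integrable; auto intro!: continuous_intros c\<eta> simp: z\<eta>)+
  have o: "(LI x. (\<eta> x * x $ j) * vcut' h x) = 0" if "j \<noteq> 3" for j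
   by (rule top_odd[OF that]) (simp add: \<eta>_def)
  have "(LI x. \<eta> x * r 3 x * vcut' h x) = (LI x. a $ 3 * (\<eta> x * vcut' h x)
   + W $ 3 $ 1 * ((\<eta> x * x $ 1) * vcut' h x) + W $ 3 $ 2 * ((\<eta> x * x $ 2) * vcut' h x))"
   by (intro Bochner_Integration.integral_cong) (auto simp: r_def W_diag algebra_simps)
  also have "\<dots> = a $ 3 * (LI x. \<eta> x * vcut' h x)"
   using i o by simp
  finally show ?thesis by (simp add: \<kappa>_def \<eta>_def)
 qed
 with X12 have a3: "a $ 3 * \<kappa> = X 1 + X 2" by simp
 define u where "u i x = - 6 * hcut \<sigma> x ^ 2 * x $ i" for i x
 define Du where "Du i x = (- 6 * hcut \<sigma> x ^ 2) *\<^sub>R axis i 1 + (x $ i) *\<^sub>R ((- 6) *\<^sub>R ((- 4 * hcut \<sigma> x) *\<^sub>R hpart x))" for i x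
 have gu: "GDERIV (u i) x :> Du i x" for i x
 proof -
  have "GDERIV (\<lambda>x. - 6 * hcut \<sigma> x ^ 2) x :> (- 6) *\<^sub>R ((- 4 * hcut \<sigma> x) *\<^sub>R hpart x)"
   by (rule GDERIV_subst[OF GDERIV_mult[OF GDERIV_const[of "- 6"] hcut_sq]]) simp
  from GDERIV_mult[OF this GDERIV_component[of i]] show ?thesis
   by (simp only: u_def[abs_def] Du_def)
 qed
 define Df where "Df i x = u i x *\<^sub>R (axis 3 1 - Dq x) + (x $ 3 - q x) *\<^sub>R Du i x" for i x
 have fe: "f i x = u i x * (x $ 3 - q x)" for i x by (simp add: f u_def)
 have fe': "f i = (\<lambda>x. u i x * (x $ 3 - q x))" for i by (simp add: fe fun_eq_iff)
 have gf: "GDERIV (f i) x :> Df i x" if "cyl \<sigma>' x" for i x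
  unfolding fe' Df_def by (intro GDERIV_mult gu GDERIV_diff GDERIV_component q(1) that)
 have cDf: "continuous_on {x. cyl \<sigma>' x} (Df i)" for i
  unfolding Df_def[abs_def] u_def Du_def by (intro continuous_intros hcut_continuous hpart_continuous q(2) cq)
 have zf: "f i x = 0" "Df i x = 0" if "hsq x \<ge> \<sigma>^2" for i x using hz[OF that] by (auto simp: f Df_def u_def Du_def)
 have cf: "continuous_on {x. cyl \<sigma>' x} (f i)" for i
  by (rule GDERIV_imp_continuous_on[OF gf]) simp
 note I2 = ibpV[of "f _", OF gf cDf zf]
 \<comment> \<open>The link between the two integrations by parts: through this equality the
   horizontal flux \<open>X i\<close> reappears when \<open>g 3 i\<close> is tested with
   \<open>f i\<close>.\<close>
 have Df3: "Df i x $ 3 = D\<eta> x $ i" if "i \<noteq> 3" for i x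
  using that exhaust_3[of i] by (auto simp: Df_def Du_def q(3) axis_def u_def D\<eta>_def)
 define Y where "Y i = (LI x. f i x * r i x * vcut' h x)" for i
 define Z where "Z i = (LI x. (cut (f i) x) * (ind \<Omega> x * g 3 i x))" for i
 have XYZ: "X i + Y i = - Z i" if "i \<noteq> 3" for i
  using I2(3)[of i 3 i] Df3[OF that] by (simp add: X_def Y_def Z_def)
 have fb: "\<bar>f i x\<bar> \<le> 18 * \<sigma> ^ 5 * h" if "i \<noteq> 3" "x \<in> D" for i x
 proof -
  have x: "cyl \<sigma> x" "- h / 2 \<le> x $ 3" "x $ 3 \<le> 2 * h" using D_bounds[OF that(2)] by auto
  have "\<bar>x $ 3 - q x\<bar> \<le> 3 * h" using q(4)[OF x(1)] x by linarith
  then have "\<bar>hcut \<sigma> x ^ 2 * x $ i\<bar> * \<bar>x $ 3 - q x\<bar> \<le> \<sigma> ^ 5 * (3 * h)"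
   using hx[OF x(1) that(1)] \<sigma>0 by (intro mult_mono) auto
  moreover have "\<bar>f i x\<bar> = 6 * (\<bar>hcut \<sigma> x ^ 2 * x $ i\<bar> * \<bar>x $ 3 - q x\<bar>)" by (simp add: f abs_mult)
  ultimately show ?thesis by (simp add: mult_ac)
 qed
 then show "i \<noteq> 3 ==> x \<in> D ==> \<bar>f i x\<bar> \<le> 18 * \<sigma> ^ 5 * h" by blast
 have SFl: "L1 (\<lambda>x. (cut (f i) x) * (ind F x * g 3 i x))"
  "\<bar>LI x. (cut (f i) x) * (ind \<Omega> x * g 3 i x)\<bar>
   \<le> \<bar>W $ i $ 3\<bar> * (10 * \<sigma>^2 * h * (18 * \<sigma> ^ 5 * h)) + \<bar>LI x. (cut (f i) x) * (ind F x * g 3 i x)\<bar>"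
  if "i \<noteq> 3" for i
  using split_fluid[where f="f i" and i=3 and k=i and M="18 * \<sigma> ^ 5 * h", OF I2(1) cf zf(1) fb[OF that]] by auto
 show "i \<noteq> 3 ==> L1 (\<lambda>x. (cut (f i) x) * (ind F x * g 3 i x))"
  using SFl(1) by blast
 define ZF where "ZF i = \<bar>LI x. (cut (f i) x) * (ind F x * g 3 i x)\<bar>" for i
 have Zb: "\<bar>Z i\<bar> \<le> 180 * \<bar>W $ i $ 3\<bar> * \<sigma> ^ 7 * h^2 + ZF i" if "i \<noteq> 3" for i
  using SFl(2)[OF that] unfolding Z_def ZF_def by (simp add: power2_eq_square eval_nat_numeral mult_ac)
 define P where "P i = (LI x. (6 * hcut \<sigma> x ^ 2 * x $ i * q x) * vcut' h x)" for i
 define Q where "Q i = (LI x. (6 * hcut \<sigma> x ^ 2 * x $ i * q x * (x $ 3 - h)) * vcut' h x)" for i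
 \<comment> \<open>Summed over \<open>i\<close>, the terms with \<open>W $ 1 $ 2\<close> and
   \<open>W $ 2 $ 1\<close> cancel by skew symmetry, and whatever does not contain \<open>q\<close>
   is odd in \<open>x $ i\<close>. There remain \<open>P i\<close> with the translation and
   \<open>Q i\<close> with the rotation.\<close>
 have Yeq: "Y 1 + Y 2 = (a $ 1 * P 1 + W $ 1 $ 3 * Q 1) + (a $ 2 * P 2 + W $ 2 $ 3 * Q 2)"
 proof -
  define O1 where "O1 i x = (hcut \<sigma> x ^ 2 * x $ i * x $ 3 * (a $ i + W $ i $ 3 * (x $ 3 - h))) * vcut' h x" for i x
  have iO: "L1 (O1 i)" for i
   unfolding O1_def[abs_def] by (rule top_integrable) (auto intro!: continuous_intros hcut_continuous simp: hz)
  have O0: "(LI x. O1 i x) = 0" if "i \<noteq> 3" for i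
   unfolding O1_def by (rule top_odd[OF that]) (use that in auto)
  have iP: "L1 (\<lambda>x. (6 * hcut \<sigma> x ^ 2 * x $ i * q x) * vcut' h x)" for i
   by (rule top_integrable) (auto intro!: continuous_intros hcut_continuous cq simp: hz)
  have iQ: "L1 (\<lambda>x. (6 * hcut \<sigma> x ^ 2 * x $ i * q x * (x $ 3 - h)) * vcut' h x)" for i
   by (rule top_integrable) (auto intro!: continuous_intros hcut_continuous cq simp: hz)
  have iY: "L1 (\<lambda>x. f i x * r i x * vcut' h x)" for i
   by (rule top_integrable) (auto intro!: continuous_intros cf simp: zf r_def)
  have pt: "f 1 x * r 1 x * vcut' h x + f 2 x * r 2 x * vcut' h x =
   (a $ 1 * ((6 * hcut \<sigma> x ^ 2 * x $ 1 * q x) * vcut' h x) + W $ 1 $ 3 * ((6 * hcut \<sigma> x ^ 2 * x $ 1 * q x * (x $ 3 - h)) * vcut' h x))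
   + (a $ 2 * ((6 * hcut \<sigma> x ^ 2 * x $ 2 * q x) * vcut' h x) + W $ 2 $ 3 * ((6 * hcut \<sigma> x ^ 2 * x $ 2 * q x * (x $ 3 - h)) * vcut' h x))
   + ((- 6) * O1 1 x + (- 6) * O1 2 x)" for x
   unfolding f r_def O1_def W_diag skew[of 2 1] by algebra
  have "Y 1 + Y 2 = (LI x. f 1 x * r 1 x * vcut' h x + f 2 x * r 2 x * vcut' h x)"
   unfolding Y_def using iY by (simp only: Bochner_Integration.integral_add)
  also have "\<dots> = (a $ 1 * P 1 + W $ 1 $ 3 * Q 1) + (a $ 2 * P 2 + W $ 2 $ 3 * Q 2) + ((- 6) * (LI x. O1 1 x) + (- 6) * (LI x. O1 2 x))"
   unfolding pt P_def Q_def using iP iQ iO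
   by (simp only: Bochner_Integration.integral_add Bochner_Integration.integrable_add integral_mult_right_zero integrable_mult_right)
  finally show ?thesis using O0 by simp
 qed
 \<comment> \<open>The half-turn \<open>\<psi>\<close> changes the sign of \<open>x $ i\<close> and
   keeps the weights, so \<open>2 * P i\<close> sees only the odd part of \<open>q\<close>; hence 24
   = 8 * 6 / 2.\<close>
 have Pb: "\<bar>P i\<bar> \<le> 24 * \<sigma> ^ 7 * E" if "i \<noteq> 3" for i
 proof -
  define \<psi> where "\<psi> x = flip 1 (flip 2 x)" for x
  have \<psi>i: "is_isometry \<psi>" using is_isometry_compose[OF flip_isometry[of 1] flip_isometry[of 2]] by (simp add: \<psi>_def[abs_def])
  have c\<psi>: "continuous_on {x. cyl \<sigma>' x} (\<lambda>x. q (\<psi> x))"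
   by (rule continuous_on_compose2[OF cq is_isometry_continuous[OF \<psi>i]]) (auto simp: \<psi>_def)
  have s: "(\<psi> x) $ i = - x $ i" for x using that exhaust_3[of i] by (auto simp: \<psi>_def)
  have iP: "L1 (\<lambda>x. (6 * hcut \<sigma> x ^ 2 * x $ i * q x) * vcut' h x)"
   by (rule top_integrable) (auto intro!: continuous_intros hcut_continuous cq simp: hz)
  have iP': "L1 (\<lambda>x. (6 * hcut \<sigma> x ^ 2 * x $ i * q (\<psi> x)) * vcut' h x)"
   by (rule top_integrable) (auto intro!: continuous_intros hcut_continuous c\<psi> simp: hz)
  have "P i = (LI x. - ((6 * hcut \<sigma> x ^ 2 * x $ i * q (\<psi> x)) * vcut' h x))"
   unfolding P_def by (subst isometry_integral[OF \<psi>i, symmetric]) (simp add: s, simp add: \<psi>_def vcut'_flip)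
  then have "2 * P i = (LI x. (6 * hcut \<sigma> x ^ 2 * x $ i * q x) * vcut' h x) - (LI x. (6 * hcut \<sigma> x ^ 2 * x $ i * q (\<psi> x)) * vcut' h x)"
   by (simp add: P_def)
  also have "\<dots> = (LI x. (6 * hcut \<sigma> x ^ 2 * x $ i * (q x - q (\<psi> x))) * vcut' h x)"
   using iP iP' by (subst Bochner_Integration.integral_diff[symmetric]) (simp_all add: algebra_simps)
  finally have "\<bar>2 * P i\<bar> = \<bar>LI x. (6 * hcut \<sigma> x ^ 2 * x $ i * (q x - q (\<psi> x))) * vcut' h x\<bar>" by simp
  also have "\<dots> \<le> 8 * \<sigma>^2 * (6 * \<sigma> ^ 5 * E)"
  proof (rule top_bound')
   show "continuous_on {x. cyl \<sigma>' x} (\<lambda>x. 6 * hcut \<sigma> x ^ 2 * x $ i * (q x - q (\<psi> x)))"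
    by (intro continuous_intros hcut_continuous cq c\<psi>)
   fix x assume x: "cyl \<sigma> x"
   have "\<bar>hcut \<sigma> x ^ 2 * x $ i\<bar> * \<bar>q x - q (\<psi> x)\<bar> \<le> \<sigma> ^ 5 * E"
    using hx[OF x that] q(5)[OF x] \<sigma>0 by (intro mult_mono) (auto simp: \<psi>_def)
   then show "\<bar>6 * hcut \<sigma> x ^ 2 * x $ i * (q x - q (\<psi> x))\<bar> \<le> 6 * \<sigma> ^ 5 * E" by (simp add: abs_mult)
  qed (simp add: hz)
  finally show ?thesis by (simp add: eval_nat_numeral mult_ac)
 qed
 have Qb: "\<bar>Q i\<bar> \<le> 48 * \<sigma> ^ 7 * h^2" if "i \<noteq> 3" for i
 proof -
  have "\<bar>Q i\<bar> \<le> 8 * \<sigma>^2 * (6 * \<sigma> ^ 5 * h * h)"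
   unfolding Q_def
  proof (rule top_bound')
   show "continuous_on {x. cyl \<sigma>' x} (\<lambda>x. 6 * hcut \<sigma> x ^ 2 * x $ i * q x * (x $ 3 - h))"
    by (intro continuous_intros hcut_continuous cq)
   fix x assume x: "cyl \<sigma> x" "3 * h / 2 \<le> x $ 3" "x $ 3 < 2 * h"
   have "\<bar>hcut \<sigma> x ^ 2 * x $ i\<bar> * \<bar>q x\<bar> * \<bar>x $ 3 - h\<bar> \<le> \<sigma> ^ 5 * h * h"
    using hx[OF x(1) that] q(4)[OF x(1)] \<sigma>0 x h(1) by (intro mult_mono) auto
   then show "\<bar>6 * hcut \<sigma> x ^ 2 * x $ i * q x * (x $ 3 - h)\<bar> \<le> 6 * \<sigma> ^ 5 * h * h" by (simp add: abs_mult mult_ac)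
  qed (simp add: hz)
  then show ?thesis by (simp add: eval_nat_numeral mult_ac)
 qed
 have aP: "\<bar>a $ i * P i\<bar> \<le> 24 * \<bar>a $ i\<bar> * \<sigma> ^ 7 * E" "\<bar>W $ i $ 3 * Q i\<bar> \<le> 48 * \<bar>W $ i $ 3\<bar> * \<sigma> ^ 7 * h^2" if "i \<noteq> 3" for i
  using mult_left_mono[OF Pb[OF that], of "\<bar>a $ i\<bar>"] mult_left_mono[OF Qb[OF that], of "\<bar>W $ i $ 3\<bar>"]
  by (auto simp: abs_mult mult_ac)
 have n: "(1::3) \<noteq> 3" "(2::3) \<noteq> 3" by auto
 \<comment> \<open>228 = 180 + 48: the body part of \<open>Z i\<close> and the term
   \<open>Q i\<close>.\<close>
 define R where "R = (\<Sum>i\<in>{1,2}. 24 * \<bar>a $ i\<bar> * \<sigma> ^ 7 * E + 228 * \<bar>W $ i $ 3\<bar> * \<sigma> ^ 7 * h^2 + ZF i)"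
 have k0: "\<kappa> \<ge> 0" using kappa_lower \<sigma>0 by (smt (verit) divide_nonneg_nonneg zero_le_power)
 have "\<bar>a $ 3\<bar> * \<kappa> = \<bar>a $ 3 * \<kappa>\<bar>" using k0 by (simp add: abs_mult)
 also have "\<dots> = \<bar>X 1 + X 2\<bar>" by (simp only: a3)
 also have "\<dots> \<le> R"
 proof -
  have aux: "\<bar>x1 + x2\<bar> \<le> (A1 + B1 + C1) + (A2 + B2 + C2)"
   if "x1 + y1 = - z1" "x2 + y2 = - z2" "y1 + y2 = (p1 + q1) + (p2 + q2)" "\<bar>z1\<bar> \<le> A1" "\<bar>z2\<bar> \<le> A2"
    "\<bar>p1\<bar> \<le> B1" "\<bar>q1\<bar> \<le> C1" "\<bar>p2\<bar> \<le> B2" "\<bar>q2\<bar> \<le> C2"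
   for x1 x2 y1 y2 z1 z2 p1 p2 q1 q2 A1 A2 B1 B2 C1 C2 :: real
   using that by linarith
  show ?thesis
   by (rule order_trans[OF aux[OF XYZ[OF n(1)] XYZ[OF n(2)] Yeq Zb[OF n(1)] Zb[OF n(2)] aP[OF n(1)] aP[OF n(2)]]])
    (simp add: R_def)
 qed
 finally have R: "\<bar>a $ 3\<bar> * \<kappa> \<le> R" .
 have "\<bar>a $ 3\<bar> * (\<sigma> ^ 8 / 16) \<le> \<bar>a $ 3\<bar> * \<kappa>" using kappa_lower by (intro mult_left_mono) auto
 then have "\<bar>a $ 3\<bar> * \<sigma> ^ 8 \<le> 16 * R" using R by simp
 then show "\<bar>a $ 3\<bar> * \<sigma> ^ 8 \<le> 16 * (\<Sum>i\<in>{1,2}. 24 * \<bar>a $ i\<bar> * \<sigma> ^ 7 * E + 228 * \<bar>W $ i $ 3\<bar> * \<sigma> ^ 7 * h^2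
   + \<bar>LI x. (cut (f i) x) * (ind F x * g 3 i x)\<bar>)"
  by (simp only: R_def ZF_def)
qed


text \<open>Testing \<open>g 3 3\<close> with the weight \<open>x $ j * hcut \<sigma> x ^ 3\<close>,
  odd in \<open>x $ j\<close>, leaves of the polynomial \<open>r 3\<close> only the term with
  \<open>W $ 3 $ j\<close>. The body contributes nothing because \<open>W $ 3 $ 3 = 0\<close>. By
  skew symmetry this controls the entries \<open>W $ i $ 3\<close> that occur in
  \<open>flux\<close>.\<close>

lemma rotation_bound:
 assumes j: "j = 1 \<or> j = 2"
  and \<Gamma>: "\<And>i k. AE x in lebesgue. x \<in> F \<longrightarrow> \<bar>g i k x\<bar> \<le> \<Gamma> x" "L1 (\<lambda>x. ind (D \<inter> F) x * \<Gamma> x)"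
 shows "\<bar>W $ 3 $ j\<bar> * \<sigma> ^ 3 \<le> 1024 * (LI x. ind (D \<inter> F) x * \<Gamma> x)"
proof -
 define J where "J = (LI x. ind (D \<inter> F) x * \<Gamma> x)"
 have j3: "j \<noteq> 3" using j by auto
 note hz = hcut_bounds(3)
 define f where "f x = x $ j * hcut \<sigma> x ^ 3" for x
 define Df where "Df x = x $ j *\<^sub>R ((- 6 * hcut \<sigma> x ^ 2) *\<^sub>R hpart x) + hcut \<sigma> x ^ 3 *\<^sub>R axis j 1" for x
 have gf: "GDERIV f x :> Df x" for x
  unfolding f_def[abs_def] Df_def by (intro GDERIV_mult GDERIV_component hcut_eta)
 have cDf: "continuous_on A Df" for A unfolding Df_def[abs_def] by (intro continuous_intros hcut_continuous hpart_continuous)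
 have cf: "continuous_on A f" for A unfolding f_def[abs_def] by (intro continuous_intros hcut_continuous)
 have z: "f x = 0" "Df x = 0" if "hsq x \<ge> \<sigma>^2" for x using hz[OF that] by (auto simp: f_def Df_def)
 have b: "\<bar>f x\<bar> \<le> \<sigma> ^ 7" if "x \<in> D" for x
 proof -
  have "\<bar>x $ j\<bar> * \<bar>hcut \<sigma> x ^ 3\<bar> \<le> \<sigma> * \<sigma> ^ 6"
   using hcut_power_le[of x 3] comp_bound[OF _ j3, of x] D_bounds[OF that] \<sigma>0 hcut_bounds[of \<sigma> x] by (intro mult_mono) auto
  then show ?thesis by (simp add: f_def abs_mult eval_nat_numeral)
 qed
 note I = ibpV[of f, OF gf cDf z, where i=3 and k=3]
 note SFl = split_fluid[where f=f and i=3 and k=3 and M="\<sigma> ^ 7", OF I(1) cf z(1) b]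
 have D3: "(\<lambda>x. (ind V x * Df x $ 3 * vcut h x) * (ind \<Omega> x * w x $ 3)) = (\<lambda>x. 0)"
  using j3 by (simp add: Df_def axis_def)
 have "\<bar>LI x. f x * r 3 x * vcut' h x\<bar> = \<bar>LI x. (cut f x) * (ind \<Omega> x * g 3 3 x)\<bar>"
  using I(3) unfolding D3 by simp
 also have "\<dots> \<le> \<bar>LI x. (cut f x) * (ind F x * g 3 3 x)\<bar>"
  using SFl(2) by (simp add: W_diag)
 also have "\<dots> \<le> \<sigma> ^ 7 * J"
  unfolding J_def by (rule fluid_bound[OF SFl(1) z(1) b \<Gamma>])
 finally have up: "\<bar>LI x. f x * r 3 x * vcut' h x\<bar> \<le> \<sigma> ^ 7 * J" .
 define j' where "j' = (if j = 1 then 2 else 1 :: 3)"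
 have j': "j' \<noteq> 3" "j' \<noteq> j" using j by (auto simp: j'_def)
 have i: "L1 (\<lambda>x. f x * vcut' h x)" "L1 (\<lambda>x. (f x * x $ k) * vcut' h x)" for k
  by (rule top_integrable; auto intro!: continuous_intros cf simp: z)+
 have o: "(LI x. f x * vcut' h x) = 0" "(LI x. (f x * x $ j') * vcut' h x) = 0"
  by (rule top_odd[OF j3], use j' in \<open>simp add: f_def\<close>)+
 have "(LI x. f x * r 3 x * vcut' h x) = (LI x. a $ 3 * (f x * vcut' h x)
   + W $ 3 $ j' * ((f x * x $ j') * vcut' h x) + W $ 3 $ j * ((f x * x $ j) * vcut' h x))"
  using j by (intro Bochner_Integration.integral_cong) (auto simp: r_def j'_def W_diag algebra_simps)
 also have "\<dots> = W $ 3 $ j * (LI x. (f x * x $ j) * vcut' h x)"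
  using i o by simp
 also have "\<dots> = W $ 3 $ j * (LI x. (x $ j)^2 * hcut \<sigma> x ^ 3 * vcut' h x)"
  by (simp add: f_def power2_eq_square mult_ac)
 finally have "\<bar>W $ 3 $ j\<bar> * - (LI x. (x $ j)^2 * hcut \<sigma> x ^ 3 * vcut' h x) \<le> \<sigma> ^ 7 * J"
  using up xkappa_lower[OF j] \<sigma>0 by (auto simp: abs_mult abs_if split: if_splits)
 moreover have "\<bar>W $ 3 $ j\<bar> * (\<sigma> ^ 10 / 1024) \<le> \<bar>W $ 3 $ j\<bar> * - (LI x. (x $ j)^2 * hcut \<sigma> x ^ 3 * vcut' h x)"
  using xkappa_lower[OF j] by (intro mult_left_mono) auto
 ultimately have "\<sigma> ^ 7 * (\<bar>W $ 3 $ j\<bar> * \<sigma> ^ 3) \<le> \<sigma> ^ 7 * (1024 * J)"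
  by (simp add: eval_nat_numeral mult_ac)
 then show ?thesis unfolding J_def using \<sigma>0 by (simp add: mult_le_cancel_left)
qed

text \<open>An even weight on \<open>g 3 k\<close> isolates the horizontal translation
  \<open>a $ k\<close>, up to a rotation term with a factor \<open>h\<close>: 18 = 10 + 8 adds its
  share in \<open>D\<close> and its share at the top, and 288 = 16 * 18. It serves the second
  estimate, where the translation survives in \<open>flux\<close>.\<close>

lemma translation_bound:
 assumes k: "k \<noteq> 3"
  and \<Gamma>: "\<And>i k. AE x in lebesgue. x \<in> F \<longrightarrow> \<bar>g i k x\<bar> \<le> \<Gamma> x" "L1 (\<lambda>x. ind (D \<inter> F) x * \<Gamma> x)"
 shows "\<bar>a $ k\<bar> * \<sigma>^2 \<le> 16 * (LI x. ind (D \<inter> F) x * \<Gamma> x) + 288 * (\<bar>W $ k $ 3\<bar> * \<sigma>^2 * h)"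
proof -
 define J where "J = (LI x. ind (D \<inter> F) x * \<Gamma> x)"
 note hz = hcut_bounds(3)
 define f where "f x = hcut \<sigma> x ^ 3" for x
 define Df where "Df x = (- 6 * hcut \<sigma> x ^ 2) *\<^sub>R hpart x" for x
 have gf: "GDERIV f x :> Df x" for x unfolding f_def[abs_def] Df_def by (rule hcut_eta)
 have cDf: "continuous_on A Df" for A unfolding Df_def[abs_def] by (intro continuous_intros hcut_continuous hpart_continuous)
 have cf: "continuous_on A f" for A unfolding f_def[abs_def] by (intro continuous_intros hcut_continuous)
 have z: "f x = 0" "Df x = 0" if "hsq x \<ge> \<sigma>^2" for x using hz[OF that] by (auto simp: f_def Df_def)
 have b: "\<bar>f x\<bar> \<le> \<sigma> ^ 6" for x
  using hcut_power_le[of x 3] hcut_bounds[of \<sigma> x] by (simp add: f_def)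
 note I = ibpV[of f, OF gf cDf z, where i=3 and k=k]
 note SFl = split_fluid[where f=f and i=3 and k=k and M="\<sigma> ^ 6", OF I(1) cf z(1) b]
 have D3: "(\<lambda>x. (ind V x * Df x $ 3 * vcut h x) * (ind \<Omega> x * w x $ k)) = (\<lambda>x. 0)"
  by (simp add: Df_def)
 have "\<bar>LI x. f x * r k x * vcut' h x\<bar> = \<bar>LI x. (cut f x) * (ind \<Omega> x * g 3 k x)\<bar>"
  using I(3) unfolding D3 by simp
 also have "\<dots> \<le> \<bar>W $ k $ 3\<bar> * (10 * \<sigma>^2 * h * \<sigma> ^ 6) + \<bar>LI x. (cut f x) * (ind F x * g 3 k x)\<bar>"
  by (rule SFl(2))
 also have "\<dots> \<le> \<bar>W $ k $ 3\<bar> * (10 * \<sigma>^2 * h * \<sigma> ^ 6) + \<sigma> ^ 6 * J"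
  unfolding J_def by (intro add_left_mono fluid_bound[OF SFl(1) z(1) b \<Gamma>])
 finally have up: "\<bar>LI x. f x * r k x * vcut' h x\<bar> \<le> \<bar>W $ k $ 3\<bar> * (10 * \<sigma>^2 * h * \<sigma> ^ 6) + \<sigma> ^ 6 * J" .
 have i: "L1 (\<lambda>x. f x * vcut' h x)" "L1 (\<lambda>x. (f x * x $ l) * vcut' h x)"
  "L1 (\<lambda>x. (f x * (x $ 3 - h)) * vcut' h x)" for l
  by (rule top_integrable; auto intro!: continuous_intros cf simp: z)+
 have o: "(LI x. (f x * x $ l) * vcut' h x) = 0" if "l \<noteq> 3" for l
  by (rule top_odd[OF that]) (simp add: f_def)
 have "(LI x. f x * r k x * vcut' h x) = (LI x. a $ k * (f x * vcut' h x)
   + W $ k $ 1 * ((f x * x $ 1) * vcut' h x) + W $ k $ 2 * ((f x * x $ 2) * vcut' h x) + W $ k $ 3 * ((f x * (x $ 3 - h)) * vcut' h x))"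
  by (intro Bochner_Integration.integral_cong) (auto simp: r_def algebra_simps)
 also have "\<dots> = a $ k * (LI x. f x * vcut' h x) + W $ k $ 3 * (LI x. (f x * (x $ 3 - h)) * vcut' h x)"
  using i o by simp
 finally have eq: "(LI x. f x * r k x * vcut' h x) = - (a $ k * \<kappa>) + W $ k $ 3 * (LI x. (f x * (x $ 3 - h)) * vcut' h x)"
  by (simp add: \<kappa>_def f_def)
 have "\<bar>LI x. (f x * (x $ 3 - h)) * vcut' h x\<bar> \<le> 8 * \<sigma>^2 * (\<sigma> ^ 6 * h)"
 proof (rule top_bound')
  show "continuous_on {x. cyl \<sigma>' x} (\<lambda>x. f x * (x $ 3 - h))" by (intro continuous_intros cf)
  fix x :: "real^3" assume "3 * h / 2 \<le> x $ 3" "x $ 3 < 2 * h"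
  then show "\<bar>f x * (x $ 3 - h)\<bar> \<le> \<sigma> ^ 6 * h" unfolding abs_mult using b[of x] h(1) by (intro mult_mono) auto
 qed (simp add: z)
 then have "\<bar>W $ k $ 3 * (LI x. (f x * (x $ 3 - h)) * vcut' h x)\<bar> \<le> \<bar>W $ k $ 3\<bar> * (8 * \<sigma>^2 * (\<sigma> ^ 6 * h))"
  unfolding abs_mult by (intro mult_left_mono) auto
 then have "\<bar>a $ k * \<kappa>\<bar> \<le> \<bar>W $ k $ 3\<bar> * (18 * \<sigma> ^ 8 * h) + \<sigma> ^ 6 * J"
  using up eq by (simp add: eval_nat_numeral mult_ac)
 moreover have "\<bar>a $ k\<bar> * (\<sigma> ^ 8 / 16) \<le> \<bar>a $ k * \<kappa>\<bar>"
  unfolding abs_mult using kappa_lower by (intro mult_left_mono) auto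
 ultimately have "\<sigma> ^ 6 * (\<bar>a $ k\<bar> * \<sigma>^2) \<le> \<sigma> ^ 6 * (16 * J + 288 * (\<bar>W $ k $ 3\<bar> * \<sigma>^2 * h))"
  by (simp add: eval_nat_numeral mult_ac algebra_simps)
 then show ?thesis unfolding J_def using \<sigma>0 by (simp add: mult_le_cancel_left)
qed

end

context gap begin

text \<open>With the level \<open>q = 0\<close> the translation disappears (\<open>E = 0\<close>).
  The rotation enters at order \<open>\<sigma> ^ 7 * h^2\<close>; \<open>rotation_bound\<close> and
  \<open>h \<le> \<sigma>\<close> bring it to the order \<open>\<sigma> ^ 5 * h\<close> of the gap
  integral. 7471680 = 32 * (228 * 1024 + 18).\<close>

lemma first_order_estimate:
 assumes \<Gamma>: "\<And>i k. AE x in lebesgue. x \<in> F \<longrightarrow> \<bar>g i k x\<bar> \<le> \<Gamma> x" "L1 (\<lambda>x. ind (D \<inter> F) x * \<Gamma> x)"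
 shows "\<bar>a $ 3\<bar> * \<sigma> ^ 3 \<le> 7471680 * (h * (LI x. ind (D \<inter> F) x * \<Gamma> x))"
proof -
 define J where "J = (LI x. ind (D \<inter> F) x * \<Gamma> x)"
 define f where "f i x = - 6 * hcut \<sigma> x ^ 2 * x $ i * (x $ 3 - 0)" for i x
 note fl = flux[of "\<lambda>_. 0" "\<lambda>_. 0" 0 f, OF GDERIV_const continuous_on_const _ _ _ f_def]
 have hz: "f i x = 0" if "hsq x \<ge> \<sigma>^2" for i x using hcut_bounds(3)[OF that] by (simp add: f_def)
 have Z: "\<bar>LI x. (cut (f i) x) * (ind F x * g 3 i x)\<bar> \<le> 18 * \<sigma> ^ 5 * h * J"
  if "i \<noteq> 3" for i
  unfolding J_def by (rule fluid_bound[OF fl(2) hz fl(3) \<Gamma>]) (use that h in auto)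
 \<comment> \<open>The rotation bound puts a non-negative quantity below
   \<open>1024 * J\<close>.\<close>
 have J0: "0 \<le> J"
  using rotation_bound[OF _ \<Gamma>, of 1] \<sigma>0 by (simp add: J_def) (smt (verit) mult_nonneg_nonneg zero_le_power abs_ge_zero)
 have Wb: "\<bar>W $ i $ 3\<bar> * \<sigma> ^ 7 * h^2 \<le> 1024 * J * \<sigma> ^ 5 * h" if "i = 1 \<or> i = 2" for i
 proof -
  have "\<bar>W $ i $ 3\<bar> * \<sigma> ^ 3 \<le> 1024 * J" using rotation_bound[OF that \<Gamma>] skew[of i 3] by (simp add: J_def)
  then have "(\<bar>W $ i $ 3\<bar> * \<sigma> ^ 3) * (\<sigma> ^ 4 * h * h) \<le> (1024 * J) * (\<sigma> ^ 4 * h * \<sigma>)"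
   by (rule mult_mono[OF _ mult_left_mono[OF h(2)]]) (use h \<sigma>0 J0 in auto)
  then show ?thesis by (simp add: eval_nat_numeral mult_ac)
 qed
 have "\<bar>a $ 3\<bar> * \<sigma> ^ 8 \<le> 16 * (\<Sum>i\<in>{1,2}. 24 * \<bar>a $ i\<bar> * \<sigma> ^ 7 * 0 + 228 * \<bar>W $ i $ 3\<bar> * \<sigma> ^ 7 * h^2
   + \<bar>LI x. (cut (f i) x) * (ind F x * g 3 i x)\<bar>)"
  by (rule fl(1)) (use h in auto)
 also have "\<dots> \<le> 16 * (\<Sum>i\<in>{1,2::3}. (228 * 1024 + 18) * (\<sigma> ^ 5 * h * J))"
 proof (intro mult_left_mono sum_mono)
  fix i :: 3 assume "i \<in> {1, 2}"
  then have i: "i = 1 \<or> i = 2" "i \<noteq> 3" by auto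
  show "24 * \<bar>a $ i\<bar> * \<sigma> ^ 7 * 0 + 228 * \<bar>W $ i $ 3\<bar> * \<sigma> ^ 7 * h^2
   + \<bar>LI x. (cut (f i) x) * (ind F x * g 3 i x)\<bar> \<le> (228 * 1024 + 18) * (\<sigma> ^ 5 * h * J)"
   using Z[OF i(2)] Wb[OF i(1)] by (simp add: mult_ac)
 qed simp
 finally have "\<sigma> ^ 5 * (\<bar>a $ 3\<bar> * \<sigma> ^ 3) \<le> \<sigma> ^ 5 * (7471680 * (h * J))"
  by (simp add: eval_nat_numeral mult_ac)
 then show ?thesis unfolding J_def using \<sigma>0 by (simp add: mult_le_cancel_left)
qed

end

text \<open>A \<open>C\<^sup>1\<close> approximation of the positive part that vanishes near \<open>0\<close>.\<close>

definition trunc :: "real \<Rightarrow> real \<Rightarrow> real" where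
 "trunc \<epsilon> y = ((max 0 (y - \<epsilon>))^2 - (max 0 (y - 2 * \<epsilon>))^2) / (2 * \<epsilon>)"

definition trunc' :: "real \<Rightarrow> real \<Rightarrow> real" where
 "trunc' \<epsilon> y = (max 0 (y - \<epsilon>) - max 0 (y - 2 * \<epsilon>)) / \<epsilon>"

lemma trunc_deriv: "(trunc \<epsilon> has_real_derivative trunc' \<epsilon> y) (at y)"
proof -
 have "((\<lambda>y. ((max 0 (y - \<epsilon>))^2 - (max 0 (y - 2 * \<epsilon>))^2) / (2 * \<epsilon>)) has_real_derivative
   (2 * max 0 (y - \<epsilon>) - 2 * max 0 (y - 2 * \<epsilon>)) / (2 * \<epsilon>)) (at y)"
  by (intro DERIV_cdivide DERIV_diff pos_part_sq_deriv')
 moreover have "(2 * max 0 (y - \<epsilon>) - 2 * max 0 (y - 2 * \<epsilon>)) / (2 * \<epsilon>) = trunc' \<epsilon> y"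
  by (cases "\<epsilon> = 0") (simp_all add: trunc'_def field_simps)
 ultimately show ?thesis by (simp add: trunc_def[abs_def])
qed

lemma trunc_values:
 assumes "\<epsilon> > 0"
 shows "y \<le> \<epsilon> ==> trunc \<epsilon> y = 0" "y \<le> \<epsilon> ==> trunc' \<epsilon> y = 0" "0 \<le> trunc' \<epsilon> y" "trunc' \<epsilon> y \<le> 1"
  "0 \<le> trunc \<epsilon> y" "trunc \<epsilon> y \<le> max 0 y" "2 * \<epsilon> \<le> y ==> trunc' \<epsilon> y = 1"
proof -
 show "y \<le> \<epsilon> ==> trunc \<epsilon> y = 0" "y \<le> \<epsilon> ==> trunc' \<epsilon> y = 0"
  using assms by (auto simp: trunc_def trunc'_def max_def)
 show "0 \<le> trunc' \<epsilon> y" "trunc' \<epsilon> y \<le> 1" "2 * \<epsilon> \<le> y ==> trunc' \<epsilon> y = 1"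
  using assms by (auto simp: trunc'_def max_def field_simps)
 define A B where "A = max 0 (y - \<epsilon>)" and "B = max 0 (y - 2 * \<epsilon>)"
 have AB: "0 \<le> B" "B \<le> A" "A - B \<le> \<epsilon>" "A + B \<le> 2 * max 0 y" using assms by (auto simp: A_def B_def)
 have e: "trunc \<epsilon> y = (A - B) * (A + B) / (2 * \<epsilon>)"
  by (simp add: trunc_def A_def B_def power2_eq_square algebra_simps)
 show "0 \<le> trunc \<epsilon> y" unfolding e using AB assms by simp
 have "(A - B) * (A + B) \<le> \<epsilon> * (2 * max 0 y)" using AB assms by (intro mult_mono) auto
 then show "trunc \<epsilon> y \<le> max 0 y" unfolding e using assms by (simp add: divide_le_eq mult_ac)
qed

lemma trunc'_continuous: "continuous_on A (trunc' \<epsilon>)"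
 unfolding trunc'_def[abs_def] divide_inverse by (intro continuous_intros)

text \<open>\<open>\<beta>\<close> is the wall and \<open>\<tau>\<close> the surface of the body.
  Their mean is nearly even, with a cubic defect; the defect is stated for every smaller radius
  since the graphs are given on the cylinder of radius \<open>\<sigma>'\<close> while the estimate
  uses it at \<open>\<sigma>\<close>.\<close>

locale gap_graphs =
 fixes \<Omega> S F :: "(real^3) set" and h \<sigma> E :: real and \<beta> \<tau> :: "real^3 \<Rightarrow> real" and Db Dt :: "real^3 \<Rightarrow> real^3"
 assumes db: "\<And>x. cyl \<sigma> x ==> GDERIV \<beta> x :> Db x" "continuous_on {x. cyl \<sigma> x} Db" "\<And>x. Db x $ 3 = 0"
  and dt: "\<And>x. cyl \<sigma> x ==> GDERIV \<tau> x :> Dt x" "continuous_on {x. cyl \<sigma> x} Dt" "\<And>x. Dt x $ 3 = 0"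
  and bb: "\<And>x. cyl \<sigma> x ==> - h / 4 \<le> \<beta> x \<and> \<beta> x \<le> h / 4"
  and t: "\<And>x. cyl \<sigma> x ==> 3 * h / 4 \<le> \<tau> x \<and> \<tau> x \<le> 5 * h / 4"
  and even: "\<And>x r. cyl r x ==> 0 < r ==> r \<le> \<sigma> ==>
   \<bar>(\<beta> x + \<tau> x) / 2 - (\<beta> (flip 1 (flip 2 x)) + \<tau> (flip 1 (flip 2 x))) / 2\<bar> \<le> E * r ^ 3" "0 \<le> E"
  and b\<Omega>: "\<And>x. cyl \<sigma> x ==> x $ 3 = \<beta> x ==> x \<notin> \<Omega>"
  and inF: "\<And>x. cyl \<sigma> x ==> \<beta> x < x $ 3 ==> x $ 3 < \<tau> x ==> x \<in> F"
  and inS: "\<And>x. cyl \<sigma> x ==> \<tau> x < x $ 3 ==> x $ 3 \<le> 2 * h ==> x \<in> S"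
  and nF: "\<And>x. cyl \<sigma> x ==> x $ 3 = \<tau> x ==> x \<notin> F"

context gap begin

text \<open>The product \<open>p\<close> of the distances has vertical derivative
  \<open>\<beta> x + \<tau> x - 2 * x $ 3\<close>, so \<open>f\<close> is \<open>- 1 / 2\<close>
  times the vertical derivative of \<open>u * p\<close>. Vanishing of \<open>p\<close> on both
  surfaces removes boundary terms, and \<open>p \<le> h^2\<close> (arithmetic and geometric mean)
  gives the power of \<open>h\<close>.\<close>

lemma hessian_bound:
 fixes \<Gamma>2 :: "real^3 \<Rightarrow> real" and H :: "3 \<Rightarrow> real^3 \<Rightarrow> real"
 assumes gg: "gap_graphs \<Omega> S F h \<sigma>' E \<beta> \<tau> Db Dt"
  and hibp: "\<And>\<theta> T K i. (\<And>x. (\<theta> has_derivative (\<lambda>v. v \<bullet> T x)) (at x)) ==> continuous_on UNIV T ==>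
    compact K ==> K \<subseteq> F ==> (\<And>x. x \<notin> K ==> \<theta> x = 0) ==>
    (LI x. T x $ 3 * (ind F x * g 3 i x)) = - (LI x. \<theta> x * (ind F x * H i x))"
  and \<Gamma>2: "AE x in lebesgue. x \<in> F \<longrightarrow> \<bar>H i x\<bar> \<le> \<Gamma>2 x" "L1 (\<lambda>x. ind (D \<inter> F) x * \<Gamma>2 x)"
  and i: "i \<noteq> 3"
  and int: "L1 (\<lambda>x. (cut f x) * (ind F x * g 3 i x))"
  and f: "\<And>x. f x = - 6 * hcut \<sigma> x ^ 2 * x $ i * (x $ 3 - (\<beta> x + \<tau> x) / 2)"
 shows "\<bar>LI x. (cut f x) * (ind F x * g 3 i x)\<bar>
  \<le> 3 * \<sigma> ^ 5 * h^2 * (LI x. ind (D \<inter> F) x * \<Gamma>2 x)"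
proof -
 note db = gap_graphs.db[OF gg] and dt = gap_graphs.dt[OF gg] and t = gap_graphs.t[OF gg]
  and inF = gap_graphs.inF[OF gg] and inS = gap_graphs.inS[OF gg] and nF = gap_graphs.nF[OF gg]
 note hz = hcut_bounds(3)
 define u where "u x = - 6 * hcut \<sigma> x ^ 2 * x $ i" for x
 define Du where "Du x = (- 6 * hcut \<sigma> x ^ 2) *\<^sub>R axis i 1 + (x $ i) *\<^sub>R ((- 6) *\<^sub>R ((- 4 * hcut \<sigma> x) *\<^sub>R hpart x))" for x
 have gu: "GDERIV u x :> Du x" for x
 proof -
  have "GDERIV (\<lambda>x. - 6 * hcut \<sigma> x ^ 2) x :> (- 6) *\<^sub>R ((- 4 * hcut \<sigma> x) *\<^sub>R hpart x)"
   by (rule GDERIV_subst[OF GDERIV_mult[OF GDERIV_const[of "- 6"] hcut_sq]]) simp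
  from GDERIV_mult[OF this GDERIV_component[of i]] show ?thesis
   by (simp only: u_def[abs_def] Du_def)
 qed
 have cu: "continuous_on A u" "continuous_on A Du" for A
  unfolding u_def[abs_def] Du_def[abs_def] by (intro continuous_intros hcut_continuous hpart_continuous)+
 have zu: "u x = 0" "Du x = 0" if "hsq x \<ge> \<sigma>^2" for x using hz[OF that] by (auto simp: u_def Du_def)
 have ub: "\<bar>u x\<bar> \<le> 6 * \<sigma> ^ 5" if "cyl \<sigma> x" for x
 proof -
  have "\<bar>hcut \<sigma> x ^ 2\<bar> * \<bar>x $ i\<bar> \<le> \<sigma> ^ 4 * \<sigma>"
   using hcut_power_le[of x 2] comp_bound[OF that i] \<sigma>0 by (intro mult_mono) auto
  then show ?thesis by (simp add: u_def abs_mult eval_nat_numeral mult_ac)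
 qed
 have Du3: "Du x $ 3 = 0" for x using i by (simp add: Du_def axis_def)
 define p where "p x = (x $ 3 - \<beta> x) * (\<tau> x - x $ 3)" for x
 define Dp where "Dp x = (x $ 3 - \<beta> x) *\<^sub>R (Dt x - axis 3 1) + (\<tau> x - x $ 3) *\<^sub>R (axis 3 1 - Db x)" for x
 have gp: "GDERIV p x :> Dp x" if "cyl \<sigma>' x" for x
  unfolding p_def[abs_def] Dp_def by (intro GDERIV_mult GDERIV_diff GDERIV_component db(1) dt(1) that)
 have ct: "continuous_on {x. cyl \<sigma>' x} \<tau>" by (rule GDERIV_imp_continuous_on[OF dt(1)]) simp
 have cp: "continuous_on {x. cyl \<sigma>' x} p" "continuous_on {x. cyl \<sigma>' x} Dp"
  unfolding p_def[abs_def] Dp_def[abs_def] by (intro continuous_intros \<beta>(1) ct db(2) dt(2))+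
 have ppos: "\<beta> x < x $ 3 \<and> x $ 3 < \<tau> x" if "cyl \<sigma>' x" "p x > 0" for x
  using that \<beta>(2)[OF that(1)] t[OF that(1)] h(1) by (auto simp: p_def zero_less_mult_iff)
 have pD: "x \<in> D \<inter> F" if "cyl \<sigma> x" "p x > 0" for x
 proof -
  have s: "cyl \<sigma>' x" using that(1) \<sigma>0 by simp
  show ?thesis using ppos[OF s that(2)] inF[OF s] t[OF s] that(1) s h(1) by (auto simp: D_def V_def)
 qed
 have ple: "p x \<le> h^2" if "cyl \<sigma>' x" for x
 proof (cases "p x > 0")
  case True
  have "0 < x $ 3 - \<beta> x" "0 < \<tau> x - x $ 3" "(x $ 3 - \<beta> x) + (\<tau> x - x $ 3) \<le> 2 * h"
   using ppos[OF that True] \<beta>(2)[OF that] t[OF that] h(1) by auto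
  moreover have "4 * (A * B) \<le> (A + B)^2" for A B :: real
   using zero_le_power2[of "A - B"] by (simp add: power2_eq_square algebra_simps)
  ultimately have "4 * p x \<le> (2 * h)^2"
   unfolding p_def by (smt (verit) power_mono)
  then show ?thesis by (simp add: power2_eq_square)
 qed (simp add: order_trans[of _ 0])
 define \<epsilon> where "\<epsilon> n = 1 / real (Suc n)" for n
 have \<epsilon>: "\<epsilon> n > 0" for n by (simp add: \<epsilon>_def)
 \<comment> \<open>The support of \<open>u * p\<close> touches both surfaces. Truncating
   \<open>p\<close> near 0 yields compact support in \<open>F\<close>, and \<open>trunc'\<close>
   tends to 1 wherever \<open>p > 0\<close>, so the truncation disappears in the limit.\<close>
 define \<theta> where "\<theta> n x = u x * trunc (\<epsilon> n) (p x)" for n x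
 define T where "T n x = (if cyl \<sigma>' x then u x *\<^sub>R (trunc' (\<epsilon> n) (p x) *\<^sub>R Dp x) + trunc (\<epsilon> n) (p x) *\<^sub>R Du x else 0)" for n x
 have outer: "open {x. \<sigma>^2 < hsq x}" by (intro open_Collect_less continuous_on_const hsq_continuous)
 have T0: "T n x = 0" if "hsq x \<ge> \<sigma>^2" for n x using zu[OF that] by (simp add: T_def)
 have der: "(\<theta> n has_derivative (\<lambda>v. v \<bullet> T n x)) (at x)" for n x
 proof (cases "cyl \<sigma>' x")
  case True
  have "GDERIV (\<lambda>x. u x * trunc (\<epsilon> n) (p x)) x :> u x *\<^sub>R (trunc' (\<epsilon> n) (p x) *\<^sub>R Dp x) + trunc (\<epsilon> n) (p x) *\<^sub>R Du x"
   by (intro GDERIV_mult gu GDERIV_DERIV_compose[OF gp[OF True] trunc_deriv])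
  then show ?thesis using True by (simp add: gderiv_def \<theta>_def[abs_def] T_def)
 next
  case False
  then have x: "\<sigma>^2 < hsq x" using \<sigma>0 by simp
  have "((\<lambda>x. 0) has_derivative (\<lambda>v. v \<bullet> T n x)) (at x)" using T0[of x] x by simp
  then show ?thesis
   by (rule has_derivative_transform_within_open[OF _ outer]) (use x zu in \<open>auto simp: \<theta>_def\<close>)
 qed
 have cT: "continuous_on UNIV (T n)" for n
 proof -
  have ctr: "continuous_on UNIV (trunc e)" for e
   by (meson DERIV_isCont continuous_at_imp_continuous_on trunc_deriv)
  have "continuous_on {x. cyl \<sigma>' x} (\<lambda>x. u x *\<^sub>R (trunc' (\<epsilon> n) (p x) *\<^sub>R Dp x) + trunc (\<epsilon> n) (p x) *\<^sub>R Du x)"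
   by (intro continuous_intros cu cp continuous_on_compose2[OF trunc'_continuous cp(1)] continuous_on_compose2[OF ctr cp(1)]) auto
  then have 1: "continuous_on {x. cyl \<sigma>' x} (T n)" by (rule continuous_on_eq) (simp add: T_def)
  have 2: "continuous_on {x. \<sigma>^2 < hsq x} (T n)" by (rule continuous_on_eq[OF continuous_on_const[of _ 0]]) (simp add: T0)
  have "{x. cyl \<sigma>' x} \<union> {x. \<sigma>^2 < hsq x} = UNIV" using \<sigma>0 by auto
  then show ?thesis using continuous_on_open_Un[OF cyl_open outer 1 2] by simp
 qed
 define K0 where "K0 = cbox (vector [-\<sigma>, -\<sigma>, -h/2]) (vector [\<sigma>, \<sigma>, 2*h] :: real^3) \<inter> {x. hsq x \<le> \<sigma>^2}"
 have K0: "compact K0" "K0 \<subseteq> {x. cyl \<sigma>' x}"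
 proof -
  have "closed {x. hsq x \<le> \<sigma>^2}" by (intro closed_Collect_le continuous_on_const hsq_continuous)
  then show "compact K0" unfolding K0_def by (intro compact_Int_closed) auto
  show "K0 \<subseteq> {x. cyl \<sigma>' x}" using \<sigma>0 by (auto simp: K0_def)
 qed
 define K where "K n = {x \<in> K0. \<epsilon> n \<le> p x}" for n
 have K1: "compact (K n)" for n
 proof -
  have "closed (K0 \<inter> p -` {\<epsilon> n..})"
   by (rule continuous_closed_preimage[OF continuous_on_subset[OF cp(1) K0(2)] compact_imp_closed[OF K0(1)]]) simp
  moreover have "K0 \<inter> p -` {\<epsilon> n..} = K n" by (auto simp: K_def)
  ultimately show ?thesis using K0(1) by (metis (no_types, lifting) K_def bounded_subset compact_eq_bounded_closed mem_Collect_eq subsetI)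
 qed
 have K2: "K n \<subseteq> F" for n
 proof
  fix x assume x: "x \<in> K n"
  then have s: "cyl \<sigma>' x" "p x > 0" using K0(2) \<epsilon>[of n] by (auto simp: K_def)
  show "x \<in> F" using ppos[OF s] inF[OF s(1)] by blast
 qed
 have K3: "\<theta> n x = 0" if "x \<notin> K n" for n x
 proof (rule ccontr)
  assume "\<theta> n x \<noteq> 0"
  then have "u x \<noteq> 0" "\<not> p x \<le> \<epsilon> n" using trunc_values(1)[OF \<epsilon>] by (auto simp: \<theta>_def)
  then have x: "cyl \<sigma> x" "p x > 0" "\<epsilon> n \<le> p x" using zu(1)[of x] \<epsilon>[of n] by (force simp: not_le)+
  then have "x \<in> K n" using pD[OF x(1,2)] D_subset x by (auto simp: K_def K0_def)
  then show False using that by blast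
 qed
 have ib: "(LI x. T n x $ 3 * (ind F x * g 3 i x)) = - (LI x. \<theta> n x * (ind F x * H i x))" for n
  by (rule hibp[OF der cT K1 K2 K3])
 have fu: "f x = u x * (x $ 3 - (\<beta> x + \<tau> x) / 2)" for x by (simp add: f u_def)
 have T3: "T n x $ 3 = - 2 * trunc' (\<epsilon> n) (p x) * f x" for n x
 proof (cases "cyl \<sigma>' x")
  case True
  then show ?thesis by (simp add: T_def Du3 Dp_def db(3) dt(3) fu field_simps)
 next
  case False
  then show ?thesis using zu(1)[of x] \<sigma>0 by (simp add: T_def fu)
 qed
 define Z where "Z x = (cut f x) * (ind F x * g 3 i x)" for x
 have Zx: "Z x = (if x \<in> F \<and> cyl \<sigma> x \<and> p x > 0 then f x * g 3 i x else 0)" for x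
 proof (cases "x \<in> F \<and> cyl \<sigma> x")
  case True
  then have s: "cyl \<sigma>' x" using \<sigma>0 by simp
  have xS: "x \<notin> S" using True SF(1) by blast
  show ?thesis
  proof (cases "p x > 0")
   case T: True
   note q = ppos[OF s T]
   have "x $ 3 \<le> 3 * h / 2" using q t[OF s] h(1) by simp
   then have "vcut h x = 1" by (rule vcut_values(1)[OF h(1)])
   moreover have "x \<in> V" using q s by (simp add: V_def)
   ultimately show ?thesis using True T by (simp add: Z_def)
  next
   case Fa: False
   \<comment> \<open>Below \<open>2 * h\<close> the points above \<open>\<tau>\<close> belong to the
     body, which misses \<open>F\<close>; a fluid point of \<open>V\<close> is therefore between the
     surfaces, where \<open>p > 0\<close>.\<close>
   have "x \<notin> V \<or> 2 * h \<le> x $ 3"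
   proof (rule ccontr)
    assume "\<not> (x \<notin> V \<or> 2 * h \<le> x $ 3)"
    then have v: "\<beta> x < x $ 3" "x $ 3 < 2 * h" by (auto simp: V_def)
    have "x $ 3 < \<tau> x" using nF[OF s] inS[OF s] v xS True by (metis less_imp_le linorder_neqE_linordered_idom)
    then have "p x > 0" using v by (simp add: p_def)
    then show False using Fa by simp
   qed
   then show ?thesis using Fa vcut_values(3)[OF h(1), of x] by (auto simp: Z_def)
  qed
 next
  case False
  then show ?thesis using zu(1)[of x] by (auto simp: Z_def fu)
 qed
 have Tp: "T n x $ 3 * (ind F x * g 3 i x) = - 2 * trunc' (\<epsilon> n) (p x) * Z x" for n x
 proof -
  have "trunc' (\<epsilon> n) (p x) = 0" if "\<not> p x > 0" using trunc_values(2)[OF \<epsilon>, of "p x" n] \<epsilon>[of n] that by simp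
  moreover have "f x = 0" if "\<not> cyl \<sigma> x" using zu(1)[of x] that by (simp add: fu)
  ultimately show ?thesis unfolding Zx T3 by auto
 qed
 have Zi: "L1 Z" using int by (simp add: Z_def[abs_def])
 have "(\<lambda>n. LI x. T n x $ 3 * (ind F x * g 3 i x)) \<longlonglongrightarrow> (LI x. - 2 * Z x)"
  unfolding Tp
 proof (rule dominated_convergence_pointwise(4))
  show "L1 (\<lambda>x. 2 * \<bar>Z x\<bar>)" using Zi by simp
  have m3: "(\<lambda>x. T n x $ 3 * (ind F x * g 3 i x)) \<in> lmeas" for n
  proof -
   have "(\<lambda>x. - 2 * trunc' (\<epsilon> n) (p x) * Z x) = (\<lambda>x. (ind {x. cyl \<sigma>' x} x *\<^sub>R (- 2 * trunc' (\<epsilon> n) (p x))) * Z x)"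
    using \<sigma>0 by (auto simp: fun_eq_iff Zx indicator_def)
   moreover have "(\<lambda>x. ind {x. cyl \<sigma>' x} x *\<^sub>R (- 2 * trunc' (\<epsilon> n) (p x))) \<in> lmeas"
    by (rule borel_measurable_indicator_continuous[OF cyl_open]) (intro continuous_intros continuous_on_compose2[OF trunc'_continuous cp(1)], auto)
   ultimately show ?thesis unfolding Tp using Zi by (simp only: borel_measurable_times[OF _ borel_measurable_integrable])
  qed
  show "(\<lambda>x. - 2 * trunc' (\<epsilon> n) (p x) * Z x) \<in> lmeas" for n using m3[of n] unfolding Tp .
  show "norm (- 2 * trunc' (\<epsilon> n) (p x) * Z x) \<le> 2 * \<bar>Z x\<bar>" for n x
   using trunc_values(3,4)[OF \<epsilon>, of n "p x"] by (simp add: abs_mult mult_left_le_one_le)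
  show "(\<lambda>n. - 2 * trunc' (\<epsilon> n) (p x) * Z x) \<longlonglongrightarrow> - 2 * Z x" for x
  proof (cases "p x > 0")
   case True
   obtain N where N: "2 / p x < real N" using reals_Archimedean2 by blast
   have "trunc' (\<epsilon> n) (p x) = 1" if "n \<ge> N" for n
   proof (rule trunc_values(7)[OF \<epsilon>])
    have "2 / p x < real (Suc n)" using N that by linarith
    then show "2 * \<epsilon> n \<le> p x" using True by (simp add: \<epsilon>_def field_simps)
   qed
   then have "eventually (\<lambda>n. - 2 * trunc' (\<epsilon> n) (p x) * Z x = - 2 * Z x) sequentially" by (auto simp: eventually_sequentially)
   then show ?thesis by (rule tendsto_eventually)
  qed (simp add: Zx)
 qed
 then have lim: "(\<lambda>n. - (LI x. \<theta> n x * (ind F x * H i x))) \<longlonglongrightarrow> - 2 * (LI x. Z x)"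
  unfolding ib by simp
 define J2 where "J2 = (LI x. ind (D \<inter> F) x * \<Gamma>2 x)"
 \<comment> \<open>\<open>hibp\<close> is only an equality between integrals; if the one with
   \<open>H\<close> does not exist it has the value 0, and the bound reduces to the sign of
   \<open>J2\<close>.\<close>
 have bd: "\<bar>- (LI x. \<theta> n x * (ind F x * H i x))\<bar> \<le> 6 * \<sigma> ^ 5 * h^2 * J2" for n
 proof (cases "L1 (\<lambda>x. \<theta> n x * (ind F x * H i x))")
  case True
  have "norm (LI x. \<theta> n x * (ind F x * H i x)) \<le> (LI x. norm (\<theta> n x * (ind F x * H i x)))"
   by (rule Bochner_Integration.integral_norm_bound)
  also have "\<dots> \<le> (LI x. (6 * \<sigma> ^ 5 * h^2) * (ind (D \<inter> F) x * \<Gamma>2 x))"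
  proof (rule integral_mono_AE[OF integrable_norm[OF True] integrable_mult_right[OF \<Gamma>2(2)]])
   show "AE x in lebesgue. norm (\<theta> n x * (ind F x * H i x)) \<le> (6 * \<sigma> ^ 5 * h^2) * (ind (D \<inter> F) x * \<Gamma>2 x)"
    using \<Gamma>2(1)
   proof eventually_elim
    case (elim x)
    show ?case
    proof (cases "cyl \<sigma> x \<and> p x > 0")
     case True
     then have xDF: "x \<in> D \<inter> F" using pD by blast
     have s: "cyl \<sigma>' x" using True \<sigma>0 by simp
     have "\<bar>trunc (\<epsilon> n) (p x)\<bar> \<le> h^2" using trunc_values(5,6)[OF \<epsilon>, of n "p x"] ple[OF s] True by simp
     then have "\<bar>\<theta> n x\<bar> \<le> 6 * \<sigma> ^ 5 * h^2"
      unfolding \<theta>_def abs_mult using ub[of x] True \<sigma>0 by (intro mult_mono) auto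
     then have "\<bar>\<theta> n x\<bar> * \<bar>H i x\<bar> \<le> (6 * \<sigma> ^ 5 * h^2) * \<Gamma>2 x"
      using elim xDF \<sigma>0 by (intro mult_mono) auto
     then show ?thesis using xDF by (simp add: abs_mult)
    next
     case False
     then have "\<theta> n x = 0"
      using zu(1)[of x] trunc_values(1)[OF \<epsilon>, of "p x" n] \<epsilon>[of n] by (auto simp: \<theta>_def)
     moreover have "0 \<le> ind (D \<inter> F) x * \<Gamma>2 x" using elim by (auto simp: indicator_def)
     ultimately show ?thesis using \<sigma>0 by simp
    qed
   qed
  qed
  finally show ?thesis by (simp add: J2_def)
 next
  case False
  have "0 \<le> J2" unfolding J2_def
   by (rule integral_nonneg_AE) (use \<Gamma>2(1) in \<open>eventually_elim, auto simp: indicator_def\<close>)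
  then show ?thesis using False \<sigma>0 by (simp add: not_integrable_integral_eq)
 qed
 have "\<bar>- 2 * (LI x. Z x)\<bar> \<le> 6 * \<sigma> ^ 5 * h^2 * J2"
  by (rule LIMSEQ_le_const2[OF tendsto_rabs[OF lim]]) (use bd in auto)
 then show ?thesis by (simp add: Z_def J2_def)
qed

text \<open>The three terms come from the translation times the odd part of the middle surface, from
  the rotation, and from \<open>hessian_bound\<close>. The constants: 294928 = 16 + 288 * 1024 for
  the translation, 226504704 = 32 * 24 * 294928, 7471104 = 32 * 228 * 1024, 96 = 32 * 3.\<close>

lemma second_order_estimate:
 fixes E :: real
 assumes \<Gamma>: "\<And>i k. AE x in lebesgue. x \<in> F \<longrightarrow> \<bar>g i k x\<bar> \<le> \<Gamma> x" "L1 (\<lambda>x. ind (D \<inter> F) x * \<Gamma> x)"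
  and gg: "gap_graphs \<Omega> S F h \<sigma>' E \<beta> \<tau> Db Dt"
  and hibp: "\<And>\<theta> T K i. (\<And>x. (\<theta> has_derivative (\<lambda>v. v \<bullet> T x)) (at x)) ==> continuous_on UNIV T ==>
    compact K ==> K \<subseteq> F ==> (\<And>x. x \<notin> K ==> \<theta> x = 0) ==>
    (LI x. T x $ 3 * (ind F x * g 3 i x)) = - (LI x. \<theta> x * (ind F x * H i x))"
  and \<Gamma>2: "\<And>i. AE x in lebesgue. x \<in> F \<longrightarrow> \<bar>H i x\<bar> \<le> \<Gamma>2 x" "L1 (\<lambda>x. ind (D \<inter> F) x * \<Gamma>2 x)"
 shows "\<bar>a $ 3\<bar> * \<sigma> ^ 3 \<le> (226504704 * E) * \<sigma> ^ 3 * (LI x. ind (D \<inter> F) x * \<Gamma> x)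
  + 7471104 * (h^2 / \<sigma>) * (LI x. ind (D \<inter> F) x * \<Gamma> x)
  + 96 * h^2 * (LI x. ind (D \<inter> F) x * \<Gamma>2 x)"
proof -
 note db = gap_graphs.db[OF gg] and dt = gap_graphs.dt[OF gg] and t = gap_graphs.t[OF gg]
 have even: "cyl \<sigma> x ==> \<bar>(\<beta> x + \<tau> x) / 2 - (\<beta> (flip 1 (flip 2 x)) + \<tau> (flip 1 (flip 2 x))) / 2\<bar> \<le> E * \<sigma> ^ 3" "0 \<le> E" for x
  using gap_graphs.even[OF gg] \<sigma>0 h by auto
 define J where "J = (LI x. ind (D \<inter> F) x * \<Gamma> x)"
 define J2 where "J2 = (LI x. ind (D \<inter> F) x * \<Gamma>2 x)"
 define q where "q x = (\<beta> x + \<tau> x) / 2" for x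
 define Dq where "Dq x = (1/2) *\<^sub>R (Db x + Dt x)" for x
 define f where "f i x = - 6 * hcut \<sigma> x ^ 2 * x $ i * (x $ 3 - q x)" for i x
 have s: "cyl \<sigma>' x" if "cyl \<sigma> x" for x using that \<sigma>0 by simp
 have q1: "GDERIV q x :> Dq x" if "cyl \<sigma>' x" for x
 proof -
  have "GDERIV (\<lambda>x. (1/2) * (\<beta> x + \<tau> x)) x :> (1/2) *\<^sub>R (Db x + Dt x)"
   by (rule GDERIV_subst[OF GDERIV_mult[OF GDERIV_const GDERIV_add[OF db(1)[OF that] dt(1)[OF that]]]]) simp
  then show ?thesis by (simp add: q_def[abs_def] Dq_def)
 qed
 have q2: "continuous_on {x. cyl \<sigma>' x} Dq" unfolding Dq_def[abs_def] by (intro continuous_intros db(2) dt(2))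
 have q3: "Dq x $ 3 = 0" for x by (simp add: Dq_def db(3) dt(3))
 have q4: "\<bar>q x\<bar> \<le> h" if "cyl \<sigma> x" for x using \<beta>(2)[OF s[OF that]] t[OF s[OF that]] h(1) unfolding q_def by auto
 have q5: "\<bar>q x - q (flip 1 (flip 2 x))\<bar> \<le> E * \<sigma> ^ 3" if "cyl \<sigma> x" for x using even(1)[OF that] by (simp add: q_def)
 note fl = flux[of q Dq "E * \<sigma> ^ 3" f, OF q1 q2 q3 q4 q5 f_def]
 have Z: "\<bar>LI x. (cut (f i) x) * (ind F x * g 3 i x)\<bar> \<le> 3 * \<sigma> ^ 5 * h^2 * J2"
  if "i \<noteq> 3" for i
  unfolding J2_def by (rule hessian_bound[where \<tau> = \<tau> and Db = Db and Dt = Dt and H = H])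
   (fact gg hibp \<Gamma>2 that fl(2)[OF _ _ _ that, simplified] | simp add: f_def q_def)+
 have J0: "0 \<le> J"
  using rotation_bound[OF _ \<Gamma>, of 1] \<sigma>0 by (simp add: J_def) (smt (verit) mult_nonneg_nonneg zero_le_power abs_ge_zero)
 have W3: "\<bar>W $ i $ 3\<bar> * \<sigma> ^ 3 \<le> 1024 * J" if "i = 1 \<or> i = 2" for i
  using rotation_bound[OF that \<Gamma>] skew[of i 3] by (simp add: J_def)
 have Wb: "\<bar>W $ i $ 3\<bar> * \<sigma> ^ 7 * h^2 \<le> 1024 * J * \<sigma> ^ 4 * h^2" if "i = 1 \<or> i = 2" for i
  using mult_right_mono[OF W3[OF that], of "\<sigma> ^ 4 * h^2"] \<sigma>0 by (simp add: eval_nat_numeral mult_ac)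
 have ab: "\<bar>a $ i\<bar> * \<sigma>^2 \<le> 294928 * J" if i: "i = 1 \<or> i = 2" for i
 proof -
  have "\<bar>W $ i $ 3\<bar> * \<sigma>^2 * h \<le> \<bar>W $ i $ 3\<bar> * \<sigma>^2 * \<sigma>" using h by (intro mult_left_mono) auto
  then have "\<bar>W $ i $ 3\<bar> * \<sigma>^2 * h \<le> 1024 * J" using W3[OF i] by (simp add: eval_nat_numeral mult_ac)
  then show ?thesis using translation_bound[OF _ \<Gamma>, of i] i by (auto simp: J_def)
 qed
 have "\<bar>a $ 3\<bar> * \<sigma> ^ 8 \<le> 16 * (\<Sum>i\<in>{1,2}. 24 * \<bar>a $ i\<bar> * \<sigma> ^ 7 * (E * \<sigma> ^ 3) + 228 * \<bar>W $ i $ 3\<bar> * \<sigma> ^ 7 * h^2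
   + \<bar>LI x. (cut (f i) x) * (ind F x * g 3 i x)\<bar>)"
  by (rule fl(1))
 also have "\<dots> \<le> 16 * (\<Sum>i\<in>{1,2::3}. 24 * 294928 * J * \<sigma> ^ 5 * (E * \<sigma> ^ 3) + 228 * (1024 * J * \<sigma> ^ 4 * h^2) + 3 * \<sigma> ^ 5 * h^2 * J2)"
 proof (intro mult_left_mono sum_mono)
  fix i :: 3 assume "i \<in> {1, 2}"
  then have i: "i = 1 \<or> i = 2" "i \<noteq> 3" by auto
  have "(\<bar>a $ i\<bar> * \<sigma>^2) * (\<sigma> ^ 5 * (E * \<sigma> ^ 3)) \<le> (294928 * J) * (\<sigma> ^ 5 * (E * \<sigma> ^ 3))"
   using ab[OF i(1)] even(2) \<sigma>0 by (intro mult_right_mono) auto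
  then have "24 * \<bar>a $ i\<bar> * \<sigma> ^ 7 * (E * \<sigma> ^ 3) \<le> 24 * 294928 * J * \<sigma> ^ 5 * (E * \<sigma> ^ 3)"
   by (simp add: eval_nat_numeral mult_ac)
  then show "24 * \<bar>a $ i\<bar> * \<sigma> ^ 7 * (E * \<sigma> ^ 3) + 228 * \<bar>W $ i $ 3\<bar> * \<sigma> ^ 7 * h^2
   + \<bar>LI x. (cut (f i) x) * (ind F x * g 3 i x)\<bar>
   \<le> 24 * 294928 * J * \<sigma> ^ 5 * (E * \<sigma> ^ 3) + 228 * (1024 * J * \<sigma> ^ 4 * h^2) + 3 * \<sigma> ^ 5 * h^2 * J2"
   using Z[OF i(2)] Wb[OF i(1)] by linarith
 qed simp
 also have "\<dots> = \<sigma> ^ 5 * ((226504704 * E) * \<sigma> ^ 3 * J + 7471104 * (h^2 / \<sigma>) * J + 96 * h^2 * J2)"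
  using \<sigma>0 by (simp add: eval_nat_numeral field_simps)
 finally have "\<sigma> ^ 5 * (\<bar>a $ 3\<bar> * \<sigma> ^ 3) \<le> \<sigma> ^ 5 * ((226504704 * E) * \<sigma> ^ 3 * J + 7471104 * (h^2 / \<sigma>) * J + 96 * h^2 * J2)"
  by (simp add: eval_nat_numeral mult_ac)
 then show ?thesis unfolding J_def J2_def using \<sigma>0 by (simp add: mult_le_cancel_left)
qed

end

section \<open>Differentiability almost everywhere on the line\<close>

text \<open>Forward averages converge for \<open>f\<close> and for its reflection; reflecting the
  second null set back gives forward and backward averages outside one null set.\<close>

lemma lebesgue_differentiation_real:
 fixes f :: "real \<Rightarrow> 'b::euclidean_space"
 assumes f: "\<And>a b. f integrable_on {a..b}"
 shows "AE t in lebesgue. \<forall>e>0. \<exists>d>0. \<forall>h. 0 < h \<and> h < d \<longrightarrow>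
  norm (integral {t..t + h} f /\<^sub>R h - f t) < e \<and> norm (integral {t - h..t} f /\<^sub>R h - f t) < e"
proof -
 have f1: "f integrable_on cbox a b" for a b using f by simp
 have f2: "(\<lambda>x. f (- x)) integrable_on cbox a b" for a b
  using f[of "- b" "- a"] Henstock_Kurzweil_Integration.integrable_reflect_real[where f=f and a="- b" and b="- a"] by simp
 obtain N1 where N1: "negligible N1" "\<And>x e. x \<notin> N1 ==> 0 < e ==>
   \<exists>d>0. \<forall>h. 0 < h \<and> h < d \<longrightarrow> norm (integral (cbox x (x + h *\<^sub>R One)) f /\<^sub>R h ^ DIM(real) - f x) < e"
  using integrable_ccontinuous_explicit[OF f1] by metis
 obtain N2 where N2: "negligible N2" "\<And>x e. x \<notin> N2 ==> 0 < e ==>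
   \<exists>d>0. \<forall>h. 0 < h \<and> h < d \<longrightarrow> norm (integral (cbox x (x + h *\<^sub>R One)) (\<lambda>x. f (- x)) /\<^sub>R h ^ DIM(real) - f (- x)) < e"
  using integrable_ccontinuous_explicit[OF f2] by metis
 have "negligible (N1 \<union> uminus ` N2)"
 proof (rule negligible_Un[OF N1(1) negligible_locally_Lipschitz_image[OF order_refl N2(1)]])
  fix x show "\<exists>T B. open T \<and> x \<in> T \<and> (\<forall>y\<in>N2 \<inter> T. norm (- y - - x) \<le> B * norm (y - x))"
   by (intro exI[of _ UNIV] exI[of _ 1]) auto
 qed
 then have "N1 \<union> uminus ` N2 \<in> null_sets lebesgue" by (simp add: negligible_iff_null_sets)
 then show ?thesis
 proof (rule AE_I'[OF _ subsetI])
  fix t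
  assume t: "t \<in> {t \<in> space lebesgue. \<not> (\<forall>e>0. \<exists>d>0. \<forall>h. 0 < h \<and> h < d \<longrightarrow>
   norm (integral {t..t + h} f /\<^sub>R h - f t) < e \<and> norm (integral {t - h..t} f /\<^sub>R h - f t) < e)}"
  show "t \<in> N1 \<union> uminus ` N2"
  proof (rule ccontr)
   assume "t \<notin> N1 \<union> uminus ` N2"
   then have n: "t \<notin> N1" "- t \<notin> N2" by (auto simp: image_iff)
   have "\<exists>d>0. \<forall>h. 0 < h \<and> h < d \<longrightarrow>
    norm (integral {t..t + h} f /\<^sub>R h - f t) < e \<and> norm (integral {t - h..t} f /\<^sub>R h - f t) < e" if e: "e > 0" for e
   proof -
    obtain d1 where d1: "d1 > 0" "\<And>h. 0 < h ==> h < d1 ==> norm (integral {t..t + h} f /\<^sub>R h - f t) < e"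
     using N1(2)[OF n(1) e] by auto
    obtain d2 where d2: "d2 > 0" "\<And>h. 0 < h ==> h < d2 ==> norm (integral {- t..- t + h} (\<lambda>x. f (- x)) /\<^sub>R h - f t) < e"
     using N2(2)[OF n(2) e] by auto
    have "integral {- t..- t + h} (\<lambda>x. f (- x)) = integral {t - h..t} f" for h
     using Henstock_Kurzweil_Integration.integral_reflect_real[of "t" "t - h" f] by simp
    then show ?thesis using d1 d2 by (intro exI[of _ "min d1 d2"]) auto
   qed
   then show False using t by blast
  qed
 qed
qed

lemma has_vector_derivative_by_integral:
 fixes F :: "real \<Rightarrow> 'b::real_normed_vector"
 assumes "\<And>e. e > 0 ==> \<exists>d>0. \<forall>h. 0 < h \<and> h < d \<longrightarrow>
  norm ((F (t + h) - F t) /\<^sub>R h - D) < e \<and> norm ((F t - F (t - h)) /\<^sub>R h - D) < e"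
 shows "(F has_vector_derivative D) (at t)"
proof -
 have "((\<lambda>h. norm (F (t + h) - F t - h *\<^sub>R D) / norm h) \<longlongrightarrow> 0) (at 0)"
 proof (rule LIM_I)
  fix e :: real assume "e > 0"
  then obtain d where d: "d > 0" "\<And>h. 0 < h ==> h < d ==>
   norm ((F (t + h) - F t) /\<^sub>R h - D) < e \<and> norm ((F t - F (t - h)) /\<^sub>R h - D) < e" using assms[of e] by metis
  have "norm (norm (F (t + h) - F t - h *\<^sub>R D) / norm h) < e" if h: "h \<noteq> 0" "norm (h - 0) < d" for h
  proof (cases "h > 0")
   case True
   have "F (t + h) - F t - h *\<^sub>R D = h *\<^sub>R ((F (t + h) - F t) /\<^sub>R h - D)"
    using True by (simp add: scaleR_diff_right)
   then have "norm (F (t + h) - F t - h *\<^sub>R D) / norm h = norm ((F (t + h) - F t) /\<^sub>R h - D)"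
    using True by simp
   then show ?thesis using d(2)[of h] True h by simp
  next
   case False
   then have k: "- h > 0" "- h < d" using h by auto
   have "F (t + h) - F t - h *\<^sub>R D = h *\<^sub>R ((F t - F (t - (- h))) /\<^sub>R (- h) - D)"
    using k by (simp add: scaleR_diff_right algebra_simps)
   then have "norm (F (t + h) - F t - h *\<^sub>R D) / norm h = norm ((F t - F (t - (- h))) /\<^sub>R (- h) - D)"
    using k by simp
   then show ?thesis using d(2)[OF k] by simp
  qed
  then show "\<exists>s>0. \<forall>h. h \<noteq> 0 \<and> norm (h - 0) < s \<longrightarrow> norm (norm (F (t + h) - F t - h *\<^sub>R D) / norm h - 0) < e"
   using d(1) by auto
 qed
 then show ?thesis
  by (simp add: has_vector_derivative_def has_derivative_at bounded_linear_scaleR_left)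
qed

text \<open>After adding a linear function the Lipschitz function \<open>F\<close> is increasing with slope at least \<open>1\<close>; the
 measure \<open>A \<mapsto> lebesgue (F ` A)\<close> has a density, and \<open>F\<close> is its indefinite integral.\<close>

lemma lipschitz_AE_differentiable:
 fixes f :: "real \<Rightarrow> real"
 assumes L: "L-lipschitz_on UNIV f"
 shows "AE t in lebesgue. f differentiable (at t)"
proof -
 have L0: "L \<ge> 0" using L lipschitz_on_nonneg by blast
 \<comment> \<open>Difference quotients of \<open>F\<close> lie between 1 and
   \<open>2 * L + 1\<close>: the inverse is 1-Lipschitz, hence Borel, and \<open>F\<close> maps null
   sets to null sets, which is the absolute continuity used for the density.\<close>
 define F where "F t = f t + (L + 1) * t" for t
 have Fd: "t - s \<le> F t - F s" "F t - F s \<le> (2 * L + 1) * (t - s)" if "s \<le> t" for s t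
 proof -
  have "\<bar>f t - f s\<bar> \<le> L * (t - s)" using lipschitz_onD[OF L, of t s] that by (simp add: dist_real_def)
  then have "f t - f s \<le> L * (t - s)" "- (L * (t - s)) \<le> f t - f s" by linarith+
  then show "t - s \<le> F t - F s" "F t - F s \<le> (2 * L + 1) * (t - s)" by (simp_all add: F_def algebra_simps)
 qed
 have Fmono: "strict_mono F" unfolding strict_mono_def using Fd(1) by (smt (verit))
 have Flip: "\<bar>F t - F s\<bar> \<le> (2 * L + 1) * \<bar>t - s\<bar>" for s t
  using Fd[of s t] Fd[of t s] by (cases "s \<le> t") (auto simp: abs_if)
 have Fc: "continuous_on UNIV F" unfolding F_def[abs_def]
  by (intro continuous_intros lipschitz_on_continuous_on[OF L])
 have Fsurj: "surj F"
 proof (rule surjI[of _ "\<lambda>y. SOME x. F x = y"], rule someI_ex)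
  fix y
  define c where "c = \<bar>y - F 0\<bar>"
  have "F (- c) \<le> y" "y \<le> F c" using Fd(1)[of "- c" 0] Fd(1)[of 0 c] by (auto simp: c_def)
  then show "\<exists>x. F x = y"
   using IVT'[of F "- c" y c] continuous_on_subset[OF Fc] by (auto simp: c_def)
 qed
 have Finj: "inj F" using Fmono strict_mono_imp_inj_on by blast
 define \<Phi> where "\<Phi> = inv F"
 have F\<Phi>: "F (\<Phi> y) = y" "\<Phi> (F x) = x" for x y
  unfolding \<Phi>_def using Fsurj Finj by (simp_all add: surj_f_inv_f)
 have \<Phi>c: "continuous_on UNIV \<Phi>"
 proof (rule lipschitz_on_continuous_on[OF lipschitz_onI])
  fix x y
  show "dist (\<Phi> x) (\<Phi> y) \<le> 1 * dist x y"
   using Fd(1)[of "\<Phi> x" "\<Phi> y"] Fd(1)[of "\<Phi> y" "\<Phi> x"] F\<Phi> by (cases "\<Phi> x \<le> \<Phi> y") (auto simp: dist_real_def)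
 qed auto
 have \<Phi>m: "\<Phi> \<in> borel_measurable borel" by (rule borel_measurable_continuous_onI[OF \<Phi>c])
 define \<mu> where "\<mu> = distr lborel borel \<Phi>"
 have vim: "\<Phi> -` A = F ` A" for A using F\<Phi> by (auto simp: image_iff) metis
 have \<mu>: "emeasure \<mu> A = emeasure lborel (F ` A)" if "A \<in> sets borel" for A
  using that \<Phi>m by (simp add: \<mu>_def emeasure_distr vim)
 have ac: "absolutely_continuous lborel \<mu>"
  unfolding absolutely_continuous_def
 proof
  fix A assume A: "A \<in> null_sets (lborel :: real measure)"
  then have Ab: "A \<in> sets borel" by (auto simp: null_sets_def)
  have "negligible A" using A by (simp add: negligible_iff_null_sets null_sets_completionI)
  then have "negligible (F ` A)"
  proof (rule negligible_locally_Lipschitz_image[OF order_refl])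
   fix x show "\<exists>T B. open T \<and> x \<in> T \<and> (\<forall>y\<in>A \<inter> T. norm (F y - F x) \<le> B * norm (y - x))"
    using Flip by (intro exI[of _ UNIV] exI[of _ "2 * L + 1"]) auto
  qed
  moreover have "F ` A \<in> sets borel" using measurable_sets[OF \<Phi>m Ab] by (simp add: vim)
  ultimately have "F ` A \<in> null_sets lborel" by (simp add: negligible_iff_null_sets null_sets_completion_iff)
  then show "A \<in> null_sets \<mu>" using \<mu>[OF Ab] Ab by (auto simp: null_sets_def \<mu>_def)
 qed
 obtain g where g: "g \<in> borel_measurable lborel" "density lborel g = \<mu>"
  using sigma_finite_measure.Radon_Nikodym[OF sigma_finite_lborel ac] by (auto simp: \<mu>_def)
 have Fim: "F ` {a..b} = {F a..F b}" if "a \<le> b" for a b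
 proof
  show "F ` {a..b} \<subseteq> {F a..F b}" using Fmono by (auto simp: strict_mono_less_eq)
  show "{F a..F b} \<subseteq> F ` {a..b}"
  proof
   fix y assume "y \<in> {F a..F b}"
   then have "y = F (\<Phi> y)" "a \<le> \<Phi> y" "\<Phi> y \<le> b" using F\<Phi> Fmono strict_mono_less_eq by (metis atLeastAtMost_iff)+
   then show "y \<in> F ` {a..b}" by auto
  qed
 qed
 have gi: "(\<integral>\<^sup>+ x. g x * indicator {a..b} x \<partial>lborel) = ennreal (F b - F a)" if "a \<le> b" for a b
 proof -
  have "(\<integral>\<^sup>+ x. g x * indicator {a..b} x \<partial>lborel) = emeasure \<mu> {a..b}"
   using g by (simp add: emeasure_density flip: g(2))
  also have "\<dots> = ennreal (F b - F a)"
   using \<mu>[of "{a..b}"] Fim[OF that] Fd(1)[OF that] that by simp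
  finally show ?thesis .
 qed
 define gr where "gr x = enn2real (g x)" for x
 have ginf: "AE x in lborel. g x \<noteq> \<infinity>"
 proof -
  have "AE x in lborel. x \<in> {- real n..real n} \<longrightarrow> g x \<noteq> \<infinity>" for n
  proof -
   have "AE x in lborel. g x * indicator {- real n..real n} x \<noteq> \<infinity>"
    by (rule nn_integral_PInf_AE) (use g(1) gi[of "- real n" "real n"] in auto)
   then show ?thesis by eventually_elim (auto split: split_indicator)
  qed
  then have "AE x in lborel. \<forall>n. x \<in> {- real n..real n} \<longrightarrow> g x \<noteq> \<infinity>" unfolding AE_all_countable by blast
  then show ?thesis
  proof eventually_elim
   case (elim x)
   obtain n where "\<bar>x\<bar> \<le> real n" using real_arch_simple by blast
   then have "x \<in> {- real n..real n}" by (simp add: abs_le_iff)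
   then show ?case using elim by blast
  qed
 qed
 have hi: "(gr has_integral (F b - F a)) {a..b}" if ab: "a \<le> b" for a b
 proof -
  have m: "(\<lambda>x. gr x * indicator {a..b} x) \<in> borel_measurable lborel" unfolding gr_def using g(1) by measurable
  have "(\<integral>\<^sup>+ x. ennreal (gr x * indicator {a..b} x) \<partial>lborel) = (\<integral>\<^sup>+ x. g x * indicator {a..b} x \<partial>lborel)"
   by (rule nn_integral_cong_AE) (use ginf in \<open>eventually_elim, auto simp: gr_def split: split_indicator simp: less_top\<close>)
  then have e: "(\<integral>\<^sup>+ x. ennreal (gr x * indicator {a..b} x) \<partial>lborel) = ennreal (F b - F a)" using gi[OF ab] by simp
  have "((\<lambda>x. gr x * indicator {a..b} x) has_integral (F b - F a)) UNIV"
   using nn_integral_has_integral[of "\<lambda>x. gr x * indicator {a..b} x" "F b - F a"] m e Fd(1)[OF ab] ab by (simp add: gr_def)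
  then show ?thesis
   using has_integral_restrict_UNIV[of "{a..b}" gr] by (simp add: indicator_times_eq_if)
 qed
 have "gr integrable_on {a..b}" for a b
  using hi[of a b] by (cases "a \<le> b") (auto simp: integrable_on_def intro: exI[of _ 0])
 from lebesgue_differentiation_real[OF this] show ?thesis
 proof eventually_elim
  case (elim t)
  have "(F has_vector_derivative gr t) (at t)"
  proof (rule has_vector_derivative_by_integral)
   fix e :: real assume "e > 0"
   then obtain d where d: "d > 0" "\<And>h. 0 < h ==> h < d ==>
    norm (integral {t..t + h} gr /\<^sub>R h - gr t) < e \<and> norm (integral {t - h..t} gr /\<^sub>R h - gr t) < e"
    using elim[THEN spec, of e, THEN mp] by metis
   have "integral {t..t + h} gr = F (t + h) - F t" "integral {t - h..t} gr = F t - F (t - h)" if "h > 0" for h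
    using hi[of t "t + h"] hi[of "t - h" t] that by (auto simp: integral_unique)
   then show "\<exists>d>0. \<forall>h. 0 < h \<and> h < d \<longrightarrow> norm ((F (t + h) - F t) /\<^sub>R h - gr t) < e \<and> norm ((F t - F (t - h)) /\<^sub>R h - gr t) < e"
    using d by (intro exI[of _ d]) auto
  qed
  then have "(F has_real_derivative gr t) (at t)" by (simp add: has_real_derivative_iff_has_vector_derivative)
  then have "((\<lambda>t. F t - (L + 1) * t) has_real_derivative gr t - (L + 1)) (at t)"
   by (auto intro!: derivative_eq_intros)
  then have "(f has_real_derivative gr t - (L + 1)) (at t)" by (simp add: F_def)
  then show ?case using real_differentiable_def by blast
 qed
qed

section \<open>Extension of isometries\<close>

text \<open>The motion is known only on the closure of the body, whereas \<open>is_isometry\<close>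
  concerns the whole space. Small multiples of the axes stay in a ball inside \<open>S\<close>;
  polarisation preserves inner products, so their images span an orthonormal frame, and every
  displacement is determined by its products with that frame.\<close>

lemma isometry_on_open_extends:
 fixes f :: "real^3 \<Rightarrow> real^3"
 assumes S: "open S" "S \<noteq> {}" and f: "\<And>x y. x \<in> S ==> y \<in> S ==> dist (f x) (f y) = dist x y"
 obtains \<psi> where "is_isometry \<psi>" "\<And>x. x \<in> S ==> \<psi> x = f x"
proof -
 obtain c where c: "c \<in> S" using S by blast
 obtain e where e: "e > 0" "ball c e \<subseteq> S" using S c open_contains_ball by blast
 define \<delta> where "\<delta> = e / 2"
 have \<delta>: "\<delta> > 0" using e by (simp add: \<delta>_def)
 define F where "F v = f (c + v) - f c" for v
 have inS: "c + \<delta> *\<^sub>R axis i 1 \<in> S" for i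
 proof -
  have "norm (\<delta> *\<^sub>R (axis i 1 :: real^3)) < e" using e by (simp add: \<delta>_def norm_axis_1)
  then have "c + \<delta> *\<^sub>R axis i 1 \<in> ball c e" by (simp only: mem_ball dist_norm) (simp add: norm_minus_commute)
  then show ?thesis using e by blast
 qed
 have Fi: "F v \<bullet> F v' = v \<bullet> v'" if "c + v \<in> S" "c + v' \<in> S" for v v'
 proof -
  have "norm (F v) = norm v" "norm (F v') = norm v'" "norm (F v - F v') = norm (v - v')"
   using f[OF that(1) c] f[OF that(2) c] f[OF that] by (simp_all add: F_def dist_norm)
  then show ?thesis by (simp add: dot_norm_neg)
 qed
 define B where "B i = (1 / \<delta>) *\<^sub>R F (\<delta> *\<^sub>R axis i 1)" for i
 have BB: "B i \<bullet> B j = (if i = j then 1 else 0)" for i j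
  using Fi[OF inS inS, of i j] \<delta> by (auto simp: B_def inner_axis_axis)
 define A where "A v = (\<Sum>i\<in>UNIV. v $ i *\<^sub>R B i)" for v :: "real^3"
 have Ain: "A v \<bullet> A v' = v \<bullet> v'" for v v'
  by (simp add: A_def inner_sum_left inner_sum_right BB if_distrib cong: if_cong) (simp add: inner_vec_def mult.commute)
 have linA: "linear A"
  by (rule linearI) (simp_all add: A_def scaleR_add_left sum.distrib scaleR_sum_right)
 have oA: "orthogonal_transformation A" using linA Ain by (simp add: orthogonal_transformation_def)
 have FA: "F v = A v" if v: "c + v \<in> S" for v
 proof -
  have b: "F v \<bullet> B i = v $ i" for i
   using Fi[OF v inS[of i]] \<delta> by (simp add: B_def inner_axis)
  have "(F v - A v) \<bullet> (F v - A v) = F v \<bullet> F v - 2 * (F v \<bullet> A v) + A v \<bullet> A v"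
   by (simp add: inner_diff_left inner_diff_right inner_commute)
  also have "F v \<bullet> A v = v \<bullet> v" by (simp add: A_def inner_sum_right b) (simp add: inner_vec_def)
  finally have "(F v - A v) \<bullet> (F v - A v) = 0" using Fi[OF v v] Ain by simp
  then show ?thesis by simp
 qed
 show ?thesis
 proof (rule that[of "\<lambda>x. (f c - A c) + A x"])
  show "is_isometry (\<lambda>x. (f c - A c) + A x)" by (rule is_isometry_affine[OF oA])
  fix x assume "x \<in> S"
  then have "F (x - c) = A (x - c)" by (intro FA) simp
  then show "(f c - A c) + A x = f x" by (simp add: F_def linear_diff[OF linA] diff_eq_eq algebra_simps)
 qed
qed

lemma norm_cross3_le: "norm (cross3 x y) \<le> norm x * norm y"
proof -
 have "(norm (cross3 x y))^2 \<le> (norm x * norm y)^2" unfolding norm_cross power_mult_distrib by simp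
 then show ?thesis by (rule power2_le_imp_le) simp
qed


section \<open>Motion of the rigid body\<close>

lemma cross3_diff_right: "cross3 a (x - y) = cross3 a x - cross3 a y"
 by (simp add: cross3_simps)

lemma bounded_bilinear_cross3: "bounded_bilinear cross3"
 using bilinear_cross bilinear_conv_bounded_bilinear by blast

lemma integral_bound_AE:
 fixes f :: "real \<Rightarrow> 'b::euclidean_space"
 assumes f: "f integrable_on {s..t}" "s \<le> t" and N: "negligible N" "\<And>r. r \<in> {s..t} - N ==> norm (f r) \<le> B" and B: "0 \<le> B"
 shows "norm (integral {s..t} f) \<le> B * (t - s)"
proof -
 have "((\<lambda>r. if r \<in> N then 0 else f r) has_integral integral {s..t} f) {s..t}"
  by (rule has_integral_spike[OF N(1) _ integrable_integral[OF f(1)]]) auto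
 then have "((\<lambda>r. if r \<in> N then 0 else f r) has_integral integral {s..t} f) (cbox s t)" by simp
 from has_integral_bound_spike_finite[OF B finite.emptyI this]
 show ?thesis using N(2) B f(2) by (simp split: if_splits)
qed

text \<open>The motion with all essential bounds made pointwise off one null set \<open>N\<close>
  and with gauge integrals; \<open>d\<close> bounds the distance of body points from the
  distinguished point \<open>y\<close>.\<close>

locale body_flow =
 fixes T :: real and C :: "(real^3) set" and us om xs :: "real \<Rightarrow> real^3" and X :: "real \<Rightarrow> real^3 \<Rightarrow> real^3" and y :: "real^3"
  and Mu Mo d :: real and N :: "real set"
 assumes N: "negligible N" "\<And>r. r \<in> {0..<T} - N ==> norm (us r) \<le> Mu" "\<And>r. r \<in> {0..<T} - N ==> norm (om r) \<le> Mo"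
  and M0: "0 \<le> Mu" "0 \<le> Mo"
  and usi: "\<And>a b. 0 \<le> a ==> b < T ==> us integrable_on {a..b}" and omi: "\<And>a b. 0 \<le> a ==> b < T ==> om integrable_on {a..b}"
  and vi: "\<And>x t. x \<in> C ==> t \<in> {0..<T} ==> (\<lambda>s. rigid_velocity us om xs s (X s x)) integrable_on {0..t}"
  and X: "\<And>x t. x \<in> C ==> t \<in> {0..<T} ==> X t x = x + integral {0..t} (\<lambda>s. rigid_velocity us om xs s (X s x))"
  and y: "y \<in> C" "\<And>t. t \<in> {0..<T} ==> xs t = X t y"
  and d: "\<And>x. x \<in> C ==> dist x y \<le> d"
begin

lemma X0: "x \<in> C ==> 0 < T ==> X 0 x = x" using X[of x 0] by simp

lemma vi': "x \<in> C ==> 0 \<le> s ==> t < T ==> (\<lambda>s. rigid_velocity us om xs s (X s x)) integrable_on {s..t}"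
 using integrable_subinterval_real[OF vi[of x t], of s t] by (cases "s \<le> t") auto

lemma X_increment:
 assumes "x \<in> C" "0 \<le> s" "s \<le> t" "t < T"
 shows "X t x - X s x = integral {s..t} (\<lambda>s. rigid_velocity us om xs s (X s x))"
 using Henstock_Kurzweil_Integration.integral_combine[of 0 s t "\<lambda>s. rigid_velocity us om xs s (X s x)"] vi[of x t] X[of x t] X[of x s] assms
 by (simp add: algebra_simps)

lemma diff_increment:
 assumes "x \<in> C" "x' \<in> C" "0 \<le> s" "s \<le> t" "t < T"
 shows "(\<lambda>r. cross3 (om r) (X r x - X r x')) integrable_on {s..t}"
  "(X t x - X t x') - (X s x - X s x') = integral {s..t} (\<lambda>r. cross3 (om r) (X r x - X r x'))"
proof -
 have e: "rigid_velocity us om xs r (X r x) - rigid_velocity us om xs r (X r x') = cross3 (om r) (X r x - X r x')" for r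
  by (simp add: rigid_velocity_def cross3_diff_right)
 show "(\<lambda>r. cross3 (om r) (X r x - X r x')) integrable_on {s..t}"
  using integrable_diff[OF vi'[OF assms(1,3,5)] vi'[OF assms(2,3,5)]] unfolding e .
 show "(X t x - X t x') - (X s x - X s x') = integral {s..t} (\<lambda>r. cross3 (om r) (X r x - X r x'))"
  using Henstock_Kurzweil_Integration.integral_diff[OF vi'[OF assms(1,3,5)] vi'[OF assms(2,3,5)]]
   X_increment[OF assms(1,3,4,5)] X_increment[OF assms(2,3,4,5)] unfolding e by (simp add: algebra_simps)
qed

text \<open>Since \<open>z \<bullet> (om \<times> z) = 0\<close>, the function \<open>\<bar>z\<bar>^2\<close> changes only by \<open>O(\<delta>^2)\<close> in time \<open>\<delta>\<close>.\<close>

lemma X_isometric: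
 assumes x: "x \<in> C" "x' \<in> C" and t: "t \<in> {0..<T}"
 shows "dist (X t x) (X t x') = dist x x'"
proof -
 define z where "z r = X r x - X r x'" for r
 have t': "0 \<le> t" "t < T" using t by auto
 have zc: "continuous_on {0..t} z"
 proof -
  have "continuous_on {0..t} (\<lambda>r. X r x)" if "x \<in> C" for x
  proof -
   have "continuous_on {0..t} (\<lambda>r. x + integral {0..r} (\<lambda>s. rigid_velocity us om xs s (X s x)))"
    by (intro continuous_intros indefinite_integral_continuous_1 vi that t)
   then show ?thesis
    by (rule continuous_on_eq) (use X[OF that] t in auto)
  qed
  then show ?thesis unfolding z_def using x by (intro continuous_intros) auto
 qed
 have "compact (z ` {0..t})" by (intro compact_continuous_image zc) auto
 then obtain B where B: "\<And>r. r \<in> {0..t} ==> norm (z r) \<le> B" by (metis compact_imp_bounded bounded_iff imageI)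
 have B0: "B \<ge> 0" using B[of 0] t by (meson atLeastAtMost_iff norm_ge_zero order_trans atLeastLessThan_iff order_refl)
 have zi: "(\<lambda>r. cross3 (om r) (z r)) integrable_on {s..s'}" "z s' - z s = integral {s..s'} (\<lambda>r. cross3 (om r) (z r))"
  if "0 \<le> s" "s \<le> s'" "s' \<le> t" for s s'
  using diff_increment[OF x, of s s'] that t by (auto simp: z_def)
 have zl: "norm (z s' - z s) \<le> Mo * B * (s' - s)" if s: "0 \<le> s" "s \<le> s'" "s' \<le> t" for s s'
  unfolding zi(2)[OF s]
 proof (rule integral_bound_AE[OF zi(1)[OF s] s(2) N(1)])
  fix r assume r: "r \<in> {s..s'} - N"
  have "norm (cross3 (om r) (z r)) \<le> norm (om r) * norm (z r)" by (rule norm_cross3_le)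
  also have "\<dots> \<le> Mo * B" using r s t' N(3)[of r] B[of r] M0 by (intro mult_mono) auto
  finally show "norm (cross3 (om r) (z r)) \<le> Mo * B" .
 qed (use M0 B0 in simp)
 define Q where "Q = 3 * (Mo * B)^2"
 have Q0: "Q \<ge> 0" by (simp add: Q_def)
 have f: "\<bar>(norm (z s'))^2 - (norm (z s))^2\<bar> \<le> Q * (s' - s)^2" if s: "0 \<le> s" "s \<le> s'" "s' \<le> t" for s s'
 proof -
  have i: "(\<lambda>r. z s \<bullet> cross3 (om r) (z r)) integrable_on {s..s'}"
   "z s \<bullet> (z s' - z s) = integral {s..s'} (\<lambda>r. z s \<bullet> cross3 (om r) (z r))"
   using integrable_linear[OF zi(1)[OF s] bounded_linear_inner_right[of "z s"]]
    integral_linear[OF zi(1)[OF s] bounded_linear_inner_right[of "z s"]] zi(2)[OF s] by (auto simp: o_def)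
  have "norm (integral {s..s'} (\<lambda>r. z s \<bullet> cross3 (om r) (z r))) \<le> (Mo * B)^2 * (s' - s) * (s' - s)"
  proof (rule integral_bound_AE[OF i(1) s(2) N(1)])
   fix r assume r: "r \<in> {s..s'} - N"
   have "z s \<bullet> cross3 (om r) (z r) = z s \<bullet> cross3 (om r) (z r - z s)"
    by (simp add: cross3_diff_right inner_diff_right dot_cross_self)
   also have "norm \<dots> \<le> norm (z s) * (norm (om r) * norm (z r - z s))"
    using Cauchy_Schwarz_ineq2 norm_cross3_le by (metis mult_left_mono norm_ge_zero order_trans real_norm_def)
   also have "\<dots> \<le> B * (Mo * (Mo * B * (s' - s)))"
   proof (intro mult_mono)
    show "norm (z r - z s) \<le> Mo * B * (s' - s)"
     using zl[of s r] r s M0 B0 by (auto intro: order_trans[OF _ mult_left_mono[of "r - s" "s' - s"]])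
   qed (use B[of s] N(3)[of r] r s t' M0 B0 in auto)
   finally show "norm (z s \<bullet> cross3 (om r) (z r)) \<le> (Mo * B)^2 * (s' - s)" by (simp add: power2_eq_square mult_ac)
  qed (use s in simp)
  then have 1: "\<bar>z s \<bullet> (z s' - z s)\<bar> \<le> (Mo * B)^2 * (s' - s)^2" unfolding i(2) by (simp add: power2_eq_square mult.assoc)
  have 2: "(norm (z s' - z s))^2 \<le> (Mo * B)^2 * (s' - s)^2"
   using power_mono[OF zl[OF s], of 2] by (simp add: power_mult_distrib)
  have "(norm (z s'))^2 - (norm (z s))^2 = 2 * (z s \<bullet> (z s' - z s)) + (norm (z s' - z s))^2"
   unfolding power2_norm_eq_inner by (simp add: inner_diff_left inner_diff_right inner_commute)
  then show ?thesis using 1 2 zero_le_power2[of "norm (z s' - z s)"] unfolding Q_def mult.assoc by linarith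
 qed
 \<comment> \<open>A quadratic modulus of continuity forces the derivative 0 at every time, also at
   those where \<open>z\<close> itself is not differentiable.\<close>
 have "\<exists>c. \<forall>r\<in>{0..t}. (norm (z r))^2 = c"
 proof (rule has_derivative_zero_constant)
  fix r assume r: "r \<in> {0..t}"
  show "((\<lambda>r. (norm (z r))^2) has_derivative (\<lambda>h. 0)) (at r within {0..t})"
   unfolding has_derivative_within_alt
  proof (intro conjI allI impI)
   fix e :: real assume e: "e > 0"
   show "\<exists>d>0. \<forall>y\<in>{0..t}. norm (y - r) < d \<longrightarrow> norm ((norm (z y))^2 - (norm (z r))^2 - 0) \<le> e * norm (y - r)"
   proof (intro exI[of _ "e / (Q + 1)"] conjI ballI impI)
    show "0 < e / (Q + 1)" using e Q0 by simp
    fix y assume y: "y \<in> {0..t}" "norm (y - r) < e / (Q + 1)"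
    have "norm ((norm (z y))^2 - (norm (z r))^2 - 0) \<le> Q * \<bar>y - r\<bar>^2"
     using f[of r y] f[of y r] r y(1) by (cases "r \<le> y") (auto simp: power2_commute abs_minus_commute)
    also have "\<dots> = (Q * \<bar>y - r\<bar>) * \<bar>y - r\<bar>" by (simp add: power2_eq_square)
    also have "\<dots> \<le> e * \<bar>y - r\<bar>"
    proof (rule mult_right_mono)
     have "\<bar>y - r\<bar> * (Q + 1) < e" using y(2) Q0 by (simp add: pos_less_divide_eq)
     then show "Q * \<bar>y - r\<bar> \<le> e" by (simp add: algebra_simps)
    qed simp
    finally show "norm ((norm (z y))^2 - (norm (z r))^2 - 0) \<le> e * norm (y - r)" by simp
   qed
  qed simp
 qed simp
 then have "(norm (z t))^2 = (norm (z 0))^2" using t' by (metis atLeastAtMost_iff order_refl)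
 then have "norm (z t) = norm (z 0)" by simp
 then show ?thesis using X0[OF x(1)] X0[OF x(2)] t' by (simp add: z_def dist_norm)
qed

definition Lv where "Lv = Mu + Mo * d"

lemma d0: "0 \<le> d" using d[OF y(1)] by simp
lemma Lv0: "0 \<le> Lv" using M0 d0 by (simp add: Lv_def)

lemma X_rel: "x \<in> C ==> t \<in> {0..<T} ==> norm (X t x - xs t) \<le> d"
 using X_isometric[OF _ y(1), of x t] d[of x] y(2)[of t] by (simp add: dist_norm)

lemma X_lipschitz:
 assumes "x \<in> C" "0 \<le> s" "s \<le> t" "t < T"
 shows "norm (X t x - X s x) \<le> Lv * (t - s)"
 unfolding X_increment[OF assms]
proof (rule integral_bound_AE[OF vi'[OF assms(1,2,4)] assms(3) N(1) _ Lv0])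
 fix r assume r: "r \<in> {s..t} - N"
 then have r': "r \<in> {0..<T}" "r \<in> {0..<T} - N" using assms by auto
 have "norm (rigid_velocity us om xs r (X r x)) \<le> norm (us r) + norm (om r) * norm (X r x - xs r)"
  unfolding rigid_velocity_def using norm_cross3_le norm_triangle_ineq by (meson add_left_mono order_trans)
 also have "\<dots> \<le> Mu + Mo * d" using N(2,3)[OF r'(2)] X_rel[OF assms(1) r'(1)] M0 by (intro add_mono mult_mono) auto
 finally show "norm (rigid_velocity us om xs r (X r x)) \<le> Lv" by (simp add: Lv_def)
qed

text \<open>At a common Lebesgue point of \<open>us\<close> and \<open>om\<close> the increment
  equals that of the velocity field with the relative position frozen at time \<open>t\<close>, up
  to an error quadratic in the time step. The condition on \<open>t\<close> does not mention
  \<open>x\<close>, so one null set of times serves all points of the body.\<close>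

lemma X_derivative:
 assumes x: "x \<in> C" and t: "t \<in> {0<..<T}"
  and lu: "\<And>e. e > 0 ==> \<exists>d>0. \<forall>h. 0 < h \<and> h < d \<longrightarrow> norm (integral {t..t + h} us /\<^sub>R h - us t) < e \<and> norm (integral {t - h..t} us /\<^sub>R h - us t) < e"
  and lo: "\<And>e. e > 0 ==> \<exists>d>0. \<forall>h. 0 < h \<and> h < d \<longrightarrow> norm (integral {t..t + h} om /\<^sub>R h - om t) < e \<and> norm (integral {t - h..t} om /\<^sub>R h - om t) < e"
 shows "((\<lambda>s. X s x) has_vector_derivative rigid_velocity us om xs t (X t x)) (at t)"
proof -
 define Y where "Y s = X s x - xs s" for s
 have key: "norm ((X q x - X p x) - (integral {p..q} us + cross3 (integral {p..q} om) (Y t))) \<le> Mo * (2 * Lv * (q - p)) * (q - p)"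
  if pq: "0 \<le> p" "p \<le> t" "t \<le> q" "q < T" for p q
 proof -
  have pq': "p \<le> q" using pq by simp
  have i1: "(\<lambda>r. cross3 (om r) (Y t)) integrable_on {p..q}" "integral {p..q} (\<lambda>r. cross3 (om r) (Y t)) = cross3 (integral {p..q} om) (Y t)"
   using integrable_linear[OF omi[OF pq(1,4)] bounded_bilinear.bounded_linear_left[OF bounded_bilinear_cross3]]
    integral_linear[OF omi[OF pq(1,4)] bounded_bilinear.bounded_linear_left[OF bounded_bilinear_cross3]] by (auto simp: o_def)
  have e: "rigid_velocity us om xs r (X r x) - (us r + cross3 (om r) (Y t)) = cross3 (om r) (Y r - Y t)" for r
   by (simp add: rigid_velocity_def Y_def cross3_diff_right)
  have i2: "(\<lambda>r. us r + cross3 (om r) (Y t)) integrable_on {p..q}" by (intro integrable_add usi i1 pq)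
  have i3: "(\<lambda>r. cross3 (om r) (Y r - Y t)) integrable_on {p..q}"
   using integrable_diff[OF vi'[OF x pq(1,4)] i2] unfolding e .
  have "(X q x - X p x) - (integral {p..q} us + cross3 (integral {p..q} om) (Y t)) = integral {p..q} (\<lambda>r. cross3 (om r) (Y r - Y t))"
   using Henstock_Kurzweil_Integration.integral_diff[OF vi'[OF x pq(1,4)] i2] Henstock_Kurzweil_Integration.integral_add[OF usi[OF pq(1,4)] i1(1)]
    X_increment[OF x pq(1) pq' pq(4)] i1(2) unfolding e by simp
  also have "norm \<dots> \<le> Mo * (2 * Lv * (q - p)) * (q - p)"
  proof (rule integral_bound_AE[OF i3 pq' N(1)])
   fix r assume r: "r \<in> {p..q} - N"
   then have r': "r \<in> {0..<T} - N" using pq by auto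
   have one: "norm (X r x - X t x) \<le> Lv * (q - p)" if "x \<in> C" for x
   proof (cases "r \<le> t")
    case True
    have "norm (X r x - X t x) \<le> Lv * (t - r)" using X_lipschitz[OF that, of r t] r pq True by (simp add: norm_minus_commute)
    also have "\<dots> \<le> Lv * (q - p)" using r pq Lv0 by (intro mult_left_mono) auto
    finally show ?thesis .
   next
    case False
    have "norm (X r x - X t x) \<le> Lv * (r - t)" using X_lipschitz[OF that, of t r] r pq False by simp
    also have "\<dots> \<le> Lv * (q - p)" using r pq Lv0 by (intro mult_left_mono) auto
    finally show ?thesis .
   qed
   have "Y r - Y t = (X r x - X t x) - (X r y - X t y)" using y(2)[of r] y(2)[of t] r' t by (simp add: Y_def)
   then have "norm (Y r - Y t) \<le> 2 * Lv * (q - p)"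
    using norm_triangle_ineq4[of "X r x - X t x" "X r y - X t y"] one[OF x] one[OF y(1)] by simp
   then show "norm (cross3 (om r) (Y r - Y t)) \<le> Mo * (2 * Lv * (q - p))"
    using norm_cross3_le[of "om r" "Y r - Y t"] N(3)[OF r'] M0
    by (meson mult_mono norm_ge_zero order_trans)
  qed (use pq Lv0 M0 in auto)
  finally show ?thesis .
 qed
 show ?thesis
 proof (rule has_vector_derivative_by_integral)
  fix e :: real assume e: "e > 0"
  define n where "n = norm (Y t)"
  have e3: "e / 3 > 0" "e / (3 * (n + 1)) > 0" using e by (auto simp: n_def add_nonneg_pos)
  obtain d1 where d1: "d1 > 0" "\<And>h. 0 < h ==> h < d1 ==> norm (integral {t..t + h} us /\<^sub>R h - us t) < e/3 \<and> norm (integral {t - h..t} us /\<^sub>R h - us t) < e/3"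
   using lu[OF e3(1)] by metis
  obtain d2 where d2: "d2 > 0" "\<And>h. 0 < h ==> h < d2 ==> norm (integral {t..t + h} om /\<^sub>R h - om t) < e / (3 * (n + 1)) \<and> norm (integral {t - h..t} om /\<^sub>R h - om t) < e / (3 * (n + 1))"
   using lo[OF e3(2)] by metis
  define c where "c = 2 * Mo * Lv + 1"
  have c0: "c > 0" using M0 Lv0 by (auto simp: c_def add_nonneg_pos)
  define d where "d = Min {d1, d2, t, T - t, e / (3 * c)}"
  have d: "d > 0" "d \<le> d1" "d \<le> d2" "d \<le> t" "d \<le> T - t" "d \<le> e / (3 * c)"
   using d1(1) d2(1) t e c0 by (auto simp: d_def)
  have main: "norm ((X q x - X p x) /\<^sub>R h - rigid_velocity us om xs t (X t x)) < e"
   if pq: "0 \<le> p" "p \<le> t" "t \<le> q" "q < T" and h: "h = q - p" "0 < h" "h < d"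
    and u: "norm (integral {p..q} us /\<^sub>R h - us t) < e/3" and o: "norm (integral {p..q} om /\<^sub>R h - om t) < e / (3 * (n + 1))" for p q h
  proof -
   define R where "R = (X q x - X p x) - (integral {p..q} us + cross3 (integral {p..q} om) (Y t))"
   have R: "norm R \<le> Mo * (2 * Lv * h) * h" unfolding R_def h(1) by (rule key[OF pq])
   have eq: "(X q x - X p x) /\<^sub>R h - rigid_velocity us om xs t (X t x)
     = (integral {p..q} us /\<^sub>R h - us t) + cross3 (integral {p..q} om /\<^sub>R h - om t) (Y t) + R /\<^sub>R h"
    by (simp add: R_def rigid_velocity_def Y_def scaleR_diff_right scaleR_add_right bounded_bilinear.diff_left[OF bounded_bilinear_cross3]
      bounded_bilinear.scaleR_left[OF bounded_bilinear_cross3])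
   have t2: "norm (cross3 (integral {p..q} om /\<^sub>R h - om t) (Y t)) \<le> e / 3"
   proof -
    have "norm (cross3 (integral {p..q} om /\<^sub>R h - om t) (Y t)) \<le> e / (3 * (n + 1)) * n"
     using norm_cross3_le[of "integral {p..q} om /\<^sub>R h - om t" "Y t"] o
     by (simp only: n_def) (meson less_imp_le mult_right_mono norm_ge_zero order_trans)
    also have "\<dots> = e / 3 * (n / (n + 1))" by simp
    also have "\<dots> \<le> e / 3 * 1" using e by (intro mult_left_mono) (auto simp: n_def divide_le_eq add_nonneg_pos)
    finally show ?thesis by simp
   qed
   have t3: "norm (R /\<^sub>R h) < e / 3"
   proof -
    have "norm (R /\<^sub>R h) = norm R / h" using h by (simp add: divide_inverse mult.commute)
    also have "\<dots> \<le> (Mo * (2 * Lv * h) * h) / h" using R h by (intro divide_right_mono) auto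
    also have "\<dots> = (2 * Mo * Lv) * h" using h by simp
    also have "\<dots> < c * h" using h by (simp add: c_def)
    also have "\<dots> \<le> c * d" using h c0 by (intro mult_left_mono) auto
    also have "\<dots> \<le> e / 3" using d(6) c0 by (simp add: pos_le_divide_eq mult_ac)
    finally show ?thesis .
   qed
   show ?thesis unfolding eq
    using u t2 t3 norm_triangle_ineq[of "(integral {p..q} us /\<^sub>R h - us t) + cross3 (integral {p..q} om /\<^sub>R h - om t) (Y t)" "R /\<^sub>R h"]
     norm_triangle_ineq[of "integral {p..q} us /\<^sub>R h - us t" "cross3 (integral {p..q} om /\<^sub>R h - om t) (Y t)"] by linarith
  qed
  show "\<exists>d>0. \<forall>h. 0 < h \<and> h < d \<longrightarrow>
   norm ((X (t + h) x - X t x) /\<^sub>R h - rigid_velocity us om xs t (X t x)) < e \<and>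
   norm ((X t x - X (t - h) x) /\<^sub>R h - rigid_velocity us om xs t (X t x)) < e"
  proof (intro exI[of _ d] conjI allI impI)
   fix h assume h: "0 < h \<and> h < d"
   show "norm ((X (t + h) x - X t x) /\<^sub>R h - rigid_velocity us om xs t (X t x)) < e"
    by (rule main) (use h d d1(2)[of h] d2(2)[of h] t in auto)
   show "norm ((X t x - X (t - h) x) /\<^sub>R h - rigid_velocity us om xs t (X t x)) < e"
    by (rule main) (use h d d1(2)[of h] d2(2)[of h] t in auto)
  qed (rule d(1))
 qed
qed

end

lemma bounded_AE_set_integrable:
 fixes g :: "real \<Rightarrow> 'b::euclidean_space"
 assumes "g \<in> lmeas" "AE x in lebesgue. norm (g x) \<le> M"
 shows "g integrable_on {a..b}"
proof -
 have i: "L1 (\<lambda>x. M * ind {a..b} x)"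
  using lmeasurable_cbox[of a b] by (intro integrable_mult_right) (simp add: lmeasurable_iff_integrable)
 have m: "(\<lambda>x. ind {a..b} x *\<^sub>R g x) \<in> lmeas"
  using lmeasurable_cbox[of a b] by (intro borel_measurable_scaleR assms(1) borel_measurable_indicator) (auto dest: fmeasurableD)
 have "L1 (\<lambda>x. ind {a..b} x *\<^sub>R g x)"
 proof (rule Bochner_Integration.integrable_bound[OF i m])
  show "AE x in lebesgue. norm (ind {a..b} x *\<^sub>R g x) \<le> norm (M * ind {a..b} x)"
   using assms(2) by eventually_elim (auto split: split_indicator)
 qed
 then have "set_integrable lebesgue {a..b} g" by (simp add: set_integrable_def)
 then show ?thesis by (rule set_lebesgue_integral_eq_integral(1))
qed

text \<open>Clamping the argument to \<open>{c n..T - c n}\<close> extends \<open>f\<close> to a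
  Lipschitz function on the line; each \<open>t\<close> is interior to one of these countably many
  intervals.\<close>

lemma lipschitz_interval_AE_differentiable:
 fixes f :: "real \<Rightarrow> real"
 assumes L: "L-lipschitz_on {0<..<T} f" and T: "0 < T"
 shows "AE t in lebesgue. t \<in> {0<..<T} \<longrightarrow> f differentiable (at t)"
proof -
 define c where "c n = T / (real n + 3)" for n
 have c: "0 < c n" "c n < T - c n" for n
 proof -
  show "0 < c n" using T by (simp add: c_def)
  have "c n \<le> T / 3" unfolding c_def using T by (intro divide_left_mono) auto
  then show "c n < T - c n" using T by linarith
 qed
 define cl where "cl n t = max (c n) (min (T - c n) t)" for n t
 have clr: "cl n t \<in> {0<..<T}" for n t using c[of n] by (auto simp: cl_def)
 have lip: "L-lipschitz_on UNIV (\<lambda>t. f (cl n t))" for n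
 proof (rule lipschitz_onI)
  fix x y
  have "dist (f (cl n x)) (f (cl n y)) \<le> L * dist (cl n x) (cl n y)" by (rule lipschitz_onD[OF L clr clr])
  also have "\<dots> \<le> L * dist x y" using lipschitz_on_nonneg[OF L]
   by (intro mult_left_mono) (auto simp: cl_def dist_real_def)
  finally show "dist (f (cl n x)) (f (cl n y)) \<le> L * dist x y" .
 qed (rule lipschitz_on_nonneg[OF L])
 have "AE t in lebesgue. \<forall>n. (\<lambda>t. f (cl n t)) differentiable (at t)"
  unfolding AE_all_countable using lipschitz_AE_differentiable[OF lip] by blast
 then show ?thesis
 proof eventually_elim
  case (elim t)
  show ?case
  proof
   assume t: "t \<in> {0<..<T}"
   obtain n where n: "T / min t (T - t) < real n" using reals_Archimedean2 by blast
   have m: "0 < min t (T - t)" using t by simp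
   have "T < real n * min t (T - t)" using n m by (simp add: pos_divide_less_eq)
   also have "\<dots> \<le> (real n + 3) * min t (T - t)" using m by (intro mult_right_mono) auto
   finally have "c n < min t (T - t)" using pos_divide_less_eq[of "real n + 3" T "min t (T - t)"] by (simp only: c_def mult.commute)
   then have tc: "t \<in> {c n<..<T - c n}" by auto
   obtain D where "((\<lambda>t. f (cl n t)) has_derivative D) (at t)" using elim unfolding differentiable_def by blast
   then have "(f has_derivative D) (at t)"
    by (rule has_derivative_transform_within_open[OF _ open_greaterThanLessThan tc]) (auto simp: cl_def max_def min_def)
   then show "f differentiable (at t)" unfolding differentiable_def by blast
  qed
 qed
qed

lemma setdist_le_add:
 assumes "\<And>b. b \<in> B ==> \<exists>a\<in>A. dist a b \<le> \<delta>" "B \<noteq> {}" "0 \<le> \<delta>"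
 shows "setdist A F \<le> setdist B F + \<delta>"
proof (cases "F = {}")
 case False
 have "setdist A F - \<delta> \<le> setdist B F"
 proof (rule le_setdistI[OF assms(2) False])
  fix b q assume bq: "b \<in> B" "q \<in> F"
  obtain a where a: "a \<in> A" "dist a b \<le> \<delta>" using assms(1)[OF bq(1)] by blast
  have "setdist A F \<le> dist a q" by (rule setdist_le_dist[OF a(1) bq(2)])
  then show "setdist A F - \<delta> \<le> dist b q" using dist_triangle[of a q b] a(2) by linarith
 qed
 then show ?thesis by simp
qed (use assms in simp)

text \<open>Extension by zero makes the function integrable over every interval of the line, as
  differentiation of integrals requires. On an interval within \<open>{0..<T}\<close> this alters at
  most the value at 0.\<close>

lemma in_Linf_truncation:
 assumes "in_Linf T f"
 obtains M where "0 \<le> M" "AE t in lebesgue. t \<in> {0<..<T} \<longrightarrow> norm (f t) \<le> M"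
  "\<And>a b. (\<lambda>t. ind {0<..<T} t *\<^sub>R f t) integrable_on {a..b}"
  "\<And>a b. 0 \<le> a ==> b < T ==> f integrable_on {a..b}"
proof -
 obtain M where M: "AE t in lebesgue. t \<in> {0<..<T} \<longrightarrow> norm (f t) \<le> M" using assms by (auto simp: in_Linf_def)
 have M': "AE t in lebesgue. t \<in> {0<..<T} \<longrightarrow> norm (f t) \<le> max 0 M" using M by eventually_elim auto
 have m: "(\<lambda>t. ind {0<..<T} t *\<^sub>R f t) \<in> lmeas"
  using assms by (simp add: in_Linf_def set_borel_measurable_def)
 have "AE t in lebesgue. norm (ind {0<..<T} t *\<^sub>R f t) \<le> max 0 M"
  using M' by eventually_elim (auto split: split_indicator)
 note i = bounded_AE_set_integrable[OF m this]
 have f: "f integrable_on {a..b}" if "0 \<le> a" "b < T" for a b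
  by (rule integrable_spike[OF i[of a b] negligible_sing[of 0]]) (use that in auto)
 show ?thesis using that[OF max.cobounded1 M' i f] .
qed

text \<open>The quantifiers over \<open>P\<close> and \<open>Q\<close> stand inside the
  almost-everywhere statement: the good times are those at which the distance is differentiable and
  both velocities have a Lebesgue point. The factor \<open>dist P Q\<close> on the left replaces the
  unit normal by \<open>P - Q\<close>.\<close>

theorem rigid_body_motion_kinematics:
 assumes m: "rigid_body_motion \<Omega> T S0 us om xs S" and S0: "open S0" "S0 \<noteq> {}" "bounded S0" and T: "0 < T"
 shows "\<And>t. t \<in> {0<..<T} ==> \<exists>\<psi>. is_isometry \<psi> \<and> S t = \<psi> ` S0"
  and "\<exists>L. L-lipschitz_on {0<..<T} (wall_distance \<Omega> S)"
  and "AE t in lebesgue. t \<in> {0<..<T} \<longrightarrow> wall_distance \<Omega> S differentiable (at t) \<and>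
   (\<forall>P Q. P \<in> frontier (S t) \<longrightarrow> Q \<in> frontier \<Omega> \<longrightarrow> dist P Q = wall_distance \<Omega> S t \<longrightarrow> 0 < dist P Q \<longrightarrow>
    deriv (wall_distance \<Omega> S) t * dist P Q = rigid_velocity us om xs t P \<bullet> (P - Q))"
proof -
 from m[unfolded rigid_body_motion_def] obtain X where
  XX': "\<forall>x0\<in>closure S0. \<forall>t\<in>{0..<T}. (\<lambda>s. rigid_velocity us om xs s (X s x0)) absolutely_integrable_on {0..t} \<and>
      X t x0 = x0 + (LINT s:{0..t}|lebesgue. rigid_velocity us om xs s (X s x0))"
  and y': "\<exists>y\<in>closure S0. \<forall>t\<in>{0..<T}. xs t = X t y"
  and St': "\<forall>t\<in>{0<..<T}. S t = X t ` S0 \<and> S t \<subseteq> \<Omega>"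
  by (elim exE conjE)
 from y' obtain y where y: "y \<in> closure S0" "\<And>t. t \<in> {0..<T} ==> xs t = X t y" by (elim bexE) simp
 note XX = XX'[THEN bspec, THEN bspec]
 have St: "S t = X t ` S0" if "t \<in> {0<..<T}" for t using St' that by simp
 have L: "in_Linf T us" "in_Linf T om" using m by (auto simp: rigid_body_motion_def)
 obtain Mu where Mu: "0 \<le> Mu" "AE t in lebesgue. t \<in> {0<..<T} \<longrightarrow> norm (us t) \<le> Mu"
  "\<And>a b. (\<lambda>t. ind {0<..<T} t *\<^sub>R us t) integrable_on {a..b}"
  "\<And>a b. 0 \<le> a ==> b < T ==> us integrable_on {a..b}" using in_Linf_truncation[OF L(1)] by metis
 obtain Mo where Mo: "0 \<le> Mo" "AE t in lebesgue. t \<in> {0<..<T} \<longrightarrow> norm (om t) \<le> Mo"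
  "\<And>a b. (\<lambda>t. ind {0<..<T} t *\<^sub>R om t) integrable_on {a..b}"
  "\<And>a b. 0 \<le> a ==> b < T ==> om integrable_on {a..b}" using in_Linf_truncation[OF L(2)] by metis
 have "AE t in lebesgue. t \<in> {0<..<T} \<longrightarrow> norm (us t) \<le> Mu \<and> norm (om t) \<le> Mo"
  using Mu(2) Mo(2) by eventually_elim auto
 then obtain N0 where N0: "N0 \<in> null_sets lebesgue" "{t. \<not> (t \<in> {0<..<T} \<longrightarrow> norm (us t) \<le> Mu \<and> norm (om t) \<le> Mo)} \<subseteq> N0"
  by (auto simp: eventually_ae_filter)
 have N0': "norm (us r) \<le> Mu \<and> norm (om r) \<le> Mo" if "r \<notin> N0" "r \<in> {0<..<T}" for r using N0(2) that by blast
 \<comment> \<open>The essential bounds concern the open time interval, the flow starts at 0; the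
   initial time joins the null set.\<close>
 define N where "N = insert 0 N0"
 have N: "negligible N" using N0(1) by (simp add: N_def negligible_iff_null_sets[symmetric])
 have Cc: "compact (closure S0)" using S0(3) by (simp add: compact_closure)
 interpret body_flow T "closure S0" us om xs X y Mu Mo "diameter (closure S0)" N
 proof
  show "norm (us r) \<le> Mu" "norm (om r) \<le> Mo" if "r \<in> {0..<T} - N" for r
   using that N0'[of r] by (auto simp: N_def)
  show "(\<lambda>s. rigid_velocity us om xs s (X s x)) integrable_on {0..t}" if "x \<in> closure S0" "t \<in> {0..<T}" for x t
   using XX[OF that] set_lebesgue_integral_eq_integral(1) by blast
  show "X t x = x + integral {0..t} (\<lambda>s. rigid_velocity us om xs s (X s x))" if "x \<in> closure S0" "t \<in> {0..<T}" for x t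
   using XX[OF that] set_lebesgue_integral_eq_integral(2) by metis
  show "dist x y \<le> diameter (closure S0)" if "x \<in> closure S0" for x
   by (rule diameter_bounded_bound[OF compact_imp_bounded[OF Cc] that y(1)])
 qed (use N Mu Mo y in auto)
 have Xc: "continuous_on (closure S0) (X t)" if "t \<in> {0..<T}" for t
  unfolding continuous_on_iff using X_isometric[OF _ _ that] by metis
 have Xcl: "X t x \<in> closure (S t)" if "x \<in> closure S0" "t \<in> {0<..<T}" for x t
 proof -
  have "X t ` closure S0 \<subseteq> closure (S t)"
   by (rule image_closure_subset[OF Xc closed_closure]) (use that St[OF that(2)] closure_subset[of "S t"] in auto)
  then show ?thesis using that by blast
 qed
 have clX: "closure (S t) \<subseteq> X t ` closure S0" if "t \<in> {0<..<T}" for t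
 proof (rule closure_minimal)
  show "S t \<subseteq> X t ` closure S0" using St[OF that] closure_subset by blast
  show "closed (X t ` closure S0)"
   by (rule compact_imp_closed[OF compact_continuous_image[OF Xc Cc]]) (use that in auto)
 qed
 show "\<exists>\<psi>. is_isometry \<psi> \<and> S t = \<psi> ` S0" if t: "t \<in> {0<..<T}" for t
 proof -
  obtain \<psi> where "is_isometry \<psi>" "\<And>x. x \<in> S0 ==> \<psi> x = X t x"
   using isometry_on_open_extends[OF S0(1,2), of "X t"] X_isometric closure_subset t
   by (metis atLeastLessThan_iff greaterThanLessThan_iff less_imp_le subsetD)
  then show ?thesis using St[OF t] by (intro exI[of _ \<psi>]) (auto simp: image_iff)
 qed
 have Xl: "dist (X s x) (X t x) \<le> Lv * dist s t" if "x \<in> closure S0" "s \<in> {0<..<T}" "t \<in> {0<..<T}" for x s t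
  using X_lipschitz[OF that(1), of s t] X_lipschitz[OF that(1), of t s] that
  by (cases "s \<le> t") (auto simp: dist_norm dist_real_def norm_minus_commute abs_if)
 have one: "wall_distance \<Omega> S s \<le> wall_distance \<Omega> S t + Lv * dist s t" if st: "s \<in> {0<..<T}" "t \<in> {0<..<T}" for s t
  unfolding wall_distance_def
 proof (rule setdist_le_add)
  fix b assume "b \<in> S t"
  then obtain x where x: "x \<in> S0" "b = X t x" using St[OF st(2)] by blast
  then show "\<exists>a\<in>S s. dist a b \<le> Lv * dist s t"
   using Xl[OF _ st, of x] closure_subset St[OF st(1)] by (intro bexI[of _ "X s x"]) auto
 qed (use St[OF st(2)] S0 Lv0 in auto)
 have wl: "Lv-lipschitz_on {0<..<T} (wall_distance \<Omega> S)"
 proof (rule lipschitz_onI[OF _ Lv0])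
  fix s t assume "s \<in> {0<..<T}" "t \<in> {0<..<T}"
  then show "dist (wall_distance \<Omega> S s) (wall_distance \<Omega> S t) \<le> Lv * dist s t"
   using one[of s t] one[of t s] by (simp add: dist_real_def abs_le_iff dist_commute abs_minus_commute)
 qed
 then show "\<exists>L. L-lipschitz_on {0<..<T} (wall_distance \<Omega> S)" by blast
 show "AE t in lebesgue. t \<in> {0<..<T} \<longrightarrow> wall_distance \<Omega> S differentiable (at t) \<and>
   (\<forall>P Q. P \<in> frontier (S t) \<longrightarrow> Q \<in> frontier \<Omega> \<longrightarrow> dist P Q = wall_distance \<Omega> S t \<longrightarrow> 0 < dist P Q \<longrightarrow>
    deriv (wall_distance \<Omega> S) t * dist P Q = rigid_velocity us om xs t P \<bullet> (P - Q))"
  using lipschitz_interval_AE_differentiable[OF wl T] lebesgue_differentiation_real[OF Mu(3)] lebesgue_differentiation_real[OF Mo(3)]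
 proof eventually_elim
  case (elim t)
  show ?case
  proof (intro impI)
   assume t: "t \<in> {0<..<T}"
   then have diff: "wall_distance \<Omega> S differentiable (at t)" using elim(1) by blast
   have leb: "\<exists>d>0. \<forall>h. 0 < h \<and> h < d \<longrightarrow> norm (integral {t..t + h} f /\<^sub>R h - f t) < e \<and> norm (integral {t - h..t} f /\<^sub>R h - f t) < e"
    if f: "\<forall>e>0. \<exists>d>0. \<forall>h. 0 < h \<and> h < d \<longrightarrow>
     norm (integral {t..t + h} (\<lambda>t. ind {0<..<T} t *\<^sub>R f t) /\<^sub>R h - ind {0<..<T} t *\<^sub>R f t) < e \<and>
     norm (integral {t - h..t} (\<lambda>t. ind {0<..<T} t *\<^sub>R f t) /\<^sub>R h - ind {0<..<T} t *\<^sub>R f t) < e" and e: "e > 0"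
    for f :: "real \<Rightarrow> real^3" and e
   proof -
    from f[THEN spec, of e, THEN mp, OF e] obtain d where d: "d > 0" "\<forall>h. 0 < h \<and> h < d \<longrightarrow>
     norm (integral {t..t + h} (\<lambda>t. ind {0<..<T} t *\<^sub>R f t) /\<^sub>R h - ind {0<..<T} t *\<^sub>R f t) < e \<and>
     norm (integral {t - h..t} (\<lambda>t. ind {0<..<T} t *\<^sub>R f t) /\<^sub>R h - ind {0<..<T} t *\<^sub>R f t) < e"
     by (elim exE conjE)
    have "integral {a..b} (\<lambda>t. ind {0<..<T} t *\<^sub>R f t) = integral {a..b} f" if "0 < a" "b < T" for a b
     by (rule Henstock_Kurzweil_Integration.integral_cong) (use that in auto)
    then have "norm (integral {t..t + h} f /\<^sub>R h - f t) < e \<and> norm (integral {t - h..t} f /\<^sub>R h - f t) < e"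
     if "0 < h" "h < min d (min t (T - t))" for h
     using d(2)[THEN spec, of h] that t by simp
    then show ?thesis using d(1) t by (intro exI[of _ "min d (min t (T - t))"]) auto
   qed
   have dX: "((\<lambda>s. X s x) has_vector_derivative rigid_velocity us om xs t (X t x)) (at t)" if "x \<in> closure S0" for x
    by (rule X_derivative[OF that t leb[OF elim(2)] leb[OF elim(3)]])
   show "wall_distance \<Omega> S differentiable (at t) \<and>
    (\<forall>P Q. P \<in> frontier (S t) \<longrightarrow> Q \<in> frontier \<Omega> \<longrightarrow> dist P Q = wall_distance \<Omega> S t \<longrightarrow> 0 < dist P Q \<longrightarrow>
    deriv (wall_distance \<Omega> S) t * dist P Q = rigid_velocity us om xs t P \<bullet> (P - Q))"
   proof (intro conjI diff allI impI)
    fix P Q assume P: "P \<in> frontier (S t)" and Q: "Q \<in> frontier \<Omega>" and PQ: "dist P Q = wall_distance \<Omega> S t" "0 < dist P Q"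
    obtain x where x: "x \<in> closure S0" "P = X t x" using P clX[OF t] unfolding frontier_def by blast
    define v where "v = rigid_velocity us om xs t P"
    have "((\<lambda>s. X s x - Q) has_derivative (\<lambda>h. h *\<^sub>R v)) (at t)"
     using dX[OF x(1)] x(2) by (auto simp: has_vector_derivative_def v_def intro!: derivative_eq_intros)
    moreover have "X t x - Q \<noteq> 0" using PQ(2) x(2) by auto
    ultimately have "((\<lambda>s. norm (X s x - Q)) has_derivative (\<lambda>h. (h *\<^sub>R v) \<bullet> sgn (X t x - Q))) (at t)"
     using has_derivative_compose[OF _ has_derivative_norm] by blast
    then have dn: "((\<lambda>s. norm (X s x - Q)) has_real_derivative v \<bullet> sgn (P - Q)) (at t)"
     using x(2) by (simp add: has_field_derivative_def mult_commute_abs)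
    have dw: "(wall_distance \<Omega> S has_real_derivative deriv (wall_distance \<Omega> S) t) (at t)"
     using diff by (simp add: DERIV_deriv_iff_real_differentiable)
    have "v \<bullet> sgn (P - Q) - deriv (wall_distance \<Omega> S) t = 0"
    proof (rule DERIV_local_min[OF DERIV_diff[OF dn dw]])
     show "0 < min t (T - t)" using t by simp
     show "\<forall>s. \<bar>t - s\<bar> < min t (T - t) \<longrightarrow> norm (X t x - Q) - wall_distance \<Omega> S t \<le> norm (X s x - Q) - wall_distance \<Omega> S s"
     proof (intro allI impI)
      fix s assume "\<bar>t - s\<bar> < min t (T - t)"
      then have s: "s \<in> {0<..<T}" by (auto simp: abs_if split: if_splits)
      have "wall_distance \<Omega> S s = setdist (closure (S s)) (frontier \<Omega>)" by (simp add: wall_distance_def)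
      also have "\<dots> \<le> dist (X s x) Q" by (rule setdist_le_dist[OF Xcl[OF x(1) s] Q])
      finally show "norm (X t x - Q) - wall_distance \<Omega> S t \<le> norm (X s x - Q) - wall_distance \<Omega> S s"
       using PQ(1) x(2) by (simp add: dist_norm)
     qed
    qed
    then have "deriv (wall_distance \<Omega> S) t * dist P Q = (v \<bullet> sgn (P - Q)) * norm (P - Q)" by (simp add: dist_norm)
    also have "\<dots> = v \<bullet> (P - Q)" using PQ(2) by (simp add: sgn_div_norm dist_norm)
    finally show "deriv (wall_distance \<Omega> S) t * dist P Q = rigid_velocity us om xs t P \<bullet> (P - Q)" by (simp add: v_def)
   qed
  qed
 qed
qed

section \<open>Boundaries of class \<open>C\<^sup>1\<^sup>,\<^sup>\<alpha>\<close> and \<open>C\<^sup>3\<close>\<close>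

lemma horiz_nth [simp]: "horiz x $ 1 = x $ 1" "horiz x $ 2 = x $ 2"
 by (simp_all add: horiz_def)

lemma norm_horiz_sq: "(norm (horiz x))^2 = hsq x"
 unfolding power2_norm_eq_inner by (simp add: inner_vec_def sum_2 hsq_def power2_eq_square)

lemma linear_horiz: "linear horiz"
 by (rule linearI) (auto simp: vec_eq_iff forall_2)

lemma norm_sq_horiz: "(norm x)^2 = hsq x + (x $ 3)^2" for x :: "real^3"
 unfolding power2_norm_eq_inner by (simp add: inner_vec_def sum_3 hsq_def power2_eq_square)

lemma norm_le_twice_component:
 fixes x :: "real^3"
 assumes "\<And>i. \<bar>x $ i\<bar> \<le> c"
 shows "norm x \<le> 2 * c"
proof (rule power2_le_imp_le)
 have "(x $ i)^2 \<le> c^2" for i using assms[of i] by (metis abs_ge_zero power2_abs power_mono)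
 from this[of 1] this[of 2] this[of 3] have "(norm x)^2 \<le> 3 * c^2" unfolding norm_sq_horiz hsq_def by linarith
 then show "(norm x)^2 \<le> (2 * c)^2" unfolding power_mult_distrib by (rule order_trans) simp
qed (use assms[of 1] in simp)

lemma norm_horiz_le: "norm (horiz x) \<le> norm x"
 by (rule power2_le_imp_le) (simp_all add: norm_horiz_sq norm_sq_horiz)

lemma norm_horiz_less_iff: "0 < s ==> norm (horiz x) < s \<longleftrightarrow> cyl s x"
 unfolding norm_horiz_sq[symmetric] using power2_less_imp_less[of "norm (horiz x)" s] power_strict_mono[of "norm (horiz x)" s 2] by auto

lemma hsq_orthogonal:
 assumes A: "orthogonal_transformation A" and n: "A (axis 3 1) = \<delta> *\<^sub>R axis 3 1" and d: "\<bar>\<delta>\<bar> = 1"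
 shows "A y $ 3 = \<delta> * y $ 3" "hsq (A y) = hsq y"
proof -
 have "A y \<bullet> A (axis 3 1) = y \<bullet> axis 3 1" using A by (simp add: orthogonal_transformation_def)
 then have e: "\<delta> * A y $ 3 = y $ 3" by (simp add: n inner_axis)
 have dd: "\<delta> * \<delta> = 1" using d by (metis abs_mult_self_eq mult_1)
 show y3: "A y $ 3 = \<delta> * y $ 3" using dd by (simp add: e[symmetric] mult.assoc[symmetric])
 have "norm (A y) = norm y" using A by (simp add: orthogonal_transformation_norm)
 then show "hsq (A y) = hsq y" using norm_sq_horiz[of y] norm_sq_horiz[of "A y"] dd
  by (simp add: y3 power_mult_distrib power2_eq_square[of \<delta>])
qed

lemma isometry_closure_image:
 assumes "is_isometry \<psi>"
 shows "closure (\<psi> ` D) = \<psi> ` closure D"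
proof -
 obtain A where A: "orthogonal_transformation A" "\<And>x. \<psi> x = \<psi> 0 + A x"
  using is_isometry_orthogonal[OF assms] by blast
 have im: "\<psi> ` E = (+) (\<psi> 0) ` A ` E" for E using A(2) by (metis image_cong image_image)
 have "closure (A ` D) = A ` closure D"
  using A(1) by (metis closure_injective_linear_image orthogonal_transformation_inj orthogonal_transformation_linear)
 then show ?thesis unfolding im by (simp add: closure_translation)
qed

lemma isometry_compl_image:
 assumes "is_isometry \<psi>" shows "- (\<psi> ` D) = \<psi> ` (- D)"
 using is_isometry_bij[OF assms] by (metis bij_image_Compl_eq)

lemma isometry_frontier_image:
 assumes "is_isometry \<psi>"
 shows "frontier (\<psi> ` D) = \<psi> ` frontier D"
proof -
 have "inj \<psi>" using is_isometry_bij[OF assms] by (simp add: bij_is_inj)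
 then show ?thesis
  unfolding frontier_closures isometry_compl_image[OF assms] isometry_closure_image[OF assms]
  by (simp add: image_Int)
qed

lemma isometry_open_image:
 assumes "is_isometry \<psi>" "open D"
 shows "open (\<psi> ` D)"
proof -
 have "closure (\<psi> ` (- D)) = \<psi> ` (- D)"
  unfolding isometry_closure_image[OF assms(1)] using assms(2) by (simp add: closure_closed closed_Compl)
 then have "closed (\<psi> ` (- D))" by (rule subst) (rule closed_closure)
 then show ?thesis unfolding isometry_compl_image[OF assms(1), symmetric] by (simp add: open_closed)
qed

text \<open>The common part of both regularity classes, without any statement on sides; it is all
  that the null-set argument for the boundary takes.\<close>

definition flat_boundary :: "real \<Rightarrow> real \<Rightarrow> real \<Rightarrow> (real^3) set \<Rightarrow> bool" where
 "flat_boundary \<alpha> k s D \<longleftrightarrow> (\<forall>x0\<in>frontier D. \<exists>R. is_isometry R \<and> R 0 = x0 \<and> R ` cusp_zone \<alpha> k s \<inter> frontier D = {})"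

text \<open>The body of \<open>uniformly_C1\<close> with its constants as parameters, so that they
  can be carried unchanged to every congruent copy of a domain.\<close>

definition C1_charts :: "real \<Rightarrow> real \<Rightarrow> real \<Rightarrow> (real^3) set \<Rightarrow> bool" where
 "C1_charts \<alpha> k s D \<longleftrightarrow> (\<forall>x0\<in>frontier D. \<exists>R. is_isometry R \<and> R 0 = x0 \<and>
    R ` cusp_zone \<alpha> k s \<inter> frontier D = {} \<and>
    R ` {x \<in> cusp_zone \<alpha> k s. x $ 3 > 0} \<subseteq> D \<and>
    R ` {x \<in> cusp_zone \<alpha> k s. x $ 3 < 0} \<inter> D = {})"

definition C3_charts :: "real \<Rightarrow> real \<Rightarrow> (real^3) set \<Rightarrow> bool" where
 "C3_charts K s D \<longleftrightarrow> (\<forall>x0\<in>frontier D. \<exists>R. \<exists>g :: real^2 \<Rightarrow> real.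
    is_isometry R \<and> R 0 = x0 \<and> Ck_on 3 (ball 0 s) g \<and>
    (\<forall>y\<in>ball 0 s. \<bar>g y\<bar> \<le> K * norm y ^ 2 \<and> norm (grad g y) \<le> K * norm y \<and>
      norm (grad (grad g) y) \<le> K \<and> norm (grad (grad (grad g)) y) \<le> K) \<and>
    (\<forall>x. norm (horiz x) < s \<and> \<bar>x $ 3\<bar> < K * s ^ 2 \<longrightarrow>
      (R x \<in> frontier D \<longleftrightarrow> x $ 3 = g (horiz x))))"

lemma isometry_image_memD: "is_isometry \<psi> ==> \<psi> x \<in> \<psi> ` D \<longleftrightarrow> x \<in> D"
 by (metis image_iff is_isometry_inv_cancel(2))

lemma C1_charts_isometry:
 assumes \<psi>: "is_isometry \<psi>" and c: "C1_charts \<alpha> k s D"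
 shows "C1_charts \<alpha> k s (\<psi> ` D)"
 unfolding C1_charts_def
proof
 have i: "inj \<psi>" using is_isometry_bij[OF \<psi>] by (simp add: bij_is_inj)
 fix x0 assume "x0 \<in> frontier (\<psi> ` D)"
 then obtain y where y: "x0 = \<psi> y" "y \<in> frontier D" by (auto simp: isometry_frontier_image[OF \<psi>])
 obtain R where R: "is_isometry R" "R 0 = y" "R ` cusp_zone \<alpha> k s \<inter> frontier D = {}"
   "R ` {x \<in> cusp_zone \<alpha> k s. x $ 3 > 0} \<subseteq> D" "R ` {x \<in> cusp_zone \<alpha> k s. x $ 3 < 0} \<inter> D = {}"
  using c y(2) unfolding C1_charts_def by meson
 have im: "(\<lambda>x. \<psi> (R x)) ` X = \<psi> ` (R ` X)" for X :: "(real^3) set" by (simp add: image_image)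
 show "\<exists>R. is_isometry R \<and> R 0 = x0 \<and> R ` cusp_zone \<alpha> k s \<inter> frontier (\<psi> ` D) = {} \<and>
    R ` {x \<in> cusp_zone \<alpha> k s. x $ 3 > 0} \<subseteq> \<psi> ` D \<and> R ` {x \<in> cusp_zone \<alpha> k s. x $ 3 < 0} \<inter> \<psi> ` D = {}"
 proof (intro exI[of _ "\<lambda>x. \<psi> (R x)"] conjI)
  show "is_isometry (\<lambda>x. \<psi> (R x))" using is_isometry_compose[OF \<psi> R(1)] .
  show "\<psi> (R 0) = x0" by (simp add: R(2) y(1))
  show "(\<lambda>x. \<psi> (R x)) ` cusp_zone \<alpha> k s \<inter> frontier (\<psi> ` D) = {}"
   using R(3) by (simp only: im isometry_frontier_image[OF \<psi>] image_Int[OF i, symmetric] image_empty)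
  show "(\<lambda>x. \<psi> (R x)) ` {x \<in> cusp_zone \<alpha> k s. x $ 3 > 0} \<subseteq> \<psi> ` D" using R(4) by auto
  show "(\<lambda>x. \<psi> (R x)) ` {x \<in> cusp_zone \<alpha> k s. x $ 3 < 0} \<inter> \<psi> ` D = {}"
   using R(5) by (simp only: im image_Int[OF i, symmetric] image_empty)
 qed
qed

lemma C3_charts_isometry:
 assumes \<psi>: "is_isometry \<psi>" and c: "C3_charts K s D"
 shows "C3_charts K s (\<psi> ` D)"
 unfolding C3_charts_def
proof
 fix x0 assume "x0 \<in> frontier (\<psi> ` D)"
 then obtain y where y: "x0 = \<psi> y" "y \<in> frontier D" by (auto simp: isometry_frontier_image[OF \<psi>])
 have f: "\<psi> x \<in> frontier (\<psi> ` D) \<longleftrightarrow> x \<in> frontier D" for x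
  by (simp only: isometry_frontier_image[OF \<psi>] isometry_image_memD[OF \<psi>])
 from bspec[OF c[unfolded C3_charts_def] y(2)]
 show "\<exists>R. \<exists>g :: real^2 \<Rightarrow> real. is_isometry R \<and> R 0 = x0 \<and> Ck_on 3 (ball 0 s) g \<and>
    (\<forall>y\<in>ball 0 s. \<bar>g y\<bar> \<le> K * norm y ^ 2 \<and> norm (grad g y) \<le> K * norm y \<and>
      norm (grad (grad g) y) \<le> K \<and> norm (grad (grad (grad g)) y) \<le> K) \<and>
    (\<forall>x. norm (horiz x) < s \<and> \<bar>x $ 3\<bar> < K * s ^ 2 \<longrightarrow>
      (R x \<in> frontier (\<psi> ` D) \<longleftrightarrow> x $ 3 = g (horiz x)))"
  apply (elim exE conjE)
  subgoal for R g by (rule exI[of _ "\<lambda>x. \<psi> (R x)"], rule exI[of _ g]) (simp add: f y(1) is_isometry_compose[OF \<psi>])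
  done
qed

lemma C1_charts_flat: "C1_charts \<alpha> k s D ==> flat_boundary \<alpha> k s D"
 unfolding C1_charts_def flat_boundary_def by meson

text \<open>The quadratic bound keeps the graph out of the cusp zone whose exponent
  \<open>1 + \<alpha>\<close> is 2.\<close>

lemma C3_charts_flat:
 assumes "C3_charts K s D" "0 < s" "0 < K"
 shows "flat_boundary 1 K s D"
 unfolding flat_boundary_def
proof
 fix x0 assume "x0 \<in> frontier D"
 from bspec[OF assms(1)[unfolded C3_charts_def] this]
 obtain R and g :: "real^2 \<Rightarrow> real" where R: "is_isometry R" "R 0 = x0" "\<And>y. y \<in> ball 0 s ==> \<bar>g y\<bar> \<le> K * norm y ^ 2"
  "\<And>x. norm (horiz x) < s ==> \<bar>x $ 3\<bar> < K * s ^ 2 ==> R x \<in> frontier D \<longleftrightarrow> x $ 3 = g (horiz x)"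
  by (elim exE conjE) (metis (no_types, lifting))
 have "R x \<notin> frontier D" if "x \<in> cusp_zone 1 K s" for x
 proof -
  have x: "K * norm (horiz x) ^ 2 < \<bar>x $ 3\<bar>" "\<bar>x $ 3\<bar> < K * s ^ 2" "norm (horiz x) < s"
   using that assms(2) by (cases "norm (horiz x) = 0"; simp add: cusp_zone_def powr_numeral)+
  show ?thesis using R(3)[of "horiz x"] R(4)[OF x(3,2)] x by auto
 qed
 then show "\<exists>R. is_isometry R \<and> R 0 = x0 \<and> R ` cusp_zone 1 K s \<inter> frontier D = {}"
  using R(1,2) by blast
qed

text \<open>The boundary is porous: below a small scale every cube with corner on it contains a ball of
 comparable size which misses it.  By Lebesgue's density theorem it is a null set.\<close>

lemma negligible_flat_boundary:
 assumes fl: "flat_boundary \<alpha> k s D" and k: "0 < k" "0 < s" "0 < \<alpha>"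
 shows "negligible (frontier D)"
proof -
 define f where "f = (indicator (frontier D) :: real^3 \<Rightarrow> real)"
 have fi: "f integrable_on cbox a b" for a b
 proof -
  have "frontier D \<inter> cbox a b \<in> lmeasurable" by (intro lmeasurable_compact compact_Int_closed closed_Int_compact frontier_closed compact_cbox)
  then show ?thesis unfolding f_def integrable_on_indicator .
 qed
 obtain N where N: "negligible N" "\<And>x e. x \<notin> N ==> 0 < e ==>
   \<exists>d>0. \<forall>h. 0 < h \<and> h < d \<longrightarrow> norm (integral (cbox x (x + h *\<^sub>R One)) f /\<^sub>R h ^ DIM(real^3) - f x) < e"
  using integrable_ccontinuous_explicit[OF fi] by metis
 define o1 where "o1 = (One :: real^3)"
 have DIM3: "DIM(real^3) = 3" by simp
 have One: "o1 $ i = 1" for i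
 proof -
  have "(One :: real^3) \<bullet> axis i 1 = 1" by (simp add: inner_sum_left inner_Basis if_distrib cong: if_cong)
  then show ?thesis by (simp add: o1_def inner_axis)
 qed
 have "frontier D \<subseteq> N"
 proof (rule ccontr)
  assume "\<not> frontier D \<subseteq> N"
  then obtain x where x: "x \<in> frontier D" "x \<notin> N" by blast
  obtain R where R: "is_isometry R" "R 0 = x" "R ` cusp_zone \<alpha> k s \<inter> frontier D = {}"
   using fl x(1) unfolding flat_boundary_def by blast
  obtain A where A: "orthogonal_transformation A" "\<And>y. R y = R 0 + A y"
   using is_isometry_orthogonal[OF R(1)] by blast
  define n where "n = A (axis 3 1)"
  have n1: "norm n = 1" using A(1) by (simp add: n_def orthogonal_transformation_norm)
  \<comment> \<open>1/512 = (1/8)^3 is the share of the cube taken by the empty cube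
    \<open>Q\<close> found below, so the density cannot come closer to 1 than this.\<close>
  obtain d where d: "d > 0" "\<And>h. 0 < h ==> h < d ==> norm (integral (cbox x (x + h *\<^sub>R o1)) f /\<^sub>R h ^ DIM(real^3) - f x) < 1/512"
   using N(2)[OF x(2), of "1/512"] by (auto simp: o1_def)
  have "eventually (\<lambda>h. h < d) (at_right (0::real))" using d(1) eventually_at_right_less by (metis eventually_at_right_field)
  moreover have "eventually (\<lambda>h. 2 * h < s) (at_right (0::real))"
   unfolding eventually_at_right_field using k by (intro exI[of _ "s/2"]) auto
  moreover have "eventually (\<lambda>h. 2 * h < k * s powr (1 + \<alpha>)) (at_right (0::real))"
   unfolding eventually_at_right_field using k by (intro exI[of _ "k * s powr (1 + \<alpha>) / 2"]) auto
  moreover have "eventually (\<lambda>h. h < (1 / (16 * k)) powr (1/\<alpha>) / 2) (at_right (0::real))"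
   unfolding eventually_at_right_field using k by (intro exI[of _ "(1 / (16 * k)) powr (1/\<alpha>) / 2"]) auto
  moreover have "eventually (\<lambda>h. 0 < h) (at_right (0::real))" by (simp add: eventually_at_right_less)
  ultimately have "eventually (\<lambda>h. 0 < h \<and> h < d \<and> 2 * h < s \<and> 2 * h < k * s powr (1 + \<alpha>) \<and> h < (1 / (16 * k)) powr (1/\<alpha>) / 2) (at_right (0::real))"
   by eventually_elim auto
  then obtain h where h: "0 < h" "h < d" "2 * h < s" "2 * h < k * s powr (1 + \<alpha>)" "h < (1 / (16 * k)) powr (1/\<alpha>) / 2"
   using eventually_happens'[OF trivial_limit_at_right_real] by blast
  have kh: "k * (2 * h) powr (1 + \<alpha>) < h / 8"
  proof -
   have "(2 * h) powr \<alpha> < ((1 / (16 * k)) powr (1/\<alpha>)) powr \<alpha>" using h k by (intro powr_less_mono2) auto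
   then have "(2 * h) powr \<alpha> < 1 / (16 * k)" using k by (simp add: powr_powr)
   then have "k * (2 * h) * (2 * h) powr \<alpha> < k * (2 * h) * (1 / (16 * k))" using k h by (intro mult_strict_left_mono) auto
   then show ?thesis using k h by (simp add: powr_add mult_ac)
  qed
  define m where "m = x + (h/2) *\<^sub>R o1"
  \<comment> \<open>The centre \<open>m\<close> of the cube is pushed by \<open>h / 4\<close> along
    the normal, away from the plane through \<open>x\<close>. The small cube \<open>Q\<close> around
    the new point then has height at least \<open>h / 8\<close>, more than the height
    \<open>k * (2 * h) powr (1 + \<alpha>)\<close> of the cusp.\<close>
  define \<epsilon> where "\<epsilon> = (if (m - x) \<bullet> n \<ge> 0 then 1 else - 1 :: real)"
  define y where "y = m + (\<epsilon> * h / 4) *\<^sub>R n"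
  define Q where "Q = cbox (y - (h/16) *\<^sub>R o1) (y + (h/16) *\<^sub>R o1)"
  have nb: "\<bar>n $ i\<bar> \<le> 1" for i using component_le_norm_cart[of n i] n1 by simp
  have zn: "\<bar>z $ i - y $ i\<bar> \<le> h / 16" if "z \<in> Q" for z i
  proof -
   have "y $ i - h / 16 \<le> z $ i" "z $ i \<le> y $ i + h / 16" using that unfolding Q_def mem_box_cart by (auto simp: One)
   then show ?thesis by linarith
  qed
  have ym: "\<bar>y $ i - x $ i - h / 2\<bar> \<le> h / 4" for i
  proof -
   have "y $ i - x $ i - h / 2 = \<epsilon> * (h/4) * n $ i" by (simp add: y_def m_def One)
   also have "\<bar>\<dots>\<bar> \<le> h / 4" using nb[of i] h by (auto simp: \<epsilon>_def abs_mult)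
   finally show ?thesis .
  qed
  have zx: "0 \<le> z $ i - x $ i \<and> z $ i - x $ i \<le> h" if "z \<in> Q" for z i
   using zn[OF that, of i] ym[of i] h(1) by arith
  have Qs: "Q \<subseteq> cbox x (x + h *\<^sub>R o1)"
   using zx by (auto simp: mem_box_cart One) (smt (verit))+
  have Qf: "z \<notin> frontier D" if "z \<in> Q" for z
  proof -
   have n2: "norm (z - x) \<le> 2 * h" by (rule norm_le_twice_component) (use zx[OF that] in \<open>simp add: abs_le_iff\<close>)
   have zy: "norm (z - y) \<le> h / 8" using norm_le_twice_component[of "z - y" "h / 16"] zn[OF that] by simp
   have "\<bar>(z - y) \<bullet> n\<bar> \<le> h / 8" using Cauchy_Schwarz_ineq2[of "z - y" n] zy n1 by simp
   moreover have "\<bar>(y - x) \<bullet> n\<bar> \<ge> h / 4"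
   proof -
    have nn: "n \<bullet> n = 1" using n1 by (simp add: norm_eq_1)
    have "(y - x) \<bullet> n = (m - x) \<bullet> n + \<epsilon> * h / 4" by (simp add: y_def inner_diff_left inner_add_left nn)
    then show ?thesis using h by (auto simp: \<epsilon>_def)
   qed
   moreover have "(z - x) \<bullet> n = (z - y) \<bullet> n + (y - x) \<bullet> n" by (simp add: inner_diff_left)
   ultimately have zn8: "h / 8 \<le> \<bar>(z - x) \<bullet> n\<bar>" by linarith
   define v where "v = inv R z"
   have Rv: "R v = z" by (simp add: v_def is_isometry_inv_cancel[OF R(1)])
   have Av: "A v = z - x" using A(2)[of v] Rv R(2) by simp
   have v3: "v $ 3 = (z - x) \<bullet> n"
   proof -
    have "A v \<bullet> n = v \<bullet> axis 3 1" using A(1) by (simp add: n_def orthogonal_transformation_def)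
    then show ?thesis by (simp add: Av inner_axis)
   qed
   have nv: "norm v \<le> 2 * h" using n2 A(1) Av by (metis orthogonal_transformation_norm)
   have hv: "norm (horiz v) \<le> 2 * h" using norm_horiz_le[of v] nv by simp
   have "k * norm (horiz v) powr (1 + \<alpha>) \<le> k * (2 * h) powr (1 + \<alpha>)"
    using hv k by (intro mult_left_mono powr_mono2) auto
   then have "v \<in> cusp_zone \<alpha> k s"
    using kh zn8 v3 hv h nv component_le_norm_cart[of v 3] by (simp add: cusp_zone_def)
   then show ?thesis using R(3) Rv by blast
  qed
  have Qm: "measure lebesgue Q = (h/8) ^ 3"
  proof -
   have "(y - (h/16) *\<^sub>R o1) $ i \<le> (y + (h/16) *\<^sub>R o1) $ i" for i using h by (simp add: One)
   from measure_cbox3[OF this] show ?thesis by (simp add: Q_def One eval_nat_numeral)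
  qed
  have Bm: "measure lebesgue (cbox x (x + h *\<^sub>R o1)) = h ^ 3"
  proof -
   have "x $ i \<le> (x + h *\<^sub>R o1) $ i" for i using h by (simp add: One)
   from measure_cbox3[OF this] show ?thesis by (simp add: One eval_nat_numeral)
  qed
  have "integral (cbox x (x + h *\<^sub>R o1)) f \<le> integral (cbox x (x + h *\<^sub>R o1)) (\<lambda>z. 1 - ind Q z)"
  proof (rule integral_le[OF fi])
   have "Q \<inter> cbox x (x + h *\<^sub>R o1) = Q" using Qs by blast
   then show "(\<lambda>z. 1 - ind Q z) integrable_on cbox x (x + h *\<^sub>R o1)"
    by (intro integrable_diff integrable_const) (simp add: integrable_on_indicator, simp add: Q_def)
   show "f z \<le> 1 - ind Q z" for z using Qf[of z] by (auto simp: f_def indicator_def)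
  qed
  also have "\<dots> = h ^ 3 - (h/8) ^ 3"
  proof -
   have QI: "Q \<inter> cbox x (x + h *\<^sub>R o1) = Q" using Qs by blast
   have i1: "ind Q integrable_on cbox x (x + h *\<^sub>R o1)"
    using QI by (simp add: integrable_on_indicator Q_def)
   have "integral (cbox x (x + h *\<^sub>R o1)) (ind Q) = (h/8)^3"
    using integral_indicator[of Q "cbox x (x + h *\<^sub>R o1)"] QI Qm by (simp add: Q_def)
   then show ?thesis using Bm by (simp add: integral_diff[OF integrable_const i1])
  qed
  finally have "integral (cbox x (x + h *\<^sub>R o1)) f / h ^ 3 \<le> (h ^ 3 - (h/8) ^ 3) / h ^ 3"
   using h by (intro divide_right_mono) auto
  also have "\<dots> = 1 - 1/512" using h by (simp add: field_simps eval_nat_numeral)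
  finally have "integral (cbox x (x + h *\<^sub>R o1)) f /\<^sub>R h ^ DIM(real^3) \<le> 1 - 1/512"
   by (simp only: DIM3 real_scaleR_def divide_inverse_commute)
  moreover have "f x = 1" using x(1) by (simp add: f_def)
  ultimately show False using d(2)[OF h(1,2)] by simp
 qed
 then show ?thesis using N(1) negligible_subset by blast
qed

section \<open>The axis of a chart at a contact point\<close>

lemma eventually_powr_less:
 assumes "0 < \<alpha>" "0 < (d::real)"
 shows "eventually (\<lambda>s. M * s powr (1 + \<alpha>) < d * s) (at_right 0)"
proof -
 have "((\<lambda>s::real. s powr \<alpha>) \<longlongrightarrow> 0) (at_right 0)"
  by (rule tendsto_zero_powrI[where b = \<alpha>]) (use assms eventually_at_right_less[of "0::real"] in \<open>auto intro: tendsto_ident_at elim: eventually_mono\<close>)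
 then have "((\<lambda>s. M * s powr \<alpha>) \<longlongrightarrow> 0) (at_right 0)" by (rule tendsto_mult_right_zero)
 from order_tendstoD(2)[OF this assms(2)] eventually_at_right_less[of "0::real"]
 show ?thesis
 proof eventually_elim
  case (elim s)
  then have "(M * s powr \<alpha>) * s < d * s" by (intro mult_strict_right_mono) auto
  then show ?case using elim by (simp add: powr_add mult_ac)
 qed
qed

lemma orthogonal_transformation_nth3:
 "orthogonal_transformation A ==> A y \<bullet> A (axis 3 1) = y $ 3" for A :: "real^3 \<Rightarrow> real^3"
 by (simp add: orthogonal_transformation_def inner_axis)

text \<open>If the axis of the cusp zone were tilted, the zone would enter the ball in the direction of
 the difference of the two axes.\<close>

lemma cusp_axis:
 fixes A :: "real^3 \<Rightarrow> real^3"
 assumes A: "orthogonal_transformation A" and h: "0 < h" "0 < k" "0 < s" "0 < \<alpha>"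
  and out: "\<And>y. y \<in> cusp_zone \<alpha> k s ==> y $ 3 < 0 ==> h \<le> norm (A y - h *\<^sub>R axis 3 1)"
 shows "A (axis 3 1) = axis 3 1"
proof (rule ccontr)
 define n where "n = A (axis 3 1)"
 define e where "e = (axis 3 1 :: real^3)"
 assume "A (axis 3 1) \<noteq> axis 3 1"
 then have ne: "n \<noteq> e" by (simp add: n_def e_def)
 have n1: "n \<bullet> n = 1" "e \<bullet> e = 1" using orthogonal_transformation_nth3[OF A, of "axis 3 1"] by (simp_all add: n_def e_def inner_axis)
 define d where "d = 1 - n \<bullet> e"
 define v where "v = e - n"
 have vv: "v \<bullet> v = 2 * d" using n1 by (simp add: v_def d_def inner_diff_left inner_diff_right inner_commute)
 have d: "d > 0" using ne vv by (metis inner_gt_zero_iff right_minus_eq v_def zero_less_mult_iff zero_less_numeral less_asym)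
 have ve: "v \<bullet> e = d" "v \<bullet> n = - d" using n1 by (simp_all add: v_def d_def inner_diff_left inner_diff_right inner_commute)
 define r where "r = sqrt (2 * d)"
 have nv: "norm v = r" by (simp add: r_def norm_eq_sqrt_inner vv)
 have r: "r > 0" using d by (simp add: r_def)
 obtain w where w: "A w = v" using A by (metis orthogonal_transformation_surj surjD)
 have nw: "norm w = r" using A w nv by (metis orthogonal_transformation_norm)
 have w3: "w $ 3 = - d" using orthogonal_transformation_nth3[OF A, of w] w ve(2) by (simp add: n_def)
 have lin: "A (t *\<^sub>R w) = t *\<^sub>R v" for t using A w by (simp add: orthogonal_transformation_linear linear_cmul)
 have "eventually (\<lambda>t. (k * r powr (1 + \<alpha>)) * t powr (1 + \<alpha>) < d * t) (at_right 0)" by (rule eventually_powr_less[OF h(4) d])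
 moreover have "eventually (\<lambda>t::real. t < h) (at_right 0)" "eventually (\<lambda>t::real. t < s / r) (at_right 0)"
  "eventually (\<lambda>t::real. t < k * s powr (1 + \<alpha>) / d) (at_right 0)"
  using h r d by (intro order_tendstoD(2)[OF tendsto_ident_at]; simp)+
 moreover have "eventually (\<lambda>t::real. 0 < t) (at_right 0)" by (rule eventually_at_right_less)
 ultimately have "eventually (\<lambda>t. 0 < t \<and> t < h \<and> t < s / r \<and> t < k * s powr (1 + \<alpha>) / d \<and> (k * r powr (1 + \<alpha>)) * t powr (1 + \<alpha>) < d * t) (at_right 0)"
  by eventually_elim auto
 then obtain t where t: "0 < t" "t < h" "t < s / r" "t < k * s powr (1 + \<alpha>) / d" "(k * r powr (1 + \<alpha>)) * t powr (1 + \<alpha>) < d * t"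
  using eventually_happens'[OF trivial_limit_at_right_real] by blast
 have nh: "norm (horiz (t *\<^sub>R w)) \<le> t * r" using norm_horiz_le[of "t *\<^sub>R w"] t nw by simp
 have "k * norm (horiz (t *\<^sub>R w)) powr (1 + \<alpha>) \<le> k * (t * r) powr (1 + \<alpha>)"
  using nh h by (intro mult_left_mono powr_mono2) auto
 also have "\<dots> < d * t" using t r by (simp add: powr_mult mult_ac)
 finally have "k * norm (horiz (t *\<^sub>R w)) powr (1 + \<alpha>) < d * t" .
 then have "t *\<^sub>R w \<in> cusp_zone \<alpha> k s"
 proof -
  have "\<bar>(t *\<^sub>R w) $ 3\<bar> = d * t" using t d by (simp add: w3 abs_mult)
  moreover have "d * t < k * s powr (1 + \<alpha>)" "t * r < s" using t(3,4) r d by (simp_all add: pos_less_divide_eq mult.commute)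
  ultimately show ?thesis using nh \<open>k * norm (horiz (t *\<^sub>R w)) powr (1 + \<alpha>) < d * t\<close> unfolding cusp_zone_def by simp
 qed
 then have "h \<le> norm (A (t *\<^sub>R w) - h *\<^sub>R e)" using out[of "t *\<^sub>R w"] t d by (simp add: w3 e_def)
 then have "h^2 \<le> (norm (t *\<^sub>R v - h *\<^sub>R e))^2" using h by (simp add: lin power_mono)
 also have "\<dots> = 2 * d * t^2 - 2 * t * h * d + h^2"
  unfolding power2_norm_eq_inner using vv ve n1
  by (simp add: inner_diff_left inner_diff_right inner_commute power2_eq_square algebra_simps)
 finally have "t * h * d \<le> d * t^2" by simp
 then show False using t d by (simp add: power2_eq_square)
qed

text \<open>Charts by graphs do not tell the sides apart, so the axis is determined only up to sign.
  If the direction \<open>m\<close> of the vertical, seen in the chart, had a horizontal part,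
  moving along the graph by \<open>\<delta> * t\<close> times that part would enter the empty ball
  to first order in \<open>t\<close>, whereas the graph deviates from its tangent plane only to
  second order.\<close>

lemma graph_axis:
 fixes A :: "real^3 \<Rightarrow> real^3"
 assumes A: "orthogonal_transformation A" and h: "0 < h" "0 < K" "0 < s" and \<delta>: "\<bar>\<delta>\<bar> = 1"
  and g: "\<And>y. y \<in> ball 0 s ==> \<bar>g y\<bar> \<le> K * norm y ^ 2"
  and out: "\<And>y. norm (horiz y) < s ==> \<bar>y $ 3\<bar> < K * s^2 ==> y $ 3 = g (horiz y) ==> h \<le> norm (A y - (\<delta> * h) *\<^sub>R axis 3 1)"
 shows "\<exists>\<epsilon>. \<bar>\<epsilon>\<bar> = 1 \<and> A (axis 3 1) = \<epsilon> *\<^sub>R axis 3 1"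
proof -
 define e where "e = (axis 3 1 :: real^3)"
 obtain m where m: "A m = e" using A by (metis orthogonal_transformation_surj surjD)
 have "norm m = 1" using A m by (metis orthogonal_transformation_norm e_def norm_axis_1)
 then have m1: "hsq m + (m $ 3)^2 = 1" using norm_sq_horiz[of m] by simp
 have dd: "\<delta> * \<delta> = 1" using \<delta> by (metis abs_mult_self_eq mult_1)
 show ?thesis
 proof (cases "hsq m = 0")
  case True
  then have "m $ 1 = 0" "m $ 2 = 0" by (auto simp: hsq_def sum_power2_eq_zero_iff)
  then have "m = (m $ 3) *\<^sub>R e" by (auto simp: vec_eq_iff forall_3 e_def axis_def)
  then have "e = (m $ 3) *\<^sub>R A e" using m A by (metis orthogonal_transformation_linear linear_cmul)
  moreover have m3: "\<bar>m $ 3\<bar> = 1" using m1 True by (auto simp: power2_eq_1_iff)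
  moreover have "(m $ 3) * (m $ 3) = 1" using m3 by (metis abs_mult_self_eq mult_1)
  ultimately have "A e = (m $ 3) *\<^sub>R e" by (metis scaleR_one scaleR_scaleR)
  then show ?thesis using m3 by (auto simp: e_def)
 next
  case False
  then have q0: "hsq m > 0" using hsq_nonneg[of m] by simp
  define q where "q = hsq m"
  have q: "0 < q" "q \<le> 1" using q0 m1 zero_le_power2[of "m $ 3"] unfolding q_def by linarith+
  have m3: "\<bar>m $ 3\<bar> \<le> 1" using m1 hsq_nonneg[of m] by (simp flip: abs_square_le_1)
  \<comment> \<open>After division by \<open>t * q\<close> this bounds the squared distance of the
    graph point from the centre of the ball, minus \<open>h^2\<close>; its limit
    \<open>- 2 * h\<close> is negative.\<close>
  have "((\<lambda>t. t + K^2 * t ^ 3 * q - 2 * h * (1 - K * t)) \<longlongrightarrow> 0 + K^2 * 0 ^ 3 * q - 2 * h * (1 - K * 0)) (at_right 0)"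
   by (intro tendsto_intros)
  then have "eventually (\<lambda>t. t + K^2 * t ^ 3 * q - 2 * h * (1 - K * t) < 0) (at_right 0)"
   by (rule order_tendstoD) (use h in simp)
  moreover have "eventually (\<lambda>t::real. t < s) (at_right 0)" "eventually (\<lambda>t::real. 0 < t) (at_right 0)"
   using h by (auto simp: eventually_at_right_field intro: exI[of _ s])
  ultimately have "eventually (\<lambda>t. 0 < t \<and> t < s \<and> t + K^2 * t ^ 3 * q - 2 * h * (1 - K * t) < 0) (at_right 0)"
   by eventually_elim auto
  then obtain t where t: "0 < t" "t < s" "t + K^2 * t ^ 3 * q - 2 * h * (1 - K * t) < 0"
   using eventually_happens'[OF trivial_limit_at_right_real] by blast
  define z where "z = (\<delta> * t) *\<^sub>R horiz m"
  define y where "y = (\<chi> i. if i = 3 then g z else (\<delta> * t) * m $ i)"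
  have hy: "horiz y = z" by (auto simp: vec_eq_iff forall_2 y_def z_def)
  have nz2: "norm z ^ 2 = t^2 * q" using \<delta> by (simp add: z_def power_mult_distrib norm_horiz_sq q_def abs_mult)
  have tq: "t^2 * q \<le> t^2" using q by (simp add: mult_left_le)
  have nz: "norm z < s"
  proof -
   have "norm z \<le> t" by (rule power2_le_imp_le) (use nz2 tq t in auto)
   then show ?thesis using t by simp
  qed
  have gz: "\<bar>g z\<bar> \<le> K * (t^2 * q)" using g[of z] nz nz2 by simp
  have y3: "y $ 3 = g z" by (simp add: y_def)
  have "t^2 < s^2" using t by (intro power_strict_mono) auto
  then have "K * (t^2 * q) < K * s^2" using tq h by (intro mult_strict_left_mono) auto
  then have "h \<le> norm (A y - (\<delta> * h) *\<^sub>R e)" unfolding e_def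
   by (intro out) (use nz gz in \<open>auto simp: hy y3\<close>)
  then have "h^2 \<le> (norm (A y - (\<delta> * h) *\<^sub>R e))^2" using h by (simp add: power_mono)
  also have "\<dots> = (norm y)^2 - 2 * (\<delta> * h) * (y \<bullet> m) + h^2"
  proof -
   have "A y \<bullet> e = y \<bullet> m" using A m by (metis orthogonal_transformation_def)
   moreover have "A y \<bullet> A y = y \<bullet> y" using A by (simp add: orthogonal_transformation_def)
   moreover have "e \<bullet> e = 1" by (simp add: e_def inner_axis)
   moreover have "(\<delta> * h) * (\<delta> * h) = h * h" using dd by (metis mult.assoc mult.left_commute mult_1)
   ultimately show ?thesis unfolding power2_norm_eq_inner
    by (simp add: inner_diff_left inner_diff_right inner_commute power2_eq_square algebra_simps)
  qed
  finally have 1: "2 * h * (\<delta> * (y \<bullet> m)) \<le> (norm y)^2" by (simp add: mult_ac)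
  have ym: "\<delta> * (y \<bullet> m) = t * q + \<delta> * (g z * m $ 3)"
  proof -
   have "y \<bullet> m = \<delta> * t * q + g z * m $ 3"
    by (simp add: inner_vec_def sum_3 y_def q_def hsq_def power2_eq_square algebra_simps)
   then show ?thesis using dd by (simp add: distrib_left)
  qed
  have "\<bar>\<delta> * (g z * m $ 3)\<bar> \<le> K * (t^2 * q) * 1"
   unfolding abs_mult \<delta> using gz m3 by (simp add: mult_mono[of "\<bar>g z\<bar>" _ "\<bar>m $ 3\<bar>" 1, simplified] order_trans[OF mult_right_le_one_le])
  then have "t * q - K * (t^2 * q) \<le> \<delta> * (y \<bullet> m)" unfolding ym by simp
  then have "2 * h * (t * q - K * (t^2 * q)) \<le> 2 * h * (\<delta> * (y \<bullet> m))" using h by (intro mult_left_mono) auto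
  also note 1
  also have "(norm y)^2 = t^2 * q + (g z)^2" using norm_sq_horiz[of y] norm_horiz_sq[of y] by (simp add: hy nz2 y3)
  also have "\<dots> \<le> t^2 * q + (K * (t^2 * q))^2" using gz by (metis abs_ge_zero add_left_mono power2_abs power_mono)
  finally have "(t * q) * (2 * h * (1 - K * t)) \<le> (t * q) * (t + K^2 * t ^ 3 * q)"
   by (simp add: power2_eq_square eval_nat_numeral algebra_simps)
  then have "2 * h * (1 - K * t) \<le> t + K^2 * t ^ 3 * q" using t q by (simp add: mult_le_cancel_left)
  then show ?thesis using t by simp
 qed
qed

lemma convex_cylinder: "convex {x. cyl s x}"
proof (cases "s = 0")
 case True
 then have "{x. cyl s x} = {}" using hsq_nonneg by (auto simp: not_less)
 then show ?thesis by (metis convex_empty)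
next
 case False
 have "horiz -` ball 0 \<bar>s\<bar> = {x. cyl s x}"
  using norm_horiz_less_iff[of "\<bar>s\<bar>"] False by (simp add: vimage_def)
 then show ?thesis using convex_linear_vimage[OF linear_horiz convex_ball[of 0 "\<bar>s\<bar>"]] by metis
qed

text \<open>Points of a region between two graphs are joined by a vertical, a horizontal and a vertical
 segment.\<close>

lemma connected_between_graphs:
 fixes lo hi :: "real^3 \<Rightarrow> real"
 assumes f: "\<And>x. cyl s x ==> lo x < x $ 3 ==> x $ 3 < hi x ==> x \<notin> frontier X"
  and z: "\<And>x. cyl s x ==> lo x < z \<and> z < hi x"
  and d: "\<And>x y. horiz x = horiz y ==> lo x = lo y \<and> hi x = hi y"
  and p: "p \<in> X" "cyl s p" "lo p < p $ 3" "p $ 3 < hi p"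
  and q: "cyl s q" "lo q < q $ 3" "q $ 3 < hi q"
 shows "q \<in> X"
proof -
 have step: "b \<in> X" if "a \<in> X" "closed_segment a b \<subseteq> {x. cyl s x \<and> lo x < x $ 3 \<and> x $ 3 < hi x}" for a b
 proof (rule ccontr)
  assume "b \<notin> X"
  then have "closed_segment a b \<inter> frontier X \<noteq> {}"
   using that(1) by (intro connected_Int_frontier) auto
  then show False using that(2) f by blast
 qed
 define lev where "lev x = (\<chi> i. if i = 3 then z else x $ i)" for x :: "real^3"
 have lev: "horiz (lev x) = horiz x" "lev x $ 3 = z" "hsq (lev x) = hsq x" for x
  by (auto simp: lev_def vec_eq_iff forall_2 hsq_def)
 have vert: "closed_segment a b \<subseteq> {x. cyl s x \<and> lo x < x $ 3 \<and> x $ 3 < hi x}"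
  if "horiz a = horiz b" "cyl s a" "lo a < a $ 3" "a $ 3 < hi a" "lo a < b $ 3" "b $ 3 < hi a" for a b
 proof
  fix x assume "x \<in> closed_segment a b"
  then obtain u where u: "x = (1 - u) *\<^sub>R a + u *\<^sub>R b" "0 \<le> u" "u \<le> 1" by (auto simp: in_segment)
  have hx: "horiz x = horiz a"
   by (simp add: u(1) linear_add[OF linear_horiz] linear_cmul[OF linear_horiz] that(1)[symmetric] flip: scaleR_add_left)
  then have "hsq x = hsq a" by (metis norm_horiz_sq)
  moreover have "x $ 3 \<in> {lo a<..<hi a}"
  proof -
   have "x $ 3 = (1 - u) *\<^sub>R a $ 3 + u *\<^sub>R b $ 3" by (simp add: u(1))
   also have "\<dots> \<in> {lo a<..<hi a}" using that u by (intro convexD) auto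
   finally show ?thesis .
  qed
  ultimately show "x \<in> {x. cyl s x \<and> lo x < x $ 3 \<and> x $ 3 < hi x}" using that(2) d[OF hx] by auto
 qed
 have hor: "closed_segment (lev p) (lev q) \<subseteq> {x. cyl s x \<and> lo x < x $ 3 \<and> x $ 3 < hi x}"
 proof
  fix x assume x: "x \<in> closed_segment (lev p) (lev q)"
  have "closed_segment (lev p) (lev q) \<subseteq> {x. cyl s x}"
   by (rule closed_segment_subset[OF _ _ convex_cylinder]) (use p q lev in auto)
  moreover have "x $ 3 = z"
  proof -
   obtain u where u: "x = (1 - u) *\<^sub>R lev p + u *\<^sub>R lev q" using x by (auto simp: in_segment)
   show ?thesis by (simp add: u lev algebra_simps)
  qed
  ultimately show "x \<in> {x. cyl s x \<and> lo x < x $ 3 \<and> x $ 3 < hi x}" using x z by auto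
 qed
 have "lev p \<in> X" by (rule step[OF p(1) vert]) (use p lev z[OF p(2)] in auto)
 then have "lev q \<in> X" by (rule step[OF _ hor])
 then show ?thesis
  by (rule step[OF _ vert]) (use q lev z[OF q(1)] d[of "lev q" q] in auto)
qed

section \<open>Taylor expansion of a boundary graph\<close>

lemma sum_partial_derivative:
 fixes f :: "real^2 \<Rightarrow> 'b::real_normed_vector"
 assumes "f differentiable_on ball 0 s" "y \<in> ball 0 s"
 shows "(f has_derivative (\<lambda>v. \<Sum>j\<in>UNIV. v $ j *\<^sub>R partial j f y)) (at y)"
proof -
 have d: "(f has_derivative frechet_derivative f (at y)) (at y)"
  using assms by (metis at_within_open differentiable_on_def frechet_derivative_works open_ball)
 have "frechet_derivative f (at y) v = (\<Sum>j\<in>UNIV. v $ j *\<^sub>R partial j f y)" for v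
 proof -
  have l: "linear (frechet_derivative f (at y))" using d has_derivative_linear by blast
  have "v = (\<Sum>j\<in>UNIV. v $ j *\<^sub>R axis j 1)" by (simp add: vec_eq_iff sum_2 forall_2 axis_def)
  then have "frechet_derivative f (at y) v = frechet_derivative f (at y) (\<Sum>j\<in>UNIV. v $ j *\<^sub>R axis j 1)" by simp
  also have "\<dots> = (\<Sum>j\<in>UNIV. v $ j *\<^sub>R partial j f y)" by (simp add: linear_sum[OF l] linear_cmul[OF l] partial_def)
  finally show ?thesis .
 qed
 then have "frechet_derivative f (at y) = (\<lambda>v. \<Sum>j\<in>UNIV. v $ j *\<^sub>R partial j f y)" by (rule ext)
 then show ?thesis using d by simp
qed

lemma has_derivative_vec:
 fixes f :: "'n::finite \<Rightarrow> 'a::real_normed_vector \<Rightarrow> 'b::euclidean_space"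
 assumes "\<And>i. (f i has_derivative f' i) (at x)"
 shows "((\<lambda>x. \<chi> i. f i x) has_derivative (\<lambda>v. \<chi> i. f' i v)) (at x)"
 by (subst has_derivative_componentwise_within)
  (auto simp: Basis_vec_def inner_axis intro!: has_derivative_inner_left assms)

text \<open>\<open>uniformly_C3\<close> bounds nested gradients, while the Taylor argument
  differentiates scalar components; this exchanges the two. Agreement on the ball is enough because
  the ball is open.\<close>

lemma partial_vec:
 fixes F :: "real^2 \<Rightarrow> 'b::euclidean_space^2"
 assumes eq: "\<And>y i. y \<in> ball 0 s ==> F y $ i = f i y" and d: "\<And>i. f i differentiable_on ball 0 s" and y: "y \<in> ball 0 s"
 shows "partial j F y $ i = partial j (f i) y"
proof -
 have "(F has_derivative (\<lambda>v. \<chi> i. \<Sum>j\<in>UNIV. v $ j *\<^sub>R partial j (f i) y)) (at y)"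
 proof (rule has_derivative_transform_within_open[OF _ open_ball y])
  show "((\<lambda>x. \<chi> i. f i x) has_derivative (\<lambda>v. \<chi> i. \<Sum>j\<in>UNIV. v $ j *\<^sub>R partial j (f i) y)) (at y)"
   by (intro has_derivative_vec sum_partial_derivative[OF d y])
  show "(\<chi> i. f i x) = F x" if "x \<in> ball 0 s" for x using eq[OF that] by (simp add: vec_eq_iff)
 qed
 moreover have "(\<Sum>k\<in>UNIV. axis j 1 $ k *\<^sub>R partial k (f i) y) = partial j (f i) y"
  using exhaust_2[of j] by (auto simp: sum_2 axis_def)
 ultimately show ?thesis using partial_eq[of F _ y j] by auto
qed

lemma abs_le_Frobenius3:
 fixes x :: "((real^2)^2)^2"
 shows "\<bar>x $ l $ k $ j\<bar> \<le> norm x"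
proof -
 have "\<bar>x $ l $ k $ j\<bar> \<le> norm (x $ l $ k)" by (rule component_le_norm_cart)
 also have "\<dots> \<le> norm (x $ l)" by (rule Finite_Cartesian_Product.norm_nth_le)
 also have "\<dots> \<le> norm x" by (rule Finite_Cartesian_Product.norm_nth_le)
 finally show ?thesis .
qed

text \<open>The quadratic part of \<open>g\<close> is even, so only the cubic Taylor remainder contributes.\<close>

lemma cubic_odd_part:
 fixes g :: "real^2 \<Rightarrow> real"
 assumes g: "Ck_on 3 (ball 0 s) g" and s: "0 < s"
  and g1: "\<And>y. y \<in> ball 0 s ==> norm (grad g y) \<le> K * norm y"
  and g3: "\<And>y. y \<in> ball 0 s ==> norm (grad (grad (grad g)) y) \<le> K" and y: "y \<in> ball 0 s"
 shows "\<bar>g y - g (- y)\<bar> \<le> 16 * K * norm y ^ 3"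
proof -
 let ?B = "ball (0 :: real^2) s"
 have d0: "g differentiable_on ?B" and d1: "\<And>j. partial j g differentiable_on ?B"
  and d2: "\<And>j k. partial k (partial j g) differentiable_on ?B"
  using g by (auto simp: numeral_3_eq_3)
 have p2: "grad (grad g) z $ k $ j = partial k (partial j g) z" if "z \<in> ?B" for z k j
  using partial_vec[of s "grad g" "\<lambda>j. partial j g" z k j] d1 that by (simp add: grad_def)
 have p2': "partial k (grad g) z $ j = partial k (partial j g) z" if "z \<in> ?B" for z k j
  using p2[OF that] by (simp add: grad_def)
 have p3: "grad (grad (grad g)) z $ l $ k $ j = partial l (partial k (partial j g)) z" if "z \<in> ?B" for z l k j
 proof -
  have "partial k (grad g) differentiable_on ?B" for k
   unfolding differentiable_on_def
  proof
   fix z assume z: "z \<in> ?B"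
   have "(partial k (grad g) has_derivative (\<lambda>v. \<chi> j. \<Sum>i\<in>UNIV. v $ i *\<^sub>R partial i (partial k (partial j g)) z)) (at z)"
   proof (rule has_derivative_transform_within_open[OF _ open_ball z])
    show "((\<lambda>x. \<chi> j. partial k (partial j g) x) has_derivative (\<lambda>v. \<chi> j. \<Sum>i\<in>UNIV. v $ i *\<^sub>R partial i (partial k (partial j g)) z)) (at z)"
     by (intro has_derivative_vec sum_partial_derivative[OF d2 z])
    show "(\<chi> j. partial k (partial j g) x) = partial k (grad g) x" if "x \<in> ?B" for x
     using p2'[OF that] by (simp add: vec_eq_iff)
   qed
   then show "partial k (grad g) differentiable (at z within ?B)"
    using differentiable_at_withinI differentiableI by blast
  qed
  then have "partial l (grad (grad g)) z $ k = partial l (partial k (grad g)) z"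
   using partial_vec[of s "grad (grad g)" "\<lambda>k. partial k (grad g)" z l k] that by (simp add: grad_def)
  moreover have "partial l (partial k (grad g)) z $ j = partial l (partial k (partial j g)) z"
   using partial_vec[of s "partial k (grad g)" "\<lambda>j. partial k (partial j g)" z l j] p2' d2 that by simp
  ultimately show ?thesis by (simp add: grad_def)
 qed
 have b3: "\<bar>partial l (partial k (partial j g)) z\<bar> \<le> K" if "z \<in> ?B" for z l k j
  using abs_le_Frobenius3[of "grad (grad (grad g)) z" l k j] g3[OF that] p3[OF that] by (simp add: grad_def)
 have K: "0 \<le> K" using b3[of 0] s abs_ge_zero order_trans by (metis centre_in_ball)
 have "norm (grad g 0) \<le> 0" using g1[of 0] s by simp
 then have z1: "partial j g 0 = 0" for j by (simp add: grad_def vec_eq_iff)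
 have line: "((\<lambda>t. f ((c * t) *\<^sub>R y)) has_real_derivative (\<Sum>j\<in>UNIV. (c * y $ j) * partial j f ((c * t) *\<^sub>R y))) (at t)"
  if "f differentiable_on ?B" "0 \<le> t" "t \<le> 1" "\<bar>c\<bar> = 1" for f :: "real^2 \<Rightarrow> real" and c t
 proof -
  have "norm ((c * t) *\<^sub>R y) \<le> norm y" using that by (simp add: abs_mult mult_left_le_one_le)
  then have B: "(c * t) *\<^sub>R y \<in> ?B" using y by simp
  have "((\<lambda>t. (c * t) *\<^sub>R y) has_derivative (\<lambda>u. (c * u) *\<^sub>R y)) (at t)" by (auto intro!: derivative_eq_intros)
  from has_derivative_compose[OF this sum_partial_derivative[OF that(1) B]]
  show ?thesis unfolding has_field_derivative_def
   by (rule has_derivative_eq_rhs) (simp add: fun_eq_iff sum_2 algebra_simps)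
 qed
 \<comment> \<open>The factors \<open>1\<close> and \<open>- 1\<close> stay visible so that
   \<open>line\<close> applies to both rays. At 0 the function and its first two derivatives vanish:
   values and second-order terms of the two rays cancel, and the gradient of \<open>g\<close> is
   zero there.\<close>
 define \<phi> where "\<phi> t = g ((1 * t) *\<^sub>R y) - g ((- 1 * t) *\<^sub>R y)" for t
 define \<phi>1 where "\<phi>1 t = (\<Sum>j\<in>UNIV. (1 * y $ j) * partial j g ((1 * t) *\<^sub>R y)) - (\<Sum>j\<in>UNIV. (- 1 * y $ j) * partial j g ((- 1 * t) *\<^sub>R y))" for t
 define \<phi>2 where "\<phi>2 t = (\<Sum>j\<in>UNIV. (1 * y $ j) * (\<Sum>k\<in>UNIV. (1 * y $ k) * partial k (partial j g) ((1 * t) *\<^sub>R y)))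
  - (\<Sum>j\<in>UNIV. (- 1 * y $ j) * (\<Sum>k\<in>UNIV. (- 1 * y $ k) * partial k (partial j g) ((- 1 * t) *\<^sub>R y)))" for t
 define \<phi>3 where "\<phi>3 t = (\<Sum>j\<in>UNIV. (1 * y $ j) * (\<Sum>k\<in>UNIV. (1 * y $ k) * (\<Sum>l\<in>UNIV. (1 * y $ l) * partial l (partial k (partial j g)) ((1 * t) *\<^sub>R y))))
  - (\<Sum>j\<in>UNIV. (- 1 * y $ j) * (\<Sum>k\<in>UNIV. (- 1 * y $ k) * (\<Sum>l\<in>UNIV. (- 1 * y $ l) * partial l (partial k (partial j g)) ((- 1 * t) *\<^sub>R y))))" for t
 have D1: "(\<phi> has_real_derivative \<phi>1 t) (at t)" if "0 \<le> t" "t \<le> 1" for t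
  unfolding \<phi>_def[abs_def] \<phi>1_def by (intro DERIV_diff line d0 that) simp_all
 have D2: "(\<phi>1 has_real_derivative \<phi>2 t) (at t)" if "0 \<le> t" "t \<le> 1" for t
  unfolding \<phi>1_def[abs_def] \<phi>2_def by (intro DERIV_diff DERIV_sum DERIV_cmult line d1 that) simp_all
 have D3: "(\<phi>2 has_real_derivative \<phi>3 t) (at t)" if "0 \<le> t" "t \<le> 1" for t
  unfolding \<phi>2_def[abs_def] \<phi>3_def by (intro DERIV_diff DERIV_sum DERIV_cmult line d2 that) simp_all
 have mvt: "\<bar>f t\<bar> \<le> M" if f: "\<And>t. 0 \<le> t ==> t \<le> 1 ==> (f has_real_derivative f' t) (at t)" "f 0 = 0"
   "\<And>t. 0 \<le> t ==> t \<le> 1 ==> \<bar>f' t\<bar> \<le> M" and t: "0 \<le> t" "t \<le> 1" for f f' :: "real \<Rightarrow> real" and t M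
 proof -
  have "norm (f t - f 0) \<le> M * norm (t - 0)"
   by (rule field_differentiable_bound[of "{0..1}" f f']) (use f t in \<open>auto intro: DERIV_subset\<close>)
  moreover have "M * t \<le> M" using f(3)[OF t] t by (intro mult_left_le) auto
  ultimately show ?thesis using f(2) t by simp
 qed
 \<comment> \<open>16 = 2 * 2 ^ 3: two rays, each with eight third-order partial
   derivatives.\<close>
 define M where "M = 16 * K * norm y ^ 3"
 have b: "\<bar>\<phi>3 t\<bar> \<le> M" if "0 \<le> t" "t \<le> 1" for t
 proof -
  have yj: "\<bar>y $ j\<bar> \<le> norm y" for j using component_le_norm_cart[of y j] by simp
  have s3: "\<bar>\<Sum>j\<in>UNIV. (c * y $ j) * (\<Sum>k\<in>UNIV. (c * y $ k) * (\<Sum>l\<in>UNIV. (c * y $ l) * partial l (partial k (partial j g)) ((c * t) *\<^sub>R y)))\<bar>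
   \<le> 8 * K * norm y ^ 3" if c: "\<bar>c\<bar> = 1" for c
  proof -
   have "norm ((c * t) *\<^sub>R y) \<le> norm y" using \<open>0 \<le> t\<close> \<open>t \<le> 1\<close> c by (simp add: abs_mult mult_left_le_one_le)
   then have B: "(c * t) *\<^sub>R y \<in> ?B" using y by simp
   have st: "\<bar>\<Sum>j\<in>UNIV. (c * y $ j) * F j\<bar> \<le> norm y * (2 * N)" if "\<And>j::2. \<bar>F j\<bar> \<le> N" for F N
   proof -
    have "\<bar>\<Sum>j\<in>UNIV. (c * y $ j) * F j\<bar> \<le> (\<Sum>j\<in>(UNIV::2 set). norm y * N)"
     by (rule order_trans[OF sum_abs sum_mono]) (use yj that c in \<open>auto simp: abs_mult intro!: mult_mono\<close>)
    then show ?thesis by (simp add: sum_2)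
   qed
   have "\<bar>\<Sum>j\<in>UNIV. (c * y $ j) * (\<Sum>k\<in>UNIV. (c * y $ k) * (\<Sum>l\<in>UNIV. (c * y $ l) * partial l (partial k (partial j g)) ((c * t) *\<^sub>R y)))\<bar>
    \<le> norm y * (2 * (norm y * (2 * (norm y * (2 * K)))))"
    by (intro st b3 B)
   then show ?thesis by (simp add: eval_nat_numeral mult_ac)
  qed
  have "\<bar>\<phi>3 t\<bar> \<le> 8 * K * norm y ^ 3 + 8 * K * norm y ^ 3"
   unfolding \<phi>3_def by (rule order_trans[OF abs_triangle_ineq4 add_mono[OF s3 s3]]) simp_all
  then show ?thesis by (simp add: M_def)
 qed
 have "\<phi>2 0 = 0" "\<phi>1 0 = 0" "\<phi> 0 = 0" by (simp_all add: \<phi>_def \<phi>1_def \<phi>2_def z1 sum_negf)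
 then have "\<bar>\<phi> 1\<bar> \<le> M"
  using mvt[OF D1 _ mvt[OF D2 _ mvt[OF D3 _ b]]] by simp
 then show ?thesis by (simp add: \<phi>_def M_def)
qed

text \<open>The axis of the chart is the vertical up to a sign, which is absorbed in
  \<open>\<beta>\<close>; \<open>L\<close> gives the horizontal coordinates of the chart.
  \<open>\<delta>\<close> says on which side of \<open>c\<close> the ball without boundary points
  lies: above the wall point, below the body point.\<close>

lemma C3_graph:
 assumes c: "C3_charts K s X" "0 < K" "0 < s" and c0: "c \<in> frontier X" and h: "0 < h" and \<delta>: "\<bar>\<delta>\<bar> = 1"
  and out: "\<And>z. z \<in> frontier X ==> h \<le> norm (z - c - (\<delta> * h) *\<^sub>R axis 3 1)"
 shows "\<exists>\<beta> Db. (\<forall>x. cyl s x \<longrightarrow> GDERIV \<beta> x :> Db x) \<and> continuous_on {x. cyl s x} Db \<and> (\<forall>x. Db x $ 3 = 0) \<and>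
  (\<forall>x. cyl s x \<longrightarrow> \<bar>\<beta> x\<bar> \<le> K * hsq x) \<and>
  (\<forall>x r. cyl r x \<longrightarrow> 0 < r \<longrightarrow> r \<le> s \<longrightarrow> \<bar>\<beta> x - \<beta> (flip 1 (flip 2 x))\<bar> \<le> 16 * K * r ^ 3) \<and>
  (\<forall>x y. horiz x = horiz y \<longrightarrow> \<beta> x = \<beta> y) \<and>
  (\<forall>x. cyl s x \<longrightarrow> \<bar>x $ 3\<bar> < K * s^2 \<longrightarrow> (c + x \<in> frontier X \<longleftrightarrow> x $ 3 = \<beta> x))"
proof -
 from bspec[OF c(1)[unfolded C3_charts_def] c0]
 obtain R and g :: "real^2 \<Rightarrow> real" where R: "is_isometry R" "R 0 = c" and g3: "Ck_on 3 (ball 0 s) g"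
  and gall: "\<forall>y\<in>ball 0 s. \<bar>g y\<bar> \<le> K * norm y ^ 2 \<and> norm (grad g y) \<le> K * norm y \<and>
      norm (grad (grad g) y) \<le> K \<and> norm (grad (grad (grad g)) y) \<le> K"
  and fr: "\<forall>x. norm (horiz x) < s \<and> \<bar>x $ 3\<bar> < K * s ^ 2 \<longrightarrow> (R x \<in> frontier X \<longleftrightarrow> x $ 3 = g (horiz x))"
  by (elim exE conjE) (rule that)
 have gb: "\<bar>g y\<bar> \<le> K * norm y ^ 2" "norm (grad g y) \<le> K * norm y" "norm (grad (grad (grad g)) y) \<le> K" if "y \<in> ball 0 s" for y
  using bspec[OF gall that] by blast+
 obtain A where A: "orthogonal_transformation A" "\<And>y. R y = R 0 + A y"
  using is_isometry_orthogonal[OF R(1)] by blast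
 have fr': "c + A x \<in> frontier X \<longleftrightarrow> x $ 3 = g (horiz x)" if "norm (horiz x) < s" "\<bar>x $ 3\<bar> < K * s^2" for x
  using fr[rule_format, of x] that A(2)[of x] R(2) by metis
 obtain \<epsilon> where e: "\<bar>\<epsilon>\<bar> = 1" "A (axis 3 1) = \<epsilon> *\<^sub>R axis 3 1"
 proof -
  have "h \<le> norm (A y - (\<delta> * h) *\<^sub>R axis 3 1)" if "norm (horiz y) < s" "\<bar>y $ 3\<bar> < K * s^2" "y $ 3 = g (horiz y)" for y
   using out[of "c + A y"] fr'[OF that(1,2)] that(3) by simp
  from graph_axis[OF A(1) h c(2,3) \<delta> gb(1) this] show ?thesis using that by blast
 qed
 have ee: "\<epsilon> * \<epsilon> = 1" using e(1) by (metis abs_mult_self_eq mult_1)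
 have linA: "linear A" using A(1) by (rule orthogonal_transformation_linear)
 define L where "L x = (\<chi> j::2. x \<bullet> A (axis (if j = 1 then 1 else 2) 1))" for x
 define iA where "iA = inv A"
 have iA: "A (iA x) = x" for x using A(1) by (simp add: iA_def orthogonal_transformation_surj surj_f_inv_f)
 have iA_nth: "iA x $ i = x \<bullet> A (axis i 1)" for x i
 proof -
  have "A (iA x) \<bullet> A (axis i 1) = iA x \<bullet> axis i 1" using A(1) by (simp add: orthogonal_transformation_def)
  then show ?thesis by (simp add: iA inner_axis)
 qed
 have L: "L x = horiz (iA x)" for x by (simp add: vec_eq_iff forall_2 L_def iA_nth)
 have i3: "iA x $ 3 = \<epsilon> * x $ 3" and hs: "hsq (iA x) = hsq x" for x
  using hsq_orthogonal[OF A(1) e(2,1), of "iA x"] ee by (simp_all add: iA)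
 have nL: "norm (L x) ^ 2 = hsq x" for x by (simp add: L norm_horiz_sq hs)
 have LB: "L x \<in> ball 0 s \<longleftrightarrow> cyl s x" for x using norm_horiz_less_iff[OF c(3), of "iA x"] by (simp add: L hs)
 define \<beta> where "\<beta> x = \<epsilon> * g (L x)" for x
 define Db where "Db x = \<epsilon> *\<^sub>R (\<Sum>j\<in>UNIV. partial j g (L x) *\<^sub>R A (axis (if j = 1 then 1 else 2) 1))" for x
 have d0: "g differentiable_on ball 0 s" and d1: "\<And>j. partial j g differentiable_on ball 0 s"
  using g3 by (auto simp: numeral_3_eq_3)
 have linL: "bounded_linear L"
  unfolding linear_conv_bounded_linear[symmetric]
  by (rule linearI) (simp_all add: vec_eq_iff L_def inner_add_left)
 have 1: "GDERIV \<beta> x :> Db x" if "cyl s x" for x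
 proof -
  have "((\<lambda>x. g (L x)) has_derivative (\<lambda>v. \<Sum>j\<in>UNIV. L v $ j *\<^sub>R partial j g (L x))) (at x)"
   by (rule has_derivative_compose[OF bounded_linear_imp_has_derivative[OF linL] sum_partial_derivative[OF d0]]) (use LB that in simp)
  from has_derivative_mult_right[OF this, of \<epsilon>]
  show ?thesis unfolding gderiv_def \<beta>_def[abs_def]
   by (rule has_derivative_eq_rhs) (simp add: fun_eq_iff Db_def inner_sum_right L_def mult_ac)
 qed
 have 2: "continuous_on {x. cyl s x} Db"
 proof -
  have "continuous_on {x. cyl s x} (\<lambda>x. partial j g (L x))" for j
   by (rule continuous_on_compose2[OF differentiable_imp_continuous_on[OF d1] linear_continuous_on[OF linL]]) (use LB in auto)
  then show ?thesis unfolding Db_def[abs_def] by (intro continuous_intros)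
 qed
 have 3: "Db x $ 3 = 0" for x
 proof -
  have "A (axis i 1) $ 3 = 0" if "i \<noteq> 3" for i
   using hsq_orthogonal(1)[OF A(1) e(2,1), of "axis i 1"] that by (simp add: axis_def)
  then show ?thesis by (simp add: Db_def sum_2)
 qed
 have 4: "\<bar>\<beta> x\<bar> \<le> K * hsq x" if "cyl s x" for x
  using gb(1)[of "L x"] that LB[of x] nL[of x] e(1) by (simp add: \<beta>_def abs_mult)
 have Lf: "L (flip 1 (flip 2 x)) = - L x" for x
 proof -
  have f: "flip 1 (flip 2 x) = - x + (2 * x $ 3) *\<^sub>R axis 3 1" by (simp add: vec_eq_iff forall_3 flip_def axis_def)
  have "axis 3 1 \<bullet> A (axis i 1) = 0" if "i \<noteq> 3" for i
  proof -
   have "A (axis i 1) $ 3 = 0" using hsq_orthogonal(1)[OF A(1) e(2,1), of "axis i 1"] that by (simp add: axis_def)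
   then show ?thesis by (simp add: inner_commute inner_axis)
  qed
  then show ?thesis unfolding vec_eq_iff forall_2 f L_def by (simp add: inner_add_left inner_diff_left)
 qed
 have 5: "\<bar>\<beta> x - \<beta> (flip 1 (flip 2 x))\<bar> \<le> 16 * K * r ^ 3" if "cyl r x" "0 < r" "r \<le> s" for x r
 proof -
  have Lr: "norm (L x) < r" using that nL[of x] by (metis less_imp_le power2_less_imp_less)
  have "\<bar>\<beta> x - \<beta> (flip 1 (flip 2 x))\<bar> = \<bar>g (L x) - g (- L x)\<bar>"
   by (simp add: \<beta>_def Lf abs_mult e(1) flip: right_diff_distrib)
  also have "\<dots> \<le> 16 * K * norm (L x) ^ 3"
   by (rule cubic_odd_part[OF g3 c(3) gb(2,3)]) (use Lr that in auto)
  also have "\<dots> \<le> 16 * K * r ^ 3" using Lr c(2) by (intro mult_left_mono power_mono) auto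
  finally show ?thesis .
 qed
 have 6: "\<beta> x = \<beta> y" if "horiz x = horiz y" for x y
 proof -
  have "hsq (x - y) = 0" using that by (metis linear_diff[OF linear_horiz] norm_horiz_sq norm_zero right_minus_eq zero_power2)
  then have "L (x - y) = 0" using nL[of "x - y"] by simp
  then have "L x = L y" using linL by (simp add: linear_diff bounded_linear.linear)
  then show ?thesis by (simp add: \<beta>_def)
 qed
 have 7: "c + x \<in> frontier X \<longleftrightarrow> x $ 3 = \<beta> x" if "cyl s x" "\<bar>x $ 3\<bar> < K * s^2" for x
 proof -
  have "c + A (iA x) \<in> frontier X \<longleftrightarrow> iA x $ 3 = g (horiz (iA x))"
   by (rule fr') (use that LB[of x] e(1) in \<open>simp_all add: L i3 abs_mult\<close>)
  also have "\<dots> \<longleftrightarrow> x $ 3 = \<beta> x" unfolding i3 L[symmetric] \<beta>_def using ee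
   by (metis mult.assoc mult_1)
  finally show ?thesis by (simp add: iA)
 qed
 show ?thesis by (rule exI[of _ \<beta>], rule exI[of _ Db]) (use 1 2 3 4 5 6 7 in blast)
qed

text \<open>The contact situation in its own frame: \<open>Q\<close> is the origin and
  \<open>P\<close> lies at height \<open>h\<close> on the third axis. Tangency is a consequence: the
  ball of radius \<open>h\<close> about \<open>P\<close> contains no point of the wall, and the one
  about \<open>Q\<close> no point of the body.\<close>

locale contact =
 fixes \<Omega> S :: "(real^3) set" and h :: real
 assumes op: "open \<Omega>" "open S" "S \<subseteq> \<Omega>" and h0: "0 < h"
  and Q: "0 \<in> frontier \<Omega>" and P: "h *\<^sub>R axis 3 1 \<in> frontier S"
  and dist: "\<And>x y. x \<in> S ==> y \<in> frontier \<Omega> ==> h \<le> norm (x - y)"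
begin

lemma dist_closure: "x \<in> closure S ==> y \<in> frontier \<Omega> ==> h \<le> norm (x - y)"
proof -
 assume x: "x \<in> closure S" and y: "y \<in> frontier \<Omega>"
 have "S \<subseteq> {x. h \<le> norm (x - y)}" using dist y by blast
 moreover have "closed {x. h \<le> norm (x - y)}" by (intro closed_Collect_le continuous_intros)
 ultimately show ?thesis using x closure_minimal by blast
qed

lemma P_in: "h *\<^sub>R axis 3 1 \<in> \<Omega>"
proof -
 have "h *\<^sub>R axis 3 1 \<in> closure S" using P by (simp add: frontier_def)
 then have "h *\<^sub>R axis 3 1 \<in> closure \<Omega>" "h *\<^sub>R axis 3 1 \<notin> frontier \<Omega>"
  using closure_mono[OF op(3)] dist_closure[of "h *\<^sub>R axis 3 1" "h *\<^sub>R axis 3 1"] h0 by auto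
 then show ?thesis by (simp add: frontier_def interior_open[OF op(1)])
qed

lemma P_far: "y \<in> frontier \<Omega> ==> h \<le> norm (y - h *\<^sub>R axis 3 1)"
 using dist_closure[of "h *\<^sub>R axis 3 1" y] P by (simp add: frontier_def norm_minus_commute)

lemma Q_far: "x \<in> closure S ==> h \<le> norm x"
 using dist_closure[of x 0] Q by simp

lemma ball_P: "norm (y - h *\<^sub>R axis 3 1) < h ==> y \<in> \<Omega>"
proof (rule ccontr)
 assume y: "norm (y - h *\<^sub>R axis 3 1) < h" "y \<notin> \<Omega>"
 have "ball (h *\<^sub>R axis 3 1) h \<inter> frontier \<Omega> \<noteq> {}"
 proof (rule connected_Int_frontier)
  have "h *\<^sub>R axis 3 1 \<in> ball (h *\<^sub>R axis 3 1) h" using h0 by simp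
  then show "ball (h *\<^sub>R axis 3 1) h \<inter> \<Omega> \<noteq> {}" using P_in by blast
  have "y \<in> ball (h *\<^sub>R axis 3 1) h" using y(1) by (simp add: dist_norm norm_minus_commute)
  then show "ball (h *\<^sub>R axis 3 1) h - \<Omega> \<noteq> {}" using y(2) by blast
 qed simp
 then obtain z where "norm (h *\<^sub>R axis 3 1 - z) < h" "z \<in> frontier \<Omega>" by (auto simp: dist_norm)
 then show False using P_far[of z] by (simp add: norm_minus_commute)
qed

text \<open>A priori the chart at \<open>Q\<close> may be tilted. Its lower zone misses
  \<open>\<Omega>\<close>, which contains the ball of radius \<open>h\<close> about
  \<open>P\<close>, so \<open>cusp_axis\<close> makes its axis vertical; since the zone is invariant
  under rotations about that axis, the chart itself drops out.\<close>

lemma lower_zone: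
 assumes c: "C1_charts \<alpha> k s \<Omega>" "0 < k" "0 < s" "0 < \<alpha>"
  and x: "x \<in> cusp_zone \<alpha> k s" "x $ 3 < 0"
 shows "x \<notin> \<Omega>"
proof -
 obtain R where R: "is_isometry R" "R 0 = 0" "R ` {x \<in> cusp_zone \<alpha> k s. x $ 3 < 0} \<inter> \<Omega> = {}"
  using c(1) Q unfolding C1_charts_def by meson
 obtain A where A: "orthogonal_transformation A" "\<And>y. R y = R 0 + A y"
  using is_isometry_orthogonal[OF R(1)] by blast
 have zone: "A y \<notin> \<Omega>" if "y \<in> cusp_zone \<alpha> k s" "y $ 3 < 0" for y
  using R(2,3) A(2)[of y] that by auto
 have e: "A (axis 3 1) = 1 *\<^sub>R axis 3 1"
  using cusp_axis[OF A(1) h0 c(2,3,4)] zone ball_P by (metis not_less scaleR_one)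
 obtain y where y: "A y = x" using A(1) by (metis orthogonal_transformation_surj surjD)
 have y3: "y $ 3 = x $ 3" and hy: "hsq y = hsq x" using hsq_orthogonal[OF A(1) e, of y] by (simp_all add: y)
 have "norm (horiz y) = norm (horiz x)" using hy by (metis norm_ge_zero norm_horiz_sq power2_eq_imp_eq)
 then have "y \<in> cusp_zone \<alpha> k s" using x(1) by (simp add: cusp_zone_def y3)
 then show ?thesis using zone[of y] x(2) by (simp add: y y3)
qed

lemma upper_zone:
 assumes c: "C1_charts \<alpha> k s S" "0 < k" "0 < s" "0 < \<alpha>"
  and x: "x \<in> cusp_zone \<alpha> k s" "x $ 3 > 0"
 shows "h *\<^sub>R axis 3 1 + x \<in> S"
proof -
 obtain R where R: "is_isometry R" "R 0 = h *\<^sub>R axis 3 1" "R ` {x \<in> cusp_zone \<alpha> k s. x $ 3 > 0} \<subseteq> S"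
  using c(1) P unfolding C1_charts_def by meson
 obtain A where A: "orthogonal_transformation A" "\<And>y. R y = R 0 + A y"
  using is_isometry_orthogonal[OF R(1)] by blast
 have zone: "h *\<^sub>R axis 3 1 + A y \<in> S" if "y \<in> cusp_zone \<alpha> k s" "y $ 3 > 0" for y
  using R(2,3) A(2)[of y] that by auto
 \<comment> \<open>The reflection of \<open>y\<close> lies in the upper zone, hence in the body, and
   the body misses the ball of radius \<open>h\<close> about \<open>Q\<close>. This gives the
   hypothesis of \<open>cusp_axis\<close> for the lower zone.\<close>
 have "h \<le> norm (A y - h *\<^sub>R axis 3 1)" if y: "y \<in> cusp_zone \<alpha> k s" "y $ 3 < 0" for y
 proof -
  have "horiz (- y) = - horiz y" by (simp add: linear_neg[OF linear_horiz])
  then have "- y \<in> cusp_zone \<alpha> k s" using y(1) by (simp add: cusp_zone_def)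
  then have "h *\<^sub>R axis 3 1 + A (- y) \<in> S" using y(2) by (intro zone) auto
  then have "h \<le> norm (h *\<^sub>R axis 3 1 + A (- y))" using Q_far closure_subset by blast
  moreover have "A (- y) = - A y" using A(1) by (simp add: orthogonal_transformation_linear linear_neg)
  ultimately show ?thesis by (simp add: norm_minus_commute)
 qed
 then have e: "A (axis 3 1) = 1 *\<^sub>R axis 3 1" using cusp_axis[OF A(1) h0 c(2,3,4)] by simp
 obtain y where y: "A y = x" using A(1) by (metis orthogonal_transformation_surj surjD)
 have y3: "y $ 3 = x $ 3" and hy: "hsq y = hsq x" using hsq_orthogonal[OF A(1) e, of y] by (simp_all add: y)
 have "norm (horiz y) = norm (horiz x)" using hy by (metis norm_ge_zero norm_horiz_sq power2_eq_imp_eq)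
 then have "y \<in> cusp_zone \<alpha> k s" using x(1) by (simp add: cusp_zone_def y3)
 then show ?thesis using zone[of y] x(2) by (simp add: y y3)
qed

lemma cusp_zoneI:
 assumes "cyl \<sigma> x" "0 < \<sigma>" "\<sigma> \<le> s" "0 < k" "0 < \<alpha>" "k * \<sigma> powr (1 + \<alpha>) \<le> h / 4" "h / 4 < \<bar>x $ 3\<bar>" "\<bar>x $ 3\<bar> \<le> 2 * h" "2 * h < k * s powr (1 + \<alpha>)"
 shows "x \<in> cusp_zone \<alpha> k s"
proof -
 have n: "norm (horiz x) < \<sigma>" using norm_horiz_less_iff[OF assms(2), of x] assms(1) by simp
 then have "k * norm (horiz x) powr (1 + \<alpha>) \<le> k * \<sigma> powr (1 + \<alpha>)" using assms by (intro mult_left_mono powr_mono2) auto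
 then have "k * norm (horiz x) powr (1 + \<alpha>) < \<bar>x $ 3\<bar>" "\<bar>x $ 3\<bar> < k * s powr (1 + \<alpha>)" "norm (horiz x) < s"
  using assms(3,6-9) n by linarith+
 then show ?thesis unfolding cusp_zone_def by simp
qed

text \<open>Within radius \<open>\<sigma>\<close> both cusps are at most \<open>h / 4\<close> high,
  so heights between \<open>h / 2\<close> and \<open>h\<close> measured from the contact points
  already lie in the zones.\<close>

lemma first_geometry:
 assumes \<alpha>: "0 < \<alpha>"
  and 1: "C1_charts \<alpha> k1 s1 \<Omega>" "0 < k1" "0 < s1" "k1 * \<sigma> powr (1 + \<alpha>) \<le> h / 4" "\<sigma> \<le> s1" "2 * h < k1 * s1 powr (1 + \<alpha>)"
  and 2: "C1_charts \<alpha> k2 s2 S" "0 < k2" "0 < s2" "k2 * \<sigma> powr (1 + \<alpha>) \<le> h / 4" "\<sigma> \<le> s2" "2 * h < k2 * s2 powr (1 + \<alpha>)"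
  and \<sigma>: "0 < \<sigma>"
 shows "cyl \<sigma> x ==> x $ 3 = - h / 2 ==> x \<notin> \<Omega>"
  and "cyl \<sigma> x ==> 3 * h / 2 \<le> x $ 3 ==> x $ 3 \<le> 2 * h ==> x \<in> S"
proof -
 assume "cyl \<sigma> x" "x $ 3 = - h / 2"
 then have "x \<in> cusp_zone \<alpha> k1 s1" "x $ 3 < 0" using h0 by (auto intro!: cusp_zoneI[OF _ \<sigma> 1(5) 1(2) \<alpha> 1(4) _ _ 1(6)])
 then show "x \<notin> \<Omega>" by (rule lower_zone[OF 1(1,2,3) \<alpha>])
next
 assume x: "cyl \<sigma> x" "3 * h / 2 \<le> x $ 3" "x $ 3 \<le> 2 * h"
 define y where "y = x - h *\<^sub>R axis 3 1"
 have y: "y $ 3 = x $ 3 - h" "hsq y = hsq x" by (simp_all add: y_def hsq_def axis_def)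
 then have "y \<in> cusp_zone \<alpha> k2 s2" using h0 x by (intro cusp_zoneI[OF _ \<sigma> 2(5) 2(2) \<alpha> 2(4) _ _ 2(6)]) auto
 then have "h *\<^sub>R axis 3 1 + y \<in> S" using x h0 y by (intro upper_zone[OF 2(1,2,3) \<alpha>]) auto
 then show "x \<in> S" by (simp add: y_def)
qed

text \<open>Charts by graphs do not say which side is which; connectedness decides. It starts from
  \<open>P\<close> for \<open>\<Omega>\<close>, from the midpoint of \<open>P\<close> and
  \<open>Q\<close> for the complement of the body, and from body points near \<open>P\<close> for
  the body. The mean of odd parts bounded by \<open>16 * K1\<close> and \<open>16 * K2\<close> gives
  \<open>8 * (K1 + K2)\<close>.\<close>

lemma second_geometry:
 assumes 1: "C3_charts K1 s1 \<Omega>" "0 < K1" "0 < s1" "K1 * \<sigma>^2 \<le> h / 4" "\<sigma> \<le> s1" "2 * h < K1 * s1^2"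
  and 2: "C3_charts K2 s2 S" "0 < K2" "0 < s2" "K2 * \<sigma>^2 \<le> h / 4" "\<sigma> \<le> s2" "2 * h < K2 * s2^2"
  and \<sigma>: "0 < \<sigma>"
 shows "\<exists>\<beta> \<tau> Db Dt. gap_graphs \<Omega> S (\<Omega> - closure S) h \<sigma> (8 * (K1 + K2)) \<beta> \<tau> Db Dt"
proof -
 define e where "e = (axis 3 1 :: real^3)"
 have e: "e $ 3 = 1" "e $ 1 = 0" "e $ 2 = 0" by (simp_all add: e_def axis_def)
 have "\<exists>\<beta> Db. (\<forall>x. cyl s1 x \<longrightarrow> GDERIV \<beta> x :> Db x) \<and> continuous_on {x. cyl s1 x} Db \<and> (\<forall>x. Db x $ 3 = 0) \<and>
  (\<forall>x. cyl s1 x \<longrightarrow> \<bar>\<beta> x\<bar> \<le> K1 * hsq x) \<and>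
  (\<forall>x r. cyl r x \<longrightarrow> 0 < r \<longrightarrow> r \<le> s1 \<longrightarrow> \<bar>\<beta> x - \<beta> (flip 1 (flip 2 x))\<bar> \<le> 16 * K1 * r ^ 3) \<and>
  (\<forall>x y. horiz x = horiz y \<longrightarrow> \<beta> x = \<beta> y) \<and>
  (\<forall>x. cyl s1 x \<longrightarrow> \<bar>x $ 3\<bar> < K1 * s1^2 \<longrightarrow> (0 + x \<in> frontier \<Omega> \<longleftrightarrow> x $ 3 = \<beta> x))"
  by (rule C3_graph[OF 1(1,2,3) Q h0, of 1]) (use P_far in simp_all)
 then obtain \<beta> Db where b': "\<forall>x. cyl s1 x \<longrightarrow> GDERIV \<beta> x :> Db x" "continuous_on {x. cyl s1 x} Db" "\<forall>x. Db x $ 3 = 0"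
  "\<forall>x. cyl s1 x \<longrightarrow> \<bar>\<beta> x\<bar> \<le> K1 * hsq x"
  "\<forall>x r. cyl r x \<longrightarrow> 0 < r \<longrightarrow> r \<le> s1 \<longrightarrow> \<bar>\<beta> x - \<beta> (flip 1 (flip 2 x))\<bar> \<le> 16 * K1 * r ^ 3"
  "\<forall>x y. horiz x = horiz y \<longrightarrow> \<beta> x = \<beta> y"
  "\<forall>x. cyl s1 x \<longrightarrow> \<bar>x $ 3\<bar> < K1 * s1^2 \<longrightarrow> (0 + x \<in> frontier \<Omega> \<longleftrightarrow> x $ 3 = \<beta> x)"
  by (elim exE conjE) (rule that)
 note b = b'[rule_format, unfolded add_0]
 have "\<exists>\<gamma> Dt. (\<forall>x. cyl s2 x \<longrightarrow> GDERIV \<gamma> x :> Dt x) \<and> continuous_on {x. cyl s2 x} Dt \<and> (\<forall>x. Dt x $ 3 = 0) \<and>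
  (\<forall>x. cyl s2 x \<longrightarrow> \<bar>\<gamma> x\<bar> \<le> K2 * hsq x) \<and>
  (\<forall>x r. cyl r x \<longrightarrow> 0 < r \<longrightarrow> r \<le> s2 \<longrightarrow> \<bar>\<gamma> x - \<gamma> (flip 1 (flip 2 x))\<bar> \<le> 16 * K2 * r ^ 3) \<and>
  (\<forall>x y. horiz x = horiz y \<longrightarrow> \<gamma> x = \<gamma> y) \<and>
  (\<forall>x. cyl s2 x \<longrightarrow> \<bar>x $ 3\<bar> < K2 * s2^2 \<longrightarrow> (h *\<^sub>R axis 3 1 + x \<in> frontier S \<longleftrightarrow> x $ 3 = \<gamma> x))"
  by (rule C3_graph[OF 2(1,2,3) P h0, of "- 1"]) (use Q_far in \<open>simp_all add: frontier_def\<close>)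
 then obtain \<gamma> Dt where t': "\<forall>x. cyl s2 x \<longrightarrow> GDERIV \<gamma> x :> Dt x" "continuous_on {x. cyl s2 x} Dt" "\<forall>x. Dt x $ 3 = 0"
  "\<forall>x. cyl s2 x \<longrightarrow> \<bar>\<gamma> x\<bar> \<le> K2 * hsq x"
  "\<forall>x r. cyl r x \<longrightarrow> 0 < r \<longrightarrow> r \<le> s2 \<longrightarrow> \<bar>\<gamma> x - \<gamma> (flip 1 (flip 2 x))\<bar> \<le> 16 * K2 * r ^ 3"
  "\<forall>x y. horiz x = horiz y \<longrightarrow> \<gamma> x = \<gamma> y"
  "\<forall>x. cyl s2 x \<longrightarrow> \<bar>x $ 3\<bar> < K2 * s2^2 \<longrightarrow> (h *\<^sub>R axis 3 1 + x \<in> frontier S \<longleftrightarrow> x $ 3 = \<gamma> x)"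
  by (elim exE conjE) (rule that)
 note t = t'[rule_format]
 define \<tau> where "\<tau> x = h + \<gamma> x" for x
 have sq: "\<sigma>^2 \<le> s1^2" "\<sigma>^2 \<le> s2^2" using \<sigma> 1(5) 2(5) by (auto intro: power_mono)
 have bb: "- h / 4 \<le> \<beta> x \<and> \<beta> x \<le> h / 4" if "cyl \<sigma> x" for x
 proof -
  have "K1 * hsq x \<le> K1 * \<sigma>^2" using that 1(2) by (intro mult_left_mono) auto
  then show ?thesis using b(4)[of x] that sq 1(4) by auto
 qed
 have tb: "3 * h / 4 \<le> \<tau> x \<and> \<tau> x \<le> 5 * h / 4" if "cyl \<sigma> x" for x
 proof -
  have "K2 * hsq x \<le> K2 * \<sigma>^2" using that 2(2) by (intro mult_left_mono) auto
  then have "\<bar>\<gamma> x\<bar> \<le> h / 4" using t(4)[of x] that sq 2(4) by auto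
  then show ?thesis unfolding \<tau>_def by linarith
 qed
 have fb: "x \<in> frontier \<Omega> \<longleftrightarrow> x $ 3 = \<beta> x" if "cyl \<sigma> x" "\<bar>x $ 3\<bar> \<le> 2 * h" for x
  using b(7)[of x] that sq 1(6) by simp
 have ft: "x \<in> frontier S \<longleftrightarrow> x $ 3 = \<tau> x" if x: "cyl \<sigma> x" "- h \<le> x $ 3" "x $ 3 \<le> 3 * h" for x
 proof -
  define y where "y = x - h *\<^sub>R e"
  have y: "hsq y = hsq x" "y $ 3 = x $ 3 - h" "horiz y = horiz x" by (simp_all add: y_def hsq_def e vec_eq_iff forall_2)
  have "h *\<^sub>R axis 3 1 + y \<in> frontier S \<longleftrightarrow> y $ 3 = \<gamma> y" using x sq 2(6) y by (intro t(7)) (auto simp: abs_le_iff)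
  then show ?thesis using t(6)[OF y(3)] y(2) by (simp add: \<tau>_def y_def e_def algebra_simps)
 qed
 have dep: "\<beta> x = \<beta> y \<and> \<tau> x = \<tau> y" if "horiz x = horiz y" for x y using b(6)[OF that] t(6)[OF that] by (simp add: \<tau>_def)
 have hs0: "hsq (c *\<^sub>R e) = 0" for c by (simp add: hsq_def e)
 have \<sigma>2: "0 < \<sigma>^2" using \<sigma> by simp
 have Om: "x \<in> \<Omega>" if x: "cyl \<sigma> x" "\<beta> x < x $ 3" "x $ 3 < 2 * h" for x
 proof (rule connected_between_graphs[where lo = \<beta> and hi = "\<lambda>_. 2 * h" and z = h and p = "h *\<^sub>R e"])
  show "y \<notin> frontier \<Omega>" if "cyl \<sigma> y" "\<beta> y < y $ 3" "y $ 3 < 2 * h" for y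
  proof -
   have "\<bar>y $ 3\<bar> \<le> 2 * h" using bb[OF that(1)] that h0 by arith
   then show ?thesis using fb[OF that(1)] that by simp
  qed
  show "\<beta> y < h \<and> h < 2 * h" if "cyl \<sigma> y" for y using bb[OF that] h0 by auto
  show "h *\<^sub>R e \<in> \<Omega>" using P_in by (simp add: e_def)
  show "\<beta> (h *\<^sub>R e) < (h *\<^sub>R e) $ 3" using bb[of "h *\<^sub>R e"] h0 \<sigma>2 by (simp add: hs0 e)
  show "\<beta> y = \<beta> y' \<and> 2 * h = 2 * h" if "horiz y = horiz y'" for y y' using dep[OF that] by simp
 qed (use x h0 hs0 \<sigma>2 in \<open>simp_all add: e\<close>)
 have below: "x \<notin> closure S" if x: "cyl \<sigma> x" "- h < x $ 3" "x $ 3 < \<tau> x" for x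
 proof -
  have nf: "y \<notin> frontier S" if "cyl \<sigma> y" "- h < y $ 3" "y $ 3 < \<tau> y" for y
   using ft[OF that(1)] tb[OF that(1)] that h0 by auto
  have "x \<in> - S"
  proof (rule connected_between_graphs[where lo = "\<lambda>_. - h" and hi = \<tau> and z = "h / 2" and p = "(h / 2) *\<^sub>R e" and s = \<sigma>])
   show "(h / 2) *\<^sub>R e \<in> - S" using Q_far[of "(h / 2) *\<^sub>R e"] closure_subset[of S] h0 by (auto simp: e_def)
   show "y \<notin> frontier (- S)" if "cyl \<sigma> y" "- h < y $ 3" "y $ 3 < \<tau> y" for y
    using nf[OF that] by (simp add: frontier_complement)
   show "((h / 2) *\<^sub>R e) $ 3 < \<tau> ((h / 2) *\<^sub>R e)" using tb[of "(h / 2) *\<^sub>R e"] h0 \<sigma>2 by (simp add: hs0 e)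
   show "- h < h / 2 \<and> h / 2 < \<tau> y" if "cyl \<sigma> y" for y using tb[OF that] h0 by auto
   show "- h = - h \<and> \<tau> y = \<tau> y'" if "horiz y = horiz y'" for y y' using dep[OF that] by simp
  qed (use x h0 hs0 \<sigma>2 in \<open>simp_all add: e\<close>)
  then show ?thesis using nf[OF x] by (simp add: frontier_def interior_open[OF op(2)])
 qed
 have above: "x \<in> S" if x: "cyl \<sigma> x" "\<tau> x < x $ 3" "x $ 3 \<le> 2 * h" for x
 proof -
  have "open ({x. cyl \<sigma> x} \<inter> {x. - h < x $ 3} \<inter> {x. x $ 3 < 3 * h})"
   by (intro open_Int open_Collect_less hsq_continuous continuous_intros)
  moreover have "h *\<^sub>R e \<in> {x. cyl \<sigma> x} \<inter> {x. - h < x $ 3} \<inter> {x. x $ 3 < 3 * h}" using h0 \<sigma>2 by (simp add: hs0 e)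
  moreover have "h *\<^sub>R e \<in> closure S" using P by (simp add: frontier_def e_def)
  \<comment> \<open>\<open>P\<close> is only a boundary point of the body, so a nearby point of the
    body takes its place; by \<open>ft\<close> and \<open>below\<close> it can be neither on nor
    under the graph of \<open>\<tau>\<close>.\<close>
  ultimately obtain p where p: "p \<in> S" "cyl \<sigma> p" "- h < p $ 3" "p $ 3 < 3 * h"
   using open_Int_closure_eq_empty[of "{x. cyl \<sigma> x} \<inter> {x. - h < x $ 3} \<inter> {x. x $ 3 < 3 * h}" S] by blast
  have "p \<notin> frontier S" using p(1) by (simp add: frontier_def interior_open[OF op(2)])
  then have "p $ 3 \<noteq> \<tau> p" using ft[of p] p by auto
  moreover have "\<not> p $ 3 < \<tau> p" using below[of p] p closure_subset by blast
  ultimately have pt: "\<tau> p < p $ 3" by simp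
  show ?thesis
  proof (rule connected_between_graphs[where lo = \<tau> and hi = "\<lambda>_. 3 * h" and z = "2 * h" and p = p and s = \<sigma>])
   show "y \<notin> frontier S" if "cyl \<sigma> y" "\<tau> y < y $ 3" "y $ 3 < 3 * h" for y
    using ft[OF that(1)] tb[OF that(1)] that h0 by auto
   show "\<tau> y < 2 * h \<and> 2 * h < 3 * h" if "cyl \<sigma> y" for y using tb[OF that] h0 by auto
   show "\<tau> y = \<tau> y' \<and> 3 * h = 3 * h" if "horiz y = horiz y'" for y y' using dep[OF that] by simp
  qed (use x h0 p pt in simp_all)
 qed
 show ?thesis
 proof (rule exI[of _ \<beta>], rule exI[of _ \<tau>], rule exI[of _ Db], rule exI[of _ Dt], unfold_locales)
  show "GDERIV \<beta> x :> Db x" if "cyl \<sigma> x" for x using b(1)[of x] that sq by simp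
  show "GDERIV \<tau> x :> Dt x" if "cyl \<sigma> x" for x
   unfolding \<tau>_def[abs_def] using GDERIV_add[OF GDERIV_const[of h] t(1)[of x]] that sq by simp
  show "continuous_on {x. cyl \<sigma> x} Db" by (rule continuous_on_subset[OF b(2)]) (use sq in auto)
  show "continuous_on {x. cyl \<sigma> x} Dt" by (rule continuous_on_subset[OF t(2)]) (use sq in auto)
  show "Db x $ 3 = 0" "Dt x $ 3 = 0" for x by (fact b(3) t(3))+
  show "- h / 4 \<le> \<beta> x \<and> \<beta> x \<le> h / 4" "3 * h / 4 \<le> \<tau> x \<and> \<tau> x \<le> 5 * h / 4" if "cyl \<sigma> x" for x by (rule bb[OF that] tb[OF that])+
  show "0 \<le> 8 * (K1 + K2)" using 1(2) 2(2) by simp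
  show "\<bar>(\<beta> x + \<tau> x) / 2 - (\<beta> (flip 1 (flip 2 x)) + \<tau> (flip 1 (flip 2 x))) / 2\<bar> \<le> 8 * (K1 + K2) * r ^ 3"
   if "cyl r x" "0 < r" "r \<le> \<sigma>" for x r
  proof -
   have "8 * (K1 + K2) * r ^ 3 = (16 * K1 * r ^ 3 + 16 * K2 * r ^ 3) / 2" by (simp add: algebra_simps)
   then show ?thesis using b(5)[of x r] t(5)[of x r] that 1(5) 2(5) unfolding \<tau>_def by (simp add: abs_le_iff) argo
  qed
  show "x \<notin> \<Omega>" if "cyl \<sigma> x" "x $ 3 = \<beta> x" for x
  proof -
   have "\<bar>x $ 3\<bar> \<le> 2 * h" using bb[OF that(1)] that(2) h0 by arith
   then show ?thesis using fb[OF that(1)] that(2) by (simp add: frontier_def interior_open[OF op(1)])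
  qed
  show "x \<in> \<Omega> - closure S" if "cyl \<sigma> x" "\<beta> x < x $ 3" "x $ 3 < \<tau> x" for x
   using Om[of x] below[of x] bb[of x] tb[of x] that h0 by auto
  show "x \<in> S" if "cyl \<sigma> x" "\<tau> x < x $ 3" "x $ 3 \<le> 2 * h" for x by (rule above[OF that])
  show "x \<notin> \<Omega> - closure S" if "cyl \<sigma> x" "x $ 3 = \<tau> x" for x
   using ft[OF that(1)] tb[OF that(1)] that(2) h0 by (auto simp: frontier_def)
 qed
qed

end

section \<open>The flow in the contact frame\<close>

lemma in_Lp_subset:
 assumes "in_Lp p A f" "C \<subseteq> A" "C \<in> sets lebesgue"
 shows "in_Lp p C f"
 using assms unfolding in_Lp_def by (metis set_borel_measurable_subset set_integrable_subset)

lemma norm_linear_combination_le: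
 fixes M :: "'b::euclidean_space^3"
 assumes "\<And>j. \<bar>c j\<bar> \<le> 1"
 shows "norm (\<Sum>j\<in>UNIV. c j *\<^sub>R M $ j) \<le> 3 * norm M"
proof -
 have "norm (\<Sum>j\<in>UNIV. c j *\<^sub>R M $ j) \<le> (\<Sum>j\<in>(UNIV::3 set). norm M)"
 proof (rule order_trans[OF norm_sum sum_mono])
  fix j
  have "norm (c j *\<^sub>R M $ j) \<le> 1 * norm (M $ j)" using assms[of j] by (simp add: mult_left_le_one_le)
  also have "\<dots> \<le> norm M" using Finite_Cartesian_Product.norm_nth_le by simp
  finally show "norm (c j *\<^sub>R M $ j) \<le> norm M" .
 qed
 then show ?thesis by simp
qed

text \<open>A single time: \<open>R\<close> is the contact frame with linear part \<open>A\<close>,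
  and \<open>c\<close>, \<open>om\<close>, \<open>z0\<close> describe the velocity of the body at
  that time. The number \<open>h\<close> only fixes the point at which this velocity is
  expanded.\<close>

locale moving_frame =
 fixes \<Omega> St :: "(real^3) set" and R A :: "real^3 \<Rightarrow> real^3" and p h :: real and u :: "real^3 \<Rightarrow> real^3"
  and c om z0 :: "real^3"
 assumes op: "open \<Omega>" "open St" "St \<subseteq> \<Omega>"
  and R: "is_isometry R" and A: "orthogonal_transformation A" and RA: "\<And>y. R y = R 0 + A y"
  and p: "1 \<le> p" and u: "u \<in> W1p_zero p \<Omega>"
  and div: "AE x in lebesgue. x \<in> \<Omega> \<longrightarrow> (\<Sum>j\<in>UNIV. weak_grad \<Omega> u x $ j $ j) = 0"
  and rig: "AE x in lebesgue. x \<in> St \<longrightarrow> u x = c + cross3 om (x - z0)"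
  and null: "negligible (frontier St)"
begin

abbreviation (input) Du where "Du \<equiv> weak_grad \<Omega> u"
abbreviation (input) fluid where "fluid \<equiv> fluid_region \<Omega> St"

definition b :: "3 \<Rightarrow> real^3" where "b k = A (axis k 1)"
definition w :: "real^3 \<Rightarrow> real^3" where "w y = (\<chi> k. u (R y) \<bullet> b k)"
definition g :: "3 \<Rightarrow> 3 \<Rightarrow> real^3 \<Rightarrow> real" where
 "g i k y = (\<Sum>j\<in>UNIV. b i $ j * (Du (R y) $ j \<bullet> b k))"
definition a :: "real^3" where "a = (\<chi> k. (c + cross3 om (R (h *\<^sub>R axis 3 1) - z0)) \<bullet> b k)"
definition W :: "real^3^3" where "W = (\<chi> k i. cross3 om (b i) \<bullet> b k)"

lemma linA: "linear A" using A by (rule orthogonal_transformation_linear)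

lemma b_inner: "A v \<bullet> b i = v $ i"
 using A by (simp add: b_def orthogonal_transformation_def inner_axis)

lemma A_surj: "\<exists>v. A v = x" using A by (metis orthogonal_transformation_surj surjD)

lemma A_coords: "A (\<chi> i. v \<bullet> b i) = v"
proof -
 obtain v' where v': "A v' = v" using A_surj by blast
 have "(\<chi> i. v \<bullet> b i) = v'" by (simp add: vec_eq_iff b_inner flip: v')
 then show ?thesis using v' by simp
qed

lemma b_sum: "(\<Sum>i\<in>UNIV. (x \<bullet> b i) * (y \<bullet> b i)) = x \<bullet> y"
proof -
 have "x \<bullet> y = A (\<chi> i. x \<bullet> b i) \<bullet> A (\<chi> i. y \<bullet> b i)" by (simp add: A_coords)
 also have "\<dots> = (\<chi> i. x \<bullet> b i) \<bullet> (\<chi> i. y \<bullet> b i)" using A by (simp add: orthogonal_transformation_def)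
 finally show ?thesis by (simp add: inner_vec_def)
qed

lemma norm_b: "norm (b i) = 1" using A by (simp add: b_def orthogonal_transformation_norm)

lemma b_nth: "\<bar>b i $ j\<bar> \<le> 1" using component_le_norm_cart[of "b i" j] norm_b by simp

lemma inner_b: "\<bar>x \<bullet> b i\<bar> \<le> norm x" using Cauchy_Schwarz_ineq2[of x "b i"] norm_b[of i] by simp

lemma g_eq: "g i k y = (\<Sum>j\<in>UNIV. b i $ j *\<^sub>R Du (R y) $ j) \<bullet> b k"
 by (simp add: g_def inner_sum_left)

lemma g_bound: "\<bar>g i k y\<bar> \<le> 3 * norm (Du (R y))"
 unfolding g_eq by (rule order_trans[OF inner_b norm_linear_combination_le]) (rule b_nth)

lemma inv_R: "R (inv R x) = x" "inv R (R x) = x" by (rule is_isometry_inv_cancel[OF R])+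

lemma inv_R_eq: "inv R x = (\<chi> i. (x - R 0) \<bullet> b i)"
proof -
 have "A (inv R x) = x - R 0" using RA[of "inv R x"] by (metis add_diff_cancel_left' inv_R(1))
 then have "(x - R 0) \<bullet> b i = inv R x $ i" for i using b_inner[of "inv R x" i] by simp
 then show ?thesis by (simp add: vec_eq_iff)
qed

lemma pullback_derivative:
 assumes "(\<theta> has_derivative (\<lambda>v. v \<bullet> T (inv R x))) (at (inv R x))"
 shows "((\<lambda>x. \<theta> (inv R x)) has_derivative (\<lambda>v. v \<bullet> A (T (inv R x)))) (at x)"
proof -
 have d: "(inv R has_derivative (\<lambda>v. \<chi> i. v \<bullet> b i)) (at x)"
  unfolding inv_R_eq[abs_def]
  by (intro has_derivative_vec) (auto intro!: derivative_eq_intros)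
 have "(\<chi> i. v \<bullet> b i) \<bullet> T (inv R x) = v \<bullet> A (T (inv R x))" for v
 proof -
  have "(\<chi> i. v \<bullet> b i) \<bullet> T (inv R x) = A (\<chi> i. v \<bullet> b i) \<bullet> A (T (inv R x))"
   using A by (simp add: orthogonal_transformation_def)
  then show ?thesis by (simp add: A_coords)
 qed
 then show ?thesis using has_derivative_compose[OF d assms] by simp
qed

text \<open>No weak gradient is formed in the new coordinates. The test function is pulled back to
  the original ones, the vector identities valid there are contracted with the rotated axes, and
  only the resulting scalar integrals are transported by \<open>R\<close>.\<close>

lemma frame_ibp:
 assumes d: "\<And>x. x \<in> R -` \<Omega> ==> (\<theta> has_derivative (\<lambda>v. v \<bullet> T x)) (at x)"
  and bd: "\<And>x. \<bar>\<theta> x\<bar> \<le> M" "\<And>x. norm (T x) \<le> M"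
  and m: "\<theta> \<in> lmeas" "T \<in> lmeas"
  and B: "bounded B" "\<And>x. x \<notin> B ==> \<theta> x = 0" "\<And>x. x \<notin> B ==> T x = 0"
 shows "L1 (\<lambda>x. T x $ i * (ind (R -` \<Omega>) x * w x $ k)) \<and>
   L1 (\<lambda>x. \<theta> x * (ind (R -` \<Omega>) x * g i k x)) \<and>
   (LI x. T x $ i * (ind (R -` \<Omega>) x * w x $ k)) = - (LI x. \<theta> x * (ind (R -` \<Omega>) x * g i k x))"
proof -
 define \<theta>' where "\<theta>' x = \<theta> (inv R x)" for x
 define T' where "T' x = A (T (inv R x))" for x
 have iR: "is_isometry (inv R)" by (rule is_isometry_inv[OF R])
 have "\<theta>' \<in> lmeas" using isometry_measurable_iff[OF iR, of \<theta>] m(1) by (simp add: \<theta>'_def[abs_def])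
 moreover have "T' \<in> lmeas"
 proof -
  have "continuous_on UNIV A" by (rule linear_continuous_on) (simp add: linA linear_conv_bounded_linear[symmetric])
  moreover have "(\<lambda>x. T (inv R x)) \<in> lmeas" using isometry_measurable_iff[OF iR, of T] m(2) by simp
  ultimately show ?thesis
   unfolding T'_def[abs_def] using measurable_compose borel_measurable_continuous_onI by blast
 qed
 moreover have "bounded (R ` B)"
 proof -
  obtain x0 e where "\<And>y. y \<in> B ==> dist x0 y \<le> e" using B(1) unfolding bounded_def by blast
  then have "\<forall>y\<in>R ` B. dist (R x0) y \<le> e" using R by (auto simp: is_isometry_def)
  then show ?thesis unfolding bounded_def by blast
 qed
 moreover have "(\<theta>' has_derivative (\<lambda>v. v \<bullet> T' x)) (at x)" if "x \<in> \<Omega>" for x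
  unfolding \<theta>'_def[abs_def] T'_def by (rule pullback_derivative, rule d) (simp add: inv_R that)
 moreover have "\<bar>\<theta>' x\<bar> \<le> M" "norm (T' x) \<le> M" for x
  using bd A by (simp_all add: \<theta>'_def T'_def orthogonal_transformation_norm)
 moreover have z: "\<theta>' x = 0" "T' x = 0" if "x \<notin> R ` B" for x
 proof -
  have "inv R x \<notin> B" using that by (metis image_eqI inv_R(1))
  then show "\<theta>' x = 0" "T' x = 0" using B(2,3) linA by (simp_all add: \<theta>'_def T'_def linear_0)
 qed
 ultimately have I: "L1 (\<lambda>x. (T' x $ j) *\<^sub>R (ind \<Omega> x *\<^sub>R u x))"
  "L1 (\<lambda>x. \<theta>' x *\<^sub>R (ind \<Omega> x *\<^sub>R (Du x $ j)))"
  "(LI x. (T' x $ j) *\<^sub>R (ind \<Omega> x *\<^sub>R u x))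
   = - (LI x. \<theta>' x *\<^sub>R (ind \<Omega> x *\<^sub>R (Du x $ j)))" for j
  using W1p_zero_integration_by_parts[OF op(1) u p, of \<theta>' T' M "R ` B" j] by auto
 define FX where "FX j x = (T' x $ j) *\<^sub>R (ind \<Omega> x *\<^sub>R u x)" for j x
 define FY where "FY j x = \<theta>' x *\<^sub>R (ind \<Omega> x *\<^sub>R (Du x $ j))" for j x
 have IF: "L1 (FX j)" "L1 (FY j)" "(LI x. FX j x) = - (LI x. FY j x)" for j
  using I[of j] by (simp_all only: FX_def[abs_def] FY_def[abs_def])
 define X where "X x = (\<Sum>j\<in>UNIV. b i $ j * (FX j x \<bullet> b k))" for x
 define Y where "Y x = (\<Sum>j\<in>UNIV. b i $ j * (FY j x \<bullet> b k))" for x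
 have comb: "L1 (\<lambda>x. \<Sum>j\<in>UNIV. b i $ j * (F j x \<bullet> b k))"
  "(LI x. (\<Sum>j\<in>UNIV. b i $ j * (F j x \<bullet> b k))) = (\<Sum>j\<in>UNIV. b i $ j * ((LI x. F j x) \<bullet> b k))"
  if "\<And>j. L1 (F j)" for F :: "3 \<Rightarrow> real^3 \<Rightarrow> real^3"
 proof -
  have 1: "L1 (\<lambda>x. b i $ j * (F j x \<bullet> b k))" for j
   by (intro integrable_mult_right integrable_inner_left that)
  show "L1 (\<lambda>x. \<Sum>j\<in>UNIV. b i $ j * (F j x \<bullet> b k))"
   by (intro Bochner_Integration.integrable_sum 1)
  show "(LI x. (\<Sum>j\<in>UNIV. b i $ j * (F j x \<bullet> b k))) = (\<Sum>j\<in>UNIV. b i $ j * ((LI x. F j x) \<bullet> b k))"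
   using 1 that by (simp add: Bochner_Integration.integral_sum)
 qed
 have Xi: "L1 X" "L1 Y"
  unfolding X_def[abs_def] Y_def[abs_def] by (intro comb(1) IF)+
 have XY: "(LI x. X x) = - (LI x. Y x)"
  unfolding X_def Y_def comb(2)[of FX, OF IF(1)] comb(2)[of FY, OF IF(2)] IF(3) by (simp add: sum_negf)
 have ind: "ind (R -` \<Omega>) y = ind \<Omega> (R y)" for y by (simp add: indicator_def)
 have "X (R y) = T y $ i * (ind (R -` \<Omega>) y * w y $ k)" for y
 proof -
  have "(\<Sum>j\<in>UNIV. b i $ j * T' (R y) $ j) = T y $ i"
   using b_inner[of "T y" i] by (simp add: T'_def inv_R inner_vec_def mult.commute)
  then have "(\<Sum>j\<in>UNIV. b i $ j * T' (R y) $ j) * (ind \<Omega> (R y) * (u (R y) \<bullet> b k)) = T y $ i * (ind (R -` \<Omega>) y * w y $ k)"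
   by (simp add: ind w_def)
  moreover have "X (R y) = (\<Sum>j\<in>UNIV. b i $ j * T' (R y) $ j) * (ind \<Omega> (R y) * (u (R y) \<bullet> b k))"
   unfolding X_def FX_def sum_distrib_right by (simp add: mult_ac)
  ultimately show ?thesis by simp
 qed
 moreover have "Y (R y) = \<theta> y * (ind (R -` \<Omega>) y * g i k y)" for y
  by (simp add: Y_def FY_def \<theta>'_def inv_R ind g_def sum_distrib_left mult_ac)
 ultimately show ?thesis
  using Xi XY isometry_integrable[OF R, of X] isometry_integrable[OF R, of Y] isometry_integral[OF R, of X] isometry_integral[OF R, of Y]
  by simp
qed

text \<open>On the open set \<open>St\<close> the field agrees with an affine one, whose classical
  gradient is also a weak gradient; uniqueness on \<open>St\<close> identifies it with the gradient
  chosen on \<open>\<Omega>\<close>.\<close>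

lemma weak_grad_rigid: "AE x in lebesgue. x \<in> St \<longrightarrow> (\<forall>j. Du x $ j = cross3 om (axis j 1))"
proof -
 have "weakly_differentiable \<Omega> u" using u by (simp add: W1p_zero_def W1p_def)
 from has_weak_gradient_subset[OF weak_grad_works[OF this] op(3)]
 have 1: "has_weak_gradient St u (Du)" .
 define v where "v x = c + cross3 om (x - z0)" for x
 define V where "V x = (\<chi> j. cross3 om (axis j 1))" for x :: "real^3"
 have lc: "linear (cross3 om)" by (simp add: linear_iff cross_add_right cross_mult_right)
 have ex: "cross3 om z = (\<Sum>j\<in>UNIV. z $ j *\<^sub>R cross3 om (axis j 1))" for z
 proof -
  have "z = (\<Sum>j\<in>UNIV. z $ j *\<^sub>R axis j 1)" by (simp add: basis_expansion flip: scalar_mult_eq_scaleR)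
  then have "cross3 om z = cross3 om (\<Sum>j\<in>UNIV. z $ j *\<^sub>R axis j 1)" by simp
  then show ?thesis by (simp add: linear_sum[OF lc] linear_cmul[OF lc])
 qed
 have bl: "bounded_linear (cross3 om)" using lc by (simp add: linear_conv_bounded_linear)
 have "has_weak_gradient St v V"
 proof (rule has_weak_gradient_C1)
  show "(v has_derivative (\<lambda>z. \<Sum>j\<in>UNIV. z $ j *\<^sub>R V x $ j)) (at x)" for x
  proof -
   have "((\<lambda>x. x - z0) has_derivative (\<lambda>z. z)) (at x)" by (auto intro!: derivative_eq_intros)
   from has_derivative_add[OF has_derivative_const[of c] has_derivative_compose[OF this bounded_linear_imp_has_derivative[OF bl]]]
   have "(v has_derivative (\<lambda>z. cross3 om z)) (at x)" by (simp add: v_def[abs_def])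
   then show ?thesis by (subst (asm) ex) (simp add: V_def)
  qed
  show "continuous_on UNIV V" by (simp add: V_def[abs_def])
 qed
 moreover have "has_weak_gradient St v (Du)"
  by (rule has_weak_gradient_cong_AE[OF 1]) (use rig in \<open>auto simp: v_def elim: eventually_mono\<close>)
 ultimately have "AE x in lebesgue. x \<in> St \<longrightarrow> Du x = V x"
  using has_weak_gradient_unique[OF op(2)] by blast
 then show ?thesis by eventually_elim (simp add: V_def)
qed

lemma cross_b: "(\<Sum>j\<in>UNIV. x $ j *\<^sub>R cross3 om (axis j 1)) = cross3 om x"
proof -
 have "x = (\<Sum>j\<in>UNIV. x $ j *\<^sub>R axis j 1)" by (simp add: basis_expansion flip: scalar_mult_eq_scaleR)
 moreover have "linear (cross3 om)" by (simp add: linear_iff cross_add_right cross_mult_right)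
 ultimately show ?thesis by (metis (no_types, lifting) linear_cmul linear_sum sum.cong)
qed

lemma cross_skew: "cross3 om x \<bullet> y = - (cross3 om y \<bullet> x)"
 by (metis cross_skew cross_triple inner_commute inner_minus_left)

lemma fluid_open: "open (fluid)" by (simp add: fluid_region_def op open_Diff)

lemma vimage_open: "open X ==> open (R -` X)"
 by (rule open_vimage[OF _ is_isometry_continuous[OF R]])

lemma flow_gap:
 assumes h: "0 < h" "h \<le> \<sigma>" "\<sigma> < \<sigma>'"
  and \<beta>: "continuous_on {x. cyl \<sigma>' x} \<beta>" "\<And>x. cyl \<sigma>' x ==> - h / 2 \<le> \<beta> x \<and> \<beta> x \<le> h / 4"
   "\<And>x. cyl \<sigma>' x ==> x $ 3 = \<beta> x ==> x \<notin> R -` \<Omega>"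
  and top: "\<And>x. cyl \<sigma>' x ==> 3 * h / 2 \<le> x $ 3 ==> x $ 3 \<le> 2 * h ==> x \<in> R -` St"
 shows "gap (R -` \<Omega>) (R -` St) (R -` fluid) w g a W h \<sigma> \<sigma>' \<beta>"
proof
 show "0 < h" "h \<le> \<sigma>" "\<sigma> < \<sigma>'" by (fact h)+
 show "open (R -` \<Omega>)" "open (R -` St)" "R -` St \<subseteq> R -` \<Omega>" "R -` fluid \<subseteq> R -` \<Omega>"
  using vimage_open op by (auto simp: fluid_region_def)
 show "R -` fluid \<in> sets lebesgue" using vimage_open[OF fluid_open] by (simp add: lebesgue_openin)
 show "R -` St \<inter> R -` fluid = {}" using closure_subset[of St] by (auto simp: fluid_region_def)
 \<comment> \<open>The fluid region omits the closure of the body, so body and fluid cover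
   \<open>\<Omega>\<close> only up to the boundary of the body.\<close>
 have "AE x in lebesgue. x \<notin> frontier St" using null by (simp add: negligible_iff_null_sets AE_not_in)
 then have "AE x in lebesgue. x \<in> \<Omega> \<longrightarrow> x \<in> St \<or> x \<in> fluid"
  by eventually_elim (auto simp: fluid_region_def frontier_def interior_open[OF op(2)])
 from isometry_AE[OF R this]
 show "AE x in lebesgue. x \<in> R -` \<Omega> \<longrightarrow> x \<in> R -` St \<or> x \<in> R -` fluid" by simp
 show "continuous_on {x. cyl \<sigma>' x} \<beta>" by (fact \<beta>)
 show "- h / 2 \<le> \<beta> x \<and> \<beta> x \<le> h / 4" if "cyl \<sigma>' x" for x by (rule \<beta>(2)[OF that])
 show "x \<notin> R -` \<Omega>" if "cyl \<sigma>' x" "x $ 3 = \<beta> x" for x by (rule \<beta>(3)[OF that])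
 show "x \<in> R -` St" if "cyl \<sigma>' x" "3 * h / 2 \<le> x $ 3" "x $ 3 \<le> 2 * h" for x by (rule top[OF that])
 have vel: "(c + cross3 om (R y - z0)) \<bullet> b k = a $ k + W $ k $ 1 * y $ 1 + W $ k $ 2 * y $ 2 + W $ k $ 3 * (y $ 3 - h)" for y k
 proof -
  have "R y - z0 = (R (h *\<^sub>R axis 3 1) - z0) + A (y - h *\<^sub>R axis 3 1)"
   using RA[of y] RA[of "h *\<^sub>R axis 3 1"] by (simp add: linear_diff[OF linA])
  then have 1: "(c + cross3 om (R y - z0)) \<bullet> b k = a $ k + cross3 om (A (y - h *\<^sub>R axis 3 1)) \<bullet> b k"
   by (simp only: a_def cross_add_right inner_add_left vec_lambda_beta add.assoc)
  define d where "d = y - h *\<^sub>R axis 3 1"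
  have d: "d $ 1 = y $ 1" "d $ 2 = y $ 2" "d $ 3 = y $ 3 - h" by (simp_all add: d_def axis_def)
  have "d = d $ 1 *\<^sub>R axis 1 1 + d $ 2 *\<^sub>R axis 2 1 + d $ 3 *\<^sub>R axis 3 1" by (simp add: vec_eq_iff forall_3 axis_def)
  then have "A d = d $ 1 *\<^sub>R b 1 + d $ 2 *\<^sub>R b 2 + d $ 3 *\<^sub>R b 3"
   using arg_cong[where f = A] by (metis (no_types, lifting) b_def linear_add[OF linA] linear_cmul[OF linA])
  then show ?thesis unfolding 1 d_def[symmetric] by (simp add: cross_add_right cross_mult_right inner_add_left W_def d)
 qed
 from isometry_AE[OF R rig]
 show "AE x in lebesgue. x \<in> R -` St \<longrightarrow> (\<forall>k. w x $ k = a $ k + W $ k $ 1 * x $ 1 + W $ k $ 2 * x $ 2 + W $ k $ 3 * (x $ 3 - h))"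
  by eventually_elim (auto simp: w_def vel)
 from isometry_AE[OF R weak_grad_rigid]
 show "AE x in lebesgue. x \<in> R -` St \<longrightarrow> (\<forall>i k. g i k x = W $ k $ i)"
  by eventually_elim (auto simp: g_eq cross_b W_def)
 show "W $ k $ i = - W $ i $ k" for i k using cross_skew[of "b i" "b k"] by (simp add: W_def)
 have tr: "g 1 1 y + g 2 2 y + g 3 3 y = (\<Sum>j\<in>UNIV. Du (R y) $ j $ j)" for y
 proof -
  have ax: "axis j 1 \<bullet> b i = b i $ j" for i j by (simp add: inner_commute[of "axis j 1"] inner_axis)
  have "g 1 1 y + g 2 2 y + g 3 3 y = (\<Sum>i\<in>UNIV. g i i y)" by (simp add: sum_3)
  also have "\<dots> = (\<Sum>j\<in>UNIV. \<Sum>i\<in>UNIV. (axis j 1 \<bullet> b i) * (Du (R y) $ j \<bullet> b i))"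
   unfolding g_def ax by (rule sum.swap)
  also have "\<dots> = (\<Sum>j\<in>UNIV. Du (R y) $ j $ j)" unfolding b_sum by (simp add: inner_commute[of "axis _ 1"] inner_axis)
  finally show ?thesis .
 qed
 from isometry_AE[OF R div]
 show "AE x in lebesgue. x \<in> R -` \<Omega> \<longrightarrow> g 1 1 x + g 2 2 x + g 3 3 x = 0"
  by eventually_elim (simp add: tr)
qed (rule frame_ibp)

text \<open>The integral runs over the thin set \<open>D\<close>, whose measure enters through
  \<open>m\<close>, while the norm is over the whole fluid part of the cylinder.\<close>

lemma frame_Lp_bound:
 fixes f :: "real^3 \<Rightarrow> 'b::euclidean_space"
 assumes D: "D \<in> lmeasurable" "measure lebesgue D \<le> m" "0 < m" "\<And>x. x \<in> D ==> cyl \<sigma> x" and \<sigma>: "0 < \<sigma>"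
  and f: "in_Lp p (fluid) f"
 shows "L1 (\<lambda>y. ind (D \<inter> R -` fluid) y * norm (f (R y)))"
  and "(LI y. ind (D \<inter> R -` fluid) y * norm (f (R y)))
   \<le> 2 * m powr (1 - 1 / p) * Lp_norm p (cylinder R \<sigma> \<inter> fluid) f"
proof -
 define \<Phi> where "\<Phi> = fluid"
 define C where "C = R ` (D \<inter> R -` \<Phi>)"
 have \<Phi>: "open \<Phi>" using fluid_open by (simp add: \<Phi>_def)
 have DF: "D \<inter> R -` \<Phi> \<in> lmeasurable" by (rule fmeasurable_Int_fmeasurable[OF D(1)]) (use vimage_open[OF \<Phi>] in \<open>simp add: lebesgue_openin\<close>)
 have "measure lebesgue (D \<inter> R -` \<Phi>) \<le> measure lebesgue D"
  by (rule measure_mono_fmeasurable) (use DF D(1) in \<open>auto dest: fmeasurableD\<close>)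
 then have Cm: "C \<in> lmeasurable" "measure lebesgue C \<le> m"
  using isometry_lmeasurable_image[OF R DF] D(2) by (auto simp: C_def)
 have "open {x. norm (horiz x) < \<sigma>}" unfolding norm_horiz_less_iff[OF \<sigma>] by (intro open_Collect_less hsq_continuous continuous_on_const)
 then have K: "open (cylinder R \<sigma>)" unfolding cylinder_def by (rule isometry_open_image[OF R])
 then have Ks: "cylinder R \<sigma> \<inter> \<Phi> \<in> sets lebesgue" using \<Phi> by (simp add: lebesgue_openin open_Int)
 have sub: "C \<subseteq> cylinder R \<sigma> \<inter> \<Phi>" using D(4) norm_horiz_less_iff[OF \<sigma>] by (auto simp: C_def cylinder_def)
 have fl: "in_Lp p (cylinder R \<sigma> \<inter> \<Phi>) f" by (rule in_Lp_subset[OF f[folded \<Phi>_def] _ Ks]) simp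
 note L = in_Lp_local_L1[OF p fl Cm(1) sub Cm(2) D(3) Ks]
 have e: "ind C (R y) = ind (D \<inter> R -` \<Phi>) y" for y
  unfolding C_def indicator_def by (simp add: isometry_image_memD[OF R])
 have n: "norm (ind C (R y) *\<^sub>R f (R y)) = ind (D \<inter> R -` \<Phi>) y * norm (f (R y))" for y
  by (simp add: e)
 have "L1 (\<lambda>y. norm (ind C (R y) *\<^sub>R f (R y)))"
  using isometry_integrable[OF R, of "\<lambda>x. norm (ind C x *\<^sub>R f x)"] integrable_norm[OF L(1)] by simp
 then show "L1 (\<lambda>y. ind (D \<inter> R -` fluid) y * norm (f (R y)))"
  unfolding n \<Phi>_def .
 show "(LI y. ind (D \<inter> R -` fluid) y * norm (f (R y)))
   \<le> 2 * m powr (1 - 1 / p) * Lp_norm p (cylinder R \<sigma> \<inter> fluid) f"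
  using L(3) isometry_integral[OF R, of "\<lambda>x. norm (ind C x *\<^sub>R f x)"] unfolding n \<Phi>_def by simp
qed

text \<open>The lower surface is the plane at height \<open>- h / 2\<close>. 44830080 = 7471680 * 3
  * 2: the 3 compares an entry in the rotated basis with the norm of the gradient, the 2 is that of
  the Hoelder bound.\<close>

lemma first_bound:
 assumes h: "0 < h" "h \<le> \<sigma>" "\<sigma> < \<sigma>'"
  and bot: "\<And>x. cyl \<sigma>' x ==> x $ 3 = - h / 2 ==> x \<notin> R -` \<Omega>"
  and top: "\<And>x. cyl \<sigma>' x ==> 3 * h / 2 \<le> x $ 3 ==> x $ 3 \<le> 2 * h ==> x \<in> R -` St"
 shows "\<bar>a $ 3\<bar> * \<sigma> ^ 3 \<le> 44830080 * h * ((10 * \<sigma>^2 * h) powr (1 - 1 / p) *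
  Lp_norm p (cylinder R \<sigma> \<inter> fluid) (Du))"
proof -
 interpret G: gap "R -` \<Omega>" "R -` St" "R -` fluid" w g a W h \<sigma> \<sigma>' "\<lambda>_. - h / 2"
  by (rule flow_gap) (use h bot top in auto)
 have \<sigma>: "0 < \<sigma>" using h by simp
 have L: "in_Lp p (fluid) (Du)"
  by (rule in_Lp_subset[of p \<Omega>]) (use u fluid_open in \<open>auto simp: W1p_zero_def W1p_def fluid_region_def lebesgue_openin\<close>)
 note B = frame_Lp_bound[OF G.D_measure(1,2) _ _ \<sigma> L]
 have D: "cyl \<sigma> x" if "x \<in> G.D" for x using G.D_bounds[OF that] by simp
 have m: "0 < 10 * \<sigma>^2 * h" using \<sigma> h by simp
 have e: "ind (G.D \<inter> R -` fluid) y * (3 * norm (Du (R y)))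
  = 3 * (ind (G.D \<inter> R -` fluid) y * norm (Du (R y)))" for y by simp
 have "\<bar>a $ 3\<bar> * \<sigma> ^ 3 \<le> 7471680 * (h * (LI y. ind (G.D \<inter> R -` fluid) y * (3 * norm (Du (R y)))))"
 proof (rule G.first_order_estimate)
  show "L1 (\<lambda>y. ind (G.D \<inter> R -` fluid) y * (3 * norm (Du (R y))))"
   unfolding e by (rule integrable_mult_right[OF B(1)[OF m D]])
  show "AE x in lebesgue. x \<in> R -` fluid \<longrightarrow> \<bar>g i k x\<bar> \<le> 3 * norm (Du (R x))" for i k
   using g_bound by auto
 qed
 also have "\<dots> = 22415040 * h * (LI y. ind (G.D \<inter> R -` fluid) y * norm (Du (R y)))"
  unfolding e by simp
 also have "\<dots> \<le> 22415040 * h * (2 * (10 * \<sigma>^2 * h) powr (1 - 1 / p) * Lp_norm p (cylinder R \<sigma> \<inter> fluid) (Du))"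
  using h by (intro mult_left_mono B(2)[OF m D]) auto
 finally show ?thesis by (simp add: mult_ac)
qed

text \<open>The second derivative along the contact normal of the velocity component along
  \<open>b i\<close>: the only second derivatives that the vertical integration by parts
  produces.\<close>

definition frame_hess :: "3 \<Rightarrow> real^3 \<Rightarrow> real" where
 "frame_hess i y = (\<Sum>l\<in>UNIV. b 3 $ l *\<^sub>R (\<Sum>j\<in>UNIV. b 3 $ j *\<^sub>R weak_hess (fluid) u (R y) $ j) $ l) \<bullet> b i"

lemma frame_hess_bound: "\<bar>frame_hess i y\<bar> \<le> 9 * norm (weak_hess (fluid) u (R y))"
proof -
 have "\<bar>frame_hess i y\<bar> \<le> 3 * norm (\<Sum>j\<in>UNIV. b 3 $ j *\<^sub>R weak_hess (fluid) u (R y) $ j)"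
  unfolding frame_hess_def by (rule order_trans[OF inner_b norm_linear_combination_le]) (rule b_nth)
 also have "\<dots> \<le> 3 * (3 * norm (weak_hess (fluid) u (R y)))"
  by (intro mult_left_mono norm_linear_combination_le) (use b_nth in auto)
 finally show ?thesis by simp
qed

lemma frame_hess_ibp:
 assumes wd: "weakly_differentiable (fluid) (weak_grad (fluid) u)"
  and d: "\<And>x. (\<theta> has_derivative (\<lambda>v. v \<bullet> T x)) (at x)" and cT: "continuous_on UNIV T"
  and K: "compact K" "K \<subseteq> R -` fluid" and z: "\<And>x. x \<notin> K ==> \<theta> x = 0"
 shows "(LI x. T x $ 3 * (ind (R -` fluid) x * g 3 i x))
  = - (LI x. \<theta> x * (ind (R -` fluid) x * frame_hess i x))"
proof -
 define \<Phi> where "\<Phi> = fluid"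
 define f where "f = weak_grad \<Phi> u"
 define H where "H = weak_hess \<Phi> u"
 have \<Phi>o: "open \<Phi>" using fluid_open by (simp add: \<Phi>_def)
 have fH: "has_weak_gradient \<Phi> f H" using weak_grad_works[OF wd] by (simp add: f_def H_def \<Phi>_def weak_hess_def)
 have "weakly_differentiable \<Omega> u" using u by (simp add: W1p_zero_def W1p_def)
 then have uG: "has_weak_gradient \<Phi> u (Du)"
  by (intro has_weak_gradient_subset[OF weak_grad_works]) (auto simp: \<Phi>_def fluid_region_def)
 then have "has_weak_gradient \<Phi> u f" unfolding f_def by (intro weak_grad_works) (auto simp: weakly_differentiable_def)
 \<comment> \<open>The gradients chosen on the fluid region and on \<open>\<Omega>\<close> are
   unrelated choices; the Hessian is built from the first, \<open>g\<close> from the second.\<close>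
 then have fG: "AE x in lebesgue. x \<in> \<Phi> \<longrightarrow> f x = Du x" using has_weak_gradient_unique[OF \<Phi>o] uG by blast
 have T0: "T x = 0" if "x \<notin> K" for x
 proof -
  have "((\<lambda>x. 0::real) has_derivative (\<lambda>v. v \<bullet> T x)) (at x)"
   by (rule has_derivative_transform_within_open[OF d, of "- K"]) (use K(1) that z in \<open>auto simp: compact_imp_closed open_Compl\<close>)
  then have "(\<lambda>v. v \<bullet> T x) = (\<lambda>v. 0)" by (rule has_derivative_unique[OF _ has_derivative_const])
  then have "T x \<bullet> T x = 0" by meson
  then show ?thesis by simp
 qed
 have iR: "is_isometry (inv R)" by (rule is_isometry_inv[OF R])
 have ciR: "continuous_on UNIV (inv R)" by (rule is_isometry_continuous[OF iR])
 have cA: "continuous_on UNIV A" by (rule linear_continuous_on) (simp add: linA linear_conv_bounded_linear[symmetric])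
 define \<theta>' where "\<theta>' x = \<theta> (inv R x)" for x
 define T' where "T' x = A (T (inv R x))" for x
 have d': "(\<theta>' has_derivative (\<lambda>v. v \<bullet> T' x)) (at x)" for x
  unfolding \<theta>'_def[abs_def] T'_def by (rule pullback_derivative) (rule d)
 have cT': "continuous_on UNIV T'"
  unfolding T'_def[abs_def]
  by (rule continuous_on_compose2[OF cA continuous_on_compose2[OF cT ciR]]) auto
 have c\<theta>': "continuous_on UNIV \<theta>'" by (intro continuous_at_imp_continuous_on ballI has_derivative_continuous[OF d'])
 have K': "compact (R ` K)" "R ` K \<subseteq> \<Phi>" using K compact_continuous_image[OF is_isometry_continuous[OF R]] by (auto simp: \<Phi>_def)
 have off: "inv R x \<notin> K" if "x \<notin> R ` K" for x using that by (metis image_eqI inv_R(1))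
 have z': "\<theta>' x = 0" "T' x = 0" if "x \<notin> R ` K" for x
  using z[OF off[OF that]] T0[OF off[OF that]] linA by (simp_all add: \<theta>'_def T'_def linear_0)
 have ci: "L1 (\<lambda>x. ind \<Phi> x *\<^sub>R (\<phi> x *\<^sub>R F x))"
  if F: "F absolutely_integrable_on R ` K" and \<phi>: "continuous_on UNIV \<phi>" "\<And>x. x \<notin> R ` K ==> \<phi> x = 0"
  for F :: "real^3 \<Rightarrow> real^3^3" and \<phi> :: "real^3 \<Rightarrow> real"
 proof -
  obtain M where M: "\<And>x. x \<in> R ` K ==> \<bar>\<phi> x\<bar> \<le> M"
   using compact_imp_bounded[OF compact_continuous_image[OF continuous_on_subset[OF \<phi>(1)] K'(1)]]
   unfolding bounded_iff by auto
  have Fi: "L1 (\<lambda>x. ind (R ` K) x *\<^sub>R F x)" using F by (simp add: set_integrable_def)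
  have e: "ind \<Phi> x *\<^sub>R (\<phi> x *\<^sub>R F x) = \<phi> x *\<^sub>R (ind (R ` K) x *\<^sub>R F x)" for x
   using \<phi>(2)[of x] K'(2) by (auto simp: indicator_def)
  show ?thesis unfolding e
  proof (rule Bochner_Integration.integrable_bound[OF integrable_mult_right[OF integrable_norm[OF Fi], of "\<bar>M\<bar>"]])
   show "(\<lambda>x. \<phi> x *\<^sub>R (ind (R ` K) x *\<^sub>R F x)) \<in> lmeas"
    by (intro borel_measurable_scaleR continuous_imp_lebesgue \<phi>(1) borel_measurable_integrable Fi)
   show "AE x in lebesgue. norm (\<phi> x *\<^sub>R (ind (R ` K) x *\<^sub>R F x)) \<le> norm (\<bar>M\<bar> * norm (ind (R ` K) x *\<^sub>R F x))"
   proof (rule AE_I2)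
    fix x
    show "norm (\<phi> x *\<^sub>R (ind (R ` K) x *\<^sub>R F x)) \<le> norm (\<bar>M\<bar> * norm (ind (R ` K) x *\<^sub>R F x))"
    proof (cases "x \<in> R ` K")
     case True
     have "\<bar>\<phi> x\<bar> \<le> \<bar>M\<bar>" using M[OF True] by simp
     then have "\<bar>\<phi> x\<bar> * norm (F x) \<le> \<bar>M\<bar> * norm (F x)" by (rule mult_right_mono) simp
     then show ?thesis using True by (simp add: abs_mult)
    qed simp
   qed
  qed
 qed
 define FX where "FX j x = ind \<Phi> x *\<^sub>R (T' x $ j *\<^sub>R f x)" for j x
 define FY where "FY j x = ind \<Phi> x *\<^sub>R (\<theta>' x *\<^sub>R (H x $ j))" for j x
 have IX: "L1 (FX j)" for j
  unfolding FX_def[abs_def]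
  by (rule ci) (use has_weak_gradientD(1)[OF fH K'] cT' z' in \<open>auto intro!: continuous_intros\<close>)
 have IY: "L1 (FY j)" for j
  unfolding FY_def[abs_def]
  by (rule ci) (use absolutely_integrable_vec_nth[OF has_weak_gradientD(2)[OF fH K']] c\<theta>' z' in auto)
 have XY: "(LI x. FX j x) = - (LI x. FY j x)" for j
  using has_weak_gradient_C1_test[OF \<Phi>o fH K' d' cT' z'(1), of j]
  by (simp add: FX_def FY_def set_lebesgue_integral_def)
 define \<kappa> where "\<kappa> M = (\<Sum>l\<in>UNIV. b 3 $ l *\<^sub>R M $ l) \<bullet> b i" for M :: "real^3^3"
 have l: "bounded_linear \<kappa>"
  unfolding linear_conv_bounded_linear[symmetric] \<kappa>_def
  by (rule linearI) (simp_all add: inner_add_left scaleR_add_right sum.distrib scaleR_sum_right mult_ac flip: inner_scaleR_left)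
 note ladd = linear_add[OF bounded_linear.linear[OF l]] and lcmul = linear_cmul[OF bounded_linear.linear[OF l]]
  and lsum = linear_sum[OF bounded_linear.linear[OF l]] and lneg = linear_neg[OF bounded_linear.linear[OF l]]
 define X where "X x = (\<Sum>j\<in>UNIV. b 3 $ j * \<kappa> (FX j x))" for x
 define Y where "Y x = (\<Sum>j\<in>UNIV. b 3 $ j * \<kappa> (FY j x))" for x
 have comb: "(LI x. (\<Sum>j\<in>UNIV. b 3 $ j * \<kappa> (F j x))) = (\<Sum>j\<in>UNIV. b 3 $ j * \<kappa> (LI x. F j x))"
  if F: "\<And>j. L1 (F j)" for F :: "3 \<Rightarrow> real^3 \<Rightarrow> real^3^3"
 proof -
  have "L1 (\<lambda>x. \<kappa> (F j x))" for j by (rule integrable_bounded_linear[OF l F])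
  then show ?thesis by (simp add: Bochner_Integration.integral_sum integral_bounded_linear[OF l F])
 qed
 have XYl: "(LI x. X x) = - (LI x. Y x)"
  unfolding X_def Y_def comb[of FX, OF IX] comb[of FY, OF IY] XY by (simp add: lneg sum_negf)
 have ind: "ind (R -` \<Phi>) y = ind \<Phi> (R y)" for y by (simp add: indicator_def)
 have XR: "X (R y) = T y $ 3 * (ind (R -` \<Phi>) y * \<kappa> (f (R y)))" for y
 proof -
  have "(\<Sum>j\<in>UNIV. b 3 $ j * T' (R y) $ j) = T y $ 3"
   using b_inner[of "T y" 3] by (simp add: T'_def inv_R inner_vec_def mult.commute)
  moreover have "X (R y) = (\<Sum>j\<in>UNIV. b 3 $ j * T' (R y) $ j) * (ind \<Phi> (R y) * \<kappa> (f (R y)))"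
   unfolding X_def FX_def sum_distrib_right by (simp add: lcmul mult_ac)
  ultimately show ?thesis by (simp add: ind)
 qed
 have YR: "Y (R y) = \<theta> y * (ind (R -` \<Phi>) y * frame_hess i y)" for y
 proof -
  have "frame_hess i y = \<kappa> (\<Sum>j\<in>UNIV. b 3 $ j *\<^sub>R H (R y) $ j)" by (simp add: frame_hess_def \<kappa>_def H_def \<Phi>_def)
  also have "\<dots> = (\<Sum>j\<in>UNIV. b 3 $ j * \<kappa> (H (R y) $ j))" by (simp add: lsum lcmul)
  finally show ?thesis
   unfolding Y_def FY_def by (simp add: lcmul \<theta>'_def inv_R ind sum_distrib_left mult_ac)
 qed
 have gl: "AE y in lebesgue. T y $ 3 * (ind (R -` \<Phi>) y * \<kappa> (f (R y))) = T y $ 3 * (ind (R -` \<Phi>) y * g 3 i y)"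
  using isometry_AE[OF R fG] by eventually_elim (auto simp: \<kappa>_def g_eq indicator_def)
 have "(LI y. T y $ 3 * (ind (R -` \<Phi>) y * g 3 i y)) = (LI y. X (R y))"
  unfolding XR by (rule lebesgue_integral_cong_AE[OF eventually_mono[OF gl sym]])
 also have "\<dots> = - (LI y. Y (R y))"
  using XYl isometry_integral[OF R, of X] isometry_integral[OF R, of Y] by simp
 finally show ?thesis unfolding YR \<Phi>_def .
qed

text \<open>The factors 6 = 3 * 2 and 18 = 9 * 2 combine the passage from frame entries to the norms
  of gradient (3) and Hessian (9) with the 2 of the Hoelder bound.\<close>

lemma second_bound:
 assumes h: "0 < h" "h \<le> \<sigma>" "\<sigma> < \<sigma>'" and p2: "p = 2"
  and wd: "weakly_differentiable (fluid) (weak_grad (fluid) u)"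
  and hL: "in_Lp 2 (fluid) (weak_hess (fluid) u)"
  and gg: "gap_graphs (R -` \<Omega>) (R -` St) (R -` fluid) h \<sigma>' E \<beta> \<tau> Db Dt"
 defines "N1 \<equiv> Lp_norm 2 (cylinder R \<sigma> \<inter> fluid) (Du)"
  and "N2 \<equiv> Lp_norm 2 (cylinder R \<sigma> \<inter> fluid) (weak_hess (fluid) u)"
 shows "\<bar>a $ 3\<bar> * \<sigma> ^ 3 \<le> (10 * \<sigma>^2 * h) powr (1 / 2) *
  (6 * 226504704 * E * \<sigma> ^ 3 * N1 + 6 * 7471104 * (h^2 / \<sigma>) * N1 + 18 * 96 * h^2 * N2)"
proof -
 interpret gr: gap_graphs "R -` \<Omega>" "R -` St" "R -` fluid" h \<sigma>' E \<beta> \<tau> Db Dt by (rule gg)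
 have c\<beta>: "continuous_on {x. cyl \<sigma>' x} \<beta>" by (rule GDERIV_imp_continuous_on[OF gr.db(1)]) simp
 interpret G: gap "R -` \<Omega>" "R -` St" "R -` fluid" w g a W h \<sigma> \<sigma>' \<beta>
 proof (rule flow_gap[OF h c\<beta> _ gr.b\<Omega>])
  show "- h / 2 \<le> \<beta> x \<and> \<beta> x \<le> h / 4" if "cyl \<sigma>' x" for x using gr.bb[OF that] h(1) by auto
  show "x \<in> R -` St" if "cyl \<sigma>' x" "3 * h / 2 \<le> x $ 3" "x $ 3 \<le> 2 * h" for x
   by (rule gr.inS) (use that gr.t[OF that(1)] h(1) in auto)
 qed
 have \<sigma>: "0 < \<sigma>" using h by simp
 have L: "in_Lp p (fluid) (Du)"
  by (rule in_Lp_subset[of p \<Omega>]) (use u fluid_open in \<open>auto simp: W1p_zero_def W1p_def fluid_region_def lebesgue_openin\<close>)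
 have D: "cyl \<sigma> x" if "x \<in> G.D" for x using G.D_bounds[OF that] by simp
 have m: "0 < 10 * \<sigma>^2 * h" using \<sigma> h by simp
 note B1 = frame_Lp_bound[OF G.D_measure(1,2) m D \<sigma> L]
 note B2 = frame_Lp_bound[OF G.D_measure(1,2) m D \<sigma> hL[folded p2]]
 define J1 where "J1 = (LI y. ind (G.D \<inter> R -` fluid) y * norm (Du (R y)))"
 define J2 where "J2 = (LI y. ind (G.D \<inter> R -` fluid) y * norm (weak_hess (fluid) u (R y)))"
 define M where "M = (10 * \<sigma>^2 * h) powr (1 / 2)"
 have J: "J1 \<le> 2 * M * N1" "J2 \<le> 2 * M * N2"
  using B1(2) B2(2) by (simp_all add: J1_def J2_def N1_def N2_def M_def p2)
 have e1: "ind (G.D \<inter> R -` fluid) y * (3 * norm (Du (R y)))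
  = 3 * (ind (G.D \<inter> R -` fluid) y * norm (Du (R y)))" for y by simp
 have e2: "ind (G.D \<inter> R -` fluid) y * (9 * norm (weak_hess (fluid) u (R y)))
  = 9 * (ind (G.D \<inter> R -` fluid) y * norm (weak_hess (fluid) u (R y)))" for y by simp
 have "\<bar>a $ 3\<bar> * \<sigma> ^ 3 \<le> (226504704 * E) * \<sigma> ^ 3 * (LI y. ind (G.D \<inter> R -` fluid) y * (3 * norm (Du (R y))))
  + 7471104 * (h^2 / \<sigma>) * (LI y. ind (G.D \<inter> R -` fluid) y * (3 * norm (Du (R y))))
  + 96 * h^2 * (LI y. ind (G.D \<inter> R -` fluid) y * (9 * norm (weak_hess (fluid) u (R y))))"
 proof (rule G.second_order_estimate[where \<tau> = \<tau> and Db = Db and Dt = Dt and H = frame_hess])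
  show "L1 (\<lambda>y. ind (G.D \<inter> R -` fluid) y * (3 * norm (Du (R y))))"
   unfolding e1 by (rule integrable_mult_right[OF B1(1)])
  show "L1 (\<lambda>y. ind (G.D \<inter> R -` fluid) y * (9 * norm (weak_hess (fluid) u (R y))))"
   unfolding e2 by (rule integrable_mult_right[OF B2(1)])
  show "AE x in lebesgue. x \<in> R -` fluid \<longrightarrow> \<bar>g i k x\<bar> \<le> 3 * norm (Du (R x))" for i k
   using g_bound by auto
  show "AE x in lebesgue. x \<in> R -` fluid \<longrightarrow> \<bar>frame_hess i x\<bar> \<le> 9 * norm (weak_hess (fluid) u (R x))" for i
   using frame_hess_bound by auto
 qed (fact gg frame_hess_ibp[OF wd])+
 also have "\<dots> = (226504704 * E) * \<sigma> ^ 3 * (3 * J1) + 7471104 * (h^2 / \<sigma>) * (3 * J1) + 96 * h^2 * (9 * J2)"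
  unfolding e1 e2 by (simp add: J1_def J2_def)
 also have "\<dots> \<le> (226504704 * E) * \<sigma> ^ 3 * (3 * (2 * M * N1)) + 7471104 * (h^2 / \<sigma>) * (3 * (2 * M * N1)) + 96 * h^2 * (9 * (2 * M * N2))"
  using J gr.even(2) \<sigma> by (intro add_mono mult_left_mono) auto
 finally show ?thesis unfolding M_def[symmetric] by (simp add: algebra_simps)
qed

end

section \<open>Scales and rates\<close>

lemma C1_charts_iff: "uniformly_C1 \<alpha> D \<longleftrightarrow> (\<exists>k>0. \<exists>s>0. C1_charts \<alpha> k s D)"
 unfolding uniformly_C1_def C1_charts_def ..

lemma C3_charts_iff: "uniformly_C3 D \<longleftrightarrow> (\<exists>s>0. \<exists>K>0. C3_charts K s D)"
 unfolding uniformly_C3_def C3_charts_def ..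

abbreviation (input) C1_rate where
 "C1_rate \<alpha> p \<Omega> St u C c h R \<equiv>
  C * h powr ((1 + 2 * \<alpha>) / (p * (1 + \<alpha>)) * (p - (3 + \<alpha>) / (1 + 2 * \<alpha>))) *
  Lp_norm p (cylinder R (c * h powr (1 / (1 + \<alpha>))) \<inter> fluid_region \<Omega> St) (weak_grad \<Omega> u)"

abbreviation (input) C3_rate where
 "C3_rate \<Omega> St u C c h R \<equiv>
  C * (h powr (3 / 2) * Lp_norm 2 (cylinder R (c * h powr (1 / 2)) \<inter> fluid_region \<Omega> St) (weak_hess (fluid_region \<Omega> St) u) +
   h * Lp_norm 2 (cylinder R (c * h powr (1 / 2)) \<inter> fluid_region \<Omega> St) (weak_grad \<Omega> u))"

text \<open>\<open>c0\<close> is chosen so that \<open>(2 * \<sigma>) powr (1 + \<alpha>)\<close>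
  equals \<open>h / (4 * m)\<close>: the cusps stay below \<open>h / 4\<close> even at radius
  \<open>2 * \<sigma>\<close>, which will be the outer radius \<open>\<sigma>'\<close>. For small
  \<open>h\<close> the inequality \<open>h \<le> \<sigma>\<close> holds because the exponent of
  \<open>\<sigma>\<close> is less than 1.\<close>

lemma gap_scale:
 fixes \<alpha> k1 s1 k2 s2 d :: real
 assumes "0 < \<alpha>" "0 < k1" "0 < s1" "0 < k2" "0 < s2" "0 < d"
 shows "\<exists>c0>0. \<exists>H>0. H \<le> d \<and> (\<forall>h \<sigma>. 0 < h \<and> h < H \<and> \<sigma> = c0 * h powr (1 / (1 + \<alpha>)) \<longrightarrow>
  h \<le> \<sigma> \<and> k1 * (2 * \<sigma>) powr (1 + \<alpha>) \<le> h / 4 \<and> 2 * \<sigma> \<le> s1 \<and> 2 * h < k1 * s1 powr (1 + \<alpha>) \<and>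
  k2 * (2 * \<sigma>) powr (1 + \<alpha>) \<le> h / 4 \<and> 2 * \<sigma> \<le> s2 \<and> 2 * h < k2 * s2 powr (1 + \<alpha>))"
proof -
 define m where "m = max k1 k2"
 have m: "0 < m" "k1 \<le> m" "k2 \<le> m" using assms by (auto simp: m_def)
 define c0 where "c0 = (1 / (4 * m)) powr (1 / (1 + \<alpha>)) / 2"
 have c0: "0 < c0" using m by (simp add: c0_def)
 have c1: "(2 * c0) powr (1 + \<alpha>) = 1 / (4 * m)" using m assms(1) by (simp add: c0_def powr_powr)
 define H where "H = Min {d, (s1 / (2 * c0)) powr (1 + \<alpha>), (s2 / (2 * c0)) powr (1 + \<alpha>),
  k1 * s1 powr (1 + \<alpha>) / 2, k2 * s2 powr (1 + \<alpha>) / 2, c0 powr ((1 + \<alpha>) / \<alpha>)}"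
 have H: "0 < H" "H \<le> d" using assms c0 by (simp_all add: H_def)
 show ?thesis
 proof (rule exI[of _ c0], intro conjI c0, rule exI[of _ H], intro conjI H allI impI; elim conjE)
  fix h \<sigma> assume h: "0 < h" "h < H" and \<sigma>: "\<sigma> = c0 * h powr (1 / (1 + \<alpha>))"
  have hb: "h < (s1 / (2 * c0)) powr (1 + \<alpha>)" "h < (s2 / (2 * c0)) powr (1 + \<alpha>)" "h < k1 * s1 powr (1 + \<alpha>) / 2"
   "h < k2 * s2 powr (1 + \<alpha>) / 2" "h < c0 powr ((1 + \<alpha>) / \<alpha>)"
   using h(2) by (simp_all add: H_def)
  have "h powr (\<alpha> / (1 + \<alpha>)) \<le> (c0 powr ((1 + \<alpha>) / \<alpha>)) powr (\<alpha> / (1 + \<alpha>))"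
   using hb(5) h assms(1) by (intro powr_mono2) auto
  also have "\<dots> = c0" using c0 assms(1) by (simp add: powr_powr)
  finally have "h powr (\<alpha> / (1 + \<alpha>)) * h powr (1 / (1 + \<alpha>)) \<le> c0 * h powr (1 / (1 + \<alpha>))" by (rule mult_right_mono) simp
  moreover have "h powr (\<alpha> / (1 + \<alpha>)) * h powr (1 / (1 + \<alpha>)) = h"
  proof -
   have "\<alpha> / (1 + \<alpha>) + 1 / (1 + \<alpha>) = 1" using assms(1) by (simp add: add_divide_distrib[symmetric])
   then show ?thesis using h by (simp flip: powr_add)
  qed
  ultimately show "h \<le> \<sigma>" by (simp add: \<sigma>)
  have pw: "(2 * \<sigma>) powr (1 + \<alpha>) = h / (4 * m)"
  proof -
   have "(2 * \<sigma>) powr (1 + \<alpha>) = ((2 * c0) * h powr (1 / (1 + \<alpha>))) powr (1 + \<alpha>)" by (simp add: \<sigma> mult.assoc)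
   also have "\<dots> = (2 * c0) powr (1 + \<alpha>) * (h powr (1 / (1 + \<alpha>))) powr (1 + \<alpha>)" using c0 by (intro powr_mult)
   also have "(h powr (1 / (1 + \<alpha>))) powr (1 + \<alpha>) = h" using h assms(1) by (simp add: powr_powr)
   finally show ?thesis by (simp add: c1)
  qed
  have kb: "k * (2 * \<sigma>) powr (1 + \<alpha>) \<le> h / 4" if "k \<le> m" for k
  proof -
   have "k * (h / (4 * m)) \<le> m * (h / (4 * m))" using that h m by (intro mult_right_mono) auto
   then show ?thesis using m by (simp add: pw)
  qed
  show "k1 * (2 * \<sigma>) powr (1 + \<alpha>) \<le> h / 4" "k2 * (2 * \<sigma>) powr (1 + \<alpha>) \<le> h / 4" using kb m by auto
  have sb: "2 * \<sigma> \<le> s" if "h < (s / (2 * c0)) powr (1 + \<alpha>)" "0 < s" for s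
  proof -
   have "h powr (1 / (1 + \<alpha>)) \<le> ((s / (2 * c0)) powr (1 + \<alpha>)) powr (1 / (1 + \<alpha>))"
    using that h assms(1) by (intro powr_mono2) auto
   also have "\<dots> = s / (2 * c0)" using that c0 assms(1) by (simp add: powr_powr)
   finally show ?thesis using c0 by (simp add: \<sigma> field_simps)
  qed
  show "2 * \<sigma> \<le> s1" "2 * \<sigma> \<le> s2" using sb hb assms by auto
  show "2 * h < k1 * s1 powr (1 + \<alpha>)" "2 * h < k2 * s2 powr (1 + \<alpha>)" using hb by auto
 qed
qed

text \<open>With r = 1 / (1 + \<open>\<alpha>\<close>), the factor \<open>h\<close> contributes 1,
  the volume of the gap (2 r + 1) (1 - 1/p), and the division by \<open>\<sigma> ^ 3\<close>
  contributes - 3 r; the sum is the stated exponent.\<close>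

lemma first_exponent:
 fixes h c0 \<alpha> p :: real
 assumes "0 < h" "0 < c0" "0 < \<alpha>" "1 \<le> p" and \<sigma>: "\<sigma> = c0 * h powr (1 / (1 + \<alpha>))"
  and b: "a * \<sigma> ^ 3 \<le> C * h * ((10 * \<sigma>^2 * h) powr (1 - 1 / p) * N)"
 shows "a \<le> (C * (10 * c0^2) powr (1 - 1 / p) / c0 ^ 3) * h powr ((1 + 2 * \<alpha>) / (p * (1 + \<alpha>)) * (p - (3 + \<alpha>) / (1 + 2 * \<alpha>))) * N"
proof -
 define r where "r = 1 / (1 + \<alpha>)"
 define q where "q = 1 - 1 / p"
 have \<sigma>3: "\<sigma> ^ 3 = c0 ^ 3 * h powr (3 * r)"
 proof -
  have "(h powr r) ^ 3 = h powr (3 * r)" using assms(1) by (simp add: powr_power mult.commute)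
  then show ?thesis by (simp add: \<sigma> power_mult_distrib r_def)
 qed
 have \<sigma>2: "10 * \<sigma>^2 * h = (10 * c0^2) * h powr (2 * r + 1)"
 proof -
  have "(h powr r)^2 = h powr (2 * r)" using assms(1) by (simp add: powr_power mult.commute)
  then show ?thesis using assms(1) by (simp add: \<sigma> power_mult_distrib powr_add r_def)
 qed
 have M: "(10 * \<sigma>^2 * h) powr q = (10 * c0^2) powr q * h powr ((2 * r + 1) * q)"
  unfolding \<sigma>2 using assms by (simp add: powr_mult powr_powr)
 define e where "e = (1 + 2 * \<alpha>) / (p * (1 + \<alpha>)) * (p - (3 + \<alpha>) / (1 + 2 * \<alpha>))"
 have e: "1 + (2 * r + 1) * q = e + 3 * r"
 proof -
  have "1 + 2 * \<alpha> \<noteq> 0" "1 + \<alpha> \<noteq> 0" "p \<noteq> 0" using assms by auto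
  have "(1 + 2 * \<alpha>) * (p - (3 + \<alpha>) / (1 + 2 * \<alpha>)) = (1 + 2 * \<alpha>) * p - (3 + \<alpha>)"
   using \<open>1 + 2 * \<alpha> \<noteq> 0\<close> by (simp add: right_diff_distrib)
  then have "e = ((1 + 2 * \<alpha>) * p - (3 + \<alpha>)) / (p * (1 + \<alpha>))" by (simp add: e_def)
  moreover have "1 + (2 * (1 / x) + 1) * (1 - 1 / p) = ((1 + 2 * (x - 1)) * p - (3 + (x - 1))) / (p * x) + 3 * (1 / x)"
   if "x \<noteq> 0" for x using that \<open>p \<noteq> 0\<close> by (simp add: field_simps)
  from this[OF \<open>1 + \<alpha> \<noteq> 0\<close>]
  have "1 + (2 * (1 / (1 + \<alpha>)) + 1) * (1 - 1 / p) = ((1 + 2 * \<alpha>) * p - (3 + \<alpha>)) / (p * (1 + \<alpha>)) + 3 * (1 / (1 + \<alpha>))" by simp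
  ultimately show ?thesis unfolding r_def q_def by simp
 qed
 have "h * (10 * \<sigma>^2 * h) powr q = (10 * c0^2) powr q * (h powr e * h powr (3 * r))"
 proof -
  have "h * h powr ((2 * r + 1) * q) = h powr (1 + (2 * r + 1) * q)" using assms(1) by (simp add: powr_add)
  then show ?thesis unfolding M e by (simp add: powr_add)
 qed
 then have "C * h * ((10 * \<sigma>^2 * h) powr q * N) = ((C * (10 * c0^2) powr q / c0 ^ 3) * h powr e * N) * \<sigma> ^ 3"
  using assms(2) unfolding \<sigma>3 by (simp add: mult_ac)
 then have "a * \<sigma> ^ 3 \<le> ((C * (10 * c0^2) powr q / c0 ^ 3) * h powr e * N) * \<sigma> ^ 3" using b by (simp add: q_def)
 moreover have "0 < \<sigma> ^ 3" using assms by (simp add: \<sigma>)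
 ultimately show ?thesis unfolding e_def q_def by (rule mult_right_le_imp_le)
qed

text \<open>Here \<open>\<sigma>\<close> is proportional to \<open>sqrt h\<close>, so the volume
  factor is of order \<open>h\<close>. After division by \<open>\<sigma> ^ 3\<close> the odd part of
  the surfaces and the rotation both end at order \<open>h\<close>, the Hessian at order
  \<open>h powr (3 / 2)\<close>.\<close>

lemma second_exponent:
 fixes h c0 :: real
 assumes "0 < h" "0 < c0" "0 \<le> E" "0 \<le> N1" "0 \<le> N2" and \<sigma>: "\<sigma> = c0 * h powr (1 / 2)"
  and b: "a * \<sigma> ^ 3 \<le> (10 * \<sigma>^2 * h) powr (1 / 2) * (A * E * \<sigma> ^ 3 * N1 + B * (h^2 / \<sigma>) * N1 + C * h^2 * N2)"
  and ABC: "0 \<le> A" "0 \<le> B" "0 \<le> C"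
 shows "a \<le> (sqrt 10 * c0 * (A * E + B / c0 ^ 4 + C / c0 ^ 3)) * (h powr (3 / 2) * N2 + h * N1)"
proof -
 define r where "r = sqrt h"
 have r: "0 < r" "h = r^2" using assms(1) by (simp_all add: r_def)
 have s: "\<sigma> = c0 * r" using \<sigma> assms(1) by (simp add: r_def powr_half_sqrt)
 have h32: "h powr (3 / 2) = r ^ 3"
 proof -
  have "h powr (3 / 2) = h powr (1 + 1 / 2)" by simp
  also have "\<dots> = h * sqrt h" unfolding powr_add using assms(1) by (simp add: powr_half_sqrt)
  finally show ?thesis using r by (simp add: r_def[symmetric] eval_nat_numeral)
 qed
 have M: "(10 * \<sigma>^2 * h) powr (1 / 2) = sqrt 10 * c0 * r^2"
 proof -
  have "10 * \<sigma>^2 * h = 10 * (c0 * r^2)^2" by (simp add: s r(2) power2_eq_square)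
  then have "(10 * \<sigma>^2 * h) powr (1 / 2) = sqrt (10 * (c0 * r^2)^2)" by (simp only:) (rule powr_half_sqrt, simp)
  then show ?thesis using assms(2) by (simp add: real_sqrt_mult)
 qed
 have "(10 * \<sigma>^2 * h) powr (1 / 2) * (A * E * \<sigma> ^ 3 * N1 + B * (h^2 / \<sigma>) * N1 + C * h^2 * N2)
  = (sqrt 10 * c0 * (A * E * (r^2 * N1) + B / c0 ^ 4 * (r^2 * N1) + C / c0 ^ 3 * (r ^ 3 * N2))) * \<sigma> ^ 3"
  unfolding M unfolding s r(2) using r(1) assms(2) by (simp add: field_simps eval_nat_numeral)
 then have "a * \<sigma> ^ 3 \<le> (sqrt 10 * c0 * (A * E * (r^2 * N1) + B / c0 ^ 4 * (r^2 * N1) + C / c0 ^ 3 * (r ^ 3 * N2))) * \<sigma> ^ 3"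
  using b by simp
 moreover have "0 < \<sigma> ^ 3" using assms(2) r by (simp add: s)
 ultimately have "a \<le> sqrt 10 * c0 * (A * E * (r^2 * N1) + B / c0 ^ 4 * (r^2 * N1) + C / c0 ^ 3 * (r ^ 3 * N2))"
  by (rule mult_right_le_imp_le)
 also have "\<dots> \<le> sqrt 10 * c0 * ((A * E + B / c0 ^ 4 + C / c0 ^ 3) * (r ^ 3 * N2 + r^2 * N1))"
 proof (intro mult_left_mono)
  have n: "0 \<le> A * E * (r ^ 3 * N2)" "0 \<le> B / c0 ^ 4 * (r ^ 3 * N2)" "0 \<le> C / c0 ^ 3 * (r^2 * N1)"
   using assms r by simp_all
  then show "A * E * (r^2 * N1) + B / c0 ^ 4 * (r^2 * N1) + C / c0 ^ 3 * (r ^ 3 * N2)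
   \<le> (A * E + B / c0 ^ 4 + C / c0 ^ 3) * (r ^ 3 * N2 + r^2 * N1)"
   unfolding distrib_left distrib_right by linarith
 qed (use assms in simp)
 finally show ?thesis unfolding h32 unfolding r(2) by (simp only: mult.assoc)
qed

lemma Lp_norm_nonneg: "0 \<le> Lp_norm p X f"
 by (simp add: Lp_norm_def)

lemma diameter_pos:
 fixes X :: "(real^3) set"
 assumes "open X" "X \<noteq> {}" "bounded X"
 shows "0 < diameter X"
proof -
 obtain x where x: "x \<in> X" using assms(2) by blast
 obtain e where e: "0 < e" "cball x e \<subseteq> X" using assms(1) x open_contains_cball by blast
 have "x + e *\<^sub>R axis 1 1 \<in> X" using e by (intro subsetD[OF e(2)]) (simp add: dist_norm)
 then have "dist x (x + e *\<^sub>R axis 1 1) \<le> diameter X" using diameter_bounded_bound[OF assms(3) x] by blast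
 then show ?thesis using e by (simp add: dist_norm)
qed

text \<open>In the frame, \<open>P - Q\<close> is \<open>h\<close> times the third basis vector, so
  the kinematic formula divided by \<open>h\<close> says that the rate of the distance is the third
  component of the velocity at \<open>P\<close>.\<close>

lemma contact_moving_frame:
 assumes \<Omega>: "open \<Omega>" and St: "open St" "St \<subseteq> \<Omega>" and null: "negligible (frontier St)"
  and p: "1 \<le> p" "u \<in> W1p_zero p \<Omega>"
  and div: "AE x in lebesgue. x \<in> \<Omega> \<longrightarrow> (\<Sum>j\<in>UNIV. weak_grad \<Omega> u x $ j $ j) = 0"
  and rig: "AE x in lebesgue. x \<in> St \<longrightarrow> u x = c + cross3 om (x - z0)"
  and cf: "contact_frame \<Omega> St P Q R" and h: "h = setdist St (frontier \<Omega>)" "0 < h"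
  and \<delta>: "\<delta> * dist P Q = (c + cross3 om (P - z0)) \<bullet> (P - Q)"
 obtains A where "moving_frame \<Omega> St R A p u c om z0" "contact (R -` \<Omega>) (R -` St) h" "\<delta> = moving_frame.a R A h c om z0 $ 3"
proof -
 have RR: "is_isometry R" "R 0 = Q" and PQ: "P \<in> frontier St" "Q \<in> frontier \<Omega>" "dist P Q = h" "R (vector [0, 0, h]) = P"
  using cf unfolding contact_frame_def h(1) by auto
 have e: "vector [0, 0, h] = h *\<^sub>R (axis 3 1 :: real^3)" by (simp add: vec_eq_iff forall_3 axis_def)
 obtain A where A: "orthogonal_transformation A" "\<And>x. R x = R 0 + A x" using is_isometry_orthogonal[OF RR(1)] by blast
 interpret moving_frame \<Omega> St R A p h u c om z0
  by unfold_locales (fact \<Omega> St RR(1) A p div rig null)+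
 have fr: "frontier (R -` X) = R -` frontier X" for X
  unfolding isometry_vimage[OF RR(1)] by (rule isometry_frontier_image[OF is_isometry_inv[OF RR(1)]])
 have "contact (R -` \<Omega>) (R -` St) h"
 proof
  show "open (R -` \<Omega>)" "open (R -` St)" "R -` St \<subseteq> R -` \<Omega>" using vimage_open op by auto
  show "0 < h" by (fact h)
  show "0 \<in> frontier (R -` \<Omega>)" "h *\<^sub>R axis 3 1 \<in> frontier (R -` St)" using PQ RR(2) by (simp_all add: fr flip: e)
  show "h \<le> norm (x - y)" if "x \<in> R -` St" "y \<in> frontier (R -` \<Omega>)" for x y
  proof -
   have "h \<le> dist (R x) (R y)" unfolding h(1) using that by (intro setdist_le_dist) (auto simp: fr)
   then show ?thesis using RR(1) by (simp add: is_isometry_def dist_norm)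
  qed
 qed
 moreover have "\<delta> = a $ 3"
 proof -
  have Ph: "R (h *\<^sub>R axis 3 1) = P" using PQ(4) by (simp add: e)
  have "P - Q = h *\<^sub>R b 3" using RA[of "h *\<^sub>R axis 3 1"] Ph RR(2) by (simp add: b_def linear_cmul[OF linA])
  then have "\<delta> * h = h * a $ 3" using \<delta> PQ(3) by (simp add: a_def Ph)
  then show ?thesis using h(2) by simp
 qed
 ultimately show ?thesis using that moving_frame_axioms by blast
qed

lemma negligible_isometry_frontier:
 assumes "is_isometry \<psi>" "negligible (frontier X)"
 shows "negligible (frontier (\<psi> ` X))"
 unfolding isometry_frontier_image[OF assms(1)]
 using isometry_lmeasurable_image[OF assms(1), of "frontier X"] assms(2)
 by (simp add: negligible_iff_measure)

text \<open>Composing the isometry from \<open>B\<close> to \<open>S0\<close> with that from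
  \<open>S0\<close> to \<open>S t\<close> makes every position congruent to \<open>B\<close>, so its
  charts have the constants of \<open>B\<close>.\<close>

lemma congruent_body_motion:
 assumes B: "open B" "B \<noteq> {}" "bounded B" and \<phi>: "is_isometry \<phi>" "S0 = \<phi> ` B"
  and mo: "rigid_body_motion \<Omega> T S0 us om xs S" and T: "0 < T"
 shows "t \<in> {0<..<T} ==> \<exists>\<psi>. is_isometry \<psi> \<and> S t = \<psi> ` B"
  and "\<exists>L. L-lipschitz_on {t \<in> {0<..<T}. wall_distance \<Omega> S t < H} (wall_distance \<Omega> S)"
  and "AE t in lebesgue. t \<in> {0<..<T} \<longrightarrow> wall_distance \<Omega> S differentiable (at t) \<and>
   (\<forall>P Q. P \<in> frontier (S t) \<longrightarrow> Q \<in> frontier \<Omega> \<longrightarrow> dist P Q = wall_distance \<Omega> S t \<longrightarrow> 0 < dist P Q \<longrightarrow>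
    deriv (wall_distance \<Omega> S) t * dist P Q = rigid_velocity us om xs t P \<bullet> (P - Q))"
proof -
 have "bounded S0" unfolding \<phi>(2)
  by (rule bounded_subset[OF compact_imp_bounded[OF compact_continuous_image[OF is_isometry_continuous[OF \<phi>(1)]]], of "closure B"])
   (use B(3) closure_subset in \<open>auto simp: compact_closure\<close>)
 moreover have "open S0" "S0 \<noteq> {}" using isometry_open_image[OF \<phi>(1) B(1)] B(2) \<phi>(2) by simp_all
 ultimately have S0: "open S0" "S0 \<noteq> {}" "bounded S0" by simp_all
 note kin = rigid_body_motion_kinematics[OF mo S0 T]
 show "AE t in lebesgue. t \<in> {0<..<T} \<longrightarrow> wall_distance \<Omega> S differentiable (at t) \<and>
   (\<forall>P Q. P \<in> frontier (S t) \<longrightarrow> Q \<in> frontier \<Omega> \<longrightarrow> dist P Q = wall_distance \<Omega> S t \<longrightarrow> 0 < dist P Q \<longrightarrow>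
    deriv (wall_distance \<Omega> S) t * dist P Q = rigid_velocity us om xs t P \<bullet> (P - Q))" by (rule kin(3))
 obtain L where "L-lipschitz_on {0<..<T} (wall_distance \<Omega> S)" using kin(2) by blast
 then have "L-lipschitz_on {t \<in> {0<..<T}. wall_distance \<Omega> S t < H} (wall_distance \<Omega> S)"
  by (rule lipschitz_on_subset) auto
 then show "\<exists>L. L-lipschitz_on {t \<in> {0<..<T}. wall_distance \<Omega> S t < H} (wall_distance \<Omega> S)" ..
 assume "t \<in> {0<..<T}"
 then obtain \<psi> where \<psi>: "is_isometry \<psi>" "S t = \<psi> ` S0" using kin(1) by blast
 then show "\<exists>\<psi>. is_isometry \<psi> \<and> S t = \<psi> ` B"
  using is_isometry_compose[OF \<psi>(1) \<phi>(1)] by (intro exI[of _ "\<lambda>x. \<psi> (\<phi> x)"]) (simp add: \<phi>(2) image_image)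
qed

lemma congruent_body:
 assumes "is_isometry \<psi>" "St = \<psi> ` B" "open B" "negligible (frontier B)"
 shows "open St" "negligible (frontier St)"
 using isometry_open_image[OF assms(1,3)] negligible_isometry_frontier[OF assms(1,4)] by (simp_all add: assms(2))

lemma Lq_W1p_zero_bodyD:
 assumes "u \<in> Linf_L2 T \<Omega> \<inter> Lq_W1p_zero_body 1 p T \<Omega> S us om xs" "div_free T \<Omega> u"
 shows "AE t in lebesgue. t \<in> {0<..<T} \<longrightarrow> u t \<in> W1p_zero p \<Omega> \<and>
  (AE x in lebesgue. x \<in> \<Omega> \<longrightarrow> (\<Sum>j\<in>UNIV. weak_grad \<Omega> (u t) x $ j $ j) = 0) \<and>
  (AE x in lebesgue. x \<in> S t \<longrightarrow> u t x = us t + cross3 (om t) (x - xs t))"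
proof -
 have "AE t in lebesgue. t \<in> {0<..<T} \<longrightarrow> u t \<in> W1p_zero p \<Omega>"
  "AE t in lebesgue. t \<in> {0<..<T} \<longrightarrow> (AE x in lebesgue. x \<in> S t \<longrightarrow> u t x = us t + cross3 (om t) (x - xs t))"
  using assms(1) by (auto simp: Lq_W1p_zero_body_def bochner_Lq_def rigid_velocity_def)
 moreover have "AE t in lebesgue. t \<in> {0<..<T} \<longrightarrow> (AE x in lebesgue. x \<in> \<Omega> \<longrightarrow> (\<Sum>j\<in>UNIV. weak_grad \<Omega> (u t) x $ j $ j) = 0)"
  using assms(2) by (simp add: div_free_def)
 ultimately show ?thesis by eventually_elim blast
qed

text \<open>All constants are fixed from the charts of \<open>\<Omega>\<close> and \<open>B\<close>
  before any motion is introduced. At each good time these charts are carried into the contact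
  frame, where the gap estimate applies with outer radius \<open>2 * \<sigma>\<close>.\<close>

lemma distance_rate_C1:
 fixes \<Omega> B :: "(real^3) set"
 assumes dom: "domain3 \<Omega>" "domain3 B" "bounded B"
  and \<alpha>: "0 < \<alpha>" and p: "1 \<le> p" and C: "uniformly_C1 \<alpha> \<Omega>" "uniformly_C1 \<alpha> B"
 shows "\<exists>H0 Cw c0. 0 < H0 \<and> H0 \<le> diameter B \<and> 0 < Cw \<and> 0 < c0 \<and>
     (\<forall>T S0 us om xs S u.
      0 < T \<and> (\<exists>\<phi>. is_isometry \<phi> \<and> S0 = \<phi> ` B) \<and> S0 \<subseteq> \<Omega> \<and>
      rigid_body_motion \<Omega> T S0 us om xs S \<and>
      u \<in> Linf_L2 T \<Omega> \<inter> Lq_W1p_zero_body 1 p T \<Omega> S us om xs \<and> div_free T \<Omega> u \<longrightarrow>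
      (\<exists>L. L-lipschitz_on {t \<in> {0<..<T}. wall_distance \<Omega> S t < H0} (wall_distance \<Omega> S)) \<and>
      (AE t in lebesgue. t \<in> {0<..<T} \<and>
      0 < wall_distance \<Omega> S t \<and> wall_distance \<Omega> S t < H0 \<longrightarrow>
      wall_distance \<Omega> S differentiable (at t) \<and>
      (\<forall>P Q R. contact_frame \<Omega> (S t) P Q R \<longrightarrow>
      \<bar>deriv (wall_distance \<Omega> S) t\<bar> \<le> C1_rate \<alpha> p \<Omega> (S t) (u t) Cw c0 (wall_distance \<Omega> S t) R)))"
proof -
 have op: "open \<Omega>" "open B" "B \<noteq> {}" using dom by (auto simp: domain3_def)
 obtain k1 s1 where 1: "0 < k1" "0 < s1" "C1_charts \<alpha> k1 s1 \<Omega>" using C(1) unfolding C1_charts_iff by blast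
 obtain k2 s2 where 2: "0 < k2" "0 < s2" "C1_charts \<alpha> k2 s2 B" using C(2) unfolding C1_charts_iff by blast
 have null: "negligible (frontier B)" by (rule negligible_flat_boundary[OF C1_charts_flat[OF 2(3)] 2(1,2) \<alpha>])
 obtain c0 H where c0: "0 < c0" and H: "0 < H" "H \<le> diameter B"
  and sc: "\<forall>h \<sigma>. 0 < h \<and> h < H \<and> \<sigma> = c0 * h powr (1 / (1 + \<alpha>)) \<longrightarrow>
   h \<le> \<sigma> \<and> k1 * (2 * \<sigma>) powr (1 + \<alpha>) \<le> h / 4 \<and> 2 * \<sigma> \<le> s1 \<and> 2 * h < k1 * s1 powr (1 + \<alpha>) \<and>
   k2 * (2 * \<sigma>) powr (1 + \<alpha>) \<le> h / 4 \<and> 2 * \<sigma> \<le> s2 \<and> 2 * h < k2 * s2 powr (1 + \<alpha>)"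
  using gap_scale[OF \<alpha> 1(1,2) 2(1,2) diameter_pos[OF op(2,3) dom(3)]] by (elim exE conjE) (rule that)
 define Cw where "Cw = 44830080 * (10 * c0^2) powr (1 - 1 / p) / c0 ^ 3"
 show ?thesis
 proof (rule exI[of _ H], rule exI[of _ Cw], rule exI[of _ c0], intro conjI H c0 allI impI; (elim conjE exE)?)
  show "0 < Cw" using c0 by (simp add: Cw_def)
  fix T S0 us om xs S u \<phi>
  assume T: "0 < T" and \<phi>: "is_isometry \<phi>" "S0 = \<phi> ` B" and S0: "S0 \<subseteq> \<Omega>" and mo: "rigid_body_motion \<Omega> T S0 us om xs S"
   and u: "u \<in> Linf_L2 T \<Omega> \<inter> Lq_W1p_zero_body 1 p T \<Omega> S us om xs" and dv: "div_free T \<Omega> u"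
  note kin = congruent_body_motion[OF op(2,3) dom(3) \<phi> mo T]
  show "\<exists>L. L-lipschitz_on {t \<in> {0<..<T}. wall_distance \<Omega> S t < H} (wall_distance \<Omega> S)" by (rule kin(2))
  show "AE t in lebesgue. t \<in> {0<..<T} \<and> 0 < wall_distance \<Omega> S t \<and> wall_distance \<Omega> S t < H \<longrightarrow>
      wall_distance \<Omega> S differentiable (at t) \<and>
      (\<forall>P Q R. contact_frame \<Omega> (S t) P Q R \<longrightarrow>
      \<bar>deriv (wall_distance \<Omega> S) t\<bar> \<le> C1_rate \<alpha> p \<Omega> (S t) (u t) Cw c0 (wall_distance \<Omega> S t) R)"
   using kin(3) Lq_W1p_zero_bodyD[OF u dv]
  proof eventually_elim
   case (elim t)
   show ?case
   proof (intro impI conjI allI; elim conjE)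
    assume t: "t \<in> {0<..<T}" and hp: "0 < wall_distance \<Omega> S t" and hH: "wall_distance \<Omega> S t < H"
    show "wall_distance \<Omega> S differentiable at t" using elim t by blast
    fix P Q R assume cf: "contact_frame \<Omega> (S t) P Q R"
    define h where "h = wall_distance \<Omega> S t"
    define \<sigma> where "\<sigma> = c0 * h powr (1 / (1 + \<alpha>))"
    have h: "0 < h" "h < H" "h = setdist (S t) (frontier \<Omega>)" using hp hH by (simp_all add: h_def wall_distance_def)
    obtain \<psi> where \<psi>: "is_isometry \<psi>" "S t = \<psi> ` B" using kin(1)[OF t] by blast
    note oS = congruent_body[OF \<psi> op(2) null]
    have sub: "S t \<subseteq> \<Omega>" using mo t unfolding rigid_body_motion_def by blast
    have PQ: "P \<in> frontier (S t)" "Q \<in> frontier \<Omega>" "dist P Q = h" "is_isometry R"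
     using cf h by (auto simp: contact_frame_def)
    have dd: "deriv (wall_distance \<Omega> S) t * dist P Q = (us t + cross3 (om t) (P - xs t)) \<bullet> (P - Q)"
     using elim t PQ h by (auto simp: rigid_velocity_def h_def)
    have ut: "u t \<in> W1p_zero p \<Omega>" and dvt: "AE x in lebesgue. x \<in> \<Omega> \<longrightarrow> (\<Sum>j\<in>UNIV. weak_grad \<Omega> (u t) x $ j $ j) = 0"
     and rg: "AE x in lebesgue. x \<in> S t \<longrightarrow> u t x = us t + cross3 (om t) (x - xs t)"
     using elim t by auto
    obtain A where mf: "moving_frame \<Omega> (S t) R A p (u t) (us t) (om t) (xs t)"
     and ct: "contact (R -` \<Omega>) (R -` S t) h" and d: "deriv (wall_distance \<Omega> S) t = moving_frame.a R A h (us t) (om t) (xs t) $ 3"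
     using contact_moving_frame[OF op(1) oS(1) sub oS(2) p ut dvt rg cf h(3,1) dd] by blast
    interpret M: moving_frame \<Omega> "S t" R A p h "u t" "us t" "om t" "xs t" by (rule mf)
    interpret K: contact "R -` \<Omega>" "R -` S t" h by (rule ct)
    have s: "h \<le> \<sigma>" "k1 * (2 * \<sigma>) powr (1 + \<alpha>) \<le> h / 4" "2 * \<sigma> \<le> s1" "2 * h < k1 * s1 powr (1 + \<alpha>)"
     "k2 * (2 * \<sigma>) powr (1 + \<alpha>) \<le> h / 4" "2 * \<sigma> \<le> s2" "2 * h < k2 * s2 powr (1 + \<alpha>)"
     using sc[rule_format, of h \<sigma>] h(1,2) \<sigma>_def by auto
    have c1: "C1_charts \<alpha> k1 s1 (R -` \<Omega>)"
     unfolding isometry_vimage[OF PQ(4)] by (rule C1_charts_isometry[OF is_isometry_inv[OF PQ(4)] 1(3)])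
    have c2: "C1_charts \<alpha> k2 s2 (R -` S t)"
     unfolding isometry_vimage[OF PQ(4)] \<psi>(2)
     by (rule C1_charts_isometry[OF is_isometry_inv[OF PQ(4)] C1_charts_isometry[OF \<psi>(1) 2(3)]])
    have \<sigma>0: "0 < 2 * \<sigma>" using h s by simp
    note geo = K.first_geometry[OF \<alpha> c1 1(1,2) s(2,3,4) c2 2(1,2) s(5,6,7) \<sigma>0]
    have "\<bar>M.a $ 3\<bar> * \<sigma> ^ 3 \<le> 44830080 * h * ((10 * \<sigma>^2 * h) powr (1 - 1 / p) *
      Lp_norm p (cylinder R \<sigma> \<inter> fluid_region \<Omega> (S t)) (weak_grad \<Omega> (u t)))"
     by (rule M.first_bound[OF h(1) s(1), of "2 * \<sigma>"]) (use \<sigma>0 geo in auto)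
    from first_exponent[OF h(1) c0 \<alpha> p \<sigma>_def this]
    show "\<bar>deriv (wall_distance \<Omega> S) t\<bar> \<le> C1_rate \<alpha> p \<Omega> (S t) (u t) Cw c0 (wall_distance \<Omega> S t) R"
     unfolding d Cw_def h_def[symmetric] \<sigma>_def .
   qed
  qed
 qed
qed

lemma distance_rate_C3:
 fixes \<Omega> B :: "(real^3) set"
 assumes dom: "domain3 \<Omega>" "domain3 B" "bounded B" and C: "uniformly_C3 \<Omega>" "uniformly_C3 B"
 shows "\<exists>H0 Cs c0. 0 < H0 \<and> H0 \<le> diameter B \<and> 0 < Cs \<and> 0 < c0 \<and>
     (\<forall>T S0 us om xs S u.
      0 < T \<and> (\<exists>\<phi>. is_isometry \<phi> \<and> S0 = \<phi> ` B) \<and> S0 \<subseteq> \<Omega> \<and>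
      rigid_body_motion \<Omega> T S0 us om xs S \<and>
      u \<in> Linf_L2 T \<Omega> \<inter> Lq_W1p_zero_body 1 2 T \<Omega> S us om xs \<and> div_free T \<Omega> u \<and>
      (AE t in lebesgue. t \<in> {0<..<T} \<longrightarrow>
      weakly_differentiable (fluid_region \<Omega> (S t))
      (weak_grad (fluid_region \<Omega> (S t)) (u t)) \<and>
      in_Lp 2 (fluid_region \<Omega> (S t)) (weak_hess (fluid_region \<Omega> (S t)) (u t))) \<longrightarrow>
      (\<exists>L. L-lipschitz_on {t \<in> {0<..<T}. wall_distance \<Omega> S t < H0} (wall_distance \<Omega> S)) \<and>
      (AE t in lebesgue. t \<in> {0<..<T} \<and> wall_distance \<Omega> S t < H0 \<longrightarrow>
      wall_distance \<Omega> S differentiable (at t) \<and>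
      (\<forall>P Q R. contact_frame \<Omega> (S t) P Q R \<longrightarrow>
      \<bar>deriv (wall_distance \<Omega> S) t\<bar> \<le> C3_rate \<Omega> (S t) (u t) Cs c0 (wall_distance \<Omega> S t) R)))"
proof -
 have op: "open \<Omega>" "open B" "B \<noteq> {}" using dom by (auto simp: domain3_def)
 obtain K1 s1 where 1: "0 < K1" "0 < s1" "C3_charts K1 s1 \<Omega>" using C(1) unfolding C3_charts_iff by blast
 obtain K2 s2 where 2: "0 < K2" "0 < s2" "C3_charts K2 s2 B" using C(2) unfolding C3_charts_iff by blast
 have null: "negligible (frontier B)"
  by (rule negligible_flat_boundary[OF C3_charts_flat[OF 2(3,2,1)] 2(1,2)]) simp
 obtain c0 H where c0: "0 < c0" and H: "0 < H" "H \<le> diameter B"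
  and sc: "\<forall>h \<sigma>. 0 < h \<and> h < H \<and> \<sigma> = c0 * h powr (1 / (1 + 1)) \<longrightarrow>
   h \<le> \<sigma> \<and> K1 * (2 * \<sigma>) powr (1 + 1) \<le> h / 4 \<and> 2 * \<sigma> \<le> s1 \<and> 2 * h < K1 * s1 powr (1 + 1) \<and>
   K2 * (2 * \<sigma>) powr (1 + 1) \<le> h / 4 \<and> 2 * \<sigma> \<le> s2 \<and> 2 * h < K2 * s2 powr (1 + 1)"
  using gap_scale[OF zero_less_one 1(1,2) 2(1,2) diameter_pos[OF op(2,3) dom(3)]] by (elim exE conjE) (rule that)
 define E where "E = 8 * (K1 + K2)"
 have E: "0 \<le> E" using 1(1) 2(1) by (simp add: E_def)
 define Cs where "Cs = sqrt 10 * c0 * (6 * 226504704 * E + 6 * 7471104 / c0 ^ 4 + 18 * 96 / c0 ^ 3)"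
 show ?thesis
 proof (rule exI[of _ H], rule exI[of _ Cs], rule exI[of _ c0], intro conjI H c0 allI impI; (elim conjE exE)?)
  show "0 < Cs" unfolding Cs_def using c0 E by (intro mult_pos_pos add_nonneg_pos add_nonneg_nonneg) auto
  fix T S0 us om xs S u \<phi>
  assume T: "0 < T" and \<phi>: "is_isometry \<phi>" "S0 = \<phi> ` B" and S0: "S0 \<subseteq> \<Omega>" and mo: "rigid_body_motion \<Omega> T S0 us om xs S"
   and u: "u \<in> Linf_L2 T \<Omega> \<inter> Lq_W1p_zero_body 1 2 T \<Omega> S us om xs" and dv: "div_free T \<Omega> u"
   and hs: "AE t in lebesgue. t \<in> {0<..<T} \<longrightarrow>
      weakly_differentiable (fluid_region \<Omega> (S t)) (weak_grad (fluid_region \<Omega> (S t)) (u t)) \<and>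
      in_Lp 2 (fluid_region \<Omega> (S t)) (weak_hess (fluid_region \<Omega> (S t)) (u t))"
  note kin = congruent_body_motion[OF op(2,3) dom(3) \<phi> mo T]
  show "\<exists>L. L-lipschitz_on {t \<in> {0<..<T}. wall_distance \<Omega> S t < H} (wall_distance \<Omega> S)" by (rule kin(2))
  show "AE t in lebesgue. t \<in> {0<..<T} \<and> wall_distance \<Omega> S t < H \<longrightarrow>
      wall_distance \<Omega> S differentiable (at t) \<and>
      (\<forall>P Q R. contact_frame \<Omega> (S t) P Q R \<longrightarrow>
      \<bar>deriv (wall_distance \<Omega> S) t\<bar> \<le> C3_rate \<Omega> (S t) (u t) Cs c0 (wall_distance \<Omega> S t) R)"
   using kin(3) Lq_W1p_zero_bodyD[OF u dv] hs
  proof eventually_elim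
   case (elim t)
   show ?case
   proof (intro impI conjI allI; elim conjE)
    assume t: "t \<in> {0<..<T}" and hH: "wall_distance \<Omega> S t < H"
    show di: "wall_distance \<Omega> S differentiable at t" using elim t by blast
    fix P Q R assume cf: "contact_frame \<Omega> (S t) P Q R"
    define h where "h = wall_distance \<Omega> S t"
    define \<sigma> where "\<sigma> = c0 * h powr (1 / 2)"
    have hS: "h = setdist (S t) (frontier \<Omega>)" by (simp add: h_def wall_distance_def)
    define N1 where "N1 = Lp_norm 2 (cylinder R \<sigma> \<inter> fluid_region \<Omega> (S t)) (weak_grad \<Omega> (u t))"
    define N2 where "N2 = Lp_norm 2 (cylinder R \<sigma> \<inter> fluid_region \<Omega> (S t)) (weak_hess (fluid_region \<Omega> (S t)) (u t))"
    have "\<bar>deriv (wall_distance \<Omega> S) t\<bar> \<le> Cs * (h powr (3 / 2) * N2 + h * N1)"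
    proof (cases "h = 0")
     case True
     \<comment> \<open>The claim covers times of contact. There the non-negative distance attains
       its minimum, so its derivative is 0, as is the right-hand side.\<close>
     have "deriv (wall_distance \<Omega> S) t = 0"
     proof (rule DERIV_local_min[OF _ zero_less_one])
      show "(wall_distance \<Omega> S has_real_derivative deriv (wall_distance \<Omega> S) t) (at t)"
       using di by (simp add: DERIV_deriv_iff_real_differentiable)
      show "\<forall>y. \<bar>t - y\<bar> < 1 \<longrightarrow> wall_distance \<Omega> S t \<le> wall_distance \<Omega> S y"
       using True by (simp add: h_def) (simp add: wall_distance_def setdist_pos_le)
     qed
     then show ?thesis using True by simp
    next
     case False
     moreover have "0 \<le> h" unfolding hS by (rule setdist_pos_le)
     ultimately have h: "0 < h" "h < H" using hH by (simp_all add: h_def)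
     obtain \<psi> where \<psi>: "is_isometry \<psi>" "S t = \<psi> ` B" using kin(1)[OF t] by blast
     note oS = congruent_body[OF \<psi> op(2) null]
     have sub: "S t \<subseteq> \<Omega>" using mo t unfolding rigid_body_motion_def by blast
     have PQ: "P \<in> frontier (S t)" "Q \<in> frontier \<Omega>" "dist P Q = h" "is_isometry R"
      using cf hS by (auto simp: contact_frame_def)
     have dd: "deriv (wall_distance \<Omega> S) t * dist P Q = (us t + cross3 (om t) (P - xs t)) \<bullet> (P - Q)"
      using elim t PQ h by (auto simp: rigid_velocity_def h_def)
     have ut: "u t \<in> W1p_zero 2 \<Omega>" and dvt: "AE x in lebesgue. x \<in> \<Omega> \<longrightarrow> (\<Sum>j\<in>UNIV. weak_grad \<Omega> (u t) x $ j $ j) = 0"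
      and rg: "AE x in lebesgue. x \<in> S t \<longrightarrow> u t x = us t + cross3 (om t) (x - xs t)"
      and wd: "weakly_differentiable (fluid_region \<Omega> (S t)) (weak_grad (fluid_region \<Omega> (S t)) (u t))"
      and hL: "in_Lp 2 (fluid_region \<Omega> (S t)) (weak_hess (fluid_region \<Omega> (S t)) (u t))"
      using elim t by auto
     obtain A where mf: "moving_frame \<Omega> (S t) R A 2 (u t) (us t) (om t) (xs t)"
      and ct: "contact (R -` \<Omega>) (R -` S t) h" and d: "deriv (wall_distance \<Omega> S) t = moving_frame.a R A h (us t) (om t) (xs t) $ 3"
      using contact_moving_frame[OF op(1) oS(1) sub oS(2) one_le_numeral ut dvt rg cf hS h(1) dd] by blast
     interpret M: moving_frame \<Omega> "S t" R A 2 h "u t" "us t" "om t" "xs t" by (rule mf)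
     interpret K: contact "R -` \<Omega>" "R -` S t" h by (rule ct)
     have half: "1 / (1 + 1) = (1 / 2 :: real)" by simp
     have sc': "h \<le> \<sigma>" "K1 * (2 * \<sigma>) powr (1 + 1) \<le> h / 4" "2 * \<sigma> \<le> s1" "2 * h < K1 * s1 powr (1 + 1)"
      "K2 * (2 * \<sigma>) powr (1 + 1) \<le> h / 4" "2 * \<sigma> \<le> s2" "2 * h < K2 * s2 powr (1 + 1)"
      using sc[unfolded half, rule_format, of h \<sigma>] h \<sigma>_def by auto
     have \<sigma>0: "0 < 2 * \<sigma>" using h sc' by simp
     have sq: "x powr (1 + 1) = x^2" if "0 < x" for x :: real using powr_realpow[OF that, of 2] by simp
     note s = sc'[unfolded sq[OF \<sigma>0] sq[OF 1(2)] sq[OF 2(2)]]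
     have c1: "C3_charts K1 s1 (R -` \<Omega>)"
      unfolding isometry_vimage[OF PQ(4)] by (rule C3_charts_isometry[OF is_isometry_inv[OF PQ(4)] 1(3)])
     have c2: "C3_charts K2 s2 (R -` S t)"
      unfolding isometry_vimage[OF PQ(4)] \<psi>(2)
      by (rule C3_charts_isometry[OF is_isometry_inv[OF PQ(4)] C3_charts_isometry[OF \<psi>(1) 2(3)]])
     have fl: "R -` \<Omega> - closure (R -` S t) = R -` fluid_region \<Omega> (S t)"
     proof -
      have "closure (R -` S t) = R -` closure (S t)"
       unfolding isometry_vimage[OF PQ(4)] by (rule isometry_closure_image[OF is_isometry_inv[OF PQ(4)]])
      then show ?thesis by (auto simp: fluid_region_def)
     qed
     from K.second_geometry[OF c1 1(1,2) s(2,3,4) c2 2(1,2) s(5,6,7) \<sigma>0, unfolded fl]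
     obtain \<beta> \<tau> Db Dt where g: "gap_graphs (R -` \<Omega>) (R -` S t) (R -` fluid_region \<Omega> (S t)) h (2 * \<sigma>) E \<beta> \<tau> Db Dt"
      unfolding E_def by blast
     have "\<sigma> < 2 * \<sigma>" using \<sigma>0 by simp
     have "\<bar>M.a $ 3\<bar> * \<sigma> ^ 3 \<le> (10 * \<sigma>^2 * h) powr (1 / 2) *
       (6 * 226504704 * E * \<sigma> ^ 3 * N1 + 6 * 7471104 * (h^2 / \<sigma>) * N1 + 18 * 96 * h^2 * N2)"
      unfolding N1_def N2_def
      by (rule M.second_bound[where \<beta> = \<beta> and \<tau> = \<tau> and Db = Db and Dt = Dt and \<sigma>' = "2 * \<sigma>"])
       (fact h(1) s(1) \<open>\<sigma> < 2 * \<sigma>\<close> refl wd hL g)+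
     from second_exponent[OF h(1) c0 E _ _ \<sigma>_def this]
     show ?thesis unfolding d Cs_def by (simp add: N1_def N2_def Lp_norm_nonneg)
    qed
    then show "\<bar>deriv (wall_distance \<Omega> S) t\<bar> \<le> C3_rate \<Omega> (S t) (u t) Cs c0 (wall_distance \<Omega> S t) R"
     unfolding N1_def N2_def \<sigma>_def h_def .
   qed
  qed
 qed
qed

(* B is the shape of the body: the initial position S0 is any congruent copy of B in \<Omega>, so that
   the constants depend on S0 only through its shape. *)
theorem theorem1p3:
  fixes \<Omega> B :: "(real^3) set"
  assumes "domain3 \<Omega>" and "domain3 B" and "bounded B"
  shows
   "(\<forall>\<alpha> p. 0 < \<alpha> \<and> \<alpha> \<le> 1 \<and> 1 \<le> p \<and>
       uniformly_C1 \<alpha> \<Omega> \<and> uniformly_C1 \<alpha> B \<and> inner_sphere_condition \<Omega> \<longrightarrow>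
       (\<exists>H0 Cw c0. 0 < H0 \<and> H0 \<le> diameter B \<and> 0 < Cw \<and> 0 < c0 \<and>
         (\<forall>T S0 us om xs S u.
            0 < T \<and> (\<exists>\<phi>. is_isometry \<phi> \<and> S0 = \<phi> ` B) \<and> S0 \<subseteq> \<Omega> \<and>
            rigid_body_motion \<Omega> T S0 us om xs S \<and>
            u \<in> Linf_L2 T \<Omega> \<inter> Lq_W1p_zero_body 1 p T \<Omega> S us om xs \<and> div_free T \<Omega> u \<longrightarrow>
            (\<exists>L. L-lipschitz_on {t \<in> {0<..<T}. wall_distance \<Omega> S t < H0} (wall_distance \<Omega> S)) \<and>
            (AE t in lebesgue. t \<in> {0<..<T} \<and>
               0 < wall_distance \<Omega> S t \<and> wall_distance \<Omega> S t < H0 \<longrightarrow>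
               wall_distance \<Omega> S differentiable (at t) \<and>
               (\<forall>P Q R. contact_frame \<Omega> (S t) P Q R \<longrightarrow>
                  \<bar>deriv (wall_distance \<Omega> S) t\<bar> \<le>
                    Cw * wall_distance \<Omega> S t powr
                           ((1 + 2 * \<alpha>) / (p * (1 + \<alpha>)) * (p - (3 + \<alpha>) / (1 + 2 * \<alpha>))) *
                    Lp_norm p
                      (cylinder R (c0 * wall_distance \<Omega> S t powr (1 / (1 + \<alpha>)))
                         \<inter> fluid_region \<Omega> (S t))
                      (weak_grad \<Omega> (u t)))))))
    \<and>
    (uniformly_C3 \<Omega> \<and> uniformly_C3 B \<longrightarrow>
       (\<exists>H0 Cs c0. 0 < H0 \<and> H0 \<le> diameter B \<and> 0 < Cs \<and> 0 < c0 \<and>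
         (\<forall>T S0 us om xs S u.
            0 < T \<and> (\<exists>\<phi>. is_isometry \<phi> \<and> S0 = \<phi> ` B) \<and> S0 \<subseteq> \<Omega> \<and>
            rigid_body_motion \<Omega> T S0 us om xs S \<and>
            u \<in> Linf_L2 T \<Omega> \<inter> Lq_W1p_zero_body 1 2 T \<Omega> S us om xs \<and> div_free T \<Omega> u \<and>
            (AE t in lebesgue. t \<in> {0<..<T} \<longrightarrow>
               weakly_differentiable (fluid_region \<Omega> (S t))
                 (weak_grad (fluid_region \<Omega> (S t)) (u t)) \<and>
               in_Lp 2 (fluid_region \<Omega> (S t)) (weak_hess (fluid_region \<Omega> (S t)) (u t))) \<longrightarrow>
            (\<exists>L. L-lipschitz_on {t \<in> {0<..<T}. wall_distance \<Omega> S t < H0} (wall_distance \<Omega> S)) \<and>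
            (AE t in lebesgue. t \<in> {0<..<T} \<and> wall_distance \<Omega> S t < H0 \<longrightarrow>
               wall_distance \<Omega> S differentiable (at t) \<and>
               (\<forall>P Q R. contact_frame \<Omega> (S t) P Q R \<longrightarrow>
                  \<bar>deriv (wall_distance \<Omega> S) t\<bar> \<le>
                    Cs * (wall_distance \<Omega> S t powr (3 / 2) *
                            Lp_norm 2
                              (cylinder R (c0 * wall_distance \<Omega> S t powr (1 / 2))
                                 \<inter> fluid_region \<Omega> (S t))
                              (weak_hess (fluid_region \<Omega> (S t)) (u t)) +
                          wall_distance \<Omega> S t *
                            Lp_norm 2
                              (cylinder R (c0 * wall_distance \<Omega> S t powr (1 / 2))
                                 \<inter> fluid_region \<Omega> (S t))
                              (weak_grad \<Omega> (u t))))))))"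
  by (intro conjI allI impI; (elim conjE)?) (rule distance_rate_C1[OF assms] distance_rate_C3[OF assms]; assumption)+

end
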